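(* Let $r\in\mathbb{R}^2$ be a root, $t_1,\dots,t_n\in\mathbb{R}^2$ terminals, and $0<\alpha<\pi/2$ a restricting angle. The greedy spiral tree for this input is a $2$-approximation of the optimal spiral tree (its length is at most twice the length of an optimal spiral tree), and it can be computed in $O(n\log n)$ time.
   Context: The root $r$ is placed at the origin. For a point $p$ with polar coordinates $(R,\phi)$ the right spiral $\mathcal{S}^+_p$ is given by $R(t)=Re^{-t}$, $\phi(t)=\phi+\tan(\alpha)\,t$, and the left spiral $\mathcal{S}^-_p$ by the same equations with $\alpha$ replaced by $-\alpha$. A spiral segment is a connected piece of a right or left spiral (possibly including the limit endpoint $r$), directed towards $r$. A spiral tree for root $r$ and terminals $t_1,\dots,t_n$ is a finite tree drawn in the plane, rooted at $r$, whose nodes include $r$ and all terminals and possibly additional (Steiner) nodes, with arcs directed from the terminals towards the root, each arc being a concatenation of (arbitrarily many) spiral segments. Its length is the sum of the lengths of its arcs; an optimal spiral tree is one of minimum length. A curve directed towards $r$ is angle-restricted if at every point $p\neq r$ of it the angle between its tangent vector at $p$ and the vector from $p$ to $r$ is at most $\alpha$. The spiral region $\mathcal{R}_p$ of a point $p$ is the set of all points reachable from $p$ by an angle-restricted path; equivalently, the region bounded by the parts of $\mathcal{S}^+_p$ and $\mathcal{S}^-_p$ with $0\le t\le \pi\cot(\alpha)$. Greedy spiral tree: start with the forest consisting of the terminals. A node is active if it has no parent yet. The join point $p_{uv}$ of two nodes $u,v$ is the point of $\mathcal{R}_u\cap\mathcal{R}_v$ farthest from $r$. In every step take the two active nodes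 $u,v$ whose join point is farthest from $r$ and connect both to $p_{uv}$ by spiral segments directed towards $r$; $p_{uv}$ becomes a new active Steiner node (if $p_{uv}$ coincides with one of $u,v$, the other one is simply connected to it). Repeat until all terminals are in a single tree, whose last active node is connected to $r$ by spiral segments. Running time is measured in the real-RAM model, with elementary operations on spirals (such as computing intersections) taking constant time. *)

theory Defs
  imports "HOL-Analysis.Analysis"
begin

text \<open>The plane is the type \<^typ>\<open>complex\<close>. In polar coordinates \<open>(R, \<phi>)\<close> of \<open>p\<close> about \<open>r\<close>, the
  curve below is \<open>R(t) = R exp (- t)\<close>, \<open>\<phi>(t) = \<phi> + tan \<alpha> * t\<close>. It is the right spiral of \<open>p\<close>; the
  left spiral is the same curve for the angle \<open>- \<alpha>\<close>.\<close>

definition spiral :: "complex \<Rightarrow> real \<Rightarrow> complex \<Rightarrow> real \<Rightarrow> complex" where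
  "spiral r \<alpha> p t = r + (p - r) * of_real (exp (- t)) * cis (tan \<alpha> * t)"

definition vec_angle :: "complex \<Rightarrow> complex \<Rightarrow> real" where
  "vec_angle u v = arccos ((u \<bullet> v) / (norm u * norm v))"

text \<open>\<^const>\<open>valid_path\<close> allows the derivative to be undefined, or to have no limit, at finitely
  many parameters (kinks, and the limit of a spiral at \<open>r\<close>). As \<^term>\<open>vec_angle 0 v = pi / 2\<close>, the
  tangent vectors considered are nonzero whenever \<^prop>\<open>\<alpha> < pi / 2\<close>.\<close>

definition angle_restricted :: "complex \<Rightarrow> real \<Rightarrow> (real \<Rightarrow> complex) \<Rightarrow> bool" where
  "angle_restricted r \<alpha> \<gamma> \<longleftrightarrow> valid_path \<gamma> \<and>
     (\<exists>S. finite S \<and> (\<forall>t\<in>{0..1} - S. \<gamma> t \<noteq> r \<longrightarrow>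
        \<gamma> differentiable (at t) \<and> vec_angle (vector_derivative \<gamma> (at t)) (r - \<gamma> t) \<le> \<alpha>))"

text \<open>The trivial path makes \<open>p\<close> itself reachable.\<close>

definition spiral_region :: "complex \<Rightarrow> real \<Rightarrow> complex \<Rightarrow> complex set" where
  "spiral_region r \<alpha> p =
     {q. q = p \<or> (\<exists>\<gamma>. angle_restricted r \<alpha> \<gamma> \<and> pathstart \<gamma> = p \<and> pathfinish \<gamma> = q)}"

text \<open>A segment is described relative to its start point: which of the two spirals of that point
  it follows, and for which parameter range \<open>[0, T]\<close>. For \<open>T = \<infinity>\<close> it ends in the limit point \<open>r\<close>.\<close>

datatype side = Right_spiral | Left_spiral

fun side_angle :: "real \<Rightarrow> side \<Rightarrow> real" where
  "side_angle \<alpha> Right_spiral = \<alpha>"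
| "side_angle \<alpha> Left_spiral = - \<alpha>"

type_synonym segment = "side \<times> ereal"

fun segment_end :: "complex \<Rightarrow> real \<Rightarrow> complex \<Rightarrow> segment \<Rightarrow> complex" where
  "segment_end r \<alpha> p (d, T) =
     (if T = \<infinity> then r else spiral r (side_angle \<alpha> d) p (real_of_ereal T))"

fun segment_length :: "complex \<Rightarrow> real \<Rightarrow> complex \<Rightarrow> segment \<Rightarrow> real" where
  "segment_length r \<alpha> p (d, T) =
     integral {t. 0 \<le> t \<and> ereal t \<le> T}
       (\<lambda>t. norm (vector_derivative (spiral r (side_angle \<alpha> d) p) (at t)))"

type_synonym arc = "segment list"

fun arc_end :: "complex \<Rightarrow> real \<Rightarrow> complex \<Rightarrow> arc \<Rightarrow> complex" where
  "arc_end r \<alpha> p [] = p"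
| "arc_end r \<alpha> p (s # ss) = arc_end r \<alpha> (segment_end r \<alpha> p s) ss"

fun arc_length :: "complex \<Rightarrow> real \<Rightarrow> complex \<Rightarrow> arc \<Rightarrow> real" where
  "arc_length r \<alpha> p [] = 0"
| "arc_length r \<alpha> p (s # ss) =
     segment_length r \<alpha> p s + arc_length r \<alpha> (segment_end r \<alpha> p s) ss"

definition arc_from_to :: "complex \<Rightarrow> real \<Rightarrow> arc \<Rightarrow> complex \<Rightarrow> complex \<Rightarrow> bool" where
  "arc_from_to r \<alpha> a p q \<longleftrightarrow> (\<forall>(d, T)\<in>set a. 0 \<le> T) \<and> arc_end r \<alpha> p a = q"

text \<open>Nodes are points of the plane; \<open>up F v\<close> is the parent of \<open>v\<close>, if any, together with the arc
  from \<open>v\<close> to it.\<close>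

record forest =
  nodes :: "complex set"
  up :: "complex \<Rightarrow> (complex \<times> arc) option"

definition parent_rel :: "forest \<Rightarrow> (complex \<times> complex) set" where
  "parent_rel F = {(u, v). \<exists>a. up F u = Some (v, a)}"

definition spiral_tree :: "complex \<Rightarrow> real \<Rightarrow> complex list \<Rightarrow> forest \<Rightarrow> bool" where
  "spiral_tree r \<alpha> ts T \<longleftrightarrow>
     finite (nodes T) \<and> r \<in> nodes T \<and> set ts \<subseteq> nodes T \<and>
     dom (up T) = nodes T - {r} \<and>
     (\<forall>u v a. up T u = Some (v, a) \<longrightarrow> v \<in> nodes T \<and> arc_from_to r \<alpha> a u v) \<and>
     (\<forall>u\<in>nodes T. (u, r) \<in> (parent_rel T)\<^sup>*)"

definition tree_length :: "complex \<Rightarrow> real \<Rightarrow> forest \<Rightarrow> real" where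
  "tree_length r \<alpha> T = (\<Sum>u\<in>dom (up T). arc_length r \<alpha> u (snd (the (up T u))))"

definition optimal_spiral_tree :: "complex \<Rightarrow> real \<Rightarrow> complex list \<Rightarrow> forest \<Rightarrow> bool" where
  "optimal_spiral_tree r \<alpha> ts T \<longleftrightarrow> spiral_tree r \<alpha> ts T \<and>
     (\<forall>T'. spiral_tree r \<alpha> ts T' \<longrightarrow> tree_length r \<alpha> T \<le> tree_length r \<alpha> T')"

text \<open>The comparison is with all spiral trees, so that the notion does not become vacuous if the
  minimum were not attained; see the lemma for the case that it is.\<close>

definition approximation :: "real \<Rightarrow> complex \<Rightarrow> real \<Rightarrow> complex list \<Rightarrow> forest \<Rightarrow> bool" where
  "approximation c r \<alpha> ts T \<longleftrightarrow> spiral_tree r \<alpha> ts T \<and>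
     (\<forall>T'. spiral_tree r \<alpha> ts T' \<longrightarrow> tree_length r \<alpha> T \<le> c * tree_length r \<alpha> T')"

lemma approximation_iff_optimal:
  assumes "optimal_spiral_tree r \<alpha> ts Opt" and "0 \<le> c"
  shows "approximation c r \<alpha> ts T \<longleftrightarrow>
    spiral_tree r \<alpha> ts T \<and> tree_length r \<alpha> T \<le> c * tree_length r \<alpha> Opt"
  using assms unfolding approximation_def optimal_spiral_tree_def
  by (meson mult_left_mono order_trans)

definition active :: "forest \<Rightarrow> complex set" where
  "active F = {v \<in> nodes F. up F v = None}"

text \<open>A relation, since the farthest point is not unique for \<open>u\<close>, \<open>v\<close> at the same distance from
  \<open>r\<close> in opposite directions.\<close>

definition join_point :: "complex \<Rightarrow> real \<Rightarrow> complex \<Rightarrow> complex \<Rightarrow> complex \<Rightarrow> bool" where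
  "join_point r \<alpha> u v p \<longleftrightarrow> p \<in> spiral_region r \<alpha> u \<inter> spiral_region r \<alpha> v \<and>
     (\<forall>q\<in>spiral_region r \<alpha> u \<inter> spiral_region r \<alpha> v. dist r q \<le> dist r p)"

definition initial_forest :: "complex list \<Rightarrow> forest" where
  "initial_forest ts = \<lparr>nodes = set ts, up = Map.empty\<rparr>"

definition connect :: "complex set \<Rightarrow> complex \<Rightarrow> (complex \<Rightarrow> arc) \<Rightarrow> forest \<Rightarrow> forest" where
  "connect U p a F =
     \<lparr>nodes = insert p (nodes F),
      up = (\<lambda>x. if x \<in> U - {p} then Some (p, a x) else up F x)\<rparr>"

text \<open>Ties between pairs of active nodes, and the choice of the spiral segments of an arc, are left
  open.\<close>

inductive greedy_step :: "complex \<Rightarrow> real \<Rightarrow> forest \<Rightarrow> forest \<Rightarrow> bool" for r \<alpha> where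
  "greedy_step r \<alpha> F (connect {u, v} p a F)"
  if "u \<in> active F" "v \<in> active F" "u \<noteq> v" "join_point r \<alpha> u v p"
    "\<And>u' v' p'. \<lbrakk>u' \<in> active F; v' \<in> active F; u' \<noteq> v'; join_point r \<alpha> u' v' p'\<rbrakk>
       \<Longrightarrow> dist r p' \<le> dist r p"
    "\<And>x. x \<in> {u, v} - {p} \<Longrightarrow> arc_from_to r \<alpha> (a x) x p"

inductive greedy_spiral_tree :: "complex \<Rightarrow> real \<Rightarrow> complex list \<Rightarrow> forest \<Rightarrow> bool" for r \<alpha> ts where
  "greedy_spiral_tree r \<alpha> ts (connect {w} r a F)"
  if "(greedy_step r \<alpha>)\<^sup>*\<^sup>* (initial_forest ts) F" "active F = {w}"
    "w \<noteq> r \<Longrightarrow> arc_from_to r \<alpha> (a w) w r"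

text \<open>A structured real RAM: finitely many arrays of natural numbers (used for indices) and of reals,
  named by strings, each with unboundedly many cells that are initially 0; a scalar variable is cell
  0 of an array. Program constants are natural numbers, so that no information can be hidden in a
  real constant. The functions in \<open>fn\<close> are those occurring in the equations of spirals and in
  their solutions, so that an elementary operation on spirals, such as an intersection, is
  evaluated in a constant number of steps. There is no rounding and no conversion from reals to
  naturals.\<close>

datatype nexp = NConst nat | NGet string nexp | NAdd nexp nexp | NSub nexp nexp | NHalf nexp

datatype fn = Sqrt | Exp | Ln | Sin | Cos | Tan | Arctan

datatype rexp =
    RConst nat | RGet string nexp | RAdd rexp rexp | RSub rexp rexp | RMul rexp rexp
  | RDiv rexp rexp | RFun fn rexp

datatype test =
    NLess nexp nexp | NEq nexp nexp | RLess rexp rexp | REq rexp rexp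
  | TNot test | TAnd test test

datatype prog =
    Skip | NSet string nexp nexp | RSet string nexp rexp
  | Seq prog prog | Cond test prog prog | While test prog

record mem =
  nmem :: "string \<Rightarrow> nat \<Rightarrow> nat"
  rmem :: "string \<Rightarrow> nat \<Rightarrow> real"

fun nval :: "mem \<Rightarrow> nexp \<Rightarrow> nat" where
  "nval s (NConst k) = k"
| "nval s (NGet x i) = nmem s x (nval s i)"
| "nval s (NAdd i j) = nval s i + nval s j"
| "nval s (NSub i j) = nval s i - nval s j"
| "nval s (NHalf i) = nval s i div 2"

fun fn_val :: "fn \<Rightarrow> real \<Rightarrow> real" where
  "fn_val Sqrt = sqrt"
| "fn_val Exp = exp"
| "fn_val Ln = ln"
| "fn_val Sin = sin"
| "fn_val Cos = cos"
| "fn_val Tan = tan"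
| "fn_val Arctan = arctan"

fun rval :: "mem \<Rightarrow> rexp \<Rightarrow> real" where
  "rval s (RConst k) = real k"
| "rval s (RGet x i) = rmem s x (nval s i)"
| "rval s (RAdd a b) = rval s a + rval s b"
| "rval s (RSub a b) = rval s a - rval s b"
| "rval s (RMul a b) = rval s a * rval s b"
| "rval s (RDiv a b) = rval s a / rval s b"
| "rval s (RFun f a) = fn_val f (rval s a)"

fun tval :: "mem \<Rightarrow> test \<Rightarrow> bool" where
  "tval s (NLess i j) \<longleftrightarrow> nval s i < nval s j"
| "tval s (NEq i j) \<longleftrightarrow> nval s i = nval s j"
| "tval s (RLess a b) \<longleftrightarrow> rval s a < rval s b"
| "tval s (REq a b) \<longleftrightarrow> rval s a = rval s b"
| "tval s (TNot b) \<longleftrightarrow> \<not> tval s b"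
| "tval s (TAnd b c) \<longleftrightarrow> tval s b \<and> tval s c"

text \<open>\<open>exec P s k s'\<close>: \<open>P\<close> started in \<open>s\<close> terminates in \<open>s'\<close> after \<open>k\<close> steps. An assignment or the
  evaluation of a test is one step; expressions have a fixed size in a fixed program, so this is
  the number of elementary operations up to a constant factor.\<close>

inductive exec :: "prog \<Rightarrow> mem \<Rightarrow> nat \<Rightarrow> mem \<Rightarrow> bool" where
  Skip: "exec Skip s 1 s"
| NSet: "exec (NSet x i e) s 1
    (s\<lparr>nmem := (nmem s)(x := (nmem s x)(nval s i := nval s e))\<rparr>)"
| RSet: "exec (RSet x i e) s 1
    (s\<lparr>rmem := (rmem s)(x := (rmem s x)(nval s i := rval s e))\<rparr>)"
| Seq: "exec P s k s' \<Longrightarrow> exec Q s' l s'' \<Longrightarrow> exec (Seq P Q) s (k + l) s''"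
| Cond_True: "tval s b \<Longrightarrow> exec P s k s' \<Longrightarrow> exec (Cond b P Q) s (Suc k) s'"
| Cond_False: "\<not> tval s b \<Longrightarrow> exec Q s k s' \<Longrightarrow> exec (Cond b P Q) s (Suc k) s'"
| While_False: "\<not> tval s b \<Longrightarrow> exec (While b P) s 1 s"
| While_True: "tval s b \<Longrightarrow> exec P s k s' \<Longrightarrow> exec (While b P) s' l s'' \<Longrightarrow>
    exec (While b P) s (Suc (k + l)) s''"

definition input_mem :: "complex \<Rightarrow> real \<Rightarrow> complex list \<Rightarrow> mem" where
  "input_mem r \<alpha> ts =
     \<lparr>nmem = (\<lambda>x i. if x = ''n'' \<and> i = 0 then length ts else 0),
      rmem = (\<lambda>x i.
        if x = ''alpha'' \<and> i = 0 then \<alpha>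
        else if x = ''rootx'' \<and> i = 0 then Re r
        else if x = ''rooty'' \<and> i = 0 then Im r
        else if x = ''x'' \<and> i < length ts then Re (ts ! i)
        else if x = ''y'' \<and> i < length ts then Im (ts ! i)
        else 0)\<rparr>"

text \<open>Output format: the nodes are numbered from 0 below \<open>nodes[0]\<close>, node \<open>i\<close> has coordinates
  \<open>nodex[i]\<close>, \<open>nodey[i]\<close> and parent number \<open>parent[i]\<close> (none if this is not a node number), and the
  segments of its arc are those with numbers from \<open>arc[i]\<close> below \<open>arc[i + 1]\<close>. Segment \<open>j\<close> is part
  of a left spiral iff \<open>left[j]\<close> is nonzero; its parameter bound is \<open>\<infinity>\<close> if \<open>unbounded[j]\<close> is
  nonzero, and \<open>param[j]\<close> otherwise.\<close>

definition out_node :: "mem \<Rightarrow> nat \<Rightarrow> complex" where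
  "out_node s i = Complex (rmem s ''nodex'' i) (rmem s ''nodey'' i)"

definition out_segment :: "mem \<Rightarrow> nat \<Rightarrow> segment" where
  "out_segment s j =
     (if nmem s ''left'' j = 0 then Right_spiral else Left_spiral,
      if nmem s ''unbounded'' j = 0 then ereal (rmem s ''param'' j) else \<infinity>)"

definition out_arc :: "mem \<Rightarrow> nat \<Rightarrow> arc" where
  "out_arc s i = map (out_segment s) [nmem s ''arc'' i..<nmem s ''arc'' (i + 1)]"

definition outputs :: "mem \<Rightarrow> forest \<Rightarrow> bool" where
  "outputs s F \<longleftrightarrow> (let N = nmem s ''nodes'' 0 in
     inj_on (out_node s) {..<N} \<and> nodes F = out_node s ` {..<N} \<and> dom (up F) \<subseteq> nodes F \<and>
     (\<forall>i<N. up F (out_node s i) =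
        (let j = nmem s ''parent'' i in
         if j < N then Some (out_node s j, out_arc s i) else None)))"

end

theory Submission
  imports Defs "HOL-Complex_Analysis.Winding_Numbers" "HOL-Real_Asymp.Real_Asymp"
begin

text \<open>A spiral segment has length \<open>1 / cos \<alpha>\<close> times the distance to the root that it gains, so the
  length of a tree is \<open>1 / cos \<alpha>\<close> times the integral over \<open>\<rho>\<close> of the number of arcs that cross the
  circle of radius \<open>\<rho>\<close>, and it suffices to compare these numbers. Let \<open>Q\<close> be the crossing points of
  an arbitrary spiral tree. Every terminal outside the circle reaches a point of \<open>Q\<close>. The arcs of the
  circle that are reachable from the nodes crossing it in the greedy tree are disjoint. Hence at most
  \<open>card Q\<close> of them contain a point of \<open>Q\<close>, and each of the gaps between consecutive points of \<open>Q\<close>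
  contains at most one of the others: the left end of such an arc lies on the left spiral of a terminal,
  its right end on the right spiral of a terminal, and for two arcs in the same gap two of these spirals
  would meet outside the circle, where the greedy algorithm would have joined their nodes.

  For the running time, a circle is swept towards the root. The active nodes form a cyclic sequence in
  which only neighbours have to be joined. The left end of the arc reachable from an active node stays
  on the left spiral of a terminal, so the terminals, sorted by the angle of their left spirals, provide
  a fixed set of slots for the active nodes; a static tournament tree over these slots finds the next
  event and the predecessor of a new terminal.\<close>


section \<open>Regions as cones in logarithmic polar coordinates\<close>

text \<open>Along an angle-restricted path the logarithm of \<open>p - r\<close> has its velocity in
  a convex cone, hence also its displacement; the two spirals are the extreme rays. Regions thus
  become sets of nonnegative coordinates along these rays, up to full turns of the angle. A farthest
  common point of two such cones cannot be moved back along a ray in both, so it is one of the two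
  nodes or the meeting of a right spiral of one with a left spiral of the other; hence the chains of
  left and of right spirals from terminals. The greedy rule enters through one separation property:
  apart from \<open>r\<close>, regions of two tree nodes share points only at distances not
  exceeding that of a parent of one of them. Its induction needs that joins come with nonincreasing
  distance. For the sweep, the obstacle is that a join moves a node, which could invalidate its
  meeting times with all others. But it moves along its left spiral, and the time at which a right
  spiral arrives there does not depend on where on it the node is. So a join changes a bounded
  number of keys. The root has no logarithm and terminals may coincide; both cases are treated
  apart.\<close>

locale spiral_geometry =
  fixes r :: complex and \<alpha> :: real
  assumes alpha: "0 < \<alpha>" "\<alpha> < pi / 2"
begin

abbreviation \<tau> :: real where "\<tau> \<equiv> tan \<alpha>"

lemma tau_pos: "0 < \<tau>" and cos_alpha_pos: "0 < cos \<alpha>"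
  using alpha by (auto intro: tan_gt_zero cos_gt_zero)

text \<open>Right spiral for time \<open>a\<close>, then left spiral for time \<open>b\<close>. In
  the logarithm of \<open>p - r\<close> this is the displacement
  \<open>- (a + b) + i * \<tau> * (a - b)\<close>, so the two motions commute, and negative
  arguments run them backwards.\<close>

definition go :: "complex \<Rightarrow> real \<Rightarrow> real \<Rightarrow> complex" where
  "go p a b = r + (p - r) * of_real (exp (- (a + b))) * cis (\<tau> * (a - b))"

lemma go_go: "go (go p a b) c d = go p (a + c) (b + d)"
proof -
  have "exp (- (a + c + (b + d))) = exp (- (a + b)) * exp (- (c + d))"
    by (simp flip: exp_add)
  moreover have "cis (\<tau> * (a + c - (b + d))) = cis (\<tau> * (a - b)) * cis (\<tau> * (c - d))"
    by (simp add: cis_mult algebra_simps)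
  ultimately show ?thesis by (simp add: go_def)
qed

lemma go_0 [simp]: "go p 0 0 = p"
  by (simp add: go_def)

lemma go_root [simp]: "go r a b = r"
  by (simp add: go_def)

lemma dist_go: "dist r (go p a b) = dist r p * exp (- (a + b))"
  by (simp add: go_def dist_norm norm_mult norm_minus_commute)

lemma go_eq_root_iff [simp]: "go p a b = r \<longleftrightarrow> p = r"
  by (simp add: go_def)

lemma spiral_right: "spiral r \<alpha> p t = go p t 0"
  and spiral_left: "spiral r (- \<alpha>) p t = go p 0 t"
  by (simp_all add: spiral_def go_def)

text \<open>Dividing by \<open>w\<close> is a similarity, so the angle is the one between
  \<open>v / w\<close> and \<open>- 1\<close>. The condition that its cosine is at least
  \<open>cos \<alpha>\<close> squares to a cone of slope \<open>\<tau>\<close> about the negative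
  real axis.\<close>

lemma vec_angle_le_iff:
  assumes "w \<noteq> 0" "v \<noteq> 0"
  shows "vec_angle v (- w) \<le> \<alpha> \<longleftrightarrow> \<bar>Im (v / w)\<bar> \<le> \<tau> * - Re (v / w)"
proof -
  define z where "z = v / w"
  have v: "v = z * w" and z0: "z \<noteq> 0" using assms by (auto simp: z_def)
  have inner: "(v \<bullet> - w) / (norm v * norm (- w)) = - Re z / norm z"
  proof -
    have "v \<bullet> w = Re z * (norm w)\<^sup>2"
      by (simp add: v inner_complex_def cmod_power2) (simp add: power2_eq_square algebra_simps)
    then show ?thesis using assms by (simp add: v norm_mult power2_eq_square)
  qed
  have bound: "\<bar>- Re z / norm z\<bar> \<le> 1"
    using z0 abs_Re_le_cmod[of z] by (simp add: abs_divide del: minus_divide_left)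
  have "vec_angle v (- w) \<le> \<alpha> \<longleftrightarrow> cos \<alpha> \<le> - Re z / norm z"
  proof -
    have "arccos (- Re z / norm z) \<le> arccos (cos \<alpha>) \<longleftrightarrow> cos \<alpha> \<le> - Re z / norm z"
      using bound by (intro arccos_le_mono) auto
    then show ?thesis using alpha inner by (simp add: vec_angle_def arccos_cos)
  qed
  also have "\<dots> \<longleftrightarrow> norm z * cos \<alpha> \<le> - Re z"
    using z0 by (subst pos_le_divide_eq) (auto simp: mult.commute)
  also have "\<dots> \<longleftrightarrow> 0 \<le> - Re z \<and> (norm z * cos \<alpha>)\<^sup>2 \<le> (- Re z)\<^sup>2"
  proof -
    have "0 \<le> norm z * cos \<alpha>" using cos_alpha_pos by simp
    then show ?thesis
      by (metis abs_le_square_iff abs_of_nonneg order_trans)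
  qed
  also have "(norm z * cos \<alpha>)\<^sup>2 \<le> (- Re z)\<^sup>2 \<longleftrightarrow> (Im z)\<^sup>2 \<le> (\<tau> * - Re z)\<^sup>2"
  proof -
    have h1: "(norm z * cos \<alpha>)\<^sup>2 = ((Re z)\<^sup>2 + (Im z)\<^sup>2) * (cos \<alpha>)\<^sup>2"
      by (simp add: power_mult_distrib cmod_power2)
    have h2: "(\<tau> * - Re z)\<^sup>2 * (cos \<alpha>)\<^sup>2 = (Re z)\<^sup>2 * (1 - (cos \<alpha>)\<^sup>2)"
      using cos_alpha_pos
      by (simp add: tan_def power_mult_distrib power_divide sin_squared_eq)
    have h3: "(Im z)\<^sup>2 \<le> (\<tau> * - Re z)\<^sup>2 \<longleftrightarrow>
        (Im z)\<^sup>2 * (cos \<alpha>)\<^sup>2 \<le> (\<tau> * - Re z)\<^sup>2 * (cos \<alpha>)\<^sup>2"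
      using cos_alpha_pos by (subst mult_le_cancel_right) auto
    show ?thesis unfolding h1 h2 h3 by (simp add: algebra_simps)
  qed
  also have "0 \<le> - Re z \<and> (Im z)\<^sup>2 \<le> (\<tau> * - Re z)\<^sup>2 \<longleftrightarrow> \<bar>Im z\<bar> \<le> \<tau> * - Re z"
  proof
    assume "0 \<le> - Re z \<and> (Im z)\<^sup>2 \<le> (\<tau> * - Re z)\<^sup>2"
    then show "\<bar>Im z\<bar> \<le> \<tau> * - Re z"
      using tau_pos by (metis abs_le_square_iff abs_of_nonneg less_imp_le mult_nonneg_nonneg)
  next
    assume *: "\<bar>Im z\<bar> \<le> \<tau> * - Re z"
    then have "0 \<le> \<tau> * - Re z" by linarith
    then have "0 \<le> - Re z" using tau_pos by (simp add: zero_le_mult_iff mult_le_0_iff)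
    moreover have "(Im z)\<^sup>2 \<le> (\<tau> * - Re z)\<^sup>2" using * by (metis abs_ge_zero power2_abs power_mono)
    ultimately show "0 \<le> - Re z \<and> (Im z)\<^sup>2 \<le> (\<tau> * - Re z)\<^sup>2" by simp
  qed
  finally show ?thesis by (simp add: z_def)
qed

text \<open>\<open>z\<close> is the integral of the derivative of \<open>\<gamma>\<close> over
  \<open>\<gamma> - r\<close>, a continuous choice of the logarithm of the quotient of the two end
  positions. The integrand lies in a convex cone, and so does the integral.\<close>

lemma angle_restricted_piece:
  assumes \<gamma>: "angle_restricted r \<alpha> \<gamma>" and s: "0 \<le> s" "s \<le> 1"
    and avoid: "\<And>t. s \<le> t \<Longrightarrow> t \<le> 1 \<Longrightarrow> \<gamma> t \<noteq> r"
  shows "\<exists>z. \<bar>Im z\<bar> \<le> \<tau> * - Re z \<and> \<gamma> 1 = r + (\<gamma> s - r) * exp z"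
proof -
  obtain S where vp: "valid_path \<gamma>" and S: "finite S"
    and ar: "\<And>t. t \<in> {0..1} - S \<Longrightarrow> \<gamma> t \<noteq> r \<Longrightarrow>
      vec_angle (vector_derivative \<gamma> (at t)) (r - \<gamma> t) \<le> \<alpha>"
    using \<gamma> unfolding angle_restricted_def by blast
  define f where "f t = vector_derivative \<gamma> (at t) / (\<gamma> t - r)" for t
  have pc: "\<gamma> piecewise_C1_differentiable_on {s..1}"
    using vp s unfolding valid_path_def
    by (meson atLeastatMost_subset_iff order_refl piecewise_C1_differentiable_on_subset)
  have nr: "r \<notin> \<gamma> ` {s..1}" using avoid by force
  have fdef: "f = (\<lambda>t. vector_derivative \<gamma> (at t) / (\<gamma> t - r))" by (auto simp: f_def)
  note * = winding_number_exp_integral[OF pc s(2) nr, folded fdef]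
  define z where "z = integral {s..1} f"
  have fint: "(f has_integral z) {s..1}" using *(1) by (simp add: z_def integrable_integral)
  have "exp (- z) * (\<gamma> 1 - r) = \<gamma> s - r" using *(2) by (simp add: z_def)
  then have eq: "\<gamma> 1 = r + (\<gamma> s - r) * exp z"
    by (simp add: exp_minus field_simps)
  have bd: "\<bar>Im (f t)\<bar> \<le> \<tau> * - Re (f t)" if "t \<in> {s..1} - S" for t
  proof (cases "vector_derivative \<gamma> (at t) = 0")
    case True then show ?thesis by (simp add: f_def)
  next
    case False
    have n: "\<gamma> t \<noteq> r" using that avoid by auto
    have "vec_angle (vector_derivative \<gamma> (at t)) (- (\<gamma> t - r)) \<le> \<alpha>"
      using ar[of t] that s n by simp
    then show ?thesis unfolding f_def
      by (subst (asm) vec_angle_le_iff) (use n False in auto)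
  qed
  have Imi: "((\<lambda>t. Im (f t)) has_integral Im z) {s..1}"
    and Rei: "((\<lambda>t. Re (f t)) has_integral Re z) {s..1}"
    using fint has_integral_componentwise_iff
    by (auto intro: has_integral_Im has_integral_Re)
  have neg: "negligible S" using S by (simp add: negligible_finite)
  have ReN: "((\<lambda>t. \<tau> * - Re (f t)) has_integral \<tau> * - Re z) {s..1}"
    by (intro has_integral_mult_right has_integral_neg Rei)
  \<comment> \<open>At the finitely many exceptional parameters the integrand is reset to 0, which
    lies in the cone, so the bound holds at every point of the interval.\<close>
  define g where "g t = (if t \<in> S then 0 else Im (f t))" for t
  define h where "h t = (if t \<in> S then 0 else \<tau> * - Re (f t))" for t
  have g: "(g has_integral Im z) {s..1}" 
    by (rule has_integral_spike[OF neg _ Imi]) (auto simp: g_def)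
  have h: "(h has_integral \<tau> * - Re z) {s..1}"
    by (rule has_integral_spike[OF neg _ ReN]) (auto simp: h_def)
  have "Im z \<le> \<tau> * - Re z"
    by (rule has_integral_le[OF g h]) (use bd in \<open>fastforce simp: g_def h_def\<close>)
  moreover have "- Im z \<le> \<tau> * - Re z"
    by (rule has_integral_le[OF has_integral_neg[OF g] h]) (use bd in \<open>fastforce simp: g_def h_def\<close>)
  ultimately have "\<bar>Im z\<bar> \<le> \<tau> * - Re z" by linarith
  with eq show ?thesis by blast
qed

text \<open>At \<open>r\<close> itself no angle is prescribed, so leaving \<open>r\<close> must be
  excluded. After the last visit the distance to \<open>r\<close> cannot grow, by the cone estimate,
  but it tends to 0 towards that visit.\<close>

lemma angle_restricted_to_root:
  assumes \<gamma>: "angle_restricted r \<alpha> \<gamma>" and t: "0 \<le> t" "t \<le> 1" "\<gamma> t = r"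
  shows "\<gamma> 1 = r"
proof (rule ccontr)
  assume neq: "\<gamma> 1 \<noteq> r"
  have cont: "continuous_on {0..1} \<gamma>"
    using \<gamma> unfolding angle_restricted_def by (auto dest: valid_path_imp_path simp: path_def)
  define Z where "Z = {t \<in> {0..1}. \<gamma> t = r}"
  have "compact Z"
  proof -
    have "closed Z" unfolding Z_def
      by (rule continuous_closed_preimage_constant[OF cont]) simp
    then show ?thesis unfolding Z_def
      by (metis (no_types, lifting) bounded_closed_interval bounded_subset compact_eq_bounded_closed mem_Collect_eq subsetI)
  qed
  moreover have "Z \<noteq> {}" using t by (auto simp: Z_def)
  ultimately obtain t0 where t0: "t0 \<in> Z" "\<And>u. u \<in> Z \<Longrightarrow> u \<le> t0"
    using compact_attains_sup by metis
  have t01: "0 \<le> t0" "t0 < 1" "\<gamma> t0 = r"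
    using t0 neq by (auto simp: Z_def order_less_le)
  have le: "dist r (\<gamma> 1) \<le> dist r (\<gamma> s)" if s: "t0 < s" "s < 1" for s
  proof -
    have "\<And>u. s \<le> u \<Longrightarrow> u \<le> 1 \<Longrightarrow> \<gamma> u \<noteq> r"
      using t0(2)[unfolded Z_def] s t01 by (smt (verit) atLeastAtMost_iff mem_Collect_eq)
    then obtain z where z: "\<bar>Im z\<bar> \<le> \<tau> * - Re z" "\<gamma> 1 = r + (\<gamma> s - r) * exp z"
      using angle_restricted_piece[OF \<gamma>, of s] s t01 by auto
    have "0 \<le> \<tau> * - Re z" using z(1) by linarith
    then have "Re z \<le> 0" using tau_pos by (simp add: mult_le_0_iff)
    then have "dist r (\<gamma> s) * exp (Re z) \<le> dist r (\<gamma> s) * 1"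
      by (intro mult_left_mono) auto
    then show ?thesis by (simp add: z(2) dist_norm norm_mult norm_minus_commute)
  qed
  have "((\<lambda>s. dist r (\<gamma> s)) \<longlongrightarrow> dist r (\<gamma> t0)) (at t0 within {0..1})"
    using cont t01 by (intro tendsto_dist tendsto_const) (auto simp: continuous_on_def)
  then have lim: "((\<lambda>s. dist r (\<gamma> s)) \<longlongrightarrow> dist r (\<gamma> t0)) (at t0 within {t0<..<1})"
    by (rule tendsto_within_subset) (use t01 in auto)
  have nt: "at t0 within {t0<..<1} \<noteq> bot"
    using t01 by (simp add: at_within_eq_bot_iff)
  have "dist r (\<gamma> 1) \<le> dist r (\<gamma> t0)"
    by (rule tendsto_lowerbound[OF lim _ nt]) (auto simp: eventually_at_filter le)
  then show False using t01 neq by simp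
qed

lemma exp_eq_go:
  assumes "\<bar>Im z\<bar> \<le> \<tau> * - Re z"
  obtains a b where "0 \<le> a" "0 \<le> b" "\<And>p. r + (p - r) * exp z = go p a b"
proof
  \<comment> \<open>The coordinates of \<open>z\<close> along the two extreme rays solve
    \<open>a + b = - Re z\<close> and \<open>a - b = Im z / \<tau>\<close>.\<close>
  define h where "h = Im z / \<tau>"
  show "0 \<le> (- Re z + h) / 2" "0 \<le> (- Re z - h) / 2"
    using assms tau_pos by (auto simp: h_def field_simps)
  show "r + (p - r) * exp z = go p ((- Re z + h) / 2) ((- Re z - h) / 2)" for p
  proof -
    have "\<tau> * ((- Re z + h) / 2 - (- Re z - h) / 2) = Im z"
      using tau_pos by (simp add: h_def field_simps)
    moreover have "- ((- Re z + h) / 2 + (- Re z - h) / 2) = Re z" by (simp add: field_simps)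
    ultimately show ?thesis
      by (simp only: go_def exp_eq_polar[of z] of_real_exp) (simp add: mult.assoc)
  qed
qed

lemma spiral_region_subset:
  assumes "q \<in> spiral_region r \<alpha> p" "q \<noteq> r"
  shows "\<exists>a b. 0 \<le> a \<and> 0 \<le> b \<and> q = go p a b"
proof (cases "q = p")
  case True then show ?thesis by (intro exI[of _ 0]) auto
next
  case False
  then obtain \<gamma> where \<gamma>: "angle_restricted r \<alpha> \<gamma>" "\<gamma> 0 = p" "\<gamma> 1 = q"
    using assms by (auto simp: spiral_region_def pathstart_def pathfinish_def)
  then have "\<And>t. 0 \<le> t \<Longrightarrow> t \<le> 1 \<Longrightarrow> \<gamma> t \<noteq> r"
    using angle_restricted_to_root assms(2) by metis
  then obtain z where "\<bar>Im z\<bar> \<le> \<tau> * - Re z" "q = r + (p - r) * exp z"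
    using angle_restricted_piece[OF \<gamma>(1), of 0] \<gamma> by auto
  then show ?thesis by (metis exp_eq_go)
qed

text \<open>A path with constant logarithmic derivative \<open>z\<close> in the cone is a
  logarithmic spiral and keeps a fixed angle to the direction of \<open>r\<close>.\<close>

lemma go_in_region:
  assumes "0 \<le> a" "0 \<le> b"
  shows "go p a b \<in> spiral_region r \<alpha> p"
proof (cases "p = r \<or> (a = 0 \<and> b = 0)")
  case True then show ?thesis by (auto simp: spiral_region_def)
next
  case False
  define z where "z = Complex (- (a + b)) (\<tau> * (a - b))"
  have z0: "z \<noteq> 0" using False assms by (auto simp: z_def complex_eq_iff)
  have zle: "\<bar>Im z\<bar> \<le> \<tau> * - Re z"
    using tau_pos assms by (simp add: z_def abs_mult)
  define \<gamma> where "\<gamma> t = r + (p - r) * exp (of_real t * z)" for t :: real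
  have exz: "exp z = of_real (exp (- (a + b))) * cis (\<tau> * (a - b))"
    by (simp add: z_def exp_eq_polar[of "Complex _ _"] exp_of_real)
  have end1: "\<gamma> 1 = go p a b" by (simp add: \<gamma>_def go_def exz mult.assoc)
  have der: "(\<gamma> has_vector_derivative (\<gamma> t - r) * z) (at t)" for t
    unfolding \<gamma>_def
    by (rule has_vector_derivative_real_field) (auto intro!: derivative_eq_intros)
  have vd: "vector_derivative \<gamma> (at t) = (\<gamma> t - r) * z" for t
    using der by (rule vector_derivative_at)
  have cont: "continuous_on S \<gamma>" for S
    unfolding \<gamma>_def by (intro continuous_intros)
  have "\<gamma> C1_differentiable_on {0..1}"
    unfolding C1_differentiable_on_def
  proof (intro exI conjI ballI)
    show "(\<gamma> has_vector_derivative (\<gamma> t - r) * z) (at t)" for t by (rule der)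
    show "continuous_on {0..1} (\<lambda>t. (\<gamma> t - r) * z)" by (intro continuous_intros cont)
  qed
  then have "valid_path \<gamma>"
    by (simp add: valid_path_def C1_differentiable_imp_piecewise)
  moreover have "\<gamma> differentiable (at t) \<and>
      vec_angle (vector_derivative \<gamma> (at t)) (r - \<gamma> t) \<le> \<alpha>" if "\<gamma> t \<noteq> r" for t
  proof
    show "\<gamma> differentiable (at t)" using der by (rule differentiableI_vector)
    have "vec_angle ((\<gamma> t - r) * z) (- (\<gamma> t - r)) \<le> \<alpha>"
      using that z0 zle by (subst vec_angle_le_iff) auto
    then show "vec_angle (vector_derivative \<gamma> (at t)) (r - \<gamma> t) \<le> \<alpha>" by (simp add: vd)
  qed
  ultimately have "angle_restricted r \<alpha> \<gamma>"
    unfolding angle_restricted_def by (intro conjI exI[of _ "{}"]) auto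
  then show ?thesis
    using end1 by (auto simp: spiral_region_def pathstart_def pathfinish_def \<gamma>_def intro!: exI[of _ \<gamma>])
qed

text \<open>Spirals reach \<open>r\<close> only in the limit, so \<open>r\<close> is no value of
  \<open>go p\<close> for \<open>p \<noteq> r\<close>. The straight segment has angle 0 to the
  direction of \<open>r\<close>.\<close>

lemma root_in_region: "r \<in> spiral_region r \<alpha> p"
proof (cases "p = r")
  case True then show ?thesis by (simp add: spiral_region_def)
next
  case False
  define \<gamma> where "\<gamma> = linepath p r"
  have vd: "vector_derivative \<gamma> (at t) = r - p" for t
    by (simp add: \<gamma>_def)
  have dif: "\<gamma> differentiable (at t)" for t
    unfolding \<gamma>_def by (metis differentiableI_vector has_vector_derivative_linepath_within)
  have "vec_angle (r - p) (r - \<gamma> t) \<le> \<alpha>" if "\<gamma> t \<noteq> r" "t \<in> {0..1}" for t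
  proof -
    have eq: "r - p = - (p - r)" and w: "\<gamma> t - r = of_real (1 - t) * (p - r)"
      by (simp_all add: \<gamma>_def linepath_def scaleR_conv_of_real algebra_simps)
    have t1: "1 - t > 0" using that w by (cases "t = 1") auto
    have "(r - p) / (\<gamma> t - r) = of_real (- (1 / (1 - t)))"
      using False t1 unfolding w eq by (simp add: divide_simps del: of_real_diff)
    then have "vec_angle (r - p) (- (\<gamma> t - r)) \<le> \<alpha>"
      using that False t1 tau_pos by (subst vec_angle_le_iff) auto
    then show ?thesis by simp
  qed
  then have "angle_restricted r \<alpha> \<gamma>"
    unfolding angle_restricted_def vd using dif by (intro conjI exI[of _ "{}"]) (auto simp: \<gamma>_def)
  then show ?thesis by (auto simp: spiral_region_def \<gamma>_def intro!: exI[of _ \<gamma>])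
qed

text \<open>The coordinates are not cut off at \<open>pi * cot \<alpha>\<close>: beyond a half turn
  the cone overlaps itself around \<open>r\<close>. A point may thus have several pairs of
  coordinates, and later statements work with any of them.\<close>

lemma spiral_region_eq: "spiral_region r \<alpha> p = insert r {go p a b |a b. 0 \<le> a \<and> 0 \<le> b}"
  using spiral_region_subset root_in_region go_in_region by blast


abbreviation reg :: "complex \<Rightarrow> complex set" where "reg \<equiv> spiral_region r \<alpha>"

lemma reg_cases:
  assumes "q \<in> reg p"
  obtains "q = r" | a b where "0 \<le> a" "0 \<le> b" "q = go p a b"
  using assms by (auto simp: spiral_region_eq)

lemma reg_refl [simp]: "p \<in> reg p"
  by (simp add: spiral_region_def)

lemma reg_trans: "q \<in> reg p \<Longrightarrow> z \<in> reg q \<Longrightarrow> z \<in> reg p"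
  unfolding spiral_region_eq by (auto simp: go_go) (metis add_nonneg_nonneg)

lemma reg_root [simp]: "reg r = {r}"
  by (auto simp: spiral_region_eq)

lemma reg_dist_le: "q \<in> reg p \<Longrightarrow> dist r q \<le> dist r p"
  by (erule reg_cases) (auto simp: dist_go intro!: mult_left_le)

lemma reg_dist_less: "q \<in> reg p \<Longrightarrow> q \<noteq> p \<Longrightarrow> dist r q < dist r p"
proof (erule reg_cases)
  fix a b :: real
  assume "0 \<le> a" "0 \<le> b" "q = go p a b" "q \<noteq> p"
  moreover from this have "a + b \<noteq> 0" "p \<noteq> r" by (auto simp: add_nonneg_eq_0_iff)
  ultimately show ?thesis by (simp add: dist_go)
qed auto

section \<open>Lengths of spiral segments and arcs\<close>

lemma vector_derivative_spiral:
  "vector_derivative (spiral r \<beta> p) (at t) = (spiral r \<beta> p t - r) * Complex (- 1) (tan \<beta>)"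
proof -
  have eq: "spiral r \<beta> p t = r + (p - r) * exp (of_real t * Complex (- 1) (tan \<beta>))" for t
    by (simp add: spiral_def exp_eq_polar[of "of_real t * Complex _ _"] exp_of_real mult.assoc mult.commute[of t])
  show ?thesis
    unfolding eq[abs_def]
    by (rule vector_derivative_at, rule has_vector_derivative_real_field)
       (auto intro!: derivative_eq_intros)
qed

lemma segment_length_eq:
  assumes "0 \<le> T"
  shows "segment_length r \<alpha> p (d, T) = (dist r p - dist r (segment_end r \<alpha> p (d, T))) / cos \<alpha>"
proof -
  define \<beta> where "\<beta> = side_angle \<alpha> d"
  have c: "cos \<beta> = cos \<alpha>" by (cases d) (auto simp: \<beta>_def)
  have nz: "norm (Complex (- 1) (tan \<beta>)) = 1 / cos \<alpha>"
  proof -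
    have "cos \<beta> \<noteq> 0" using c cos_alpha_pos by simp
    then have "1 + (tan \<beta>)\<^sup>2 = (1 / cos \<alpha>)\<^sup>2" using tan_sec[of \<beta>] c by (simp add: field_simps)
    then show ?thesis using cos_alpha_pos by (simp add: complex_norm)
  qed
  have ds: "dist r (spiral r \<beta> p t) = dist r p * exp (- t)" for t
    by (simp add: spiral_def dist_norm norm_mult norm_minus_commute)
  have nd: "norm (vector_derivative (spiral r \<beta> p) (at t)) = dist r p / cos \<alpha> * exp (- t)" for t
    using ds[of t] by (simp add: vector_derivative_spiral norm_mult nz dist_norm norm_minus_commute)
  show ?thesis
  proof (cases T)
    case (real x)
    then have x: "0 \<le> x" using assms by simp
    have "((\<lambda>t. exp (- t)) has_integral (- exp (- x) - (- exp (- 0)))) {0..x}"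
      using x by (intro fundamental_theorem_of_calculus)
        (auto intro!: derivative_eq_intros simp flip: has_real_derivative_iff_has_vector_derivative)
    then have "((\<lambda>t. dist r p / cos \<alpha> * exp (- t)) has_integral
        dist r p / cos \<alpha> * (- exp (- x) - (- exp (- 0)))) {0..x}"
      by (rule has_integral_mult_right)
    then have "integral {0..x} (\<lambda>t. dist r p / cos \<alpha> * exp (- t)) =
        dist r p / cos \<alpha> * (- exp (- x) - (- exp (- 0)))"
      by (rule integral_unique)
    moreover have "{t. 0 \<le> t \<and> ereal t \<le> T} = {0..x}" using real by auto
    ultimately have "segment_length r \<alpha> p (d, T) = dist r p / cos \<alpha> * (- exp (- x) - (- exp (- 0)))"
      by (simp only: segment_length.simps nd flip: \<beta>_def)
    then show ?thesis
      using real by (simp add: ds diff_divide_distrib right_diff_distrib flip: \<beta>_def)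
  next
    case PInf
    have "((\<lambda>t::real. exp (- 1 * t)) has_integral exp (- 1 * 0) / 1) {0..}"
      by (rule has_integral_exp_minus_to_infinity) simp
    then have "((\<lambda>t. dist r p / cos \<alpha> * exp (- t)) has_integral dist r p / cos \<alpha> * 1) {0..}"
      by (intro has_integral_mult_right) simp
    moreover have "{t. 0 \<le> t \<and> ereal t \<le> T} = {0..}" using PInf by auto
    ultimately have "segment_length r \<alpha> p (d, T) = dist r p / cos \<alpha> * 1"
      by (simp only: segment_length.simps nd integral_unique flip: \<beta>_def)
    then show ?thesis
      using PInf by simp
  qed (use assms in auto)
qed

lemma segment_end_reg:
  assumes "0 \<le> T"
  shows "segment_end r \<alpha> p (d, T) \<in> reg p"
  using assms by (cases d; cases T)
    (auto simp: spiral_right spiral_left intro: go_in_region root_in_region)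

lemma arc_length_eq:
  assumes "\<forall>(d, T)\<in>set a. 0 \<le> T"
  shows "arc_length r \<alpha> p a = (dist r p - dist r (arc_end r \<alpha> p a)) / cos \<alpha>"
  using assms
proof (induction a arbitrary: p)
  case (Cons s a)
  obtain d T where s: "s = (d, T)" by force
  have "arc_length r \<alpha> (segment_end r \<alpha> p s) a =
      (dist r (segment_end r \<alpha> p s) - dist r (arc_end r \<alpha> (segment_end r \<alpha> p s) a)) / cos \<alpha>"
    using Cons by simp
  moreover have "segment_length r \<alpha> p s = (dist r p - dist r (segment_end r \<alpha> p s)) / cos \<alpha>"
    using Cons.prems segment_length_eq[of T p d] by (simp add: s del: segment_length.simps segment_end.simps)
  ultimately show ?case by (simp add: diff_divide_distrib del: segment_length.simps segment_end.simps)
qed simp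

lemma arc_end_reg:
  assumes "\<forall>(d, T)\<in>set a. 0 \<le> T"
  shows "arc_end r \<alpha> p a \<in> reg p"
  using assms
proof (induction a arbitrary: p)
  case (Cons s a)
  obtain d T where s: "s = (d, T)" by force
  have "segment_end r \<alpha> p s \<in> reg p" using Cons.prems by (auto simp: s intro!: segment_end_reg simp del: segment_end.simps)
  then show ?case using Cons reg_trans by simp
qed simp

lemma arc_from_toD:
  assumes "arc_from_to r \<alpha> a p q"
  shows "q \<in> reg p" and "arc_length r \<alpha> p a = (dist r p - dist r q) / cos \<alpha>"
  using assms arc_end_reg arc_length_eq by (auto simp: arc_from_to_def)

section \<open>Existence and position of join points\<close>

text \<open>Common points no nearer than \<open>z\<close> form a compact set: in coordinates each
  region is cut down to the triangle \<open>a + b \<le> c\<close>. So a farthest one exists, which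
  turns maximality among join points into a bound on all common points.\<close>

lemma join_exists:
  assumes "z \<in> reg u" "z \<in> reg v" "z \<noteq> r"
  shows "\<exists>p. join_point r \<alpha> u v p \<and> dist r z \<le> dist r p"
proof -
  define \<rho> where "\<rho> = dist r z"
  have \<rho>: "0 < \<rho>" using assms by (simp add: \<rho>_def)
  have comp: "compact {q \<in> reg w. \<rho> \<le> dist r q}" if w: "z \<in> reg w" for w
  proof -
    have "w \<noteq> r" using w assms(3) reg_root by blast
    then have wr: "0 < dist r w" by simp
    define c where "c = ln (dist r w / \<rho>)"
    define K where "K = {ab :: real \<times> real. 0 \<le> fst ab \<and> 0 \<le> snd ab \<and> fst ab + snd ab \<le> c}"
    have "compact K"
      unfolding compact_eq_bounded_closed
    proof (intro conjI)
      show "closed K" unfolding K_def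
        by (intro closed_Collect_conj closed_Collect_le continuous_intros)
      have "K \<subseteq> {0..c} \<times> {0..c}" by (auto simp: K_def)
      moreover have "bounded ({0..c} \<times> {0..c})" by (intro bounded_Times) auto
      ultimately show "bounded K" by (rule bounded_subset[rotated])
    qed
    moreover have "continuous_on K (\<lambda>ab. go w (fst ab) (snd ab))"
      unfolding go_def cis_conv_exp by (intro continuous_intros)
    moreover have "{q \<in> reg w. \<rho> \<le> dist r q} = (\<lambda>ab. go w (fst ab) (snd ab)) ` K"
    proof -
      have *: "\<rho> \<le> dist r w * exp (- s) \<longleftrightarrow> s \<le> c" for s
      proof -
        have "\<rho> \<le> dist r w * exp (- s) \<longleftrightarrow> exp s \<le> dist r w / \<rho>"
          using \<rho> by (simp add: exp_minus field_simps)
        then show ?thesis using \<rho> wr by (simp add: c_def ln_ge_iff)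
      qed
      have "\<rho> \<le> dist r (go w a b) \<longleftrightarrow> a + b \<le> c" for a b
        using *[of "a + b"] by (simp add: dist_go)
      moreover have "\<not> \<rho> \<le> dist r r" using \<rho> by simp
      ultimately show ?thesis
        unfolding spiral_region_eq K_def by (auto simp: image_def simp del: dist_self)
    qed
    ultimately show ?thesis using compact_continuous_image by metis
  qed
  define C where "C = {q \<in> reg u. \<rho> \<le> dist r q} \<inter> {q \<in> reg v. \<rho> \<le> dist r q}"
  have "compact C" "z \<in> C"
    unfolding C_def using comp assms by (auto intro: compact_Int simp: \<rho>_def)
  then obtain p where p: "p \<in> C" "\<And>q. q \<in> C \<Longrightarrow> dist r q \<le> dist r p"
    using continuous_attains_sup[of C "dist r"] continuous_on_dist[OF continuous_on_const continuous_on_id]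
    by (metis empty_iff id_apply)
  have "dist r q \<le> dist r p" if "q \<in> reg u \<inter> reg v" for q
    using p that by (cases "\<rho> \<le> dist r q") (auto simp: C_def)
  then show ?thesis using p \<open>z \<in> C\<close>
    by (intro exI[of _ p]) (auto simp: join_point_def C_def \<rho>_def)
qed

text \<open>Moving \<open>p\<close> back along a spiral that both representations use for a positive
  time stays in both regions and gains distance from \<open>r\<close>, against the choice of
  \<open>p\<close>.\<close>

lemma join_not_interior:
  assumes "join_point r \<alpha> u v p" "p \<noteq> r" "p = go u a b" "p = go v c d"
    and "0 \<le> a" "0 \<le> b" "0 \<le> c" "0 \<le> d"
  shows "\<not> (0 < b \<and> 0 < d)" "\<not> (0 < a \<and> 0 < c)"
proof -
  have shift: "s = 0 \<and> t = 0"
    if "0 \<le> a - s" "0 \<le> b - t" "0 \<le> c - s" "0 \<le> d - t" "0 \<le> s" "0 \<le> t" for s t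
  proof -
    have q: "go p (- s) (- t) = go u (a - s) (b - t)" "go p (- s) (- t) = go v (c - s) (d - t)"
      using assms(3,4) by (metis go_go uminus_add_conv_diff add.commute)+
    then have "go p (- s) (- t) \<in> reg u \<inter> reg v"
      using that by (metis IntI go_in_region)
    then have "dist r (go p (- s) (- t)) \<le> dist r p" using assms(1) by (auto simp: join_point_def)
    then have "s + t \<le> 0" using assms(2) by (simp add: dist_go mult_le_cancel_left1)
    then show ?thesis using that by linarith
  qed
  show "\<not> (0 < b \<and> 0 < d)"
    using shift[of 0 "min b d"] assms(5-) by (cases "b \<le> d") auto
  show "\<not> (0 < a \<and> 0 < c)"
    using shift[of "min a c" 0] assms(5-) by (cases "a \<le> c") auto
qed

text \<open>For each of the two kinds of spiral, one of the nodes uses it for time 0. If the same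
  node does so for both, it is \<open>p\<close>; otherwise the nodes arrive on different kinds of
  spiral.\<close>

lemma join_cases:
  assumes "join_point r \<alpha> u v p" "p \<noteq> r"
  shows "p = u \<or> p = v \<or> (\<exists>s t. 0 \<le> s \<and> 0 \<le> t \<and> p = go u s 0 \<and> p = go v 0 t) \<or>
    (\<exists>s t. 0 \<le> s \<and> 0 \<le> t \<and> p = go u 0 s \<and> p = go v t 0)"
proof -
  obtain a b c d where ab: "0 \<le> a" "0 \<le> b" "p = go u a b" and cd: "0 \<le> c" "0 \<le> d" "p = go v c d"
    using assms by (auto simp: join_point_def elim!: reg_cases)
  consider "a = 0" "b = 0" | "c = 0" "d = 0" | "b = 0" "c = 0" | "a = 0" "d = 0"
    using join_not_interior[OF assms ab(3) cd(3)] ab cd by fastforce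
  then show ?thesis using ab cd by cases (auto, metis, metis)
qed

end

section \<open>The forests of the greedy algorithm\<close>

context spiral_geometry
begin

text \<open>The default 0 treats an active node as if its arc already led to \<open>r\<close>:
  connecting the last node to \<open>r\<close> then changes no value.\<close>

definition parent_dist :: "forest \<Rightarrow> complex \<Rightarrow> real" where
  "parent_dist F u = (case up F u of None \<Rightarrow> 0 | Some (v, _) \<Rightarrow> dist r v)"

definition left_rel :: "forest \<Rightarrow> (complex \<times> complex) set" where
  "left_rel F = {(x, y) \<in> parent_rel F. \<exists>t\<ge>0. y = go x 0 t}"

definition right_rel :: "forest \<Rightarrow> (complex \<times> complex) set" where
  "right_rel F = {(x, y) \<in> parent_rel F. \<exists>t\<ge>0. y = go x t 0}"

definition arc_forest :: "complex list \<Rightarrow> forest \<Rightarrow> bool" where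
  "arc_forest ts F \<longleftrightarrow> finite (nodes F) \<and> set ts \<subseteq> nodes F \<and> dom (up F) \<subseteq> nodes F \<and>
     (\<forall>u v a. up F u = Some (v, a) \<longrightarrow> v \<in> nodes F \<and> v \<noteq> u \<and> arc_from_to r \<alpha> a u v)"

text \<open>Lying on a spiral of a terminal would not suffice: the chain through nodes of the forest
  also provides, for each circle passed on the way, a node from which the point of the spiral on
  that circle is reachable.\<close>

definition chained :: "complex list \<Rightarrow> forest \<Rightarrow> bool" where
  "chained ts F \<longleftrightarrow> (\<forall>p\<in>nodes F. p \<noteq> r \<longrightarrow>
     (\<exists>l\<in>set ts. (l, p) \<in> (left_rel F)\<^sup>*) \<and> (\<exists>l\<in>set ts. (l, p) \<in> (right_rel F)\<^sup>*))"

text \<open>The fourth conjunct is the separation used for the count; the fifth says that joins come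
  with nonincreasing distance. The fifth lets the fourth survive a step, when the new node is
  compared with nodes that received parents earlier.\<close>

definition greedy_inv :: "complex list \<Rightarrow> forest \<Rightarrow> bool" where
  "greedy_inv ts F \<longleftrightarrow> arc_forest ts F \<and> chained ts F \<and>
     (\<forall>u\<in>nodes F. \<exists>w\<in>active F. (u, w) \<in> (parent_rel F)\<^sup>*) \<and>
     (\<forall>u\<in>nodes F. \<forall>v\<in>nodes F. \<forall>z\<in>reg u \<inter> reg v. u \<noteq> v \<longrightarrow> z \<noteq> r \<longrightarrow>
        (u \<in> active F \<and> v \<in> active F) \<or> dist r z \<le> max (parent_dist F u) (parent_dist F v)) \<and>
     (\<forall>y\<in>dom (up F). \<forall>u\<in>active F. \<forall>v\<in>active F. \<forall>z\<in>reg u \<inter> reg v. u \<noteq> v \<longrightarrow>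
        dist r z \<le> parent_dist F y)"

lemma parent_dist_nonneg: "0 \<le> parent_dist F u"
  by (auto simp: parent_dist_def split: option.splits)

lemma arc_forest_parent:
  assumes "arc_forest ts F" "(u, v) \<in> parent_rel F"
  shows "u \<in> nodes F" "v \<in> nodes F" "v \<in> reg u" "dist r v < dist r u" "parent_dist F u = dist r v"
proof -
  obtain a where a: "up F u = Some (v, a)" using assms(2) by (auto simp: parent_rel_def)
  show "u \<in> nodes F" "v \<in> nodes F" using assms(1) a by (auto simp: arc_forest_def)
  have "arc_from_to r \<alpha> a u v" using assms(1) a by (simp add: arc_forest_def)
  then show "v \<in> reg u" by (rule arc_from_toD)
  moreover have "v \<noteq> u" using assms(1) a by (simp add: arc_forest_def)
  ultimately show "dist r v < dist r u" by (rule reg_dist_less)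
  show "parent_dist F u = dist r v" by (simp add: a parent_dist_def)
qed

lemma root_has_no_parent: "arc_forest ts F \<Longrightarrow> up F r = None"
proof (rule ccontr)
  assume af: "arc_forest ts F" and "up F r \<noteq> None"
  then obtain v a where "up F r = Some (v, a)" by auto
  then have "(r, v) \<in> parent_rel F" by (auto simp: parent_rel_def)
  from arc_forest_parent(4)[OF af this] show False by simp
qed

lemma greedy_inv_initial: "greedy_inv ts (initial_forest ts)"
  by (auto simp: greedy_inv_def arc_forest_def chained_def initial_forest_def active_def)

lemma join_point_bound:
  assumes max: "\<forall>u'\<in>active F. \<forall>v'\<in>active F. \<forall>p'. u' \<noteq> v' \<longrightarrow> join_point r \<alpha> u' v' p' \<longrightarrow>
      dist r p' \<le> dist r p"
    and "u \<in> active F" "v \<in> active F" "u \<noteq> v" "z \<in> reg u" "z \<in> reg v"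
  shows "dist r z \<le> dist r p"
proof (cases "z = r")
  case False
  then show ?thesis using join_exists[of z u v] max assms(2-) by force
qed auto

text \<open>A parent of \<open>p\<close> would be nearer to \<open>r\<close> than \<open>p\<close>,
  yet parents assigned earlier are no nearer than any common point of two active nodes. So
  \<open>p\<close> is new or active.\<close>

lemma join_point_not_inactive:
  assumes inv: "greedy_inv ts F" and "u \<in> active F" "v \<in> active F" "u \<noteq> v" "join_point r \<alpha> u v p"
  shows "up F p = None"
proof (rule ccontr)
  assume "up F p \<noteq> None"
  then obtain q a where q: "up F p = Some (q, a)" by auto
  have "p \<in> reg u \<inter> reg v" using assms(5) by (simp add: join_point_def)
  then have "dist r p \<le> parent_dist F p"
    using inv assms(2-4) q unfolding greedy_inv_def by blast
  moreover have "dist r q < dist r p" "parent_dist F p = dist r q"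
    using arc_forest_parent[of ts F p q] inv q by (auto simp: greedy_inv_def parent_rel_def)
  ultimately show False by simp
qed

lemma connect_simps [simp]:
  "nodes (connect U p a F) = insert p (nodes F)"
  "up (connect U p a F) x = (if x \<in> U - {p} then Some (p, a x) else up F x)"
  by (simp_all add: connect_def)

lemma greedy_inv_step:
  assumes inv: "greedy_inv ts F" and u: "u \<in> active F" and v: "v \<in> active F" and uv: "u \<noteq> v"
    and join: "join_point r \<alpha> u v p"
    and max: "\<forall>u'\<in>active F. \<forall>v'\<in>active F. \<forall>p'. u' \<noteq> v' \<longrightarrow> join_point r \<alpha> u' v' p' \<longrightarrow>
      dist r p' \<le> dist r p"
    and arcs: "\<forall>x\<in>{u, v} - {p}. arc_from_to r \<alpha> (a x) x p"
  shows "greedy_inv ts (connect {u, v} p a F)"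
proof -
  let ?F = "connect {u, v} p a F"
  have af: "arc_forest ts F" and ch: "chained ts F"
    and reach: "\<And>x. x \<in> nodes F \<Longrightarrow> \<exists>w\<in>active F. (x, w) \<in> (parent_rel F)\<^sup>*"
    and sep: "\<And>x y z. \<lbrakk>x \<in> nodes F; y \<in> nodes F; z \<in> reg x; z \<in> reg y; x \<noteq> y; z \<noteq> r\<rbrakk> \<Longrightarrow>
        (x \<in> active F \<and> y \<in> active F) \<or> dist r z \<le> max (parent_dist F x) (parent_dist F y)"
    and mono: "\<And>x y y' z. \<lbrakk>x \<in> dom (up F); y \<in> active F; y' \<in> active F; z \<in> reg y; z \<in> reg y';
        y \<noteq> y'\<rbrakk> \<Longrightarrow> dist r z \<le> parent_dist F x"
    using inv unfolding greedy_inv_def by blast+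
  have pu: "p \<in> reg u" and pv: "p \<in> reg v" using join by (auto simp: join_point_def)
  have upp: "up F p = None" using join_point_not_inactive[OF inv u v uv join] .
  have upu: "up F u = None" "up F v = None" and un: "u \<in> nodes F" "v \<in> nodes F"
    using u v by (auto simp: active_def)
  have act: "active ?F = (active F - {u, v}) \<union> {p}"
    using upp by (auto simp: active_def)
  have bound: "dist r z \<le> dist r p"
    if "x \<in> active F" "y \<in> active F" "x \<noteq> y" "z \<in> reg x" "z \<in> reg y" for x y z
    using join_point_bound[OF max] that by metis
  have pd: "parent_dist ?F x = (if x \<in> {u, v} - {p} then dist r p else parent_dist F x)" for x
    by (simp add: parent_dist_def)
  have pr: "parent_rel ?F = parent_rel F \<union> ({u, v} - {p}) \<times> {p}"
    using upu by (auto simp: parent_rel_def split: if_splits)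
  have dm: "dom (up ?F) = dom (up F) \<union> ({u, v} - {p})" by (auto split: if_splits)
  have pactive: "p \<in> active F" if "p \<in> nodes F" using that upp by (simp add: active_def)
  have af': "arc_forest ts ?F"
    using af un arcs unfolding arc_forest_def by (auto simp: dm split: if_splits)
  have ch': "chained ts ?F"
    unfolding chained_def
  proof (intro ballI impI)
    fix x assume x: "x \<in> nodes ?F" "x \<noteq> r"
    have L: "left_rel F \<subseteq> left_rel ?F" and R: "right_rel F \<subseteq> right_rel ?F"
      by (auto simp: left_rel_def right_rel_def pr)
    have old: "(\<exists>l\<in>set ts. (l, y) \<in> (left_rel ?F)\<^sup>*) \<and> (\<exists>l\<in>set ts. (l, y) \<in> (right_rel ?F)\<^sup>*)"
      if "y \<in> nodes F" "y \<noteq> r" for y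
      using ch that rtrancl_mono[OF L] rtrancl_mono[OF R] unfolding chained_def by blast
    show "(\<exists>l\<in>set ts. (l, x) \<in> (left_rel ?F)\<^sup>*) \<and> (\<exists>l\<in>set ts. (l, x) \<in> (right_rel ?F)\<^sup>*)"
    proof (cases "x \<in> nodes F")
      case True then show ?thesis using old x by blast
    next
      case False
      then have xp: "x = p" "p \<notin> {u, v}" using x un by auto
      have nr: "u \<noteq> r" "v \<noteq> r" using pu pv x xp by auto
      \<comment> \<open>\<open>y\<close> arrives at \<open>p\<close> on its right spiral and
        \<open>y'\<close> on its left spiral; which of \<open>u\<close> and \<open>v\<close> is
        which stays open.\<close>
      obtain y y' s t where y: "{y, y'} = {u, v}" and s: "0 \<le> s" "p = go y s 0" "0 \<le> t" "p = go y' 0 t"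
      proof -
        have "p \<noteq> r" "p \<noteq> u" "p \<noteq> v" using x xp by auto
        with join_cases[OF join] consider
          s t where "0 \<le> s" "0 \<le> t" "p = go u s 0" "p = go v 0 t"
          | s t where "0 \<le> s" "0 \<le> t" "p = go u 0 s" "p = go v t 0" by blast
        then show thesis by cases (auto intro: that[of u v] that[of v u])
      qed
      then have "(y, p) \<in> right_rel ?F" "(y', p) \<in> left_rel ?F"
        using xp unfolding left_rel_def right_rel_def pr by blast+
      moreover have "y \<in> {u, v}" "y' \<in> {u, v}" using y by blast+
      ultimately show ?thesis
        using old[of y] old[of y'] un nr xp by (metis empty_iff insert_iff rtrancl.rtrancl_into_rtrancl)
    qed
  qed
  have reach': "\<exists>w\<in>active ?F. (x, w) \<in> (parent_rel ?F)\<^sup>*" if "x \<in> nodes ?F" for x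
  proof (cases "x \<in> nodes F")
    case True
    then obtain w where w: "w \<in> active F" "(x, w) \<in> (parent_rel F)\<^sup>*" using reach by blast
    have w': "(x, w) \<in> (parent_rel ?F)\<^sup>*" using w(2) rtrancl_mono[of "parent_rel F" "parent_rel ?F"] by (auto simp: pr)
    show ?thesis
    proof (cases "w \<in> {u, v} - {p}")
      case True
      then have "(w, p) \<in> parent_rel ?F" by (auto simp: pr)
      then show ?thesis using w' unfolding act by (meson UnI2 rtrancl.rtrancl_into_rtrancl singletonI)
    next
      case False
      then show ?thesis using w w' unfolding act by blast
    qed
  next
    case False
    then show ?thesis using that act by auto
  qed
  have pd0: "parent_dist F x = 0" if "x \<in> active F" for x
    using that by (simp add: parent_dist_def active_def)
  \<comment> \<open>\<open>x\<close> has just received the parent \<open>p\<close>. Against active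
    nodes the maximality of \<open>p\<close> bounds all common points; against inactive ones the old
    invariant applies, to whose maximum \<open>x\<close> contributed 0.\<close>
  have sep1: "(x \<in> active ?F \<and> y \<in> active ?F) \<or> dist r z \<le> max (parent_dist ?F x) (parent_dist ?F y)"
    if x: "x \<in> {u, v} - {p}" and y: "y \<in> nodes ?F" and z: "z \<in> reg x" "z \<in> reg y" "x \<noteq> y" "z \<noteq> r" for x y z
  proof -
    have pdx: "parent_dist ?F x = dist r p" using x by (simp add: pd)
    have xn: "x \<in> active F" "x \<in> nodes F" using x u v un by auto
    show ?thesis
    proof (cases "y \<in> nodes F")
      case False
      then have "y = p" using y by auto
      then show ?thesis using reg_dist_le[of z p] z pdx by auto
    next
      case True
      show ?thesis
      proof (cases "y \<in> active F")
        case True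
        then show ?thesis using bound[OF xn(1) True z(3,1,2)] pdx by auto
      next
        case False
        then have "parent_dist ?F y = parent_dist F y" using u v by (auto simp: pd)
        then show ?thesis using sep[OF xn(2) \<open>y \<in> nodes F\<close> z] False pd0[OF xn(1)] parent_dist_nonneg[of F y]
          by auto
      qed
    qed
  qed
  \<comment> \<open>An inactive node got its parent earlier, hence at a distance no smaller than
    that of \<open>p\<close>, and nothing reachable from \<open>p\<close> is farther than
    \<open>p\<close>.\<close>
  have sep2: "(p \<in> active ?F \<and> y \<in> active ?F) \<or> dist r z \<le> max (parent_dist ?F p) (parent_dist ?F y)"
    if y: "y \<in> nodes F" "y \<notin> {u, v} - {p}" and z: "z \<in> reg p" "z \<in> reg y" "p \<noteq> y" "z \<noteq> r" for y z
  proof (cases "y \<in> active F")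
    case True
    then show ?thesis using act y by auto
  next
    case False
    then have "y \<in> dom (up F)" using y by (auto simp: active_def)
    then have "dist r p \<le> parent_dist F y" using mono u v uv pu pv by blast
    then show ?thesis using reg_dist_le[OF z(1)] y by (auto simp: pd)
  qed
  have sep': "(x \<in> active ?F \<and> y \<in> active ?F) \<or> dist r z \<le> max (parent_dist ?F x) (parent_dist ?F y)"
    if xy: "x \<in> nodes ?F" "y \<in> nodes ?F" and z: "z \<in> reg x" "z \<in> reg y" "x \<noteq> y" "z \<noteq> r" for x y z
  proof -
    consider "x \<in> {u, v} - {p}" | "y \<in> {u, v} - {p}"
      | "x = p" "y \<in> nodes F" "y \<notin> {u, v} - {p}" | "y = p" "x \<in> nodes F" "x \<notin> {u, v} - {p}"
      | "x \<in> nodes F" "x \<notin> {u, v}" "y \<in> nodes F" "y \<notin> {u, v}" "x \<noteq> p" "y \<noteq> p"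
      using xy z(3) by auto
    then show ?thesis
    proof cases
      case 1 then show ?thesis using sep1 xy z by blast
    next
      case 2 then show ?thesis using sep1[of y x z] xy z by (metis max.commute)
    next
      case 3 then show ?thesis using sep2 z by blast
    next
      case 4 then show ?thesis using sep2[of x z] z by (metis max.commute)
    next
      case 5 then show ?thesis using sep[of x y z] z by (auto simp: pd act)
    qed
  qed
  have mono': "dist r z \<le> parent_dist ?F y"
    if y: "y \<in> dom (up ?F)" and xx: "x \<in> active ?F" "x' \<in> active ?F" "x \<noteq> x'"
      and z: "z \<in> reg x" "z \<in> reg x'" for x x' y z
  proof -
    have zp: "dist r z \<le> dist r p" 
    proof (cases "x = p \<or> x' = p")
      case True then show ?thesis using z reg_dist_le by blast
    next
      case False then show ?thesis using bound xx z act by auto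
    qed
    show ?thesis
    proof (cases "y \<in> {u, v} - {p}")
      case True then show ?thesis using zp by (simp add: pd)
    next
      case False
      then have "y \<in> dom (up F)" using y dm by auto
      then have "dist r p \<le> parent_dist F y" using mono u v uv pu pv by blast
      then show ?thesis using zp False by (auto simp: pd)
    qed
  qed
  show ?thesis
    unfolding greedy_inv_def using af' ch' reach' sep' mono' by blast
qed

lemma greedy_steps_inv:
  assumes "(greedy_step r \<alpha>)\<^sup>*\<^sup>* (initial_forest ts) F"
  shows "greedy_inv ts F"
  using assms
proof induction
  case base show ?case by (rule greedy_inv_initial)
next
  case (step F F')
  from step(2,3) show ?case
  proof (cases rule: greedy_step.cases)
    case (1 u v p a)
    show ?thesis
      unfolding 1(1) by (rule greedy_inv_step) (use step 1(2-) in blast)+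
  qed
qed

text \<open>The separation of \<open>greedy_inv\<close> once no two different nodes are
  active.\<close>

definition separated :: "forest \<Rightarrow> bool" where
  "separated F \<longleftrightarrow> (\<forall>u\<in>nodes F. \<forall>v\<in>nodes F. \<forall>z\<in>reg u \<inter> reg v. u \<noteq> v \<longrightarrow> z \<noteq> r \<longrightarrow>
     dist r z \<le> max (parent_dist F u) (parent_dist F v))"

lemma greedy_tree_props:
  assumes "greedy_spiral_tree r \<alpha> ts G" "ts \<noteq> []"
  shows "spiral_tree r \<alpha> ts G" "arc_forest ts G" "chained ts G" "separated G"
proof -
  obtain w a F where G: "G = connect {w} r a F" and F: "(greedy_step r \<alpha>)\<^sup>*\<^sup>* (initial_forest ts) F"
    and act: "active F = {w}" and arc: "w \<noteq> r \<Longrightarrow> arc_from_to r \<alpha> (a w) w r"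
    using assms(1) by (cases rule: greedy_spiral_tree.cases) blast
  have inv: "greedy_inv ts F" using greedy_steps_inv[OF F] .
  then have af: "arc_forest ts F" and ch: "chained ts F" 
    and reach: "\<And>x. x \<in> nodes F \<Longrightarrow> (x, w) \<in> (parent_rel F)\<^sup>*"
    using act by (auto simp: greedy_inv_def)
  have w: "w \<in> nodes F" "up F w = None" using act by (auto simp: active_def)
  have upr: "up F r = None" using root_has_no_parent[OF af] .
  \<comment> \<open>\<open>r\<close> never has a parent, so if it is a node of \<open>F\<close> it
    is active and hence equal to \<open>w\<close>.\<close>
  have rw: "r \<notin> nodes F \<or> r = w" using act upr by (auto simp: active_def)
  have pr: "parent_rel G = parent_rel F \<union> ({w} - {r}) \<times> {r}"
    using w by (auto simp: G parent_rel_def split: if_splits)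
  show af': "arc_forest ts G"
    using af w arc unfolding arc_forest_def G by (auto split: if_splits dest: subsetD[OF _ domI])
  have dm: "dom (up G) = nodes G - {r}"
  proof -
    have "dom (up F) \<subseteq> nodes F" using af by (simp add: arc_forest_def)
    moreover have "x = w" if "x \<in> nodes F" "x \<notin> dom (up F)" for x
    proof -
      have "x \<in> active F" using that by (cases "up F x") (auto simp: active_def)
      then show ?thesis using act by simp
    qed
    moreover have "w \<notin> dom (up F)" using w by (simp add: domIff)
    ultimately have "dom (up F) = nodes F - {w}" by blast
    moreover have "dom (up G) = dom (up F) \<union> ({w} - {r})" by (auto simp: G split: if_splits)
    ultimately have "dom (up G) = (nodes F - {w}) \<union> ({w} - {r})" by simp
    then show ?thesis using rw w unfolding G connect_simps by blast
  qed
  have "(x, r) \<in> (parent_rel G)\<^sup>*" if "x \<in> nodes G" for x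
  proof (cases "x \<in> nodes F")
    case True
    have "(x, w) \<in> (parent_rel G)\<^sup>*"
      using reach[OF True] rtrancl_mono[of "parent_rel F" "parent_rel G"] by (auto simp: pr)
    moreover have "(w, r) \<in> (parent_rel G)\<^sup>*" by (cases "w = r") (auto simp: pr)
    ultimately show ?thesis by simp
  next
    case False then show ?thesis using that by (simp add: G)
  qed
  then show "spiral_tree r \<alpha> ts G"
  proof -
    assume conn: "\<And>x. x \<in> nodes G \<Longrightarrow> (x, r) \<in> (parent_rel G)\<^sup>*"
    have "r \<in> nodes G" by (simp add: G)
    then show ?thesis
      using af' dm conn unfolding spiral_tree_def arc_forest_def by blast
  qed
  show "chained ts G"
    unfolding chained_def
  proof (intro ballI impI)
    fix x assume x: "x \<in> nodes G" "x \<noteq> r"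
    then have xF: "x \<in> nodes F" by (simp add: G)
    have L: "left_rel F \<subseteq> left_rel G" and R: "right_rel F \<subseteq> right_rel G"
      by (auto simp: left_rel_def right_rel_def pr)
    show "(\<exists>l\<in>set ts. (l, x) \<in> (left_rel G)\<^sup>*) \<and> (\<exists>l\<in>set ts. (l, x) \<in> (right_rel G)\<^sup>*)"
      using ch x xF rtrancl_mono[OF L] rtrancl_mono[OF R] unfolding chained_def by blast
  qed
  have pd: "parent_dist G x = parent_dist F x" for x
    using w by (simp add: parent_dist_def G)
  show "separated G"
    unfolding separated_def
  proof (intro ballI impI)
    fix x y z assume *: "x \<in> nodes G" "y \<in> nodes G" "z \<in> reg x \<inter> reg y" "x \<noteq> y" "z \<noteq> r"
    then have "x \<noteq> r" "y \<noteq> r" by auto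
    then have "x \<in> nodes F" "y \<in> nodes F" "\<not> (x \<in> active F \<and> y \<in> active F)"
      using * act by (auto simp: G)
    then show "dist r z \<le> max (parent_dist G x) (parent_dist G y)"
      using inv * unfolding greedy_inv_def pd by blast
  qed
qed

end

section \<open>Counting the arcs that cross a circle\<close>

context spiral_geometry
begin

text \<open>The half-open interval makes the radius intervals of consecutive edges adjoin without
  overlap, so a path to \<open>r\<close> crosses a circle in only one node.\<close>

definition crossing :: "forest \<Rightarrow> real \<Rightarrow> complex set" where
  "crossing F \<rho> = {u \<in> nodes F. parent_dist F u < \<rho> \<and> \<rho> \<le> dist r u}"

lemma ancestor_dist_le:
  assumes "arc_forest ts F" "(u, v) \<in> (parent_rel F)\<^sup>*"
  shows "dist r v \<le> dist r u"
  using assms(2) by induction (use arc_forest_parent(4)[OF assms(1)] in force)+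

text \<open>Parents are unique, so two ancestors of \<open>w\<close> are comparable, and everything
  beyond a crossing node lies strictly inside the circle.\<close>

lemma crossing_ancestor_unique:
  assumes af: "arc_forest ts F" and "u \<in> crossing F \<rho>" "v \<in> crossing F \<rho>"
    and "(w, u) \<in> (parent_rel F)\<^sup>*" "(w, v) \<in> (parent_rel F)\<^sup>*"
  shows "u = v"
proof -
  have stuck: "x = y" if "(x, y) \<in> (parent_rel F)\<^sup>*" "x \<in> crossing F \<rho>" "y \<in> crossing F \<rho>" for x y
    using that(1)
  proof (cases rule: converse_rtranclE)
    case (step x')
    then have "dist r y \<le> dist r x'" "parent_dist F x = dist r x'"
      using ancestor_dist_le arc_forest_parent(5) af by blast+
    then show ?thesis using that by (auto simp: crossing_def)
  qed
  have "single_valued (parent_rel F)"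
    by (auto simp: single_valued_def parent_rel_def)
  then have "(u, v) \<in> (parent_rel F)\<^sup>* \<or> (v, u) \<in> (parent_rel F)\<^sup>*"
    using assms(4,5) single_valued_confluent by metis
  then show ?thesis using stuck assms(2,3) by metis
qed

lemma left_chain:
  assumes "(l, u) \<in> (left_rel F)\<^sup>*"
  shows "\<exists>t\<ge>0. u = go l 0 t"
  using assms
proof (induction rule: converse_rtrancl_induct)
  case base show ?case by (intro exI[of _ 0]) simp
next
  case (step x y)
  then obtain s t where "0 \<le> s" "u = go y 0 s" "0 \<le> t" "y = go x 0 t" by (auto simp: left_rel_def)
  then show ?case by (intro exI[of _ "t + s"]) (simp add: go_go)
qed

lemma right_chain:
  assumes "(l, u) \<in> (right_rel F)\<^sup>*"
  shows "\<exists>t\<ge>0. u = go l t 0"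
  using assms
proof (induction rule: converse_rtrancl_induct)
  case base show ?case by (intro exI[of _ 0]) simp
next
  case (step x y)
  then obtain s t where "0 \<le> s" "u = go y s 0" "0 \<le> t" "y = go x t 0" by (auto simp: right_rel_def)
  then show ?case by (intro exI[of _ "t + s"]) (simp add: go_go)
qed

text \<open>\<open>ln (dist r l / \<sigma>)\<close> is the time at which a spiral of
  \<open>l\<close> reaches radius \<open>\<sigma>\<close>. As long as the chain has not passed that
  circle, the left spiral of the next node is the same curve; the last node not inside is
  \<open>w\<close>. It occurs no later than \<open>u\<close> because
  \<open>\<rho> \<le> \<sigma>\<close>.\<close>

lemma left_chain_crossing:
  assumes af: "arc_forest ts F" and "(l, u) \<in> (left_rel F)\<^sup>*"
    and "u \<in> crossing F \<rho>" "0 < \<rho>" "\<rho> \<le> \<sigma>" "\<sigma> \<le> dist r l"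
  shows "\<exists>w\<in>crossing F \<sigma>. (w, u) \<in> (parent_rel F)\<^sup>* \<and> go l 0 (ln (dist r l / \<sigma>)) \<in> reg w"
  using assms(2,6)
proof (induction rule: converse_rtrancl_induct)
  case base
  then have "u \<in> crossing F \<sigma>" using assms(3,5) by (auto simp: crossing_def)
  then show ?case using base assms(4,5) by (intro bexI[of _ u]) (auto intro: go_in_region)
next
  case (step x y)
  then obtain t where xy: "(x, y) \<in> parent_rel F" and t: "0 \<le> t" "y = go x 0 t" by (auto simp: left_rel_def)
  have sub: "(x, u) \<in> (parent_rel F)\<^sup>*"
  proof -
    have "(y, u) \<in> (parent_rel F)\<^sup>*" using step(2) rtrancl_mono[of "left_rel F" "parent_rel F"]
      by (auto simp: left_rel_def)
    then show ?thesis using xy by (rule converse_rtrancl_into_rtrancl[rotated])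
  qed
  show ?case
  proof (cases "\<sigma> \<le> dist r y")
    case True
    have "go y 0 (ln (dist r y / \<sigma>)) = go x 0 (ln (dist r x / \<sigma>))"
    proof -
      have x0: "0 < dist r x" using step.prems assms(4,5) by linarith
      have "ln (dist r y / \<sigma>) = ln (dist r x / \<sigma> * exp (- t))"
        using t by (simp add: dist_go)
      also have "\<dots> = ln (dist r x / \<sigma>) - t"
        using x0 assms(4,5) by (subst ln_mult_pos) auto
      finally show ?thesis by (simp add: t go_go)
    qed
    then show ?thesis using step.IH True by simp
  next
    case False
    then have "x \<in> crossing F \<sigma>"
      using arc_forest_parent[OF af xy] step.prems by (auto simp: crossing_def)
    then show ?thesis using sub step.prems assms(4,5) by (intro bexI[of _ x]) (auto intro: go_in_region)
  qed
qed

lemma right_chain_crossing: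
  assumes af: "arc_forest ts F" and "(l, u) \<in> (right_rel F)\<^sup>*"
    and "u \<in> crossing F \<rho>" "0 < \<rho>" "\<rho> \<le> \<sigma>" "\<sigma> \<le> dist r l"
  shows "\<exists>w\<in>crossing F \<sigma>. (w, u) \<in> (parent_rel F)\<^sup>* \<and> go l (ln (dist r l / \<sigma>)) 0 \<in> reg w"
  using assms(2,6)
proof (induction rule: converse_rtrancl_induct)
  case base
  then have "u \<in> crossing F \<sigma>" using assms(3,5) by (auto simp: crossing_def)
  then show ?case using base assms(4,5) by (intro bexI[of _ u]) (auto intro: go_in_region)
next
  case (step x y)
  then obtain t where xy: "(x, y) \<in> parent_rel F" and t: "0 \<le> t" "y = go x t 0" by (auto simp: right_rel_def)
  have sub: "(x, u) \<in> (parent_rel F)\<^sup>*"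
  proof -
    have "(y, u) \<in> (parent_rel F)\<^sup>*" using step(2) rtrancl_mono[of "right_rel F" "parent_rel F"]
      by (auto simp: right_rel_def)
    then show ?thesis using xy by (rule converse_rtrancl_into_rtrancl[rotated])
  qed
  show ?case
  proof (cases "\<sigma> \<le> dist r y")
    case True
    have "go y (ln (dist r y / \<sigma>)) 0 = go x (ln (dist r x / \<sigma>)) 0"
    proof -
      have x0: "0 < dist r x" using step.prems assms(4,5) by linarith
      have "ln (dist r y / \<sigma>) = ln (dist r x / \<sigma> * exp (- t))"
        using t by (simp add: dist_go)
      also have "\<dots> = ln (dist r x / \<sigma>) - t"
        using x0 assms(4,5) by (subst ln_mult_pos) auto
      finally show ?thesis by (simp add: t go_go)
    qed
    then show ?thesis using step.IH True by simp
  next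
    case False
    then have "x \<in> crossing F \<sigma>"
      using arc_forest_parent[OF af xy] step.prems by (auto simp: crossing_def)
    then show ?thesis using sub step.prems assms(4,5) by (intro bexI[of _ x]) (auto intro: go_in_region)
  qed
qed

text \<open>The parameters in \<open>[0, c]\<close> that hit \<open>Q\<close> form a nonempty
  compact set, so there is a first one: it gives the next point of \<open>Q\<close> counterclockwise
  from \<open>p\<close>.\<close>

lemma next_point_exists:
  assumes "finite Q" "0 \<le> c" "go p c (- c) \<in> Q"
  shows "\<exists>N\<ge>0. N \<le> c \<and> go p N (- N) \<in> Q \<and> (\<forall>s. 0 \<le> s \<longrightarrow> s < N \<longrightarrow> go p s (- s) \<notin> Q)"
proof -
  define Z where "Z = {s \<in> {0..c}. go p s (- s) \<in> Q}"
  have "continuous_on {0..c} (\<lambda>s. go p s (- s))"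
    unfolding go_def cis_conv_exp by (intro continuous_intros)
  then have "closed Z"
    using continuous_closed_preimage[of "{0..c}" "\<lambda>s. go p s (- s)" Q] finite_imp_closed[OF assms(1)]
    by (simp add: Z_def vimage_def Int_def)
  moreover have "bounded Z" by (rule bounded_subset[of "{0..c}"]) (auto simp: Z_def)
  moreover have "Z \<noteq> {}" using assms by (auto simp: Z_def)
  ultimately obtain N where N: "N \<in> Z" "\<And>s. s \<in> Z \<Longrightarrow> N \<le> s"
    using compact_attains_inf[of Z] by (auto simp: compact_eq_bounded_closed)
  have "go p s (- s) \<notin> Q" if "0 \<le> s" "s < N" for s
  proof
    assume "go p s (- s) \<in> Q"
    then have "s \<in> Z" using that N(1) by (simp add: Z_def)
    then show False using N(2)[of s] that by simp
  qed
  then show ?thesis using N(1) by (intro exI[of _ N]) (auto simp: Z_def)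
qed

lemma reg_on_circle:
  assumes "q \<in> reg l" "dist r q = \<rho>" "0 < \<rho>"
  obtains c d where "0 \<le> c" "0 \<le> d" "c + d = ln (dist r l / \<rho>)" "q = go l c d"
proof -
  have "q \<noteq> r" using assms(2,3) by auto
  then obtain c d where cd: "0 \<le> c" "0 \<le> d" "q = go l c d" using assms(1) by (auto elim: reg_cases)
  define s where "s = c + d"
  have "\<rho> = dist r l * exp (- s)" using assms(2) cd by (simp add: dist_go s_def)
  then have "dist r l / \<rho> = exp s" using assms(3) by (auto simp: exp_minus field_simps)
  then show thesis using that[of c d] cd by (simp add: s_def)
qed

text \<open>On a circle about the root, the points reachable from \<open>u\<close> form an arc that begins at
  \<open>left_end \<rho> u\<close>; \<open>go p s (- s)\<close> is \<open>p\<close> turned counterclockwise by an angle proportional to \<open>s\<close>.\<close>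

definition left_end :: "real \<Rightarrow> complex \<Rightarrow> complex" where
  "left_end \<rho> u = go u 0 (ln (dist r u / \<rho>))"

text \<open>If no point of \<open>Q\<close> separated the arcs of \<open>u1\<close> and \<open>u2\<close>, the left spiral through \<open>u1\<close> of a
  terminal and the right spiral through \<open>u2\<close> of a terminal would meet outside the circle, in a
  point reachable from two different nodes of the tree whose arcs cross its radius.\<close>

lemma gap_unique:
  assumes af: "arc_forest ts F" and ch: "chained ts F" and sep: "separated F" and \<rho>: "0 < \<rho>"
    and Q: "\<And>q. q \<in> Q \<Longrightarrow> dist r q = \<rho>"
    and pierce: "\<And>t. t \<in> set ts \<Longrightarrow> \<rho> \<le> dist r t \<Longrightarrow> \<exists>q\<in>Q. q \<in> reg t"
    and u1: "u1 \<in> crossing F \<rho>" and u2: "u2 \<in> crossing F \<rho>" "Q \<inter> reg u2 = {}"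
    and N1: "go (left_end \<rho> u1) N1 (- N1) \<in> Q"
      "\<And>s. 0 \<le> s \<Longrightarrow> s < N1 \<Longrightarrow> go (left_end \<rho> u1) s (- s) \<notin> Q"
    and N2: "0 \<le> N2" "go (left_end \<rho> u2) N2 (- N2) = go (left_end \<rho> u1) N1 (- N1)"
    and le: "N2 \<le> N1"
  shows "u1 = u2"
proof (rule ccontr)
  assume neq: "u1 \<noteq> u2"
  define h2 where "h2 = ln (dist r u2 / \<rho>)"
  have nr: "u1 \<noteq> r" "u2 \<noteq> r" and un: "u1 \<in> nodes F" "u2 \<in> nodes F"
    and far: "\<rho> \<le> dist r u1" "\<rho> \<le> dist r u2"
    using u1 u2 \<rho> by (auto simp: crossing_def)
  have h2: "0 \<le> h2" using far \<rho> by (simp add: h2_def)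
  \<comment> \<open>The arc of \<open>u2\<close> spans the turn \<open>h2\<close> from its left end.
    It misses \<open>Q\<close>, so it ends before the point of \<open>Q\<close> reached by the turn
    \<open>N2\<close>.\<close>
  have h2N: "h2 < N2"
  proof (rule ccontr)
    assume "\<not> h2 < N2"
    then have "go (left_end \<rho> u2) N2 (- N2) \<in> reg u2"
      using N2(1) by (auto simp: left_end_def go_go h2_def intro: go_in_region)
    then show False using N1(1) N2(2) u2(2) by auto
  qed
  \<comment> \<open>The turn from the left end of the arc of \<open>u1\<close> to the right end of
    the arc of \<open>u2\<close>; both lie before the same point of \<open>Q\<close>.\<close>
  define g where "g = N1 - N2 + h2"
  have g: "0 \<le> g" "g < N1" using le h2 h2N by (auto simp: g_def)
  define a1 where "a1 = left_end \<rho> u1"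
  have b2: "go u2 h2 0 = go a1 g (- g)"
  proof -
    have "go a1 (N1 - N2) (N2 - N1) = go (go a1 N1 (- N1)) (- N2) N2" by (simp add: go_go)
    also have "\<dots> = left_end \<rho> u2" using N2(2) by (simp add: a1_def go_go flip: N2(2))
    finally have "left_end \<rho> u2 = go a1 (N1 - N2) (N2 - N1)" ..
    moreover have "go u2 h2 0 = go (left_end \<rho> u2) h2 (- h2)" by (simp add: left_end_def go_go h2_def)
    ultimately show ?thesis by (simp add: go_go g_def algebra_simps)
  qed
  obtain l1 where l1: "l1 \<in> set ts" "(l1, u1) \<in> (left_rel F)\<^sup>*"
    using ch un nr unfolding chained_def by blast
  obtain r2 where r2: "r2 \<in> set ts" "(r2, u2) \<in> (right_rel F)\<^sup>*"
    using ch un nr unfolding chained_def by blast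
  obtain t1 where t1: "0 \<le> t1" "u1 = go l1 0 t1" using left_chain[OF l1(2)] by blast
  obtain t2 where t2: "0 \<le> t2" "u2 = go r2 t2 0" using right_chain[OF r2(2)] by blast
  have far': "\<rho> \<le> dist r l1" "\<rho> \<le> dist r r2"
    using far t1 t2 reg_dist_le[of u1 l1] reg_dist_le[of u2 r2] go_in_region by fastforce+
  define H1 where "H1 = ln (dist r l1 / \<rho>)"
  define H2 where "H2 = ln (dist r r2 / \<rho>)"
  have shift: "ln (dist r (go x a b) / \<rho>) = ln (dist r x / \<rho>) - (a + b)" if "\<rho> \<le> dist r x" for x a b
  proof -
    have "dist r (go x a b) / \<rho> = dist r x / \<rho> * exp (- (a + b))" by (simp add: dist_go)
    moreover have "0 < dist r x / \<rho>" using that \<rho> by (intro divide_pos_pos) linarith+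
    ultimately show ?thesis by (simp only: ln_mult_pos exp_gt_zero ln_exp)
  qed
  have a1: "a1 = go l1 0 H1"
    using shift[OF far'(1), of 0 t1] t1 by (simp add: a1_def left_end_def H1_def go_go)
  have b2': "go a1 g (- g) = go r2 H2 0"
    using shift[OF far'(2), of t2 0] t2 by (simp add: h2_def H2_def go_go flip: b2)
  obtain q1 where q1: "q1 \<in> Q" "q1 \<in> reg l1" using pierce l1 far' by blast
  then obtain c1 d1 where c1: "0 \<le> c1" "0 \<le> d1" "c1 + d1 = H1" "q1 = go l1 c1 d1"
    using reg_on_circle[OF _ Q \<rho>] H1_def by metis
  have "q1 = go a1 c1 (- c1)"
    using c1 by (simp add: a1 go_go flip: c1(3))
  \<comment> \<open>The arc of the terminal \<open>l1\<close> also begins at \<open>a1\<close> and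
    contains a point of \<open>Q\<close>, the first of which comes at the turn \<open>N1\<close>; so
    it is longer than \<open>g\<close>.\<close>
  then have gH1: "g < H1" using N1(2) q1(1) c1 g by (force simp: a1_def not_less)
  obtain q2 where q2: "q2 \<in> Q" "q2 \<in> reg r2" using pierce r2 far' by blast
  then obtain c2 d2 where c2: "0 \<le> c2" "0 \<le> d2" "c2 + d2 = H2" "q2 = go r2 c2 d2"
    using reg_on_circle[OF _ Q \<rho>] H2_def by metis
  have "q2 = go (go r2 H2 0) (- d2) d2" using c2 by (simp add: go_go flip: c2(3))
  also have "\<dots> = go a1 (g - d2) (- (g - d2))" by (simp add: go_go flip: b2')
  finally have "go a1 (g - d2) (- (g - d2)) \<in> Q" using q2 by simp
  \<comment> \<open>The arc of \<open>r2\<close> has the same right end as that of \<open>u2\<close>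
    and contains a point of \<open>Q\<close>. There is none on the way back to \<open>a1\<close>, so
    it begins before \<open>a1\<close>.\<close>
  then have "\<not> 0 \<le> g - d2" using N1(2)[of "g - d2"] g c2 by (auto simp: a1_def)
  then have gH2: "g < H2" using c2 by linarith
  \<comment> \<open>The apex over the piece of the circle between the two ends: the left spiral
    through one and the right spiral through the other, both followed backwards for time
    \<open>g\<close>. By \<open>g < H1\<close> and \<open>g < H2\<close> it comes after the
    terminals on their spirals.\<close>
  define z where "z = go a1 0 (- g)"
  define \<sigma> where "\<sigma> = dist r z"
  have z1: "z = go l1 0 (H1 - g)" by (simp add: z_def a1 go_go)
  have z2: "z = go r2 (H2 - g) 0"
  proof -
    have "z = go (go a1 g (- g)) (- g) 0" by (simp add: z_def go_go)
    then show ?thesis by (simp add: b2' go_go)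
  qed
  have lnz: "ln (\<sigma> / \<rho>) = g" using shift[OF far'(1), of 0 "H1 - g"] by (simp add: \<sigma>_def z1 H1_def)
  have l1r: "0 < dist r l1" "0 < dist r r2" using far' \<rho> by linarith+
  then have \<sigma>0: "0 < \<sigma>" unfolding \<sigma>_def z1 by (simp add: dist_go)
  have \<sigma>\<rho>: "\<rho> \<le> \<sigma>"
  proof -
    have "1 \<le> \<sigma> / \<rho>" using lnz g(1) \<sigma>0 \<rho> by (metis divide_pos_pos ln_ge_zero_iff)
    then show ?thesis using \<rho> by simp
  qed
  have \<sigma>l: "\<sigma> \<le> dist r l1" "\<sigma> \<le> dist r r2"
  proof -
    have "z \<in> reg l1" unfolding z1 using gH1 by (intro go_in_region) auto
    moreover have "z \<in> reg r2" unfolding z2 using gH2 by (intro go_in_region) auto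
    ultimately show "\<sigma> \<le> dist r l1" "\<sigma> \<le> dist r r2" by (simp_all add: \<sigma>_def reg_dist_le)
  qed
  have "ln (dist r l1 / \<sigma>) = H1 - g" "ln (dist r r2 / \<sigma>) = H2 - g"
    using lnz l1r \<sigma>0 \<rho> by (simp_all add: H1_def H2_def ln_div)
  then have "go l1 0 (ln (dist r l1 / \<sigma>)) = z" "go r2 (ln (dist r r2 / \<sigma>)) 0 = z"
    using z1 z2 by simp_all
  then obtain w w' where w: "w \<in> crossing F \<sigma>" "(w, u1) \<in> (parent_rel F)\<^sup>*" "z \<in> reg w"
    and w': "w' \<in> crossing F \<sigma>" "(w', u2) \<in> (parent_rel F)\<^sup>*" "z \<in> reg w'"
    using left_chain_crossing[OF af l1(2) u1 \<rho> \<sigma>\<rho> \<sigma>l(1)]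
      right_chain_crossing[OF af r2(2) u2(1) \<rho> \<sigma>\<rho> \<sigma>l(2)] by auto
  have "w \<noteq> w'" using crossing_ancestor_unique[OF af u1 u2(1)] w w' neq by blast
  moreover have "z \<noteq> r" using \<sigma>0 by (auto simp: \<sigma>_def)
  ultimately have "\<sigma> \<le> max (parent_dist F w) (parent_dist F w')"
    using sep w w' unfolding separated_def \<sigma>_def crossing_def by blast
  then show False using w w' by (auto simp: crossing_def)
qed

lemma card_crossing_le:
  assumes af: "arc_forest ts F" and ch: "chained ts F" and sep: "separated F" and \<rho>: "0 < \<rho>"
    and Q: "finite Q" "\<And>q. q \<in> Q \<Longrightarrow> dist r q = \<rho>"
    and pierce: "\<And>t. t \<in> set ts \<Longrightarrow> \<rho> \<le> dist r t \<Longrightarrow> \<exists>q\<in>Q. q \<in> reg t"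
  shows "card (crossing F \<rho>) \<le> 2 * card Q"
proof -
  define A where "A = {u \<in> crossing F \<rho>. Q \<inter> reg u \<noteq> {}}"
  define B where "B = {u \<in> crossing F \<rho>. Q \<inter> reg u = {}}"
  have fin: "finite (crossing F \<rho>)" using af by (simp add: crossing_def arc_forest_def)
  have "card A \<le> card Q"
  proof -
    define f where "f u = (SOME q. q \<in> Q \<inter> reg u)" for u
    have f: "f u \<in> Q \<inter> reg u" if "u \<in> A" for u
      using that some_in_eq[of "Q \<inter> reg u"] by (auto simp: f_def A_def)
    have "inj_on f A"
    proof (rule inj_onI, rule ccontr)
      fix u v assume uv: "u \<in> A" "v \<in> A" "f u = f v" "u \<noteq> v"
      then have "f u \<in> reg u \<inter> reg v" "dist r (f u) = \<rho>" using f[of u] f[of v] Q by auto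
      moreover from this have "f u \<noteq> r" using \<rho> by auto
      ultimately have "\<rho> \<le> max (parent_dist F u) (parent_dist F v)"
        using sep uv unfolding separated_def A_def crossing_def by (metis (no_types, lifting) mem_Collect_eq)
      then show False using uv by (auto simp: A_def crossing_def)
    qed
    moreover have "f ` A \<subseteq> Q" using f by auto
    ultimately show ?thesis using Q(1) card_inj_on_le by blast
  qed
  moreover have "card B \<le> card Q"
  proof -
    \<comment> \<open>The terminal whose left spiral carries \<open>u\<close> has an arc with the
      same left end, and that arc contains a point of \<open>Q\<close>.\<close>
    have "\<exists>N\<ge>0. go (left_end \<rho> u) N (- N) \<in> Q \<and> (\<forall>s. 0 \<le> s \<longrightarrow> s < N \<longrightarrow> go (left_end \<rho> u) s (- s) \<notin> Q)"
      if "u \<in> B" for u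
    proof -
      have u: "u \<in> nodes F" "u \<noteq> r" "\<rho> \<le> dist r u" using that \<rho> by (auto simp: B_def crossing_def)
      obtain l where l: "l \<in> set ts" "(l, u) \<in> (left_rel F)\<^sup>*"
        using ch u unfolding chained_def by blast
      obtain t where t: "0 \<le> t" "u = go l 0 t" using left_chain[OF l(2)] by blast
      have far: "\<rho> \<le> dist r l" using u(3) t reg_dist_le[of u l] go_in_region[of 0 t l] by force
      obtain q where q: "q \<in> Q" "q \<in> reg l" using pierce l far by blast
      then obtain c d where c: "0 \<le> c" "0 \<le> d" "c + d = ln (dist r l / \<rho>)" "q = go l c d"
        using reg_on_circle[OF _ Q(2) \<rho>] by metis
      have l0: "0 < dist r l / \<rho>" using far \<rho> by (intro divide_pos_pos) linarith+
      have "dist r u / \<rho> = dist r l / \<rho> * exp (- t)" by (simp add: t dist_go)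
      then have "ln (dist r u / \<rho>) = ln (dist r l / \<rho>) - t"
        using l0 by (simp only: ln_mult_pos exp_gt_zero ln_exp)
      then have "left_end \<rho> u = go l 0 (c + d)" using t by (simp add: left_end_def go_go c(3))
      then have "go (left_end \<rho> u) c (- c) = go l c d" by (simp only: go_go) simp
      then have "go (left_end \<rho> u) c (- c) \<in> Q" using q c by simp
      from next_point_exists[OF Q(1) c(1) this] show ?thesis by blast
    qed
    then obtain N where N: "\<And>u. u \<in> B \<Longrightarrow> 0 \<le> N u \<and> go (left_end \<rho> u) (N u) (- N u) \<in> Q \<and>
        (\<forall>s. 0 \<le> s \<longrightarrow> s < N u \<longrightarrow> go (left_end \<rho> u) s (- s) \<notin> Q)"
      by metis
    define f where "f u = go (left_end \<rho> u) (N u) (- N u)" for u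
    have "inj_on f B"
    proof (rule inj_onI)
      \<comment> \<open>\<open>gap_unique\<close> asks that the node with the larger turn comes
        first; symmetry covers the other order.\<close>
      have key: "u = v" if "u \<in> B" "v \<in> B" "f u = f v" "N v \<le> N u" for u v
      proof (rule gap_unique[OF af ch sep \<rho>, where Q = Q and ?N1.0 = "N u" and ?N2.0 = "N v"])
        show "go (left_end \<rho> u) (N u) (- N u) \<in> Q" "0 \<le> N v"
          and "\<And>s. 0 \<le> s \<Longrightarrow> s < N u \<Longrightarrow> go (left_end \<rho> u) s (- s) \<notin> Q"
          using N that by blast+
      qed (use that Q pierce in \<open>auto simp: B_def f_def\<close>)
      fix u v assume "u \<in> B" "v \<in> B" "f u = f v"
      then show "u = v" using key[of u v] key[of v u] by (metis linear)
    qed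
    moreover have "f ` B \<subseteq> Q" using N by (auto simp: f_def)
    ultimately show ?thesis using Q(1) card_inj_on_le by blast
  qed
  moreover have "crossing F \<rho> = A \<union> B" by (auto simp: A_def B_def)
  ultimately show ?thesis using card_Un_le[of A B] by simp
qed

section \<open>Lengths of spiral trees as integrals of crossing numbers\<close>

lemma spiral_tree_parent:
  assumes "spiral_tree r \<alpha> ts T" "up T u = Some (v, a)"
  shows "v \<in> reg u" "v \<in> nodes T" "u \<in> nodes T" "parent_dist T u = dist r v"
    "arc_length r \<alpha> u a = (dist r u - dist r v) / cos \<alpha>"
  using assms arc_from_toD[of a u v] unfolding spiral_tree_def
  by (auto simp: parent_dist_def)

text \<open>The last node not inside the circle on the way from \<open>t\<close> to \<open>r\<close>
  crosses it, and reachability composes along the way.\<close>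

lemma spiral_tree_crossing_exists:
  assumes T: "spiral_tree r \<alpha> ts T" and "t \<in> set ts" and \<rho>: "0 < \<rho>" "\<rho> \<le> dist r t"
  shows "\<exists>u\<in>crossing T \<rho>. u \<in> reg t"
proof -
  have "(t, r) \<in> (parent_rel T)\<^sup>*" using assms by (auto simp: spiral_tree_def)
  then show ?thesis using \<rho>(2)
  proof (induction rule: converse_rtrancl_induct)
    case base then show ?case using \<rho> by simp
  next
    case (step x y)
    then obtain a where a: "up T x = Some (y, a)" by (auto simp: parent_rel_def)
    note * = spiral_tree_parent[OF T a]
    show ?case
    proof (cases "\<rho> \<le> dist r y")
      case True
      then show ?thesis using step.IH reg_trans[OF *(1)] by blast
    next
      case False
      then have "x \<in> crossing T \<rho>" using * step.prems by (auto simp: crossing_def)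
      then show ?thesis using reg_refl by blast
    qed
  qed
qed

lemma tree_length_eq:
  assumes T: "spiral_tree r \<alpha> ts T"
  shows "tree_length r \<alpha> T = (\<Sum>u\<in>nodes T. dist r u - parent_dist T u) / cos \<alpha>"
proof -
  have fin: "finite (nodes T)" and rt: "r \<in> nodes T" and dm: "dom (up T) = nodes T - {r}"
    using T by (auto simp: spiral_tree_def)
  have "tree_length r \<alpha> T = (\<Sum>u\<in>nodes T - {r}. (dist r u - parent_dist T u) / cos \<alpha>)"
    unfolding tree_length_def dm
  proof (rule sum.cong[OF refl])
    fix u assume "u \<in> nodes T - {r}"
    then have "u \<in> dom (up T)" by (simp only: dm)
    then obtain v a where a: "up T u = Some (v, a)" by auto
    show "arc_length r \<alpha> u (snd (the (up T u))) = (dist r u - parent_dist T u) / cos \<alpha>"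
      using spiral_tree_parent[OF T a] by (simp add: a)
  qed
  also have "\<dots> = (\<Sum>u\<in>nodes T - {r}. dist r u - parent_dist T u) / cos \<alpha>"
    by (simp add: sum_divide_distrib)
  also have "(\<Sum>u\<in>nodes T - {r}. dist r u - parent_dist T u) = (\<Sum>u\<in>nodes T. dist r u - parent_dist T u)"
  proof -
    have "r \<notin> dom (up T)" by (simp only: dm) simp
    then have "up T r = None" by (simp only: domIff not_not)
    then show ?thesis using fin rt by (simp add: sum.remove parent_dist_def)
  qed
  finally show ?thesis .
qed

text \<open>Each edge contributes the indicator of the radii between its ends; exchanging the finite
  sum with the integral leaves the distances gained.\<close>

lemma sum_dist_eq_integral:
  assumes T: "spiral_tree r \<alpha> ts T"
  shows "integrable lborel (\<lambda>\<rho>. real (card (crossing T \<rho>)))"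
    "(\<integral>\<rho>. real (card (crossing T \<rho>)) \<partial>lborel) = (\<Sum>u\<in>nodes T. dist r u - parent_dist T u)"
proof -
  have fin: "finite (nodes T)" using T by (simp add: spiral_tree_def)
  have le: "parent_dist T u \<le> dist r u" if "u \<in> nodes T" for u
  proof (cases "up T u")
    case None then show ?thesis by (simp add: parent_dist_def)
  next
    case (Some va)
    then show ?thesis using spiral_tree_parent[OF T, of u] reg_dist_le by (cases va) auto
  qed
  have eq: "real (card (crossing T \<rho>)) =
      (\<Sum>u\<in>nodes T. indicator {parent_dist T u<..dist r u} \<rho>)" for \<rho>
  proof -
    have "(\<Sum>u\<in>nodes T. indicator {parent_dist T u<..dist r u} \<rho>) = (\<Sum>u\<in>crossing T \<rho>. 1::real)"
      using fin by (intro sum.mono_neutral_cong_right) (auto simp: crossing_def indicator_def)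
    then show ?thesis by simp
  qed
  have int: "integrable lborel (indicator {parent_dist T u<..dist r u} :: real \<Rightarrow> real)" for u
    by (cases "parent_dist T u \<le> dist r u") (auto intro!: integrable_real_indicator)
  show "integrable lborel (\<lambda>\<rho>. real (card (crossing T \<rho>)))"
    unfolding eq by (intro Bochner_Integration.integrable_sum int)
  have "(\<integral>\<rho>. real (card (crossing T \<rho>)) \<partial>lborel) =
      (\<Sum>u\<in>nodes T. (\<integral>\<rho>. indicator {parent_dist T u<..dist r u} \<rho> \<partial>lborel))"
    unfolding eq by (intro Bochner_Integration.integral_sum int)
  also have "\<dots> = (\<Sum>u\<in>nodes T. dist r u - parent_dist T u)"
    using le by (intro sum.cong) auto
  finally show "(\<integral>\<rho>. real (card (crossing T \<rho>)) \<partial>lborel) = (\<Sum>u\<in>nodes T. dist r u - parent_dist T u)" .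
qed

theorem greedy_approximation:
  assumes G: "greedy_spiral_tree r \<alpha> ts G" and ts: "ts \<noteq> []"
  shows "approximation 2 r \<alpha> ts G"
  unfolding approximation_def
proof (intro conjI allI impI)
  note props = greedy_tree_props[OF G ts]
  show "spiral_tree r \<alpha> ts G" by (rule props(1))
  fix T assume T: "spiral_tree r \<alpha> ts T"
  have "card (crossing G \<rho>) \<le> 2 * card (crossing T \<rho>)" for \<rho>
  proof (cases "0 < \<rho>")
    case False
    then have "crossing G \<rho> = {}" using parent_dist_nonneg[of G] by (auto simp: crossing_def not_less intro: order_trans)
    then show ?thesis by simp
  next
    case True
    \<comment> \<open>Any point of the circle reachable from \<open>u\<close> can stand for the
      crossing; the one on the right spiral is explicit.\<close>
    define f where "f u = go u (ln (dist r u / \<rho>)) 0" for u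
    have fin: "finite (crossing T \<rho>)" using T by (simp add: crossing_def spiral_tree_def)
    have f: "dist r (f u) = \<rho>" "f u \<in> reg u" if "u \<in> crossing T \<rho>" for u
    proof -
      have u: "\<rho> \<le> dist r u" using that by (simp add: crossing_def)
      then have "0 < dist r u" using True by linarith
      then show "dist r (f u) = \<rho>" using True by (simp add: f_def dist_go exp_minus)
      show "f u \<in> reg u" using u True by (auto simp: f_def intro: go_in_region)
    qed
    have "card (crossing G \<rho>) \<le> 2 * card (f ` crossing T \<rho>)"
    proof (rule card_crossing_le[OF props(2-4) True])
      show "finite (f ` crossing T \<rho>)" using fin by simp
      show "dist r q = \<rho>" if "q \<in> f ` crossing T \<rho>" for q using that f by auto
      show "\<exists>q\<in>f ` crossing T \<rho>. q \<in> reg t" if "t \<in> set ts" "\<rho> \<le> dist r t" for t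
        using spiral_tree_crossing_exists[OF T that(1) True that(2)] f(2) reg_trans by blast
    qed
    also have "\<dots> \<le> 2 * card (crossing T \<rho>)" using fin by (simp add: card_image_le)
    finally show ?thesis .
  qed
  then have "real (card (crossing G \<rho>)) \<le> 2 * real (card (crossing T \<rho>))" for \<rho>
    by (metis of_nat_le_iff of_nat_mult of_nat_numeral)
  then have "(\<integral>\<rho>. real (card (crossing G \<rho>)) \<partial>lborel) \<le> (\<integral>\<rho>. 2 * real (card (crossing T \<rho>)) \<partial>lborel)"
    by (intro integral_mono sum_dist_eq_integral(1)[OF props(1)] integrable_mult_right
        sum_dist_eq_integral(1)[OF T])
  then have "(\<Sum>u\<in>nodes G. dist r u - parent_dist G u) \<le> 2 * (\<Sum>u\<in>nodes T. dist r u - parent_dist T u)"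
    using sum_dist_eq_integral(2)[OF props(1)] sum_dist_eq_integral(2)[OF T] by simp
  then show "tree_length r \<alpha> G \<le> 2 * tree_length r \<alpha> T"
    using cos_alpha_pos by (simp add: tree_length_eq[OF props(1)] tree_length_eq[OF T] divide_right_mono)
qed

end

section \<open>The sweep\<close>

context spiral_geometry
begin

text \<open>\<open>X\<close> is the time of the spirals, counted from the unit circle, and \<open>A\<close> is constant along left
  spirals and grows by \<open>2 * \<tau>\<close> per unit of time along right spirals.\<close>

definition pt :: "real \<Rightarrow> real \<Rightarrow> complex" where
  "pt A X = r + of_real (exp (- X)) * cis (A - \<tau> * X)"

lemma go_pt: "go (pt A X) a b = pt (A + 2 * \<tau> * a) (X + a + b)"
proof -
  have e: "exp (- (X + a + b)) = exp (- X) * exp (- (a + b))"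
    by (simp flip: exp_add)
  have c: "cis (A + 2 * \<tau> * a - \<tau> * (X + a + b)) = cis (A - \<tau> * X) * cis (\<tau> * (a - b))"
    by (simp add: cis_mult algebra_simps)
  show ?thesis unfolding pt_def go_def e c by simp
qed

lemma dist_pt [simp]: "dist r (pt A X) = exp (- X)"
  by (simp add: pt_def dist_norm norm_mult)

lemma pt_neq_root [simp]: "pt A X \<noteq> r" "r \<noteq> pt A X"
  by (auto simp: pt_def)

lemma pt_eq_iff: "pt A X = pt B Y \<longleftrightarrow> X = Y \<and> (\<exists>z::int. A = B + 2 * pi * z)"
proof
  assume eq: "pt A X = pt B Y"
  then have "exp (- X) = exp (- Y)" using dist_pt by metis
  then have XY: "X = Y" by simp
  then have "cis (A - \<tau> * X) = cis (B - \<tau> * X)" using eq by (simp add: pt_def)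
  then obtain z :: int where "\<i> * of_real (A - \<tau> * X) = \<i> * of_real (B - \<tau> * X) + (of_int (2 * z) * pi) * \<i>"
    unfolding cis_conv_exp exp_eq by blast
  from arg_cong[OF this, of Im] have "A = B + 2 * pi * z" by simp
  then show "X = Y \<and> (\<exists>z::int. A = B + 2 * pi * z)" using XY by auto
next
  assume "X = Y \<and> (\<exists>z::int. A = B + 2 * pi * z)"
  then obtain z :: int where "X = Y" "A = B + 2 * pi * z" by blast
  moreover have "cis (B + 2 * pi * z - \<tau> * Y) = cis (B - \<tau> * Y) * cis (2 * pi * z)"
    by (simp add: cis_mult algebra_simps)
  ultimately show "pt A X = pt B Y" by (simp add: pt_def cis_multiple_2pi)
qed

lemma two_pi_int_less: "2 * pi * of_int z < 2 * pi * of_int w \<Longrightarrow> z < (w::int)"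
  by simp

lemma pt_eq_reduced:
  assumes "pt A X = pt B Y" "0 \<le> A" "A < 2 * pi" "0 \<le> B" "B < 2 * pi"
  shows "A = B" "X = Y"
proof -
  obtain z :: int where z: "X = Y" "A = B + 2 * pi * z" using assms(1) pt_eq_iff by blast
  have "2 * pi * z = A - B" using z by simp
  then have "2 * pi * z < 2 * pi * of_int 1" "2 * pi * of_int (- 1) < 2 * pi * z"
    using assms(2-) by (simp_all only: of_int_1 of_int_minus)
  then have "z < 1" "- 1 < z" using two_pi_int_less by blast+
  then have "z = 0" by simp
  then show "A = B" "X = Y" using z by auto
qed

lemma reg_pt:
  assumes "pt B Y \<in> reg (pt A X)"
  obtains a b z where "0 \<le> a" "0 \<le> b" "Y = X + a + b" "B = A + 2 * \<tau> * a + 2 * pi * of_int z"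
  using assms by (auto elim!: reg_cases simp: go_pt pt_eq_iff)

lemma pt_in_regI: "0 \<le> a \<Longrightarrow> 0 \<le> b \<Longrightarrow> pt (A + 2 * \<tau> * a) (X + a + b) \<in> reg (pt A X)"
  using go_in_region[of a b "pt A X"] by (simp add: go_pt)

lemma reg_pt_cases:
  assumes "q \<in> reg (pt A X)" "q \<noteq> r"
  obtains B Y where "q = pt B Y"
  using assms by (auto elim!: reg_cases simp: go_pt)

lemma reg_pt_le: "pt B Y \<in> reg (pt A X) \<Longrightarrow> X \<le> Y"
  by (erule reg_pt) simp

section \<open>Meeting times of nodes in angular slots\<close>

text \<open>Compares indices instead of angles: for equal angles the turn from the smaller index to
  the larger is 0 and the turn back is a full \<open>2 * pi\<close>. So the two turns between
  different slots always add up to \<open>2 * pi\<close>.\<close>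

definition gap :: "(nat \<Rightarrow> real) \<Rightarrow> nat \<Rightarrow> nat \<Rightarrow> real" where
  "gap A i j = (if i < j then A j - A i else A j - A i + 2 * pi)"

text \<open>The time when the right spiral of the node in slot \<open>i\<close> arrives at the left
  spiral of slot \<open>j\<close>. Of the two times only \<open>X i\<close> enters: a node moving
  along its left spiral stays in its slot.\<close>

definition meet :: "(nat \<Rightarrow> real) \<Rightarrow> (nat \<Rightarrow> real) \<Rightarrow> nat \<Rightarrow> nat \<Rightarrow> real" where
  "meet A X i j = X i + gap A i j / (2 * \<tau>)"

text \<open>Among terminals on a common left spiral the order by time gives the smaller index to the
  one that the sweep reaches first.\<close>

definition slots :: "nat \<Rightarrow> (nat \<Rightarrow> real) \<Rightarrow> (nat \<Rightarrow> real) \<Rightarrow> bool" where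
  "slots k A X0 \<longleftrightarrow> (\<forall>i<k. 0 \<le> A i \<and> A i < 2 * pi) \<and>
     (\<forall>j<k. \<forall>i<j. A i < A j \<or> A i = A j \<and> X0 i \<le> X0 j)"

lemma slots_mono: "slots k A X0 \<Longrightarrow> i \<le> j \<Longrightarrow> j < k \<Longrightarrow> A i \<le> A j"
  unfolding slots_def by (metis le_less order_refl)

lemma gap_nonneg: "slots k A X0 \<Longrightarrow> i < k \<Longrightarrow> j < k \<Longrightarrow> 0 \<le> gap A i j"
  using slots_mono[of k A X0 i j] unfolding gap_def slots_def
  by (smt (verit) less_imp_le_nat)

lemma meet_ge: "slots k A X0 \<Longrightarrow> i < k \<Longrightarrow> j < k \<Longrightarrow> X i \<le> meet A X i j"
  using gap_nonneg tau_pos by (simp add: meet_def)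

text \<open>A common point needs turns \<open>2 * \<tau> * a\<close> and
  \<open>2 * \<tau> * c\<close> whose difference is \<open>D\<close> modulo \<open>2 * pi\<close>.
  Before both meeting times the first is below \<open>D\<close> and the second below
  \<open>2 * pi - D\<close>, so the difference lies strictly between \<open>D - 2 * pi\<close> and
  \<open>D\<close>.\<close>

lemma meet_lower_aux:
  assumes sl: "slots k A X0" and ij: "i < j" "j < k"
    and Y: "Y < meet A X i j" "Y < meet A X j i"
    and q: "pt B Y \<in> reg (pt (A i) (X i))" "pt B Y \<in> reg (pt (A j) (X j))"
  shows False
proof -
  obtain a b z where a: "0 \<le> a" "0 \<le> b" "Y = X i + a + b" "B = A i + 2 * \<tau> * a + 2 * pi * of_int z"
    using q(1) by (rule reg_pt)
  obtain c d z' where c: "0 \<le> c" "0 \<le> d" "Y = X j + c + d" "B = A j + 2 * \<tau> * c + 2 * pi * of_int z'"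
    using q(2) by (rule reg_pt)
  define D where "D = A j - A i"
  have D: "0 \<le> D" "D < 2 * pi"
    using sl ij slots_mono[OF sl, of i j] unfolding slots_def D_def by (auto simp: less_diff_eq) (smt (verit) less_trans)
  have "2 * \<tau> * Y < 2 * \<tau> * meet A X i j" "2 * \<tau> * Y < 2 * \<tau> * meet A X j i"
    using Y tau_pos by auto
  moreover have "2 * \<tau> * meet A X s t = 2 * \<tau> * X s + gap A s t" for s t
    using tau_pos by (simp add: meet_def distrib_left)
  ultimately have "2 * \<tau> * (Y - X i) < D" "2 * \<tau> * (Y - X j) < 2 * pi - D"
    using ij by (auto simp: gap_def D_def right_diff_distrib)
  moreover have "2 * \<tau> * a \<le> 2 * \<tau> * (Y - X i)" "2 * \<tau> * c \<le> 2 * \<tau> * (Y - X j)"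
    using a c tau_pos by auto
  moreover have "0 \<le> 2 * \<tau> * a" "0 \<le> 2 * \<tau> * c" using a c tau_pos by auto
  ultimately have e: "0 \<le> 2 * \<tau> * a" "2 * \<tau> * a < D" "0 \<le> 2 * \<tau> * c" "2 * \<tau> * c < 2 * pi - D"
    by linarith+
  have "2 * \<tau> * a - 2 * \<tau> * c = D + 2 * pi * of_int (z' - z)"
    using a(4) c(4) by (simp add: D_def algebra_simps)
  then have "2 * pi * of_int (z' - z) < 2 * pi * of_int 0" "2 * pi * of_int (- 1) < 2 * pi * of_int (z' - z)"
    using e by (simp_all only: of_int_0 of_int_1 of_int_minus)
  then have "z' - z < 0" "- 1 < z' - z" using two_pi_int_less by blast+
  then show False by simp
qed

lemma meet_lower:
  assumes "slots k A X0" "i < k" "j < k" "i \<noteq> j"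
    and "Y0 \<le> meet A X i j" "Y0 \<le> meet A X j i"
    and "pt B Y \<in> reg (pt (A i) (X i))" "pt B Y \<in> reg (pt (A j) (X j))"
  shows "Y0 \<le> Y"
proof (rule ccontr)
  assume "\<not> Y0 \<le> Y"
  then have "Y < meet A X i j" "Y < meet A X j i" using assms by auto
  then show False
    using meet_lower_aux[OF assms(1), of i j] meet_lower_aux[OF assms(1), of j i] assms
    by (meson linorder_neqE_nat)
qed

definition slot_pt :: "(nat \<Rightarrow> real) \<Rightarrow> (nat \<Rightarrow> real) \<Rightarrow> nat \<Rightarrow> complex" where
  "slot_pt A X i = pt (A i) (X i)"

text \<open>The state of the sweep when the circle of radius \<open>exp (- L)\<close> has been reached: an active node
  outside the circle occupies the slot of the terminal on whose left spiral it lies; \<open>Fut\<close> are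
  the slots of the terminals inside the circle.\<close>

definition sweep_inv :: "complex list \<Rightarrow> nat \<Rightarrow> (nat \<Rightarrow> real) \<Rightarrow> (nat \<Rightarrow> real) \<Rightarrow> nat set \<Rightarrow> nat set \<Rightarrow>
    (nat \<Rightarrow> real) \<Rightarrow> forest \<Rightarrow> real \<Rightarrow> bool" where
  "sweep_inv ts k A X0 Act Fut X F L \<longleftrightarrow>
     slots k A X0 \<and> Act \<subseteq> {..<k} \<and> Fut \<subseteq> {..<k} \<and> Act \<inter> Fut = {} \<and>
     (greedy_step r \<alpha>)\<^sup>*\<^sup>* (initial_forest ts) F \<and>
     active F - {r} = slot_pt A X ` (Act \<union> Fut) \<and>
     (\<forall>i\<in>Act. X0 i \<le> X i \<and> X i \<le> L) \<and> (\<forall>i\<in>Fut. X i = X0 i \<and> L \<le> X0 i) \<and>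
     (\<forall>i\<in>Act. \<forall>j\<in>Act. \<forall>B Y. i \<noteq> j \<longrightarrow>
        pt B Y \<in> reg (slot_pt A X i) \<inter> reg (slot_pt A X j) \<longrightarrow> L \<le> Y) \<and>
     (\<forall>i\<in>Act. \<forall>j\<in>Act. i < j \<longrightarrow> A i = A j \<longrightarrow> X i < X j) \<and>
     (\<forall>i\<in>Fut. \<forall>j<k. j \<notin> Fut \<longrightarrow> X0 j < X0 i \<or> X0 j = X0 i \<and> j < i)"

lemma sweep_invD:
  assumes "sweep_inv ts k A X0 Act Fut X F L"
  shows "slots k A X0" "Act \<subseteq> {..<k}" "Fut \<subseteq> {..<k}" "Act \<inter> Fut = {}"
    "(greedy_step r \<alpha>)\<^sup>*\<^sup>* (initial_forest ts) F"
    "active F - {r} = slot_pt A X ` (Act \<union> Fut)"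
    "\<And>i. i \<in> Act \<Longrightarrow> X0 i \<le> X i" "\<And>i. i \<in> Act \<Longrightarrow> X i \<le> L"
    "\<And>i. i \<in> Fut \<Longrightarrow> X i = X0 i" "\<And>i. i \<in> Fut \<Longrightarrow> L \<le> X0 i"
    "\<And>i j B Y. \<lbrakk>i \<in> Act; j \<in> Act; i \<noteq> j; pt B Y \<in> reg (slot_pt A X i); pt B Y \<in> reg (slot_pt A X j)\<rbrakk>
       \<Longrightarrow> L \<le> Y"
    "\<And>i j. \<lbrakk>i \<in> Act; j \<in> Act; i < j; A i = A j\<rbrakk> \<Longrightarrow> X i < X j"
    "\<And>i j. \<lbrakk>i \<in> Fut; j < k; j \<notin> Fut\<rbrakk> \<Longrightarrow> X0 j < X0 i \<or> X0 j = X0 i \<and> j < i"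
proof -
  note I = assms[unfolded sweep_inv_def]
  note c1 = I[THEN conjunct1]
  note c2 = I[THEN conjunct2, THEN conjunct1]
  note c3 = I[THEN conjunct2, THEN conjunct2, THEN conjunct1]
  note c4 = I[THEN conjunct2, THEN conjunct2, THEN conjunct2, THEN conjunct1]
  note c5 = I[THEN conjunct2, THEN conjunct2, THEN conjunct2, THEN conjunct2, THEN conjunct1]
  note c6 = I[THEN conjunct2, THEN conjunct2, THEN conjunct2, THEN conjunct2, THEN conjunct2, THEN conjunct1]
  note c7 = I[THEN conjunct2, THEN conjunct2, THEN conjunct2, THEN conjunct2, THEN conjunct2, THEN conjunct2, THEN conjunct1]
  note c8 = I[THEN conjunct2, THEN conjunct2, THEN conjunct2, THEN conjunct2, THEN conjunct2, THEN conjunct2, THEN conjunct2, THEN conjunct1]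
  note c9 = I[THEN conjunct2, THEN conjunct2, THEN conjunct2, THEN conjunct2, THEN conjunct2, THEN conjunct2, THEN conjunct2, THEN conjunct2, THEN conjunct1]
  note c10 = I[THEN conjunct2, THEN conjunct2, THEN conjunct2, THEN conjunct2, THEN conjunct2, THEN conjunct2, THEN conjunct2, THEN conjunct2, THEN conjunct2, THEN conjunct1]
  note c11 = I[THEN conjunct2, THEN conjunct2, THEN conjunct2, THEN conjunct2, THEN conjunct2, THEN conjunct2, THEN conjunct2, THEN conjunct2, THEN conjunct2, THEN conjunct2]
  show "slots k A X0" "Act \<subseteq> {..<k}" "Fut \<subseteq> {..<k}" "Act \<inter> Fut = {}"
    "(greedy_step r \<alpha>)\<^sup>*\<^sup>* (initial_forest ts) F"
    "active F - {r} = slot_pt A X ` (Act \<union> Fut)"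
    by (fact c1 c2 c3 c4 c5 c6)+
  show "\<And>i. i \<in> Act \<Longrightarrow> X0 i \<le> X i" "\<And>i. i \<in> Act \<Longrightarrow> X i \<le> L" using c7 by blast+
  show "\<And>i. i \<in> Fut \<Longrightarrow> X i = X0 i" "\<And>i. i \<in> Fut \<Longrightarrow> L \<le> X0 i" using c8 by blast+
  show "\<And>i j B Y. \<lbrakk>i \<in> Act; j \<in> Act; i \<noteq> j; pt B Y \<in> reg (slot_pt A X i); pt B Y \<in> reg (slot_pt A X j)\<rbrakk>
       \<Longrightarrow> L \<le> Y" using c9 by blast
  show "\<And>i j. \<lbrakk>i \<in> Act; j \<in> Act; i < j; A i = A j\<rbrakk> \<Longrightarrow> X i < X j" using c10 by blast
  show "\<And>i j. \<lbrakk>i \<in> Fut; j < k; j \<notin> Fut\<rbrakk> \<Longrightarrow> X0 j < X0 i \<or> X0 j = X0 i \<and> j < i" using c11 by blast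
qed

lemma sweep_invI:
  assumes "slots k A X0" "Act \<subseteq> {..<k}" "Fut \<subseteq> {..<k}" "Act \<inter> Fut = {}"
    "(greedy_step r \<alpha>)\<^sup>*\<^sup>* (initial_forest ts) F"
    "active F - {r} = slot_pt A X ` (Act \<union> Fut)"
    "\<And>i. i \<in> Act \<Longrightarrow> X0 i \<le> X i \<and> X i \<le> L"
    "\<And>i. i \<in> Fut \<Longrightarrow> X i = X0 i \<and> L \<le> X0 i"
    "\<And>i j B Y. \<lbrakk>i \<in> Act; j \<in> Act; i \<noteq> j; pt B Y \<in> reg (slot_pt A X i); pt B Y \<in> reg (slot_pt A X j)\<rbrakk>
       \<Longrightarrow> L \<le> Y"
    "\<And>i j. \<lbrakk>i \<in> Act; j \<in> Act; i < j; A i = A j\<rbrakk> \<Longrightarrow> X i < X j"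
    "\<And>i j. \<lbrakk>i \<in> Fut; j < k; j \<notin> Fut\<rbrakk> \<Longrightarrow> X0 j < X0 i \<or> X0 j = X0 i \<and> j < i"
  shows "sweep_inv ts k A X0 Act Fut X F L"
  unfolding sweep_inv_def
  by (intro conjI ballI allI impI assms(1-6); (elim IntE)?;
      rule assms(7)[THEN conjunct1] assms(7)[THEN conjunct2] assms(8)[THEN conjunct1]
        assms(8)[THEN conjunct2] assms(9) assms(10) assms(11); assumption)

lemma sweep_slot_pt_eq:
  assumes "sweep_inv ts k A X0 Act Fut X F L" "i < k" "j < k" "slot_pt A X i = slot_pt A X' j"
  shows "A i = A j" "X i = X' j"
  using assms(2-) sweep_invD(1)[OF assms(1)] pt_eq_reduced[of "A i" "X i" "A j" "X' j"]
  unfolding slots_def slot_pt_def by blast+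

lemma sweep_slot_pt_inj:
  assumes "sweep_inv ts k A X0 Act Fut X F L"
  shows "inj_on (slot_pt A X) Act"
proof (rule inj_onI)
  fix i j assume ij: "i \<in> Act" "j \<in> Act" "slot_pt A X i = slot_pt A X j"
  then have "A i = A j" "X i = X j"
    using sweep_slot_pt_eq[OF assms, of i j X] sweep_invD(2)[OF assms] by auto
  then show "i = j" using sweep_invD(12)[OF assms] ij by (metis less_irrefl linorder_neqE_nat)
qed

text \<open>Active slots on the left spiral of \<open>s\<close> precede \<open>s\<close> and have
  strictly increasing times bounded by \<open>L\<close>. One at the place of \<open>s\<close> is the
  last of them, hence the predecessor. A coincidence can therefore be detected by looking at that
  node alone.\<close>

lemma sweep_pred_duplicate:
  assumes inv: "sweep_inv ts k A X0 Act Fut X F L" and s: "s \<in> Fut"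
    and j: "j \<in> Act" "slot_pt A X j = slot_pt A X s"
    and u: "u \<in> Act" "\<And>t. t \<in> Act \<Longrightarrow> t < s \<Longrightarrow> u < s \<and> t \<le> u"
  shows "u = j"
proof -
  note I = sweep_invD[OF inv]
  have k: "s < k" "j < k" "u < k" using I(2,3) s j u by auto
  have eq: "A j = A s" "X j = X s" using sweep_slot_pt_eq[OF inv k(2,1) j(2)] by auto
  have "j \<notin> Fut" using I(4) j by blast
  then have pop: "X0 j < X0 s \<or> X0 j = X0 s \<and> j < s" using I(13)[OF s k(2)] by blast
  have "j < s"
  proof (rule ccontr)
    assume "\<not> j < s"
    moreover have "j \<noteq> s" using I(4) j s by blast
    ultimately have "s < j" by simp
    then have "X0 s \<le> X0 j" using I(1) k eq unfolding slots_def by force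
    then show False using pop \<open>s < j\<close> by auto
  qed
  then have us: "u < s" "j \<le> u" using u j by auto
  then have "A u = A j" using slots_mono[OF I(1), of j u] slots_mono[OF I(1), of u s] k eq by auto
  show "u = j"
  proof (rule ccontr)
    assume "u \<noteq> j"
    then have "X j < X u" using I(12)[OF j(1) u(1)] us \<open>A u = A j\<close> by auto
    moreover have "X u \<le> L" using I(8) u by blast
    moreover have "L \<le> X s" using I(9,10) s by auto
    ultimately show False using eq by auto
  qed
qed

text \<open>Nodes are points, so a terminal at the place of an active node is that node, and its
  slot can be forgotten.\<close>

lemma sweep_drop:
  assumes inv: "sweep_inv ts k A X0 Act Fut X F L" and s: "s \<in> Fut"
    and min: "\<And>i. i \<in> Fut \<Longrightarrow> X0 s < X0 i \<or> X0 s = X0 i \<and> s \<le> i"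
    and j: "j \<in> Act" "slot_pt A X j = slot_pt A X s"
  shows "sweep_inv ts k A X0 Act (Fut - {s}) X F L"
proof -
  note I = sweep_invD[OF inv]
  have "slot_pt A X ` (Act \<union> Fut) = slot_pt A X ` (Act \<union> (Fut - {s}))"
  proof -
    have "Act \<union> Fut = insert s (Act \<union> (Fut - {s}))" using s by blast
    moreover have "slot_pt A X s \<in> slot_pt A X ` (Act \<union> (Fut - {s}))" using j by (metis UnI1 imageI)
    ultimately show ?thesis by (metis image_insert insert_absorb)
  qed
  then have "active F - {r} = slot_pt A X ` (Act \<union> (Fut - {s}))" using I(6) by simp
  moreover have "X0 t < X0 i \<or> X0 t = X0 i \<and> t < i" if "i \<in> Fut - {s}" "t < k" "t \<notin> Fut - {s}" for i t
    using that I(13)[of i t] min[of i] by (cases "t = s") auto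
  moreover have "Fut - {s} \<subseteq> {..<k}" "Act \<inter> (Fut - {s}) = {}" using I(3,4) by auto
  ultimately show ?thesis
    using I(7-10) by (intro sweep_invI I(1,2,5,12)) (auto intro: I(11) simp del: Diff_iff)
qed

text \<open>By their keys no two active nodes meet before the arrival of \<open>s\<close>, and
  points reachable from \<open>s\<close> come no earlier than \<open>s\<close>. So the circle may
  advance to \<open>s\<close>.\<close>

lemma sweep_insert:
  assumes inv: "sweep_inv ts k A X0 Act Fut X F L" and s: "s \<in> Fut"
    and min: "\<And>i. i \<in> Fut \<Longrightarrow> X0 s < X0 i \<or> X0 s = X0 i \<and> s \<le> i"
    and keys: "\<And>i j. i \<in> Act \<Longrightarrow> j \<in> Act \<Longrightarrow> i \<noteq> j \<Longrightarrow> X0 s \<le> meet A X i j"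
    and new: "\<And>j. j \<in> Act \<Longrightarrow> slot_pt A X j \<noteq> slot_pt A X s"
  shows "sweep_inv ts k A X0 (insert s Act) (Fut - {s}) X F (X0 s)"
proof -
  note I = sweep_invD[OF inv]
  have k: "s < k" using I(3) s by auto
  have Xs: "X s = X0 s" "L \<le> X0 s" using I(9,10) s by auto
  have "insert s Act \<union> (Fut - {s}) = Act \<union> Fut" using s by auto
  then have 1: "active F - {r} = slot_pt A X ` (insert s Act \<union> (Fut - {s}))" using I(6) by simp
  have 2: "X0 t < X0 i \<or> X0 t = X0 i \<and> t < i" if "i \<in> Fut - {s}" "t < k" "t \<notin> Fut - {s}" for i t
    using that I(13)[of i t] min[of i] by (cases "t = s") auto
  have 3: "X0 s \<le> Y"
    if ij: "i \<in> insert s Act" "j \<in> insert s Act" "i \<noteq> j"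
      and q: "pt B Y \<in> reg (slot_pt A X i)" "pt B Y \<in> reg (slot_pt A X j)" for i j B Y
  proof (cases "i = s \<or> j = s")
    case True
    then show ?thesis using q Xs reg_pt_le unfolding slot_pt_def by metis
  next
    case False
    then have "i \<in> Act" "j \<in> Act" using ij by auto
    then show ?thesis
      using meet_lower[OF I(1), of i j "X0 s" X B Y] keys ij(3) q I(2) unfolding slot_pt_def by auto
  qed
  have 4: "X i < X j" if ij: "i \<in> insert s Act" "j \<in> insert s Act" "i < j" "A i = A j" for i j
  proof -
    have before: "j' < s \<and> X j' < X s" if j': "j' \<in> Act" "A j' = A s" for j'
    proof -
      have j'k: "j' < k" "j' \<notin> Fut" using j' I(2,4) by auto
      then have pop: "X0 j' < X0 s \<or> X0 j' = X0 s \<and> j' < s" using I(13)[OF s] by blast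
      have "\<not> s < j'"
      proof
        assume "s < j'"
        then have "X0 s \<le> X0 j'" using I(1) j'k j' unfolding slots_def by force
        then show False using pop \<open>s < j'\<close> by auto
      qed
      moreover have "j' \<noteq> s" using s j' I(4) by auto
      moreover have "X j' \<le> X s" using I(8)[OF j'(1)] Xs by auto
      moreover have "X j' \<noteq> X s" using new[OF j'(1)] j'(2) by (auto simp: slot_pt_def)
      ultimately show ?thesis by auto
    qed
    show ?thesis
    proof (cases "i = s")
      case True
      then show ?thesis using before[of j] ij by auto
    next
      case False
      then show ?thesis using before[of i] I(12)[of i j] ij by (cases "j = s") auto
    qed
  qed
  have 5: "X0 i \<le> X i \<and> X i \<le> X0 s" if "i \<in> insert s Act" for i
    using that I(7,8)[of i] Xs by auto
  have 6: "X i = X0 i \<and> X0 s \<le> X0 i" if "i \<in> Fut - {s}" for i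
    using that I(9)[of i] min[of i] by auto
  have "insert s Act \<subseteq> {..<k}" "Fut - {s} \<subseteq> {..<k}" "insert s Act \<inter> (Fut - {s}) = {}"
    using I(2-4) k by auto
  then show ?thesis
    by (intro sweep_invI I(1,5) 1 2 3 4 5 6)
qed

text \<open>The right spiral of \<open>u\<close> reaches the left spiral of \<open>v\<close> at time
  \<open>meet A X u v\<close>. If \<open>v\<close> comes only later on that spiral, following it
  leads to \<open>v\<close> itself, hence the maximum. A pair with a terminal inside the circle
  cannot do better, as the terminal is no earlier than this meeting and than
  \<open>v\<close>.\<close>

lemma sweep_join_point:
  assumes inv: "sweep_inv ts k A X0 Act Fut X F L"
    and uv: "u \<in> Act" "v \<in> Act" "u \<noteq> v"
    and keys: "\<And>i j. i \<in> Act \<Longrightarrow> j \<in> Act \<Longrightarrow> i \<noteq> j \<Longrightarrow> meet A X u v \<le> meet A X i j"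
    and fut: "\<And>i. i \<in> Fut \<Longrightarrow> meet A X u v \<le> X0 i"
    and y: "y = max (X v) (meet A X u v)"
  shows "pt (A v) y \<in> reg (slot_pt A X u)" "pt (A v) y \<in> reg (slot_pt A X v)" "L \<le> y"
    "\<And>p q B Y. \<lbrakk>p \<in> active F; q \<in> active F; p \<noteq> q; pt B Y \<in> reg p; pt B Y \<in> reg q\<rbrakk> \<Longrightarrow> y \<le> Y"
proof -
  note I = sweep_invD[OF inv]
  have k: "u < k" "v < k" using I(2) uv by auto
  define \<kappa> where "\<kappa> = meet A X u v"
  have \<kappa>u: "X u \<le> \<kappa>" using meet_ge[OF I(1) k] by (simp add: \<kappa>_def)
  have pv: "pt (A v) y \<in> reg (slot_pt A X v)"
    using pt_in_regI[of 0 "y - X v" "A v" "X v"] y by (simp add: slot_pt_def)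
  have "2 * \<tau> * (\<kappa> - X u) = gap A u v" using tau_pos by (simp add: \<kappa>_def meet_def)
  then have "pt (A u + gap A u v) y \<in> reg (slot_pt A X u)"
    using pt_in_regI[of "\<kappa> - X u" "y - \<kappa>" "A u" "X u"] \<kappa>u y by (simp add: slot_pt_def \<kappa>_def)
  moreover have "pt (A u + gap A u v) y = pt (A v) y"
    unfolding pt_eq_iff gap_def by (auto intro: exI[of _ 0] exI[of _ 1])
  ultimately have pu: "pt (A v) y \<in> reg (slot_pt A X u)" by simp
  show "pt (A v) y \<in> reg (slot_pt A X u)" "pt (A v) y \<in> reg (slot_pt A X v)" by fact+
  show Ly: "L \<le> y" using I(11)[OF uv pu pv] .
  have lowact: "y \<le> Y" if ij: "i \<in> Act" "j \<in> Act" "i \<noteq> j"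
      and q: "pt B Y \<in> reg (slot_pt A X i)" "pt B Y \<in> reg (slot_pt A X j)" for i j B Y
  proof -
    have "L \<le> Y" using I(11) ij q by blast
    moreover have "\<kappa> \<le> Y"
      using meet_lower[OF I(1), of i j \<kappa> X B Y] keys ij q I(2) unfolding slot_pt_def \<kappa>_def by auto
    moreover have "X v \<le> L" using I(8) uv by blast
    ultimately show ?thesis using y \<kappa>_def by auto
  qed
  have lowfut: "y \<le> Y" if i: "i \<in> Fut" "pt B Y \<in> reg (slot_pt A X i)" for i B Y
  proof -
    have "X i \<le> Y" using reg_pt_le i(2) unfolding slot_pt_def by blast
    moreover have "X v \<le> X i" using I(8)[OF uv(2)] I(9,10)[OF i(1)] by auto
    moreover have "\<kappa> \<le> X i" using fut[OF i(1)] I(9)[OF i(1)] by (simp add: \<kappa>_def)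
    ultimately show ?thesis using y \<kappa>_def by auto
  qed
  fix p q B Y
  assume pq: "p \<in> active F" "q \<in> active F" "p \<noteq> q" and Y: "pt B Y \<in> reg p" "pt B Y \<in> reg q"
  have "p \<noteq> r" "q \<noteq> r" using Y by auto
  then obtain i j where ij: "i \<in> Act \<union> Fut" "j \<in> Act \<union> Fut" "p = slot_pt A X i" "q = slot_pt A X j"
    using pq I(6) by blast
  then have "i \<noteq> j" using pq(3) by auto
  then show "y \<le> Y" using ij Y lowact lowfut by blast
qed

text \<open>The join point lies on the left spiral of \<open>v\<close>, so it inherits the slot of
  \<open>v\<close>, and the slot of \<open>u\<close> becomes free.\<close>

lemma sweep_join:
  assumes inv: "sweep_inv ts k A X0 Act Fut X F L"
    and uv: "u \<in> Act" "v \<in> Act" "u \<noteq> v"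
    and keys: "\<And>i j. i \<in> Act \<Longrightarrow> j \<in> Act \<Longrightarrow> i \<noteq> j \<Longrightarrow> meet A X u v \<le> meet A X i j"
    and fut: "\<And>i. i \<in> Fut \<Longrightarrow> meet A X u v \<le> X0 i"
    and y: "y = max (X v) (meet A X u v)"
    and pu: "pu = slot_pt A X u" and pv: "pv = slot_pt A X v" and p: "p = pt (A v) y"
    and arcs: "arc_from_to r \<alpha> (a pu) pu p" "p \<noteq> pv \<Longrightarrow> arc_from_to r \<alpha> (a pv) pv p"
  shows "sweep_inv ts k A X0 (Act - {u}) Fut (X(v := y)) (connect {pu, pv} p a F) y"
    "pu \<noteq> pv" "p \<noteq> pu" "up F p = None" "X v < meet A X u v \<Longrightarrow> p \<notin> slot_pt A X ` Act"
proof -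
  note I = sweep_invD[OF inv]
  note J = sweep_join_point[OF inv uv keys fut y, simplified]
  have ginv: "greedy_inv ts F" using greedy_steps_inv[OF I(5)] .
  have k: "u < k" "v < k" using I(2) uv by auto
  define \<kappa> where "\<kappa> = meet A X u v"
  have \<kappa>u: "X u \<le> \<kappa>" using meet_ge[OF I(1) k] by (simp add: \<kappa>_def)
  have A: "\<And>i. i < k \<Longrightarrow> 0 \<le> A i \<and> A i < 2 * pi" using I(1) by (simp add: slots_def)
  have pact: "pu \<in> active F" "pv \<in> active F" using I(6) uv pu pv by blast+
  show puv: "pu \<noteq> pv" using sweep_slot_pt_inj[OF inv] uv pu pv by (auto dest: inj_onD)
  \<comment> \<open>For equal angles \<open>u\<close> is either earlier than \<open>v\<close> on the
    left spiral, or \<open>v\<close> is a full turn away; in both cases the join is strictly later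
    than \<open>u\<close>.\<close>
  have same: False if "A u = A v" "y = X u"
  proof (cases "u < v")
    case True
    then show False using I(12)[OF uv(1,2) True that(1)] that(2) y by auto
  next
    case False
    then have "\<kappa> = X u + 2 * pi / (2 * \<tau>)" using that(1) by (simp add: \<kappa>_def meet_def gap_def)
    moreover have "0 < 2 * pi / (2 * \<tau>)" using tau_pos by simp
    ultimately show False using that(2) y unfolding \<kappa>_def by linarith
  qed
  show ppu: "p \<noteq> pu"
    using same pt_eq_reduced[of "A v" y "A u" "X u"] A k by (auto simp: p pu slot_pt_def)
  have join: "join_point r \<alpha> pu pv p"
    unfolding join_point_def
  proof (intro conjI ballI)
    show "p \<in> reg pu \<inter> reg pv" using J(1,2) by (simp add: p pu pv)
    fix q assume q: "q \<in> reg pu \<inter> reg pv"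
    show "dist r q \<le> dist r p"
    proof (cases "q = r")
      case False
      then obtain B Y where BY: "q = pt B Y" using q reg_pt_cases[of q "A u" "X u"] by (auto simp: pu slot_pt_def)
      then show ?thesis using J(4)[OF pact puv, of B Y] q by (simp add: p)
    qed simp
  qed
  have max: "dist r p' \<le> dist r p"
    if "u' \<in> active F" "v' \<in> active F" "u' \<noteq> v'" "join_point r \<alpha> u' v' p'" for u' v' p'
  proof (cases "p' = r")
    case False
    have p': "p' \<in> reg u'" "p' \<in> reg v'" using that(4) by (auto simp: join_point_def)
    then have "u' \<noteq> r" using False by auto
    then have "u' \<in> slot_pt A X ` (Act \<union> Fut)" using that(1) by (simp flip: I(6))
    then obtain i where "u' = pt (A i) (X i)" by (auto simp: slot_pt_def)
    then obtain B Y where BY: "p' = pt B Y" using p'(1) False reg_pt_cases by blast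
    then show ?thesis using J(4)[OF that(1-3), of B Y] p' by (simp add: p)
  qed simp
  have arcs': "arc_from_to r \<alpha> (a x) x p" if "x \<in> {pu, pv} - {p}" for x
    using that arcs by auto
  have step: "greedy_step r \<alpha> F (connect {pu, pv} p a F)"
    by (rule greedy_step.intros[OF pact puv join]) (use max arcs' in blast)+
  show upp: "up F p = None" using join_point_not_inactive[OF ginv pact puv join] .
  have act: "active (connect {pu, pv} p a F) = (active F - {pu, pv}) \<union> {p}"
    using upp by (auto simp: active_def)
  \<comment> \<open>The turn from \<open>v\<close> to such a slot is 0, so the least meeting time is
    at most \<open>X v\<close> and \<open>v\<close> does not move.\<close>
  have later: "\<kappa> \<le> X v" if "t \<in> Act" "v < t" "A t = A v" for t
    using keys[OF uv(2) that(1)] that by (simp add: meet_def gap_def \<kappa>_def)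
  have alone: "t = u \<or> t = v" if t: "t \<in> Act" "A t = A v" "X t = y" for t
  proof (rule ccontr)
    assume n: "\<not> (t = u \<or> t = v)"
    show False
    proof (cases "v < t")
      case True
      then have "y = X v" using later[OF t(1) True t(2)] y by (simp add: \<kappa>_def)
      then show False using I(12)[OF uv(2) t(1) True] t by auto
    next
      case False
      then have tv: "t < v" using n by auto
      then have "X t < X v" using I(12)[OF t(1) uv(2)] t by auto
      then show False using t(3) y by auto
    qed
  qed
  show new: "p \<notin> slot_pt A X ` Act" if "X v < meet A X u v"
  proof
    assume "p \<in> slot_pt A X ` Act"
    then obtain t where t: "t \<in> Act" "p = slot_pt A X t" by blast
    then have "A t = A v" "X t = y"
      using pt_eq_reduced[of "A v" y "A t" "X t"] A I(2) k by (auto simp: p slot_pt_def)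
    then have "t = u \<or> t = v" using alone t by blast
    then show False
    proof
      assume "t = u" then show False using ppu t pu by simp
    next
      assume "t = v" then show False using \<open>X t = y\<close> that y by simp
    qed
  qed
  have 1: "active (connect {pu, pv} p a F) - {r} = slot_pt A (X(v := y)) ` ((Act - {u}) \<union> Fut)"
  proof -
    have vF: "v \<notin> Fut" "u \<notin> Fut" using uv I(4) by auto
    have new_im: "slot_pt A (X(v := y)) ` ((Act - {u}) \<union> Fut) =
        insert p (slot_pt A X ` ((Act - {u, v}) \<union> Fut))"
    proof -
      have "(Act - {u}) \<union> Fut = insert v ((Act - {u, v}) \<union> Fut)" using uv by auto
      moreover have "slot_pt A (X(v := y)) v = p" by (simp add: slot_pt_def p)
      moreover have "slot_pt A (X(v := y)) ` ((Act - {u, v}) \<union> Fut) = slot_pt A X ` ((Act - {u, v}) \<union> Fut)"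
        using vF by (intro image_cong) (auto simp: slot_pt_def)
      ultimately show ?thesis by simp
    qed
    have "p \<noteq> r" by (simp add: p)
    then have "active (connect {pu, pv} p a F) - {r} = insert p ((active F - {r}) - {pu, pv})"
      unfolding act by auto
    also have "\<dots> = insert p (slot_pt A X ` (Act \<union> Fut) - {pu, pv})" by (simp only: I(6))
    also have "\<dots> = insert p (slot_pt A X ` ((Act - {u, v}) \<union> Fut))"
    proof -
      \<comment> \<open>A terminal not yet inserted may coincide with \<open>v\<close>, but only if
        \<open>v\<close> itself is the join point and stays active.\<close>
      have futp: "slot_pt A X i \<noteq> pu \<or> p = pu" "slot_pt A X i \<noteq> pv \<or> p = pv" if i: "i \<in> Fut" for i
      proof -
        have yi: "y \<le> X i" using J(3) fut[OF i] I(8)[OF uv(2)] I(9,10)[OF i] y by auto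
        have ik: "i < k" using i I(3) by auto
        show "slot_pt A X i \<noteq> pv \<or> p = pv"
        proof (rule disjCI)
          assume "p \<noteq> pv"
          then have "y \<noteq> X v" by (auto simp: p pv slot_pt_def)
          then have "X v < y" using y by auto
          then show "slot_pt A X i \<noteq> pv" using yi sweep_slot_pt_eq(2)[OF inv ik k(2), of X] by (auto simp: pv)
        qed
        show "slot_pt A X i \<noteq> pu \<or> p = pu"
        proof (rule disjI1, rule notI)
          assume "slot_pt A X i = pu"
          then have e: "A i = A u" "X i = X u" using sweep_slot_pt_eq[OF inv ik k(1), of X] by (auto simp: pu)
          then have "y \<le> X u" using yi by simp
          then have yu: "y = X u" "\<kappa> = X u" using \<kappa>u y by (auto simp: \<kappa>_def)
          then have "gap A u v = 0" using tau_pos by (simp add: \<kappa>_def meet_def)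
          then have "A u = A v" using A k unfolding gap_def by (smt (verit, ccfv_SIG))
          then show False using same yu by blast
        qed
      qed
      define S where "S = slot_pt A X ` (Act - {u, v})"
      define T where "T = slot_pt A X ` Fut"
      have "slot_pt A X i \<noteq> pu" "slot_pt A X i \<noteq> pv" if "i \<in> Act - {u, v}" for i
        using that sweep_slot_pt_inj[OF inv] uv by (auto simp: pu pv dest: inj_onD)
      then have S: "pu \<notin> S" "pv \<notin> S" unfolding S_def by auto
      have T: "pu \<notin> T" "pv \<in> T \<Longrightarrow> p = pv" using futp ppu unfolding T_def by auto
      have "Act = insert u (insert v (Act - {u, v}))" using uv by auto
      then have "slot_pt A X ` Act = insert pu (insert pv S)" unfolding S_def pu pv by (metis image_insert)
      then have im: "slot_pt A X ` (Act \<union> Fut) = insert pu (insert pv S) \<union> T"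
        by (simp only: image_Un T_def)
      have im': "slot_pt A X ` ((Act - {u, v}) \<union> Fut) = S \<union> T"
        by (simp only: image_Un T_def S_def)
      show ?thesis unfolding im im' using S T by blast
    qed
    finally show ?thesis unfolding new_im .
  qed
  have X': "X t \<le> (X(v := y)) t" for t using y by simp
  have reg': "reg (slot_pt A (X(v := y)) t) \<subseteq> reg (slot_pt A X t)" for t
  proof (cases "t = v")
    case True
    then show ?thesis using J(2) reg_trans by (auto simp: slot_pt_def)
  qed (auto simp: slot_pt_def)
  have 2: "y \<le> Y" if ij: "i \<in> Act - {u}" "j \<in> Act - {u}" "i \<noteq> j"
      and q: "pt B Y \<in> reg (slot_pt A (X(v := y)) i) \<inter> reg (slot_pt A (X(v := y)) j)" for i j B Y
  proof -
    have a: "slot_pt A X i \<in> active F" "slot_pt A X j \<in> active F" using ij I(6) by blast+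
    have "slot_pt A X i \<noteq> slot_pt A X j" using ij sweep_slot_pt_inj[OF inv] by (auto dest: inj_onD)
    then show ?thesis using J(4)[OF a, of B Y] q reg'[of i] reg'[of j] by blast
  qed
  have 3: "(X(v := y)) i < (X(v := y)) j" if ij: "i \<in> Act - {u}" "j \<in> Act - {u}" "i < j" "A i = A j" for i j
  proof -
    have old: "X i < X j" using I(12) ij by blast
    show ?thesis
    proof (cases "i = v")
      case True
      then have "y = X v" using later[of j] ij y by (auto simp: \<kappa>_def)
      then show ?thesis using old True ij by simp
    next
      case False
      then show ?thesis using old X'[of j] by auto
    qed
  qed
  have 4: "X0 i \<le> (X(v := y)) i \<and> (X(v := y)) i \<le> y" if "i \<in> Act - {u}" for i
    using that I(7,8)[of i] J(3) X'[of i] by auto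
  have 5: "(X(v := y)) i = X0 i \<and> y \<le> X0 i" if "i \<in> Fut" for i
  proof -
    have "i \<noteq> v" using that uv I(4) by auto
    then show ?thesis using I(8)[OF uv(2)] I(9,10)[OF that] fut[OF that] y by auto
  qed
  have 6: "(greedy_step r \<alpha>)\<^sup>*\<^sup>* (initial_forest ts) (connect {pu, pv} p a F)"
    using I(5) step by (rule rtranclp.rtrancl_into_rtrancl)
  have "Act - {u} \<subseteq> {..<k}" "(Act - {u}) \<inter> Fut = {}" using I(2,4) by auto
  then show "sweep_inv ts k A X0 (Act - {u}) Fut (X(v := y)) (connect {pu, pv} p a F) y"
    using 2 by (intro sweep_invI I(1,3,13) 1 3 4 5 6) blast+
qed

end

section \<open>Time-bounded weakest preconditions and tournament trees\<close>

text \<open>\<open>t\<close> counts the steps spent before \<open>P\<close>, and \<open>Q\<close>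
  sees the total, so time bounds are proved together with correctness. Termination is part of the
  claim.\<close>

definition wp :: "prog \<Rightarrow> (mem \<Rightarrow> nat \<Rightarrow> bool) \<Rightarrow> mem \<Rightarrow> nat \<Rightarrow> bool" where
  "wp P Q s t \<longleftrightarrow> (\<exists>k s'. exec P s k s' \<and> Q s' (t + k))"

definition setn :: "string \<Rightarrow> nat \<Rightarrow> nat \<Rightarrow> mem \<Rightarrow> mem" where
  "setn x i v s = s\<lparr>nmem := (nmem s)(x := (nmem s x)(i := v))\<rparr>"

definition setr :: "string \<Rightarrow> nat \<Rightarrow> real \<Rightarrow> mem \<Rightarrow> mem" where
  "setr x i v s = s\<lparr>rmem := (rmem s)(x := (rmem s x)(i := v))\<rparr>"

lemma set_simps [simp]:
  "nmem (setn x i v s) = (nmem s)(x := (nmem s x)(i := v))" "rmem (setn x i v s) = rmem s"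
  "nmem (setr x i c s) = nmem s" "rmem (setr x i c s) = (rmem s)(x := (rmem s x)(i := c))"
  by (simp_all add: setn_def setr_def)

inductive_cases exec_SkipE: "exec Skip s k s'"
inductive_cases exec_NSetE: "exec (NSet x i e) s k s'"
inductive_cases exec_RSetE: "exec (RSet x i e) s k s'"
inductive_cases exec_SeqE: "exec (Seq P R) s k s'"
inductive_cases exec_CondE: "exec (Cond b P R) s k s'"

lemma wp_Skip: "wp Skip Q s t \<longleftrightarrow> Q s (Suc t)"
proof
  show "wp Skip Q s t \<Longrightarrow> Q s (Suc t)" unfolding wp_def by (auto elim!: exec_SkipE)
  show "Q s (Suc t) \<Longrightarrow> wp Skip Q s t"
    unfolding wp_def using exec.Skip[of s] by (intro exI[of _ 1] exI[of _ s]) simp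
qed

lemma wp_NSet: "wp (NSet x i e) Q s t \<longleftrightarrow> Q (setn x (nval s i) (nval s e) s) (Suc t)"
  unfolding wp_def setn_def using exec.NSet by (auto elim!: exec_NSetE) fastforce

lemma wp_RSet: "wp (RSet x i e) Q s t \<longleftrightarrow> Q (setr x (nval s i) (rval s e) s) (Suc t)"
  unfolding wp_def setr_def using exec.RSet by (auto elim!: exec_RSetE) fastforce

lemma wp_Seq: "wp (Seq P R) Q s t \<longleftrightarrow> wp P (wp R Q) s t"
proof
  assume "wp (Seq P R) Q s t"
  then obtain k s' where "exec (Seq P R) s k s'" "Q s' (t + k)" by (auto simp: wp_def)
  then show "wp P (wp R Q) s t" unfolding wp_def by (auto elim!: exec_SeqE simp: add.assoc)
next
  assume "wp P (wp R Q) s t"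
  then obtain k l s' s'' where "exec P s k s'" "exec R s' l s''" "Q s'' (t + k + l)" unfolding wp_def by blast
  then show "wp (Seq P R) Q s t" unfolding wp_def using exec.Seq by (metis add.assoc)
qed

lemma wp_Cond: "wp (Cond b P R) Q s t \<longleftrightarrow> (if tval s b then wp P Q s (Suc t) else wp R Q s (Suc t))"
proof -
  have "exec (Cond b P R) s k s' \<longleftrightarrow> (\<exists>l. k = Suc l \<and> exec (if tval s b then P else R) s l s')" for k s'
    using exec.Cond_True[of s b P _ s' R] exec.Cond_False[of s b R _ s' P]
    by (auto elim!: exec_CondE)
  then have "(\<exists>k s'. exec (Cond b P R) s k s' \<and> Q s' (t + k)) \<longleftrightarrow>
      (\<exists>k s'. exec (if tval s b then P else R) s k s' \<and> Q s' (t + Suc k))"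
    by (simp only:) blast
  then show ?thesis by (simp add: wp_def)
qed

lemmas wp_simps = wp_Skip wp_NSet wp_RSet wp_Seq wp_Cond

lemma wp_mono: "wp P Q s t \<Longrightarrow> (\<And>s' t'. Q s' t' \<Longrightarrow> Q' s' t') \<Longrightarrow> wp P Q' s t"
  unfolding wp_def by blast

lemma wp_While:
  fixes n :: nat
  assumes "I n s t"
    and step: "\<And>n s t. I n s t \<Longrightarrow> tval s b \<Longrightarrow> wp P (\<lambda>s' t'. \<exists>n'<n. I n' s' t') s (Suc t)"
    and exit: "\<And>n s t. I n s t \<Longrightarrow> \<not> tval s b \<Longrightarrow> Q s (Suc t)"
  shows "wp (While b P) Q s t"
  using assms(1)
proof (induction n arbitrary: s t rule: less_induct)
  case (less n)
  show ?case
  proof (cases "tval s b")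
    case True
    then obtain k s' n' where k: "exec P s k s'" "n' < n" "I n' s' (Suc t + k)"
      using step[OF less.prems] unfolding wp_def by blast
    then obtain l s'' where "exec (While b P) s' l s''" "Q s'' (Suc t + k + l)"
      using less.IH unfolding wp_def by blast
    then show ?thesis
      unfolding wp_def using exec.While_True[OF True k(1)] by (metis add.assoc add_Suc add_Suc_right)
  next
    case False
    then show ?thesis
      unfolding wp_def using exec.While_False[OF False] exit[OF less.prems] by (metis Suc_eq_plus1)
  qed
qed

definition same_but :: "string set \<Rightarrow> string set \<Rightarrow> mem \<Rightarrow> mem \<Rightarrow> bool" where
  "same_but U V s s' \<longleftrightarrow> (\<forall>x. x \<notin> U \<longrightarrow> nmem s' x = nmem s x) \<and> (\<forall>x. x \<notin> V \<longrightarrow> rmem s' x = rmem s x)"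

section \<open>Tournament trees for least keys and greatest occupied slots\<close>

definition pick :: "(nat \<Rightarrow> nat \<Rightarrow> bool) \<Rightarrow> nat set \<Rightarrow> nat \<Rightarrow> bool" where
  "pick R S v \<longleftrightarrow> (v = 0 \<and> S = {}) \<or> (\<exists>i\<in>S. v = Suc i \<and> (\<forall>t\<in>S. R i t))"

text \<open>The second key serves the sort, by angle and then by time; during the sweep it is 0, and
  ties go to the smaller slot.\<close>

definition lexle :: "(nat \<Rightarrow> real) \<Rightarrow> (nat \<Rightarrow> real) \<Rightarrow> nat \<Rightarrow> nat \<Rightarrow> bool" where
  "lexle K L i t \<longleftrightarrow> K i < K t \<or> K i = K t \<and> (L i < L t \<or> L i = L t \<and> i \<le> t)"

definition leaves :: "nat \<Rightarrow> nat set \<Rightarrow> nat \<Rightarrow> nat \<Rightarrow> nat set" where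
  "leaves h D e j = {i \<in> D. (2 ^ h + i) div 2 ^ e = j}"

text \<open>Node \<open>j\<close> of a complete binary tree with \<open>2 ^ h\<close> leaves, the children of \<open>j\<close> being \<open>2 * j\<close> and
  \<open>2 * j + 1\<close>; the leaf of \<open>i\<close> is \<open>2 ^ h + i\<close>, and its ancestor of height \<open>e\<close> is
  \<open>(2 ^ h + i) div 2 ^ e\<close>. In \<open>w\<close> and \<open>b\<close>, \<open>0\<close> stands for no element and \<open>Suc i\<close> for \<open>i\<close>.\<close>

definition node_ok :: "nat \<Rightarrow> (nat \<Rightarrow> real) \<Rightarrow> (nat \<Rightarrow> real) \<Rightarrow> (nat \<Rightarrow> nat) \<Rightarrow> (nat \<Rightarrow> nat) \<Rightarrow>
    nat set \<Rightarrow> nat set \<Rightarrow> nat \<Rightarrow> nat \<Rightarrow> bool" where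
  "node_ok h K L w b D B e j \<longleftrightarrow>
     pick (lexle K L) (leaves h D e j) (w j) \<and> pick (\<ge>) (leaves h B e j) (b j)"

text \<open>The nodes of height \<open>e\<close> are the numbers with
  \<open>j div 2 ^ (h - e) = 1\<close>. One shape carries two tournaments: \<open>w\<close> finds
  the least key in \<open>D\<close>, and \<open>b\<close> the greatest element of \<open>B\<close>,
  from which predecessors are read off.\<close>

definition trees :: "nat \<Rightarrow> (nat \<Rightarrow> real) \<Rightarrow> (nat \<Rightarrow> real) \<Rightarrow> (nat \<Rightarrow> nat) \<Rightarrow> (nat \<Rightarrow> nat) \<Rightarrow>
    nat set \<Rightarrow> nat set \<Rightarrow> bool" where
  "trees h K L w b D B \<longleftrightarrow> D \<subseteq> {..<2 ^ h} \<and> B \<subseteq> {..<2 ^ h} \<and>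
     (\<forall>e\<le>h. \<forall>j. j div 2 ^ (h - e) = 1 \<longrightarrow> node_ok h K L w b D B e j)"

lemma leaves_Suc: "leaves h D (Suc e) j = leaves h D e (2 * j) \<union> leaves h D e (2 * j + 1)"
  by (auto simp: leaves_def div_mult2_eq mult.commute[of 2 "2 ^ e"])

lemma ancestor_valid:
  fixes i :: nat
  assumes "i < 2 ^ h" "e \<le> h"
  shows "(2 ^ h + i) div 2 ^ e div 2 ^ (h - e) = 1"
proof -
  have "(2 ^ h + i) div 2 ^ e div 2 ^ (h - e) = (2 ^ h + i) div (2 ^ e * 2 ^ (h - e))"
    by (simp add: div_mult2_eq)
  also have "\<dots> = (2 ^ h + i) div 2 ^ h" using assms by (simp flip: power_add)
  also have "\<dots> = 1" using assms by simp
  finally show ?thesis .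
qed

lemma trees_root:
  assumes "trees h K L w b D B"
  shows "pick (lexle K L) D (w 1)" "pick (\<ge>) B (b 1)"
proof -
  have *: "D \<subseteq> {..<2 ^ h}" "B \<subseteq> {..<2 ^ h}" "node_ok h K L w b D B h 1"
    using assms unfolding trees_def by auto
  have "leaves h S h 1 = S" if "S \<subseteq> {..<2 ^ h}" for S
    using that by (auto simp: leaves_def)
  then show "pick (lexle K L) D (w 1)" "pick (\<ge>) B (b 1)"
    using * unfolding node_ok_def by auto
qed

lemma trees_leaf_value:
  assumes "trees h K L w b D B" "i < 2 ^ h"
  shows "w (2 ^ h + i) = (if i \<in> D then Suc i else 0)" "b (2 ^ h + i) = (if i \<in> B then Suc i else 0)"
proof -
  have "node_ok h K L w b D B 0 (2 ^ h + i)"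
    using assms ancestor_valid[of i h 0] unfolding trees_def by auto
  then show "w (2 ^ h + i) = (if i \<in> D then Suc i else 0)" "b (2 ^ h + i) = (if i \<in> B then Suc i else 0)"
    unfolding node_ok_def pick_def leaves_def by auto
qed

lemma pick_union_lex:
  assumes "pick (lexle K L) S a" "pick (lexle K L) T c" "\<And>i t. i \<in> S \<Longrightarrow> t \<in> T \<Longrightarrow> i < t"
    and "v = (if a = 0 then c else if c = 0 then a else
      if K (c - 1) < K (a - 1) \<or> K (c - 1) = K (a - 1) \<and> L (c - 1) < L (a - 1) then c else a)"
  shows "pick (lexle K L) (S \<union> T) v"
proof (cases "a = 0 \<or> c = 0")
  case True
  then show ?thesis using assms(1,2,4) by (auto simp: pick_def)
next
  case False
  then obtain i t where i: "i \<in> S" "a = Suc i" "\<And>x. x \<in> S \<Longrightarrow> lexle K L i x"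
    and t: "t \<in> T" "c = Suc t" "\<And>x. x \<in> T \<Longrightarrow> lexle K L t x"
    using assms(1,2) unfolding pick_def by auto
  have it: "i < t" using assms(3) i t by blast
  have tr: "lexle K L x y \<Longrightarrow> lexle K L y z \<Longrightarrow> lexle K L x z" for x y z
    unfolding lexle_def by auto
  show ?thesis
  proof (cases "K t < K i \<or> K t = K i \<and> L t < L i")
    case True
    then have "v = Suc t" "lexle K L t i" using assms(4) i t by (auto simp: lexle_def)
    then show ?thesis unfolding pick_def using i t tr by (intro disjI2 bexI[of _ t]) auto
  next
    case False
    then have "v = Suc i" "lexle K L i t" using assms(4) i t it by (auto simp: lexle_def)
    then show ?thesis unfolding pick_def using i t tr by (intro disjI2 bexI[of _ i]) auto
  qed
qed

lemma pick_union_max: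
  assumes "pick (\<ge>) S a" "pick (\<ge>) T c" "\<And>i t. i \<in> S \<Longrightarrow> t \<in> T \<Longrightarrow> i < t"
  shows "pick (\<ge>) (S \<union> T) (if c = 0 then a else c)"
proof (cases "c = 0")
  case True
  then show ?thesis using assms(1,2) by (auto simp: pick_def)
next
  case False
  then obtain t where t: "t \<in> T" "c = Suc t" "\<And>x. x \<in> T \<Longrightarrow> x \<le> t"
    using assms(2) unfolding pick_def by auto
  moreover have "x \<le> t" if "x \<in> S" for x using assms(3)[OF that t(1)] by simp
  ultimately show ?thesis unfolding pick_def by (intro disjI2 bexI[of _ t]) auto
qed

lemma leaves_order:
  assumes "i \<in> leaves h D e (2 * j)" "t \<in> leaves h D' e (2 * j + 1)"
  shows "i < t"
proof (rule ccontr)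
  assume "\<not> i < t"
  then have "(2 ^ h + t) div 2 ^ e \<le> (2 ^ h + i) div 2 ^ e" by (intro div_le_mono) simp
  then show False using assms by (simp add: leaves_def)
qed

abbreviation nv :: "string \<Rightarrow> nexp" where "nv x \<equiv> NGet x (NConst 0)"
abbreviation rv :: "string \<Rightarrow> rexp" where "rv x \<equiv> RGet x (NConst 0)"
abbreviation nset :: "string \<Rightarrow> nexp \<Rightarrow> prog" where "nset x e \<equiv> NSet x (NConst 0) e"
abbreviation rset :: "string \<Rightarrow> rexp \<Rightarrow> prog" where "rset x e \<equiv> RSet x (NConst 0) e"

definition combine_prog :: prog where
  "combine_prog =
    (let l = NAdd (nv ''j'') (nv ''j''); u = NAdd l (NConst 1);
         a = NGet ''w'' l; c = NGet ''w'' u; i = NSub a (NConst 1); t = NSub c (NConst 1) in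
     Seq (Cond (NEq a (NConst 0)) (NSet ''w'' (nv ''j'') c)
           (Cond (NEq c (NConst 0)) (NSet ''w'' (nv ''j'') a)
             (Cond (TAnd (TNot (RLess (RGet ''K'' t) (RGet ''K'' i)))
                     (TNot (TAnd (REq (RGet ''K'' t) (RGet ''K'' i)) (RLess (RGet ''L'' t) (RGet ''L'' i)))))
               (NSet ''w'' (nv ''j'') a) (NSet ''w'' (nv ''j'') c))))
       (Cond (NEq (NGet ''b'' u) (NConst 0)) (NSet ''b'' (nv ''j'') (NGet ''b'' l))
         (NSet ''b'' (nv ''j'') (NGet ''b'' u))))"

definition fix_prog :: prog where
  "fix_prog = Seq (nset ''j'' (NAdd (nv ''m'') (nv ''i'')))
     (While (NLess (NConst 1) (nv ''j'')) (Seq (nset ''j'' (NHalf (nv ''j''))) combine_prog))"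

lemma wp_combine:
  fixes s :: mem
  defines "j \<equiv> nmem s ''j'' 0" and "w \<equiv> nmem s ''w''" and "b \<equiv> nmem s ''b''"
    and "K \<equiv> rmem s ''K''" and "L \<equiv> rmem s ''L''"
  assumes j: "0 < j"
    and Q: "\<And>s' t'. \<lbrakk>t' \<le> t + 6; same_but {''w'', ''b''} {} s s';
      nmem s' ''w'' = w(j := (let a = w (2 * j); c = w (2 * j + 1) in if a = 0 then c else if c = 0 then a else
        if K (c - 1) < K (a - 1) \<or> K (c - 1) = K (a - 1) \<and> L (c - 1) < L (a - 1) then c else a));
      nmem s' ''b'' = b(j := (if b (2 * j + 1) = 0 then b (2 * j) else b (2 * j + 1)))\<rbrakk> \<Longrightarrow> Q s' t'"
  shows "wp combine_prog Q s t"
proof -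
  have d: "j + j = 2 * j" by simp
  show ?thesis
    unfolding combine_prog_def Let_def wp_simps
    by (auto simp: same_but_def Let_def d fun_eq_iff simp flip: j_def w_def b_def K_def L_def intro!: Q)
qed


lemma node_ok_parent:
  assumes "node_ok h K L w b D B e (2 * j)" "node_ok h K L w b D B e (2 * j + 1)"
    and "w' j = (let a = w (2 * j); c = w (2 * j + 1) in if a = 0 then c else if c = 0 then a else
        if K (c - 1) < K (a - 1) \<or> K (c - 1) = K (a - 1) \<and> L (c - 1) < L (a - 1) then c else a)"
    and "b' j = (if b (2 * j + 1) = 0 then b (2 * j) else b (2 * j + 1))"
  shows "node_ok h K L w' b' D B (Suc e) j"
  unfolding node_ok_def leaves_Suc
proof
  note * = assms(1,2)[unfolded node_ok_def]
  show "pick (lexle K L) (leaves h D e (2 * j) \<union> leaves h D e (2 * j + 1)) (w' j)"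
    by (rule pick_union_lex[OF *(1)[THEN conjunct1] *(2)[THEN conjunct1] leaves_order])
       (simp_all only: assms(3) Let_def)
  show "pick (\<ge>) (leaves h B e (2 * j) \<union> leaves h B e (2 * j + 1)) (b' j)"
    unfolding assms(4)
    by (rule pick_union_max[OF *(1)[THEN conjunct2] *(2)[THEN conjunct2] leaves_order])
qed

definition node_at :: "nat \<Rightarrow> nat \<Rightarrow> nat \<Rightarrow> bool" where
  "node_at h e j \<longleftrightarrow> e \<le> h \<and> j div 2 ^ (h - e) = 1"

text \<open>A node of height \<open>e\<close> has exactly \<open>h - e + 1\<close> binary
  digits.\<close>

lemma node_at_unique:
  assumes "node_at h e j" "node_at h e' j"
  shows "e = e'"
proof -
  have *: "j div 2 ^ n = 1 \<Longrightarrow> m < n \<Longrightarrow> j div 2 ^ m \<noteq> 1" for m n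
  proof
    assume "j div 2 ^ n = 1" "m < n" "j div 2 ^ m = 1"
    moreover from \<open>m < n\<close> have "(2::nat) ^ n = 2 ^ m * 2 ^ (n - m)" by (simp flip: power_add)
    ultimately have "1 div 2 ^ (n - m) = (1::nat)" by (simp add: div_mult2_eq)
    moreover have "(1::nat) < 2 ^ (n - m)" using \<open>m < n\<close> by (intro one_less_power) auto
    ultimately show False by simp
  qed
  have "h - e = h - e'"
    using *[of "h - e" "h - e'"] *[of "h - e'" "h - e"] assms unfolding node_at_def
    by (metis linorder_neqE_nat)
  then show ?thesis using assms unfolding node_at_def by linarith
qed

text \<open>After a change at leaf \<open>i\<close> only the ancestors of that leaf are wrong. The climb repairs them one
  height at a time.\<close>

lemma wp_fix:
  assumes m: "nmem s ''m'' 0 = 2 ^ h" and i: "nmem s ''i'' 0 = i" "i < 2 ^ h"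
    and D: "D \<subseteq> {..<2 ^ h}" "B \<subseteq> {..<2 ^ h}"
    and other: "\<And>e j. node_at h e j \<Longrightarrow> (2 ^ h + i) div 2 ^ e \<noteq> j \<Longrightarrow>
      node_ok h (rmem s ''K'') (rmem s ''L'') (nmem s ''w'') (nmem s ''b'') D B e j"
    and leaf: "node_ok h (rmem s ''K'') (rmem s ''L'') (nmem s ''w'') (nmem s ''b'') D B 0 (2 ^ h + i)"
    and Q: "\<And>s' t'. \<lbrakk>t' \<le> t + 8 * h + 2; same_but {''j'', ''w'', ''b''} {} s s';
      trees h (rmem s ''K'') (rmem s ''L'') (nmem s' ''w'') (nmem s' ''b'') D B\<rbrakk> \<Longrightarrow> Q s' t'"
  shows "wp fix_prog Q s t"
proof -
  let ?K = "rmem s ''K''" let ?L = "rmem s ''L''"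
  \<comment> \<open>Eight steps per level: the test, the halving of \<open>j\<close>, and at most
    six for \<open>combine_prog\<close>.\<close>
  define I where "I n s' t' \<longleftrightarrow> (\<exists>e. n = h - e \<and> e \<le> h \<and> nmem s' ''j'' 0 = (2 ^ h + i) div 2 ^ e \<and>
      same_but {''j'', ''w'', ''b''} {} s s' \<and> t' \<le> t + 1 + 8 * e \<and>
      (\<forall>e' j. node_at h e' j \<longrightarrow> e' \<le> e \<or> (2 ^ h + i) div 2 ^ e' \<noteq> j \<longrightarrow>
        node_ok h ?K ?L (nmem s' ''w'') (nmem s' ''b'') D B e' j))" for n s' t'
  show ?thesis
    unfolding fix_prog_def wp_simps
  proof (rule wp_While[where I = I and n = h])
    show "I h (setn ''j'' (nval s (NConst 0)) (nval s (NAdd (nv ''m'') (nv ''i''))) s) (Suc t)"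
    proof -
      have "node_ok h ?K ?L (nmem s ''w'') (nmem s ''b'') D B e j"
        if "node_at h e j" "e \<le> 0 \<or> (2 ^ h + i) div 2 ^ e \<noteq> j" for e j
        using other[OF that(1)] leaf that(2) by (cases "(2 ^ h + i) div 2 ^ e = j") auto
      then show ?thesis
        unfolding I_def using m i by (intro exI[of _ 0]) (simp add: same_but_def)
    qed
  next
    fix n s' t'
    assume "I n s' t'" and test: "tval s' (NLess (NConst 1) (nv ''j''))"
    then obtain e where e: "n = h - e" "e \<le> h" "nmem s' ''j'' 0 = (2 ^ h + i) div 2 ^ e"
      and same: "same_but {''j'', ''w'', ''b''} {} s s'" and t': "t' \<le> t + 1 + 8 * e"
      and ok: "\<And>e' j. node_at h e' j \<Longrightarrow> e' \<le> e \<or> (2 ^ h + i) div 2 ^ e' \<noteq> j \<Longrightarrow>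
        node_ok h ?K ?L (nmem s' ''w'') (nmem s' ''b'') D B e' j"
      unfolding I_def by blast
    have eh: "e < h"
      using test e i ancestor_valid[of i h h] by (cases "e = h") auto
    define p where "p = (2 ^ h + i) div 2 ^ Suc e"
    have p: "nmem s' ''j'' 0 div 2 = p"
      by (simp add: p_def e div_mult2_eq mult.commute[of 2 "2 ^ e"])
    have pat: "node_at h (Suc e) p"
      using ancestor_valid[of i h "Suc e"] i eh by (simp add: node_at_def p_def)
    then have p0: "0 < p" by (cases p) (auto simp: node_at_def)
    have child: "node_at h e (2 * p)" "node_at h e (2 * p + 1)"
    proof -
      have "(2::nat) ^ (h - e) = 2 * 2 ^ (h - Suc e)" using eh by (simp flip: power_Suc add: Suc_diff_Suc)
      then show "node_at h e (2 * p)" "node_at h e (2 * p + 1)"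
        using pat eh by (auto simp: node_at_def div_mult2_eq)
    qed
    show "wp (Seq (nset ''j'' (NHalf (nv ''j''))) combine_prog) (\<lambda>s' t'. \<exists>n'<n. I n' s' t') s' (Suc t')"
      unfolding wp_simps
    proof (rule wp_combine)
      let ?s = "setn ''j'' (nval s' (NConst 0)) (nval s' (NHalf (nv ''j''))) s'"
      show "0 < nmem ?s ''j'' 0" using p p0 by simp
      fix s'' t''
      assume t'': "t'' \<le> Suc (Suc t') + 6" and same': "same_but {''w'', ''b''} {} ?s s''"
        and w: "nmem s'' ''w'' = (nmem ?s ''w'')(nmem ?s ''j'' 0 :=
           (let a = nmem ?s ''w'' (2 * nmem ?s ''j'' 0); c = nmem ?s ''w'' (2 * nmem ?s ''j'' 0 + 1) in
             if a = 0 then c else if c = 0 then a else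
             if rmem ?s ''K'' (c - 1) < rmem ?s ''K'' (a - 1) \<or>
               rmem ?s ''K'' (c - 1) = rmem ?s ''K'' (a - 1) \<and> rmem ?s ''L'' (c - 1) < rmem ?s ''L'' (a - 1)
             then c else a))"
        and b: "nmem s'' ''b'' = (nmem ?s ''b'')(nmem ?s ''j'' 0 :=
           (if nmem ?s ''b'' (2 * nmem ?s ''j'' 0 + 1) = 0 then nmem ?s ''b'' (2 * nmem ?s ''j'' 0)
            else nmem ?s ''b'' (2 * nmem ?s ''j'' 0 + 1)))"
      have jp: "nmem ?s ''j'' 0 = p" using p by simp
      have old: "rmem ?s ''K'' = ?K" "rmem ?s ''L'' = ?L" "nmem ?s ''w'' = nmem s' ''w''" "nmem ?s ''b'' = nmem s' ''b''"
        using same by (auto simp: same_but_def)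
      note w = w[unfolded jp old] and b = b[unfolded jp old]
      have j'': "nmem s'' ''j'' 0 = p" using same' p by (simp add: same_but_def)
      have w': "nmem s'' ''w'' x = nmem s' ''w'' x" "nmem s'' ''b'' x = nmem s' ''b'' x" if "x \<noteq> p" for x
        using w b that p by simp_all
      have okp: "node_ok h ?K ?L (nmem s'' ''w'') (nmem s'' ''b'') D B (Suc e) p"
        by (rule node_ok_parent[OF ok[OF child(1)] ok[OF child(2)]]) (simp_all only: w b fun_upd_same order_refl simp_thms)
      have ok': "node_ok h ?K ?L (nmem s'' ''w'') (nmem s'' ''b'') D B e' j"
        if "node_at h e' j" "e' \<le> Suc e \<or> (2 ^ h + i) div 2 ^ e' \<noteq> j" for e' j
      proof (cases "j = p")
        case True
        then have "e' = Suc e" using that(1) pat node_at_unique by blast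
        then show ?thesis using okp True by simp
      next
        case False
        have "e' \<le> e \<or> (2 ^ h + i) div 2 ^ e' \<noteq> j" using that(2) False p_def by (auto simp: le_Suc_eq)
        then show ?thesis using ok[OF that(1)] w'[OF False] by (simp add: node_ok_def)
      qed
      have "I (h - Suc e) s'' t''"
        unfolding I_def
        using eh j'' p_def same same' t' t'' ok' by (intro exI[of _ "Suc e"]) (auto simp: same_but_def)
      then show "\<exists>n'<n. I n' s'' t''" using e eh by (intro exI[of _ "h - Suc e"]) auto
    qed
  next
    fix n s' t'
    assume "I n s' t'" and test: "\<not> tval s' (NLess (NConst 1) (nv ''j''))"
    then obtain e where e: "n = h - e" "e \<le> h" "nmem s' ''j'' 0 = (2 ^ h + i) div 2 ^ e"
      and same: "same_but {''j'', ''w'', ''b''} {} s s'" and t': "t' \<le> t + 1 + 8 * e"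
      and ok: "\<And>e' j. node_at h e' j \<Longrightarrow> e' \<le> e \<or> (2 ^ h + i) div 2 ^ e' \<noteq> j \<Longrightarrow>
        node_ok h ?K ?L (nmem s' ''w'') (nmem s' ''b'') D B e' j"
      unfolding I_def by blast
    have "node_at h e (nmem s' ''j'' 0)" using e ancestor_valid i by (simp add: node_at_def)
    moreover have "nmem s' ''j'' 0 \<le> 1" using test by simp
    ultimately have "nmem s' ''j'' 0 = 1" by (cases "nmem s' ''j'' 0") (auto simp: node_at_def)
    then have "node_at h h 1" "node_at h e 1" using \<open>node_at h e (nmem s' ''j'' 0)\<close> by (auto simp: node_at_def)
    then have "e = h" using node_at_unique by blast
    then have "trees h ?K ?L (nmem s' ''w'') (nmem s' ''b'') D B"
      using ok D unfolding trees_def node_at_def by blast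
    then show "Q s' (Suc t')" using Q same t' \<open>e = h\<close> by simp
  qed
qed

lemma pick_cong:
  assumes "\<And>i t. i \<in> S \<Longrightarrow> t \<in> S \<Longrightarrow> R i t = R' i t"
  shows "pick R S v = pick R' S v"
  using assms unfolding pick_def by (metis (no_types, lifting))

text \<open>At a node that is no ancestor of leaf \<open>i\<close> neither the membership nor the
  key of \<open>i\<close> matters, so one climb repairs any change concerning \<open>i\<close>
  alone.\<close>

lemma wp_leaf_fix:
  assumes tr: "trees h K L w b D B"
    and m: "nmem s ''m'' 0 = 2 ^ h" and i: "nmem s ''i'' 0 = i" "i < 2 ^ h"
    and D': "D' - {i} = D - {i}" "B' - {i} = B - {i}"
    and K: "\<And>x. x \<noteq> i \<Longrightarrow> rmem s ''K'' x = K x" "\<And>x. x \<noteq> i \<Longrightarrow> rmem s ''L'' x = L x"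
    and w: "nmem s ''w'' = w(2 ^ h + i := (if i \<in> D' then Suc i else 0))"
    and b: "nmem s ''b'' = b(2 ^ h + i := (if i \<in> B' then Suc i else 0))"
    and Q: "\<And>s' t'. \<lbrakk>t' \<le> t + 8 * h + 2; same_but {''j'', ''w'', ''b''} {} s s';
      trees h (rmem s ''K'') (rmem s ''L'') (nmem s' ''w'') (nmem s' ''b'') D' B'\<rbrakk> \<Longrightarrow> Q s' t'"
  shows "wp fix_prog Q s t"
proof (rule wp_fix[OF m i])
  show "D' \<subseteq> {..<2 ^ h}" "B' \<subseteq> {..<2 ^ h}"
    using tr D' i unfolding trees_def by auto
  show "node_ok h (rmem s ''K'') (rmem s ''L'') (nmem s ''w'') (nmem s ''b'') D' B' 0 (2 ^ h + i)"
    by (auto simp: node_ok_def leaves_def pick_def w b lexle_def)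
  show "node_ok h (rmem s ''K'') (rmem s ''L'') (nmem s ''w'') (nmem s ''b'') D' B' e j"
    if at: "node_at h e j" and j: "(2 ^ h + i) div 2 ^ e \<noteq> j" for e j
  proof -
    have "j \<noteq> 2 ^ h + i"
    proof
      assume "j = 2 ^ h + i"
      then have "node_at h 0 j" using ancestor_valid[of i h 0] i by (simp add: node_at_def)
      then have "e = 0" using at node_at_unique by blast
      then show False using j \<open>j = 2 ^ h + i\<close> by simp
    qed
    then have wb: "nmem s ''w'' j = w j" "nmem s ''b'' j = b j" by (simp_all add: w b)
    have lv: "leaves h D' e j = leaves h D e j" "leaves h B' e j = leaves h B e j" "i \<notin> leaves h D e j"
      using D' j unfolding leaves_def by blast+
    have "pick (lexle (rmem s ''K'') (rmem s ''L'')) (leaves h D e j) v = pick (lexle K L) (leaves h D e j) v" for v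
    proof (rule pick_cong)
      fix x y assume "x \<in> leaves h D e j" "y \<in> leaves h D e j"
      then have "x \<noteq> i" "y \<noteq> i" using lv(3) by auto
      then show "lexle (rmem s ''K'') (rmem s ''L'') x y = lexle K L x y" using K by (simp add: lexle_def)
    qed
    moreover have "node_ok h K L w b D B e j"
      using tr at unfolding trees_def node_at_def by blast
    ultimately show ?thesis by (simp add: node_ok_def lv wb)
  qed
qed (rule Q)

section \<open>Search for the cyclic predecessor\<close>

text \<open>Climbs from the leaf of \<open>s\<close>. Whenever the current node is a right child,
  which has an odd number, its left sibling covers the slots just before those seen so far, and the
  maximum there, if any, is the predecessor. If nothing is found, no smaller slot is occupied and
  the overall maximum is taken.\<close>

definition pred_prog :: prog where
  "pred_prog = Seq (nset ''j'' (NAdd (nv ''m'') (nv ''s''))) (Seq (nset ''u'' (NConst 0))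
     (Seq (While (TAnd (NLess (NConst 1) (nv ''j'')) (NEq (nv ''u'') (NConst 0)))
        (Seq (Cond (NEq (nv ''j'') (NAdd (NHalf (nv ''j'')) (NHalf (nv ''j'')))) Skip
           (nset ''u'' (NGet ''b'' (NSub (nv ''j'') (NConst 1)))))
         (nset ''j'' (NHalf (nv ''j'')))))
      (Cond (NEq (nv ''u'') (NConst 0)) (nset ''u'' (NGet ''b'' (NConst 1))) Skip)))"

definition cyclic_pred :: "nat set \<Rightarrow> nat \<Rightarrow> nat \<Rightarrow> bool" where
  "cyclic_pred B s u \<longleftrightarrow> u \<in> B \<and>
     (if \<exists>t\<in>B. t < s then u < s \<and> (\<forall>t\<in>B. t < s \<longrightarrow> t \<le> u) else \<forall>t\<in>B. t \<le> u)"

lemma half_less_even: "a < j \<Longrightarrow> even j \<Longrightarrow> a div 2 < j div 2" for a j :: nat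
  by presburger

lemma half_less_odd: "a < j \<Longrightarrow> a \<noteq> j - 1 \<Longrightarrow> odd j \<Longrightarrow> a div 2 < j div 2" for a j :: nat
  by presburger

lemma wp_pred:
  assumes tr: "trees h K L (nmem s ''w'') (nmem s ''b'') D B"
    and m: "nmem s ''m'' 0 = 2 ^ h" and i: "nmem s ''s'' 0 = i" "i < 2 ^ h"
    and Q: "\<And>s' t'. \<lbrakk>t' \<le> t + 4 * h + 8; same_but {''j'', ''u''} {} s s';
      (B = {} \<and> nmem s' ''u'' 0 = 0) \<or> (\<exists>u. nmem s' ''u'' 0 = Suc u \<and> cyclic_pred B i u)\<rbrakk> \<Longrightarrow> Q s' t'"
  shows "wp pred_prog Q s t"
proof -
  let ?a = "\<lambda>x e. (2 ^ h + x) div 2 ^ e :: nat"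
  \<comment> \<open>While \<open>u\<close> is 0, all occupied slots before \<open>i\<close> lie
    strictly to the left of the subtree of \<open>j\<close>.\<close>
  define I where "I n s' t' \<longleftrightarrow> (\<exists>e. n = h - e \<and> e \<le> h \<and> nmem s' ''j'' 0 = ?a i e \<and>
      same_but {''j'', ''u''} {} s s' \<and> t' \<le> t + 2 + 4 * e \<and>
      ((nmem s' ''u'' 0 = 0 \<and> (\<forall>t\<in>B. t < i \<longrightarrow> ?a t e < ?a i e)) \<or>
       (\<exists>u\<in>B. nmem s' ''u'' 0 = Suc u \<and> u < i \<and> (\<forall>t\<in>B. t < i \<longrightarrow> t \<le> u))))" for n s' t'
  have Bh: "B \<subseteq> {..<2 ^ h}" using tr by (simp add: trees_def)
  show ?thesis
    unfolding pred_prog_def wp_Seq wp_NSet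
  proof (rule wp_While[where I = I and n = h])
    show "I h (setn ''u'' (nval (setn ''j'' (nval s (NConst 0)) (nval s (NAdd (nv ''m'') (nv ''s''))) s) (NConst 0))
        (nval (setn ''j'' (nval s (NConst 0)) (nval s (NAdd (nv ''m'') (nv ''s''))) s) (NConst 0))
        (setn ''j'' (nval s (NConst 0)) (nval s (NAdd (nv ''m'') (nv ''s''))) s)) (Suc (Suc t))"
      unfolding I_def using m i
      by (intro exI[of _ 0]) (auto simp: same_but_def)
  next
    fix n s' t'
    assume "I n s' t'" and test: "tval s' (TAnd (NLess (NConst 1) (nv ''j'')) (NEq (nv ''u'') (NConst 0)))"
    then obtain e where e: "n = h - e" "e \<le> h" "nmem s' ''j'' 0 = ?a i e"
      and same: "same_but {''j'', ''u''} {} s s'" and t': "t' \<le> t + 2 + 4 * e"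
      and lt: "\<And>t. t \<in> B \<Longrightarrow> t < i \<Longrightarrow> ?a t e < ?a i e"
      unfolding I_def by auto
    have eh: "e < h"
      using test e i ancestor_valid[of i h h] by (cases "e = h") auto
    have sc: "?a x (Suc e) = ?a x e div 2" for x
      by (simp add: div_mult2_eq mult.commute[of 2 "2 ^ e"])
    have b: "nmem s' ''b'' = nmem s ''b''" using same by (simp add: same_but_def)
    define j where "j = ?a i e"
    have j1: "1 < j" using test e by (simp add: j_def)
    have ej: "nmem s' ''j'' 0 = j" using e by (simp add: j_def)
    have less: "h - Suc e < n" using e(1) eh by simp
    have intro: "I (h - Suc e) s'' t''"
      if "nmem s'' ''j'' 0 = j div 2" "same_but {''j'', ''u''} {} s s''" "t'' \<le> t + 2 + 4 * Suc e"
        "(nmem s'' ''u'' 0 = 0 \<and> (\<forall>t\<in>B. t < i \<longrightarrow> ?a t (Suc e) < ?a i (Suc e))) \<or>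
         (\<exists>u\<in>B. nmem s'' ''u'' 0 = Suc u \<and> u < i \<and> (\<forall>t\<in>B. t < i \<longrightarrow> t \<le> u))" for s'' t''
      unfolding I_def
    proof (intro exI conjI)
      show "nmem s'' ''j'' 0 = ?a i (Suc e)" using that(1) by (simp only: sc j_def)
      show "Suc e \<le> h" using eh by simp
    qed (rule refl that)+
    have u0: "nmem s' ''u'' 0 = 0" using test by simp
    show "wp (Seq (Cond (NEq (nv ''j'') (NAdd (NHalf (nv ''j'')) (NHalf (nv ''j'')))) Skip
           (nset ''u'' (NGet ''b'' (NSub (nv ''j'') (NConst 1))))) (nset ''j'' (NHalf (nv ''j''))))
         (\<lambda>s' t'. \<exists>n'<n. I n' s' t') s' (Suc t')"
    proof (cases "even j")
      case True
      then have half: "j div 2 + j div 2 = j" by presburger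
      have "?a t (Suc e) < ?a i (Suc e)" if "t \<in> B" "t < i" for t
        using lt[OF that] True unfolding sc j_def[symmetric] by (rule half_less_even)
      then have "I (h - Suc e) (setn ''j'' 0 (j div 2) s') (Suc (Suc (Suc (Suc t'))))"
        using u0 same t' by (intro intro) (auto simp: same_but_def)
      then show ?thesis
        unfolding wp_simps using half ej less by auto
    next
      case False
      then have odd: "odd j" and half: "j div 2 + j div 2 \<noteq> j" by presburger+
      define v where "v = nmem s ''b'' (j - 1)"
      have "node_at h e (j - 1)"
      proof -
        have "(2::nat) ^ (h - e) = 2 * 2 ^ (h - Suc e)" using eh by (simp flip: power_Suc add: Suc_diff_Suc)
        moreover have "(j - 1) div 2 = j div 2" using False by presburger
        ultimately have "(j - 1) div 2 ^ (h - e) = j div 2 ^ (h - e)" by (simp add: div_mult2_eq)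
        then show ?thesis using ancestor_valid[OF i(2) e(2)] e(2) by (simp add: node_at_def j_def)
      qed
      then have v: "pick (\<ge>) (leaves h B e (j - 1)) v"
        using tr unfolding trees_def node_at_def node_ok_def v_def by blast
      have "I (h - Suc e) (setn ''j'' 0 (j div 2) (setn ''u'' 0 v s')) (Suc (Suc (Suc (Suc t'))))"
      proof (cases "v = 0")
        case True
        then have none: "?a t e \<noteq> j - 1" if "t \<in> B" for t
          using v that by (auto simp: pick_def leaves_def)
        have "?a t (Suc e) < ?a i (Suc e)" if "t \<in> B" "t < i" for t
          using lt[OF that] none[OF that(1)] odd unfolding sc j_def[symmetric] by (rule half_less_odd)
        then show ?thesis
          using True same t' by (intro intro) (auto simp: same_but_def)
      next
        case False
        then obtain u where u: "v = Suc u" "u \<in> B" "?a u e = j - 1"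
          "\<And>t. t \<in> B \<Longrightarrow> ?a t e = j - 1 \<Longrightarrow> t \<le> u"
          using v by (auto simp: pick_def leaves_def)
        have "u < i"
        proof (rule ccontr)
          assume "\<not> u < i"
          then have "?a i e \<le> ?a u e" by (intro div_le_mono) simp
          then show False using u(3) j1 by (simp add: j_def[symmetric])
        qed
        moreover have "t \<le> u" if t: "t \<in> B" "t < i" for t
        proof (cases "?a t e = j - 1")
          case True then show ?thesis using u(4) t by blast
        next
          case False
          then have "?a t e < ?a u e" using lt[OF t] u(3) by (simp add: j_def[symmetric])
          then show ?thesis using div_le_mono[of "2 ^ h + u" "2 ^ h + t" "2 ^ e"] by linarith
        qed
        ultimately show ?thesis
          using same t' u(1,2) by (intro intro) (auto simp: same_but_def)
      qed
      then show ?thesis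
        unfolding wp_simps using half ej less by (auto simp: v_def b)
    qed
  next
    fix n s' t'
    assume "I n s' t'" and test: "\<not> tval s' (TAnd (NLess (NConst 1) (nv ''j'')) (NEq (nv ''u'') (NConst 0)))"
    then obtain e where e: "e \<le> h" "nmem s' ''j'' 0 = ?a i e"
      and same: "same_but {''j'', ''u''} {} s s'" and t': "t' \<le> t + 2 + 4 * e"
      and alt: "(nmem s' ''u'' 0 = 0 \<and> (\<forall>t\<in>B. t < i \<longrightarrow> ?a t e < ?a i e)) \<or>
       (\<exists>u\<in>B. nmem s' ''u'' 0 = Suc u \<and> u < i \<and> (\<forall>t\<in>B. t < i \<longrightarrow> t \<le> u))"
      unfolding I_def by blast
    have b: "nmem s' ''b'' 1 = nmem s ''b'' 1" using same by (simp add: same_but_def)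
    show "wp (Cond (NEq (nv ''u'') (NConst 0)) (nset ''u'' (NGet ''b'' (NConst 1))) Skip) Q s' (Suc t')"
    proof (cases "nmem s' ''u'' 0 = 0")
      case False
      then obtain u where u: "u \<in> B" "nmem s' ''u'' 0 = Suc u" "u < i" "\<forall>t\<in>B. t < i \<longrightarrow> t \<le> u"
        using alt by auto
      then have "cyclic_pred B i u" by (auto simp: cyclic_pred_def)
      then show ?thesis unfolding wp_simps using u(2) same t' e(1) by (auto intro!: Q)
    next
      case True
      then have lt: "?a t e < ?a i e" if "t \<in> B" "t < i" for t using alt that by auto
      have "?a i e \<le> 1" using test True e by simp
      \<comment> \<open>A leaf strictly to the left of the root would have ancestor 0, but ancestors
        of leaves up to height \<open>h\<close> are positive.\<close>
      have none: "\<not> t < i" if "t \<in> B" for t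
      proof
        assume "t < i"
        then have "?a t e = 0" using lt[OF that] \<open>?a i e \<le> 1\<close> by simp
        moreover have "?a t e div 2 ^ (h - e) = 1" using ancestor_valid[of t h e] that Bh e by auto
        ultimately show False by simp
      qed
      have r: "pick (\<ge>) B (nmem s ''b'' 1)" using trees_root(2)[OF tr] .
      define s'' where "s'' = setn ''u'' 0 (nmem s ''b'' 1) s'"
      have "Q s'' (Suc (Suc (Suc t')))"
      proof (rule Q)
        show "same_but {''j'', ''u''} {} s s''" using same by (simp add: same_but_def s''_def)
        show "(B = {} \<and> nmem s'' ''u'' 0 = 0) \<or> (\<exists>u. nmem s'' ''u'' 0 = Suc u \<and> cyclic_pred B i u)"
          using r none by (auto simp: pick_def s''_def cyclic_pred_def)
      qed (use t' e in simp)
      then show ?thesis unfolding wp_simps using True b by (simp add: s''_def)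
    qed
  qed
qed

section \<open>The cyclic list of active nodes and the output table\<close>

text \<open>\<open>cdist k i i\<close> is \<open>k\<close>, the way once around, and not 0. Every
  other element is nearer to \<open>i\<close> than \<open>i\<close> itself, so only a sole element
  is its own successor.\<close>

definition cdist :: "nat \<Rightarrow> nat \<Rightarrow> nat \<Rightarrow> nat" where
  "cdist k i j = (if i < j then j - i else j + k - i)"

definition links :: "nat \<Rightarrow> (nat \<Rightarrow> nat) \<Rightarrow> (nat \<Rightarrow> nat) \<Rightarrow> nat set \<Rightarrow> bool" where
  "links k nx pv B \<longleftrightarrow> B \<subseteq> {..<k} \<and> (\<forall>i\<in>B. nx i \<in> B \<and> pv i \<in> B \<and> nx (pv i) = i \<and> pv (nx i) = i \<and>
     (\<forall>j\<in>B. cdist k i (nx i) \<le> cdist k i j))"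

lemma linksD:
  assumes "links k nx pv B" "i \<in> B"
  shows "i < k" "nx i \<in> B" "pv i \<in> B" "nx (pv i) = i" "pv (nx i) = i"
    "\<And>j. j \<in> B \<Longrightarrow> cdist k i (nx i) \<le> cdist k i j"
  using assms unfolding links_def by auto

lemma cdist_less: "i < k \<Longrightarrow> j < k \<Longrightarrow> i \<noteq> j \<Longrightarrow> cdist k i j < k"
  by (auto simp: cdist_def)

lemma cdist_diff:
  assumes "i < k" "j < k" "l < k" "cdist k i l < cdist k i j"
  shows "cdist k l j + cdist k i l = cdist k i j"
  using assms unfolding cdist_def by (auto split: if_splits)

lemma cdist_inj: "i < k \<Longrightarrow> j < k \<Longrightarrow> l < k \<Longrightarrow> cdist k i j = cdist k i l \<Longrightarrow> j = l"
  unfolding cdist_def by (auto split: if_splits)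

lemma links_self_iff:
  assumes "links k nx pv B" "i \<in> B"
  shows "nx i = i \<longleftrightarrow> B = {i}"
proof
  assume eq: "nx i = i"
  have "j = i" if "j \<in> B" for j
    using linksD(6)[OF assms that] linksD(1)[OF assms(1) that] linksD(1)[OF assms] cdist_less[of i k j]
    by (auto simp: eq cdist_def split: if_splits)
  then show "B = {i}" using assms(2) by blast
qed (use linksD(2)[OF assms] in auto)

lemma links_single: "s < k \<Longrightarrow> nx s = s \<Longrightarrow> pv s = s \<Longrightarrow> links k nx pv {s}"
  by (simp add: links_def)

lemma cyclic_pred_cdist:
  assumes "cyclic_pred B s u" "s < k" "s \<notin> B" "B \<subseteq> {..<k}" "i \<in> B" "i \<noteq> u"
  shows "cdist k u s < cdist k u i" "cdist k u s < cdist k i s"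
proof -
  have u: "u \<in> B" "u < k" "i < k" "i \<noteq> s" "u \<noteq> s" using assms unfolding cyclic_pred_def by auto
  have "cdist k u s < cdist k u i \<and> cdist k u s < cdist k i s"
  proof (cases "\<exists>t\<in>B. t < s")
    case True
    then have "u < s" "i < s \<Longrightarrow> i \<le> u" using assms unfolding cyclic_pred_def by auto
    then show ?thesis using u assms(2,6) by (cases "i < s") (auto simp: cdist_def)
  next
    case False
    then have "i \<le> u" "\<not> u < s" "\<not> i < s" using assms u unfolding cyclic_pred_def by auto
    then show ?thesis using u assms(2,6) by (auto simp: cdist_def)
  qed
  then show "cdist k u s < cdist k u i" "cdist k u s < cdist k i s" by auto
qed

lemma links_insert:
  assumes ln: "links k nx pv B" and s: "s < k" "s \<notin> B" and u: "cyclic_pred B s u" and v: "v = nx u"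
    and nx': "\<And>i. nx' i = (if i = s then v else if i = u then s else nx i)"
    and pv': "\<And>i. pv' i = (if i = v then s else if i = s then u else pv i)"
  shows "links k nx' pv' (insert s B)"
proof -
  have B: "B \<subseteq> {..<k}" using ln by (simp add: links_def)
  have uB: "u \<in> B" "u < k" "u \<noteq> s" using u s B by (auto simp: cyclic_pred_def)
  note U = linksD[OF ln uB(1), folded v]
  have vB: "v \<in> B" "v \<noteq> s" "v < k" using U(2) s B by auto
  have "nx' i \<in> insert s B \<and> pv' i \<in> insert s B \<and> nx' (pv' i) = i \<and> pv' (nx' i) = i \<and>
     (\<forall>j\<in>insert s B. cdist k i (nx' i) \<le> cdist k i j)" if i: "i \<in> insert s B" for i
  proof -
    consider "i = s" | "i = u" | "i \<in> B" "i \<noteq> u" "i \<noteq> s" using i by blast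
    then show ?thesis
    proof cases
      case 1
      have "cdist k s v \<le> cdist k s j" if j: "j \<in> insert s B" for j
      proof (cases "j = s")
        case True then show ?thesis using cdist_less[of s k v] s vB by (auto simp: cdist_def)
      next
        case False
        have d: "cdist k u s < cdist k u l" if "l \<in> B" for l
        proof (cases "l = u")
          case True then show ?thesis using cdist_less[OF uB(2) s(1) uB(3)] by (simp add: cdist_def)
        qed (use cyclic_pred_cdist(1)[OF u s B that] in simp)
        have "j \<in> B" "j < k" using False j B by auto
        then show ?thesis
          using cdist_diff[OF uB(2) _ s(1) d, of v] cdist_diff[OF uB(2) _ s(1) d, of j] U(6)[of j] vB by linarith
      qed
      then show ?thesis using 1 uB vB by (auto simp: nx' pv')
    next
      case 2
      have "cdist k u s \<le> cdist k u j" if j: "j \<in> insert s B" for j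
        using j cyclic_pred_cdist(1)[OF u s B, of j] cdist_less[OF uB(2) s(1) uB(3)]
        by (cases "j = u") (auto simp: cdist_def)
      moreover have "nx' (pv' u) = u"
      proof (cases "u = v")
        case True then show ?thesis using uB by (simp add: nx' pv')
      next
        case False
        have "pv u \<noteq> u" using U(4) False v by auto
        moreover have "pv u \<noteq> s" using U(3) s by auto
        ultimately show ?thesis using False uB U(4) by (simp add: nx' pv')
      qed
      moreover have "pv' u \<in> insert s B" using U(3) by (simp add: pv')
      moreover have "nx' u = s" "pv' s = u" using uB vB by (simp_all add: nx' pv')
      ultimately show ?thesis using 2 by simp
    next
      case 3
      note I = linksD[OF ln 3(1)]
      have "cdist k u s < cdist k i s" using cyclic_pred_cdist(2)[OF u s B 3(1,2)] .
      \<comment> \<open>Going around from \<open>i\<close>, the predecessor \<open>u\<close> of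
        \<open>s\<close> is met before \<open>s\<close>, so inserting \<open>s\<close> does not
        change the successor of \<open>i\<close>.\<close>
      have lt: "cdist k i u < cdist k i s"
        using cyclic_pred_cdist[OF u s B 3(1,2)] 3 I(1) uB s
        unfolding cdist_def by (auto split: if_splits)
      then have "cdist k i (nx i) \<le> cdist k i s" using I(6)[OF uB(1)] by simp
      moreover have "nx i \<noteq> v" using 3(2) U(5) I(5) by auto
      moreover have "nx i \<noteq> s" "pv i \<noteq> s" "pv i \<noteq> u \<or> i = v" using I s v by auto
      moreover have "nx' (pv' i) = i"
      proof (cases "i = v")
        case True then show ?thesis using vB by (simp add: nx' pv')
      next
        case False
        then have "pv i \<noteq> u" using I(4) v by auto
        then show ?thesis using False 3 I \<open>pv i \<noteq> s\<close> by (simp add: nx' pv')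
      qed
      ultimately show ?thesis using 3 I s by (auto simp: nx' pv')
    qed
  qed
  then show ?thesis using B s unfolding links_def by auto
qed

lemma links_delete:
  assumes ln: "links k nx pv B" and u: "u \<in> B" and v: "v = nx u" "v \<noteq> u" and p: "p = pv u"
    and nx': "\<And>i. nx' i = (if i = p then v else nx i)"
    and pv': "\<And>i. pv' i = (if i = v then p else pv i)"
  shows "links k nx' pv' (B - {u})"
proof -
  have B: "B \<subseteq> {..<k}" using ln by (simp add: links_def)
  note U = linksD[OF ln u, folded v(1) p]
  have pu: "p \<noteq> u" using U v by auto
  have pk: "p < k" "v < k" using U B by auto
  note P = linksD[OF ln U(3), unfolded U(4)]
  have "nx' i \<in> B - {u} \<and> pv' i \<in> B - {u} \<and> nx' (pv' i) = i \<and> pv' (nx' i) = i \<and>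
     (\<forall>j\<in>B - {u}. cdist k i (nx' i) \<le> cdist k i j)" if i: "i \<in> B - {u}" for i
  proof (cases "i = p")
    case True
    have "cdist k p v \<le> cdist k p j" if j: "j \<in> B - {u}" for j
    proof -
      have jk: "j < k" using j B by auto
      have lt: "cdist k p u < cdist k p l" if "l \<in> B - {u}" "l < k" for l
        using P(6)[of l] cdist_inj[OF pk(1) U(1) that(2)] that(1) by force
      show ?thesis
        using cdist_diff[OF pk(1) _ U(1) lt, of v] cdist_diff[OF pk(1) _ U(1) lt, of j] U(6)[of j] U(2) v(2) pk jk j
        by auto
    qed
    moreover have "nx' (pv' p) = p"
    proof (cases "p = v")
      case False
      have "pv p \<noteq> p" using U(4) linksD(4)[OF ln U(3)] pu by metis
      then show ?thesis using False linksD(4)[OF ln U(3)] by (simp add: nx' pv')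
    qed (simp add: nx' pv')
    moreover have "pv' p \<in> B - {u}"
    proof (cases "p = v")
      case False
      have "pv p \<noteq> u" using linksD(4)[OF ln U(3)] v False by metis
      then show ?thesis using False linksD(3)[OF ln U(3)] by (simp add: pv')
    qed (use U pu in \<open>simp add: pv'\<close>)
    ultimately show ?thesis using True U v by (simp add: nx' pv')
  next
    case False
    then have iB: "i \<in> B" "i \<noteq> u" using i by auto
    note I = linksD[OF ln iB(1)]
    have "nx i \<noteq> u" using I(5) p False by metis
    moreover have "nx i \<noteq> v" using I(5) U(5) iB by metis
    moreover have "pv' i \<in> B - {u} \<and> nx' (pv' i) = i"
    proof (cases "i = v")
      case True then show ?thesis using U pu by (simp add: nx' pv')
    next
      case False
      then have "pv i \<noteq> u" using I(4) v by metis
      moreover have "pv i \<noteq> p" using I(4) U(4) iB by metis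
      ultimately show ?thesis using False I by (simp add: nx' pv')
    qed
    ultimately show ?thesis using False I by (simp add: nx' pv')
  qed
  then show ?thesis using B unfolding links_def by auto
qed

context spiral_geometry
begin

lemma gap_mono:
  assumes sl: "slots k A X0" and "i < k" "j < k" "l < k" "l \<noteq> i" "j \<noteq> i" "cdist k i l \<le> cdist k i j"
  shows "gap A i l \<le> gap A i j"
proof -
  have "A l < 2 * pi" "0 \<le> A j" using sl assms unfolding slots_def by auto
  then show ?thesis
    using slots_mono[OF sl, of l j] assms(2-)
    unfolding gap_def cdist_def by (auto split: if_splits)
qed

text \<open>The turn from \<open>i\<close> does not decrease along the cyclic order of slots, so
  \<open>i\<close> meets no other node earlier than its successor. The least meeting time over
  neighbours is thus the least over all pairs.\<close>

lemma meet_next_le: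
  assumes "slots k A X0" "links k nx pv B" "i \<in> B" "j \<in> B" "i \<noteq> j"
  shows "nx i \<noteq> i" "meet A X i (nx i) \<le> meet A X i j"
proof -
  show ni: "nx i \<noteq> i" using links_self_iff[OF assms(2,3)] assms by auto
  have "gap A i (nx i) \<le> gap A i j"
    using gap_mono[OF assms(1), of i j "nx i"] ni linksD[OF assms(2,3)] linksD(1)[OF assms(2)] assms by auto
  then show "meet A X i (nx i) \<le> meet A X i j"
    using tau_pos by (simp add: meet_def divide_right_mono)
qed

section \<open>The table of output nodes\<close>

text \<open>\<open>P\<close>, \<open>par\<close> and \<open>arcs\<close> stand for the output
  arrays, and \<open>nd\<close> gives the output number of the node in an active slot. Terminals
  still inside the circle need no number yet, and \<open>r\<close> is left out until the end even
  when it is a terminal.\<close>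

definition table :: "nat \<Rightarrow> (nat \<Rightarrow> complex) \<Rightarrow> (nat \<Rightarrow> nat) \<Rightarrow> (nat \<Rightarrow> nat) \<Rightarrow> (nat \<Rightarrow> arc) \<Rightarrow>
    (nat \<Rightarrow> complex) \<Rightarrow> nat set \<Rightarrow> nat set \<Rightarrow> forest \<Rightarrow> bool" where
  "table N P nd par arcs S Act Fut F \<longleftrightarrow>
     inj_on P {..<N} \<and> (\<forall>j<N. P j \<noteq> r) \<and> (\<forall>i\<in>Act. nd i < N \<and> P (nd i) = S i) \<and>
     nodes F - {r} = P ` {..<N} \<union> S ` Fut \<and>
     (\<forall>j<N. if j \<in> nd ` Act then up F (P j) = None
        else par j < N \<and> up F (P j) = Some (P (par j), arcs j))"

lemma tableD:
  assumes "table N P nd par arcs S Act Fut F"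
  shows "inj_on P {..<N}" "\<And>j. j < N \<Longrightarrow> P j \<noteq> r" "\<And>i. i \<in> Act \<Longrightarrow> nd i < N"
    "\<And>i. i \<in> Act \<Longrightarrow> P (nd i) = S i" "nodes F - {r} = P ` {..<N} \<union> S ` Fut"
    "\<And>j. j < N \<Longrightarrow> j \<in> nd ` Act \<Longrightarrow> up F (P j) = None"
    "\<And>j. j < N \<Longrightarrow> j \<notin> nd ` Act \<Longrightarrow> par j < N" 
    "\<And>j. j < N \<Longrightarrow> j \<notin> nd ` Act \<Longrightarrow> up F (P j) = Some (P (par j), arcs j)"
proof -
  note * = assms[unfolded table_def]
  show "inj_on P {..<N}" "\<And>j. j < N \<Longrightarrow> P j \<noteq> r" "\<And>i. i \<in> Act \<Longrightarrow> nd i < N"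
    "\<And>i. i \<in> Act \<Longrightarrow> P (nd i) = S i" "nodes F - {r} = P ` {..<N} \<union> S ` Fut" using * by simp_all
  fix j assume j: "j < N"
  have c: "if j \<in> nd ` Act then up F (P j) = None
        else par j < N \<and> up F (P j) = Some (P (par j), arcs j)" using * j by blast
  show "j \<in> nd ` Act \<Longrightarrow> up F (P j) = None" using c by (simp only: if_True)
  show "j \<notin> nd ` Act \<Longrightarrow> par j < N" using c by (simp only: if_False)
  show "j \<notin> nd ` Act \<Longrightarrow> up F (P j) = Some (P (par j), arcs j)" using c by (simp only: if_False)
qed

lemma tableI:
  assumes "inj_on P {..<N}" "\<And>j. j < N \<Longrightarrow> P j \<noteq> r" "\<And>i. i \<in> Act \<Longrightarrow> nd i < N \<and> P (nd i) = S i"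
    "nodes F - {r} = P ` {..<N} \<union> S ` Fut"
    "\<And>j. j < N \<Longrightarrow> j \<in> nd ` Act \<Longrightarrow> up F (P j) = None"
    "\<And>j. j < N \<Longrightarrow> j \<notin> nd ` Act \<Longrightarrow> par j < N \<and> up F (P j) = Some (P (par j), arcs j)"
  shows "table N P nd par arcs S Act Fut F"
  using assms unfolding table_def by auto

text \<open>Numbered nodes without a parent are those in active slots, so a numbered
  \<open>p\<close> would have to be one of them.\<close>

lemma table_not_active:
  assumes "table N P nd par arcs S Act Fut F" "up F p = None" "p \<notin> S ` Act"
  shows "p \<notin> P ` {..<N}"
proof
  assume "p \<in> P ` {..<N}"
  then obtain j where j: "j < N" "p = P j" by auto
  note T = tableD[OF assms(1)]
  have "j \<in> nd ` Act" using T(8)[OF j(1)] assms(2) j(2) by auto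
  then show False using T(4) assms(3) j(2) by force
qed

lemma table_insert:
  assumes tb: "table N P nd par arcs S Act Fut F" and s: "s \<in> Fut" "s \<notin> Act"
    and none: "up F (S s) = None" and sr: "S s \<noteq> r" and new: "S s \<notin> S ` Act"
    and P': "\<And>j. j < N \<Longrightarrow> P' j = P j" "P' N = S s"
    and arcs': "\<And>j. j < N \<Longrightarrow> arcs' j = arcs j"
    and nd': "\<And>i. nd' i = (if i = s then N else nd i)"
  shows "table (Suc N) P' nd' par arcs' S (insert s Act) (Fut - {s}) F"
proof -
  note T = tableD[OF tb]
  have notin: "S s \<notin> P ` {..<N}" using table_not_active[OF tb none new] .
  have imP: "P' ` {..<N} = P ` {..<N}" using P' by (auto intro!: image_cong)
  have im: "nd' ` insert s Act = insert N (nd ` Act)"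
  proof -
    have "nd' ` Act = nd ` Act" using s nd' by (intro image_cong) auto
    moreover have "nd' s = N" using nd' by simp
    ultimately show ?thesis by (simp only: image_insert)
  qed
  show ?thesis
  proof (rule tableI)
    have "inj_on P' {..<N}" using T(1) P'(1) by (simp add: inj_on_def)
    moreover have "P' N \<notin> P' ` ({..<N} - {N})" using notin imP P'(2) by auto
    ultimately show "inj_on P' {..<Suc N}" by (simp only: lessThan_Suc inj_on_insert simp_thms)
    have "S ` Fut = insert (S s) (S ` (Fut - {s}))" using s by blast
    then show "nodes F - {r} = P' ` {..<Suc N} \<union> S ` (Fut - {s})"
      using T(5) imP P'(2) unfolding lessThan_Suc by simp
    fix j assume j: "j < Suc N"
    show "P' j \<noteq> r" using T(2) P' sr j by (cases "j = N") auto
    show "up F (P' j) = None" if "j \<in> nd' ` insert s Act"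
      using that T(6)[of j] P' none j unfolding im by (cases "j = N") auto
    show "par j < Suc N \<and> up F (P' j) = Some (P' (par j), arcs' j)" if "j \<notin> nd' ` insert s Act"
    proof -
      have jN: "j < N" "j \<notin> nd ` Act" using that j unfolding im by auto
      then show ?thesis using T(7,8)[OF jN] P'(1) arcs' by simp
    qed
  next
    fix i assume "i \<in> insert s Act"
    then show "nd' i < Suc N \<and> P' (nd' i) = S i"
      using T(3,4)[of i] P' s by (cases "i = s") (auto simp: nd' less_Suc_eq)
  qed
qed

lemma table_drop:
  assumes tb: "table N P nd par arcs S Act Fut F" and j: "j \<in> Act" "S j = S s"
  shows "table N P nd par arcs S Act (Fut - {s}) F"
proof -
  note T = tableD[OF tb]
  have "S s \<in> P ` {..<N}" using T(3,4)[OF j(1)] j(2) by (metis image_eqI lessThan_iff)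
  then have "P ` {..<N} \<union> S ` Fut = P ` {..<N} \<union> S ` (Fut - {s})" by auto
  then show ?thesis using T by (intro tableI) auto
qed

lemma table_join_old:
  assumes tb: "table N P nd par arcs S Act Fut F" and uv: "u \<in> Act" "v \<in> Act" "S u \<noteq> S v"
    and inj: "inj_on S Act"
    and par': "\<And>j. par' j = (if j = nd u then nd v else par j)"
    and arcs': "\<And>j. j < N \<Longrightarrow> j \<noteq> nd u \<Longrightarrow> arcs' j = arcs j" and a: "a (S u) = arcs' (nd u)"
  shows "table N P nd par' arcs' S (Act - {u}) Fut (connect {S u, S v} (S v) a F)"
proof -
  note T = tableD[OF tb]
  have ndinj: "inj_on nd Act"
    using inj T(4) unfolding inj_on_def by metis
  then have im: "nd ` (Act - {u}) = nd ` Act - {nd u}" using uv by (auto simp: inj_on_def)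
  have vF: "S v \<in> nodes F" using T(3,4)[OF uv(2)] T(5) by (metis DiffD1 UnI1 image_eqI lessThan_iff)
  have Pj: "P j = S u \<longleftrightarrow> j = nd u" if "j < N" for j
    using T(1) T(3,4)[OF uv(1)] that by (auto simp: inj_on_def)
  show ?thesis
  proof (rule tableI)
    show "nodes (connect {S u, S v} (S v) a F) - {r} = P ` {..<N} \<union> S ` Fut"
      using T(5) vF by (simp add: insert_absorb)
    fix j assume j: "j < N"
    show "up (connect {S u, S v} (S v) a F) (P j) = None" if "j \<in> nd ` (Act - {u})"
      using that T(6)[OF j] Pj[OF j] unfolding im by auto
    show "par' j < N \<and> up (connect {S u, S v} (S v) a F) (P j) = Some (P (par' j), arcs' j)"
      if "j \<notin> nd ` (Act - {u})"
    proof (cases "j = nd u")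
      case True
      then show ?thesis using T(3,4) uv par' a by auto
    next
      case False
      then have "j \<notin> nd ` Act" using that unfolding im by auto
      then show ?thesis using T(7,8)[OF j] Pj[OF j] False par' arcs'[OF j] by auto
    qed
  qed (use T in auto)
qed

lemma table_join_new:
  assumes tb: "table N P nd par arcs S Act Fut F" and uv: "u \<in> Act" "v \<in> Act" "S u \<noteq> S v"
    and inj: "inj_on S Act" and disj: "Act \<inter> Fut = {}"
    and p: "up F p = None" "p \<notin> S ` Act" "p \<noteq> r"
    and P': "\<And>j. j < N \<Longrightarrow> P' j = P j" "P' N = p"
    and par': "\<And>j. j < N \<Longrightarrow> par' j = (if j = nd u \<or> j = nd v then N else par j)"
    and arcs': "\<And>j. j < N \<Longrightarrow> j \<noteq> nd u \<Longrightarrow> j \<noteq> nd v \<Longrightarrow> arcs' j = arcs j"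
    and a: "a (S u) = arcs' (nd u)" "a (S v) = arcs' (nd v)"
    and nd': "\<And>i. nd' i = (if i = v then N else nd i)"
    and S': "\<And>i. i \<noteq> v \<Longrightarrow> S' i = S i" "S' v = p"
  shows "table (Suc N) P' nd' par' arcs' S' (Act - {u}) Fut (connect {S u, S v} p a F)"
proof -
  note T = tableD[OF tb]
  let ?F = "connect {S u, S v} p a F"
  have notin: "p \<notin> P ` {..<N}" using table_not_active[OF tb p(1,2)] .
  have imP: "P' ` {..<N} = P ` {..<N}" using P' by (auto intro!: image_cong)
  have ndinj: "inj_on nd Act"
    using inj T(4) unfolding inj_on_def by metis
  have neq: "nd u \<noteq> nd v" "u \<noteq> v" using uv(3) T(4)[OF uv(1)] T(4)[OF uv(2)] by auto
  have im: "nd' ` (Act - {u}) = insert N (nd ` Act - {nd u, nd v})"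
  proof -
    have "Act - {u} = insert v (Act - {u, v})" using uv neq by auto
    moreover have "nd' ` (Act - {u, v}) = nd ` (Act - {u, v})" using nd' by (intro image_cong) auto
    moreover have "nd ` (Act - {u, v}) = nd ` Act - {nd u, nd v}" using ndinj uv by (auto simp: inj_on_def)
    moreover have "nd' v = N" using nd' by simp
    ultimately show ?thesis by (simp only: image_insert)
  qed
  have pS: "p \<noteq> S u" "p \<noteq> S v" using p(2) uv by auto
  have Pj: "P j = S u \<longleftrightarrow> j = nd u" "P j = S v \<longleftrightarrow> j = nd v" "P j \<noteq> p" if "j < N" for j
    using T(1) T(3,4)[OF uv(1)] T(3,4)[OF uv(2)] that notin by (auto simp: inj_on_def)
  show ?thesis
  proof (rule tableI)
    have "inj_on P' {..<N}" using T(1) P'(1) by (simp add: inj_on_def)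
    moreover have "P' N \<notin> P' ` ({..<N} - {N})" using notin imP P'(2) by auto
    ultimately show "inj_on P' {..<Suc N}" by (simp only: lessThan_Suc inj_on_insert simp_thms)
    have "v \<notin> Fut" using disj uv by auto
    then have "S' ` Fut = S ` Fut" using S'(1) by (intro image_cong) metis+
    moreover have "nodes ?F - {r} = insert p (nodes F - {r})" using p(3) by auto
    ultimately show "nodes ?F - {r} = P' ` {..<Suc N} \<union> S' ` Fut"
      using T(5) imP P'(2) unfolding lessThan_Suc by simp
    fix j assume j: "j < Suc N"
    show "P' j \<noteq> r" using T(2) P' p(3) j by (cases "j = N") auto
    show "up ?F (P' j) = None" if "j \<in> nd' ` (Act - {u})"
    proof (cases "j = N")
      case True then show ?thesis using P'(2) p(1) pS by simp
    next
      case False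
      then have "j < N" "j \<in> nd ` Act" "j \<noteq> nd u" "j \<noteq> nd v" using that j unfolding im by auto
      then show ?thesis using T(6)[of j] Pj[of j] P'(1) by simp
    qed
    show "par' j < Suc N \<and> up ?F (P' j) = Some (P' (par' j), arcs' j)" if "j \<notin> nd' ` (Act - {u})"
    proof -
      have jN: "j < N" using that j unfolding im by auto
      show ?thesis
      proof (cases "j = nd u \<or> j = nd v")
        case True
        then have "P j \<in> {S u, S v} - {p}" using Pj[OF jN] by auto
        moreover have "a (P j) = arcs' j" using True a T(4)[OF uv(1)] T(4)[OF uv(2)] by auto
        ultimately show ?thesis using par'[OF jN] True P' jN by simp
      next
        case False
        then have "j \<notin> nd ` Act" using that unfolding im by auto
        then have "par j < N" "up F (P j) = Some (P (par j), arcs j)" using T(7,8)[OF jN] by auto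
        then show ?thesis using False P' jN par'[OF jN] arcs' Pj[OF jN] by simp
      qed
    qed
  next
    fix i assume i: "i \<in> Act - {u}"
    show "nd' i < Suc N \<and> P' (nd' i) = S' i"
      using T(3,4)[of i] P' i S' by (cases "i = v") (auto simp: nd' less_Suc_eq)
  qed
qed

end

section \<open>The program\<close>

abbreviation ne :: "string \<Rightarrow> nexp \<Rightarrow> nexp" where "ne x i \<equiv> NGet x i"
abbreviation rneg :: "rexp \<Rightarrow> rexp" where "rneg a \<equiv> RSub (RConst 0) a"
abbreviation nsuc :: "nexp \<Rightarrow> nexp" where "nsuc a \<equiv> NAdd a (NConst 1)"
abbreviation npred :: "nexp \<Rightarrow> nexp" where "npred a \<equiv> NSub a (NConst 1)"
abbreviation ndbl :: "nexp \<Rightarrow> nexp" where "ndbl a \<equiv> NAdd a a"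

abbreviation seq_prog :: "prog \<Rightarrow> prog \<Rightarrow> prog" (infixr ";;" 60) where "P ;; Q \<equiv> Seq P Q"

text \<open>Every arc of a node with number \<open>N\<close> has two segments, a right one numbered
  \<open>2 * N\<close> and a left one numbered \<open>2 * N + 1\<close>, possibly of length 0. This
  layout can be written at creation; the parameters follow when the parent is known.\<close>

definition newnode_prog :: prog where
  "newnode_prog =
    (let i = nv ''i''; N = nv ''nodes''; R = RFun Exp (rneg (RGet ''X'' i));
         \<phi> = RSub (RGet ''A'' i) (RMul (rv ''tau'') (RGet ''X'' i)) in
     RSet ''nodex'' N (RAdd (rv ''rootx'') (RMul R (RFun Cos \<phi>))) ;;
     RSet ''nodey'' N (RAdd (rv ''rooty'') (RMul R (RFun Sin \<phi>))) ;;
     NSet ''nd'' i N ;;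
     NSet ''left'' (nsuc (ndbl N)) (NConst 1) ;;
     NSet ''arc'' (nsuc N) (ndbl (nsuc N)) ;;
     nset ''nodes'' (nsuc N))"

text \<open>A lone active node is its own successor and takes no part in the tournament of keys;
  otherwise the branch on the order of indices reproduces \<open>gap\<close>.\<close>

definition setkey_prog :: prog where
  "setkey_prog =
    (let i = nv ''i''; q = nv ''q''; g = RSub (RGet ''A'' q) (RGet ''A'' i) in
     nset ''q'' (ne ''nx'' i) ;;
     Cond (NEq q i) (NSet ''w'' (NAdd (nv ''m'') i) (NConst 0))
       (Cond (NLess i q) (rset ''d'' g) (rset ''d'' (RAdd g (RMul (RConst 2) (rv ''pi'')))) ;;
        RSet ''K'' i (RAdd (RGet ''X'' i) (RDiv (rv ''d'') (RMul (RConst 2) (rv ''tau'')))) ;;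
        NSet ''w'' (NAdd (nv ''m'') i) (nsuc i)) ;;
     fix_prog)"

text \<open>Besides removing \<open>u\<close>, two keys are renewed: that of its predecessor, which
  has a new successor, and that of \<open>v\<close>, whose node may have moved.\<close>

definition unlink_prog :: prog where
  "unlink_prog =
    (nset ''p'' (ne ''pv'' (nv ''u'')) ;;
     NSet ''nx'' (nv ''p'') (nv ''v'') ;;
     NSet ''pv'' (nv ''v'') (nv ''p'') ;;
     nset ''i'' (nv ''u'') ;;
     NSet ''b'' (NAdd (nv ''m'') (nv ''u'')) (NConst 0) ;;
     NSet ''w'' (NAdd (nv ''m'') (nv ''u'')) (NConst 0) ;;
     fix_prog ;;
     nset ''i'' (nv ''p'') ;; setkey_prog ;;
     nset ''i'' (nv ''v'') ;; setkey_prog)"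

text \<open>\<open>c\<close> is the time at which \<open>u\<close> reaches the left spiral of
  \<open>v\<close>. If that is after \<open>v\<close>, a Steiner node is created, reached by
  \<open>u\<close> on a right and by \<open>v\<close> on a left spiral; otherwise \<open>u\<close>
  turns onto the left spiral and follows it to \<open>v\<close>.\<close>

definition connect_tail_prog :: prog where
  "connect_tail_prog =
    (let v = nv ''v''; e = nv ''e''; f = nv ''f''; c = rv ''c'' in
     Cond (RLess (RGet ''X'' v) c)
       (RSet ''param'' (nsuc (ndbl e)) (RConst 0) ;;
        RSet ''param'' (ndbl f) (RConst 0) ;;
        RSet ''param'' (nsuc (ndbl f)) (RSub c (RGet ''X'' v)) ;;
        RSet ''X'' v c ;;
        NSet ''parent'' e (nv ''nodes'') ;;
        NSet ''parent'' f (nv ''nodes'') ;;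
        nset ''i'' v ;; newnode_prog)
       (RSet ''param'' (nsuc (ndbl e)) (RSub (RGet ''X'' v) c) ;;
        NSet ''parent'' e f))"

definition connect_prog :: prog where
  "connect_prog =
    (nset ''e'' (ne ''nd'' (nv ''u'')) ;;
     nset ''f'' (ne ''nd'' (nv ''v'')) ;;
     rset ''c'' (RGet ''K'' (nv ''u'')) ;;
     RSet ''param'' (ndbl (nv ''e'')) (RSub (rv ''c'') (RGet ''X'' (nv ''u''))) ;;
     connect_tail_prog)"

definition join_prog :: prog where
  "join_prog = (nset ''u'' (nv ''s'') ;; nset ''v'' (ne ''nx'' (nv ''u'')) ;; connect_prog ;; unlink_prog)"

definition insert_first_prog :: prog where
  "insert_first_prog =
    (let s = nv ''s''; leaf = NAdd (nv ''m'') s in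
     NSet ''nx'' s s ;; NSet ''pv'' s s ;; nset ''i'' s ;; newnode_prog ;;
     NSet ''b'' leaf (nsuc s) ;; NSet ''w'' leaf (NConst 0) ;; fix_prog)"

definition drop_prog :: prog where
  "drop_prog = (nset ''i'' (nv ''s'') ;; NSet ''w'' (NAdd (nv ''m'') (nv ''s'')) (NConst 0) ;; fix_prog)"

definition insert_after_prog :: prog where
  "insert_after_prog =
    (let s = nv ''s''; u = nv ''u'' in
     nset ''v'' (ne ''nx'' u) ;;
     NSet ''nx'' u s ;; NSet ''pv'' s u ;;
     NSet ''nx'' s (nv ''v'') ;; NSet ''pv'' (nv ''v'') s ;;
     nset ''i'' s ;; newnode_prog ;;
     NSet ''b'' (NAdd (nv ''m'') s) (nsuc s) ;; fix_prog ;;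
     nset ''i'' u ;; setkey_prog ;;
     nset ''i'' s ;; setkey_prog)"

definition insert_prog :: prog where
  "insert_prog =
    (let s = nv ''s''; u = nv ''u'' in
     pred_prog ;;
     Cond (NEq u (NConst 0)) insert_first_prog
       (nset ''u'' (npred u) ;;
        Cond (TAnd (REq (RGet ''A'' u) (RGet ''A'' s)) (REq (RGet ''X'' u) (RGet ''X'' s)))
          drop_prog insert_after_prog))"

context spiral_geometry
begin

section \<open>State predicates and correctness of the event procedures\<close>

definition consts_ok :: "nat \<Rightarrow> nat \<Rightarrow> (nat \<Rightarrow> real) \<Rightarrow> mem \<Rightarrow> bool" where
  "consts_ok h k A s \<longleftrightarrow> nmem s ''m'' 0 = 2 ^ h \<and> k \<le> 2 ^ h \<and> rmem s ''A'' = A \<and> rmem s ''tau'' 0 = \<tau> \<and>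
     rmem s ''pi'' 0 = pi \<and> rmem s ''rootx'' 0 = Re r \<and> rmem s ''rooty'' 0 = Im r"

definition arcs_format :: "mem \<Rightarrow> bool" where
  "arcs_format s \<longleftrightarrow> (\<forall>j\<le>nmem s ''nodes'' 0. nmem s ''arc'' j = 2 * j) \<and>
     (\<forall>j. nmem s ''left'' (2 * j) = 0) \<and> (\<forall>j<nmem s ''nodes'' 0. nmem s ''left'' (Suc (2 * j)) = 1) \<and>
     (\<forall>j. nmem s ''unbounded'' j = 0)"

definition segs :: "mem \<Rightarrow> nat \<Rightarrow> arc" where
  "segs s j = [(Right_spiral, ereal (rmem s ''param'' (2 * j))),
     (Left_spiral, ereal (rmem s ''param'' (Suc (2 * j))))]"

text \<open>\<open>E\<close> collects the slots whose keys are momentarily out of date. A future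
  terminal is keyed by its arrival and an active node by the meeting with its successor, so the
  least key is the next event.\<close>

definition keys_state :: "nat \<Rightarrow> nat \<Rightarrow> (nat \<Rightarrow> real) \<Rightarrow> (nat \<Rightarrow> real) \<Rightarrow> nat set \<Rightarrow> nat set \<Rightarrow> nat set \<Rightarrow>
    mem \<Rightarrow> bool" where
  "keys_state h k A X0 Act Fut E s \<longleftrightarrow> (\<exists>D.
     trees h (rmem s ''K'') (rmem s ''L'') (nmem s ''w'') (nmem s ''b'') D Act \<and>
     (\<forall>i. i \<notin> E \<longrightarrow> (i \<in> D \<longleftrightarrow> i \<in> Fut \<or> (i \<in> Act \<and> nmem s ''nx'' i \<noteq> i))) \<and>
     (\<forall>i\<in>Fut - E. rmem s ''K'' i = X0 i) \<and>
     (\<forall>i\<in>Act - E. nmem s ''nx'' i \<noteq> i \<longrightarrow> rmem s ''K'' i = meet A (rmem s ''X'') i (nmem s ''nx'' i)) \<and>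
     (\<forall>i<k. rmem s ''L'' i = 0))"

lemma wp_newnode:
  fixes s :: mem
  defines "N \<equiv> nmem s ''nodes'' 0" and "i \<equiv> nmem s ''i'' 0"
  assumes c: "consts_ok h k A s"
    and Q: "\<And>s'. \<lbrakk>same_but {''nd'', ''nodes'', ''arc'', ''left''} {''nodex'', ''nodey''} s s';
      nmem s' ''nodes'' 0 = Suc N; nmem s' ''nd'' = (nmem s ''nd'')(i := N);
      \<And>j. j \<noteq> N \<Longrightarrow> out_node s' j = out_node s j;
      out_node s' N = slot_pt A (rmem s ''X'') i; arcs_format s \<Longrightarrow> arcs_format s'\<rbrakk> \<Longrightarrow> Q s' (t + 6)"
  shows "wp newnode_prog Q s t"
proof -
  have pt: "slot_pt A (rmem s ''X'') i = Complex
      (Re r + exp (- rmem s ''X'' i) * cos (A i - \<tau> * rmem s ''X'' i))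
      (Im r + exp (- rmem s ''X'' i) * sin (A i - \<tau> * rmem s ''X'' i))"
    by (simp add: slot_pt_def pt_def complex_eq_iff)
  let ?s = "setn ''nodes'' 0 (Suc N) (setn ''arc'' (Suc N) (Suc N + Suc N) (setn ''left'' (Suc (N + N)) 1
    (setn ''nd'' i N (setr ''nodey'' N (Im r + exp (- rmem s ''X'' i) * sin (A i - \<tau> * rmem s ''X'' i))
    (setr ''nodex'' N (Re r + exp (- rmem s ''X'' i) * cos (A i - \<tau> * rmem s ''X'' i)) s)))))"
  have fmt: "arcs_format ?s" if "arcs_format s"
  proof -
    have "odd (Suc (N + N))" by simp
    then have "2 * j \<noteq> Suc (N + N)" for j by presburger
    then show ?thesis using that by (auto simp: arcs_format_def N_def le_Suc_eq less_Suc_eq)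
  qed
  have "Q ?s (t + 6)"
    by (rule Q) (use fmt in \<open>auto simp: same_but_def out_node_def pt\<close>)
  then show ?thesis
    using c unfolding newnode_prog_def Let_def wp_Seq wp_NSet wp_RSet
    by (simp add: consts_ok_def numeral_eq_Suc flip: N_def i_def)
qed

lemma wp_setkey:
  assumes c: "consts_ok h k A s" and ks: "keys_state h k A X0 Act Fut E s"
    and i: "nmem s ''i'' 0 = i" "i \<in> Act" "i \<notin> Fut"
    and Q: "\<And>s' t'. \<lbrakk>t' \<le> t + 8 * h + 8; same_but {''q'', ''j'', ''w'', ''b''} {''d'', ''K''} s s';
      keys_state h k A X0 Act Fut (E - {i}) s'\<rbrakk> \<Longrightarrow> Q s' t'"
  shows "wp setkey_prog Q s t"
proof -
  obtain D where tr: "trees h (rmem s ''K'') (rmem s ''L'') (nmem s ''w'') (nmem s ''b'') D Act"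
    and D: "\<And>i. i \<notin> E \<Longrightarrow> i \<in> D \<longleftrightarrow> i \<in> Fut \<or> (i \<in> Act \<and> nmem s ''nx'' i \<noteq> i)"
    and K: "\<And>i. i \<in> Fut - E \<Longrightarrow> rmem s ''K'' i = X0 i"
      "\<And>i. i \<in> Act - E \<Longrightarrow> nmem s ''nx'' i \<noteq> i \<Longrightarrow> rmem s ''K'' i = meet A (rmem s ''X'') i (nmem s ''nx'' i)"
      "\<And>i. i < k \<Longrightarrow> rmem s ''L'' i = 0"
    using ks unfolding keys_state_def by blast
  have ih: "i < 2 ^ h" using tr i unfolding trees_def by auto
  have bi: "nmem s ''b'' (2 ^ h + i) = Suc i" using trees_leaf_value(2)[OF tr ih] i by simp
  define q where "q = nmem s ''nx'' i"
  define s1 where "s1 = setn ''q'' 0 q s"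
  show ?thesis
  proof (cases "q = i")
    case True
    define s2 where "s2 = setn ''w'' (2 ^ h + i) 0 s1"
    have "wp fix_prog Q s2 (t + 3)"
    proof (rule wp_leaf_fix[OF tr, where D' = "D - {i}" and B' = Act])
      show "nmem s2 ''b'' = (nmem s ''b'')(2 ^ h + i := (if i \<in> Act then Suc i else 0))"
        using bi i by (auto simp: s2_def s1_def)
      fix s' t'
      assume t': "t' \<le> t + 3 + 8 * h + 2" and same: "same_but {''j'', ''w'', ''b''} {} s2 s'"
        and tr': "trees h (rmem s2 ''K'') (rmem s2 ''L'') (nmem s' ''w'') (nmem s' ''b'') (D - {i}) Act"
      have e: "rmem s' = rmem s" "nmem s' ''nx'' = nmem s ''nx''"
        using same by (auto simp: same_but_def s2_def s1_def)
      show "Q s' t'"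
      proof (rule Q)
        show "same_but {''q'', ''j'', ''w'', ''b''} {''d'', ''K''} s s'"
          using same by (simp add: same_but_def s2_def s1_def)
        show "keys_state h k A X0 Act Fut (E - {i}) s'"
          unfolding keys_state_def e
          using tr' D K i True by (intro exI[of _ "D - {i}"]) (auto simp: s2_def s1_def q_def)
      qed (use t' in simp)
    qed (use i c ih in \<open>auto simp: s2_def s1_def consts_ok_def\<close>)
    then show ?thesis
      using c i True unfolding setkey_prog_def Let_def
      by (simp add: wp_simps consts_ok_def s2_def s1_def numeral_eq_Suc flip: q_def)
  next
    case False
    define g where "g = gap A i q"
    define s2 where "s2 = setn ''w'' (2 ^ h + i) (Suc i) (setr ''K'' i (meet A (rmem s ''X'') i q) (setr ''d'' 0 g s1))"
    have "wp fix_prog Q s2 (t + 6)"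
    proof (rule wp_leaf_fix[OF tr, where D' = "insert i D" and B' = Act])
      show "nmem s2 ''b'' = (nmem s ''b'')(2 ^ h + i := (if i \<in> Act then Suc i else 0))"
        using bi i by (auto simp: s2_def s1_def)
      fix s' t'
      assume t': "t' \<le> t + 6 + 8 * h + 2" and same: "same_but {''j'', ''w'', ''b''} {} s2 s'"
        and tr': "trees h (rmem s2 ''K'') (rmem s2 ''L'') (nmem s' ''w'') (nmem s' ''b'') (insert i D) Act"
      have e: "rmem s' ''K'' = (rmem s ''K'')(i := meet A (rmem s ''X'') i q)" "rmem s' ''L'' = rmem s ''L''"
        "rmem s' ''X'' = rmem s ''X''" "nmem s' ''nx'' = nmem s ''nx''"
        using same by (auto simp: same_but_def s2_def s1_def)
      show "Q s' t'"
      proof (rule Q)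
        show "same_but {''q'', ''j'', ''w'', ''b''} {''d'', ''K''} s s'"
          using same by (simp add: same_but_def s2_def s1_def)
        show "keys_state h k A X0 Act Fut (E - {i}) s'"
          unfolding keys_state_def e
          using tr' D K i False by (intro exI[of _ "insert i D"]) (auto simp: s2_def s1_def q_def)
      qed (use t' in simp)
    qed (use i c ih in \<open>auto simp: s2_def s1_def consts_ok_def\<close>)
    then show ?thesis
      using c i False unfolding setkey_prog_def Let_def
      by (cases "i < q"; simp add: wp_simps consts_ok_def s2_def s1_def g_def gap_def meet_def numeral_eq_Suc
          flip: q_def)
  qed
qed

lemma consts_ok_same:
  assumes "consts_ok h k A s" "same_but U V s s'" "''m'' \<notin> U" "{''A'', ''tau'', ''pi'', ''rootx'', ''rooty''} \<inter> V = {}"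
  shows "consts_ok h k A s'"
  using assms by (auto simp: consts_ok_def same_but_def)

lemma same_but_chain:
  assumes "same_but U V s s'" "same_but U' V' s' s''" "U \<union> U' \<subseteq> U''" "V \<union> V' \<subseteq> V''"
  shows "same_but U'' V'' s s''"
proof -
  have "x \<notin> U'' \<Longrightarrow> x \<notin> U \<and> x \<notin> U'" "x \<notin> V'' \<Longrightarrow> x \<notin> V \<and> x \<notin> V'" for x
    using assms(3,4) by blast+
  then show ?thesis using assms(1,2) unfolding same_but_def by simp
qed

lemma wp_unlink:
  assumes c: "consts_ok h k A s" and ks: "keys_state h k A X0 Act Fut {v} s"
    and ln: "links k (nmem s ''nx'') (nmem s ''pv'') Act" and disj: "Act \<inter> Fut = {}"
    and u: "nmem s ''u'' 0 = u" "u \<in> Act" and v: "nmem s ''v'' 0 = v" "v = nmem s ''nx'' u" "v \<noteq> u"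
    and Q: "\<And>s' t'. \<lbrakk>t' \<le> t + 24 * h + 28;
      same_but {''p'', ''nx'', ''pv'', ''i'', ''b'', ''w'', ''j'', ''q''} {''d'', ''K''} s s';
      keys_state h k A X0 (Act - {u}) Fut {} s';
      links k (nmem s' ''nx'') (nmem s' ''pv'') (Act - {u})\<rbrakk> \<Longrightarrow> Q s' t'"
  shows "wp unlink_prog Q s t"
proof -
  let ?U = "{''p'', ''nx'', ''pv'', ''i'', ''b'', ''w'', ''j'', ''q''}"
  define p where "p = nmem s ''pv'' u"
  obtain D where tr: "trees h (rmem s ''K'') (rmem s ''L'') (nmem s ''w'') (nmem s ''b'') D Act"
    and D: "\<And>i. i \<notin> {v} \<Longrightarrow> i \<in> D \<longleftrightarrow> i \<in> Fut \<or> (i \<in> Act \<and> nmem s ''nx'' i \<noteq> i)"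
    and K: "\<And>i. i \<in> Fut - {v} \<Longrightarrow> rmem s ''K'' i = X0 i"
      "\<And>i. i \<in> Act - {v} \<Longrightarrow> nmem s ''nx'' i \<noteq> i \<Longrightarrow> rmem s ''K'' i = meet A (rmem s ''X'') i (nmem s ''nx'' i)"
      "\<And>i. i < k \<Longrightarrow> rmem s ''L'' i = 0"
    using ks unfolding keys_state_def by blast
  have uh: "u < 2 ^ h" using tr u unfolding trees_def by auto
  note lu = linksD[OF ln u(2), folded v(2) p_def]
  have pu: "p \<noteq> u" using lu v by auto
  define s1 where "s1 = setn ''w'' (2 ^ h + u) 0 (setn ''b'' (2 ^ h + u) 0 (setn ''i'' 0 u
    (setn ''pv'' v p (setn ''nx'' p v (setn ''p'' 0 p s)))))"
  have m: "nmem s ''m'' 0 = 2 ^ h" using c by (simp add: consts_ok_def)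
  have same1: "same_but ?U {} s s1" by (simp add: same_but_def s1_def)
  have links1: "links k (nmem s1 ''nx'') (nmem s1 ''pv'') (Act - {u})"
    by (rule links_delete[OF ln u(2) v(2,3) p_def]) (auto simp: s1_def)
  have "wp fix_prog (wp (Seq (nset ''i'' (nv ''p'')) (Seq setkey_prog (Seq (nset ''i'' (nv ''v'')) setkey_prog))) Q) s1 (t + 6)"
  proof (rule wp_leaf_fix[OF tr, where D' = "D - {u}" and B' = "Act - {u}"])
    fix s2 t2
    assume t2: "t2 \<le> t + 6 + 8 * h + 2" and same: "same_but {''j'', ''w'', ''b''} {} s1 s2"
      and tr2: "trees h (rmem s1 ''K'') (rmem s1 ''L'') (nmem s2 ''w'') (nmem s2 ''b'') (D - {u}) (Act - {u})"
    have same2: "same_but ?U {} s s2" using same_but_chain[OF same1 same] by auto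
    have nx2: "nmem s2 ''nx'' = (nmem s ''nx'')(p := v)" "nmem s2 ''pv'' = nmem s1 ''pv''"
      "nmem s2 ''p'' 0 = p" "nmem s2 ''v'' 0 = v" "rmem s2 = rmem s" "rmem s1 = rmem s"
      using same v by (auto simp: same_but_def s1_def)
    \<comment> \<open>\<open>p\<close> is now out of date as well, since its successor changed from
      \<open>u\<close> to \<open>v\<close>.\<close>
    have ks2: "keys_state h k A X0 (Act - {u}) Fut {v, p} s2"
      unfolding keys_state_def nx2
      using tr2 D K u disj unfolding nx2 by (intro exI[of _ "D - {u}"]) auto
    define s3 where "s3 = setn ''i'' 0 p s2"
    have ks3: "keys_state h k A X0 (Act - {u}) Fut {v, p} s3"
      using ks2 by (simp add: keys_state_def s3_def)
    have c3: "consts_ok h k A s3"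
      by (rule consts_ok_same[OF c, of "insert ''i'' ?U" "{}"]) (use same2 in \<open>auto simp: same_but_def s3_def\<close>)
    have "wp setkey_prog (wp (Seq (nset ''i'' (nv ''v'')) setkey_prog) Q) s3 (Suc t2)"
    proof (rule wp_setkey[OF c3 ks3])
      show "nmem s3 ''i'' 0 = p" by (simp add: s3_def)
      show "p \<in> Act - {u}" "p \<notin> Fut" using lu pu disj by auto
      fix s4 t4
      assume t4: "t4 \<le> Suc t2 + 8 * h + 8" and same34: "same_but {''q'', ''j'', ''w'', ''b''} {''d'', ''K''} s3 s4"
        and ks4: "keys_state h k A X0 (Act - {u}) Fut ({v, p} - {p}) s4"
      define s5 where "s5 = setn ''i'' 0 v s4"
      have ks5: "keys_state h k A X0 (Act - {u}) Fut ({v, p} - {p}) s5"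
        using ks4 by (simp add: keys_state_def s5_def)
      have c5: "consts_ok h k A s5"
        by (rule consts_ok_same[OF c3, of "{''i'', ''q'', ''j'', ''w'', ''b''}" "{''d'', ''K''}"])
          (use same34 in \<open>auto simp: same_but_def s5_def\<close>)
      have v4: "nmem s4 ''v'' 0 = v" using same34 nx2 by (simp add: same_but_def s3_def)
      have "wp setkey_prog Q s5 (Suc t4)"
      proof (rule wp_setkey[OF c5 ks5])
        show "nmem s5 ''i'' 0 = v" by (simp add: s5_def)
        show "v \<in> Act - {u}" "v \<notin> Fut" using lu v disj by auto
        fix s6 t6
        assume t6: "t6 \<le> Suc t4 + 8 * h + 8" and same56: "same_but {''q'', ''j'', ''w'', ''b''} {''d'', ''K''} s5 s6"
          and ks6: "keys_state h k A X0 (Act - {u}) Fut ({v, p} - {p} - {v}) s6"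
        show "Q s6 t6"
        proof (rule Q)
          show "t6 \<le> t + 24 * h + 28" using t2 t4 t6 by simp
          show "same_but ?U {''d'', ''K''} s s6"
            using same2 same34 same56 by (simp add: same_but_def s3_def s5_def)
          have "{v, p} - {p} - {v} = {}" by blast
          then show "keys_state h k A X0 (Act - {u}) Fut {} s6" using ks6 by (simp only:)
          have "nmem s6 ''nx'' = nmem s1 ''nx''" "nmem s6 ''pv'' = nmem s1 ''pv''"
            using same same34 same56 by (simp_all add: same_but_def s3_def s5_def)
          then show "links k (nmem s6 ''nx'') (nmem s6 ''pv'') (Act - {u})" using links1 by simp
        qed
      qed
      then show "wp (Seq (nset ''i'' (nv ''v'')) setkey_prog) Q s4 t4"
        using v4 by (simp add: wp_Seq wp_NSet s5_def)
    qed
    then show "wp (Seq (nset ''i'' (nv ''p'')) (Seq setkey_prog (Seq (nset ''i'' (nv ''v'')) setkey_prog))) Q s2 t2"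
      using nx2 by (simp add: wp_Seq wp_NSet s3_def)
  qed (use m uh in \<open>auto simp: s1_def\<close>)
  then show ?thesis
    unfolding unlink_prog_def wp_Seq wp_NSet using m u v
    by (simp add: s1_def p_def numeral_eq_Suc flip: m)
qed

lemma arc_two:
  assumes "0 \<le> a" "0 \<le> b"
  shows "arc_from_to r \<alpha> [(Right_spiral, ereal a), (Left_spiral, ereal b)] p (go p a b)"
  using assms by (auto simp: arc_from_to_def spiral_right spiral_left go_go)

text \<open>By the meeting time the angle coordinate along the right spiral has grown by
  \<open>gap A u v\<close>, which makes it that of slot \<open>v\<close> up to a full turn.\<close>

lemma go_meet: "go (slot_pt A X u) (meet A X u v - X u) b = pt (A v) (meet A X u v + b)"
proof -
  have "2 * \<tau> * (meet A X u v - X u) = gap A u v" using tau_pos by (simp add: meet_def)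
  then have "go (slot_pt A X u) (meet A X u v - X u) b = pt (A u + gap A u v) (meet A X u v + b)"
    by (simp add: slot_pt_def go_pt)
  also have "\<dots> = pt (A v) (meet A X u v + b)"
    unfolding pt_eq_iff gap_def by (auto intro: exI[of _ 0] exI[of _ 1])
  finally show ?thesis .
qed

lemma wp_connect:
  fixes s :: mem
  defines "X \<equiv> rmem s ''X''"
  assumes c: "consts_ok h k A s"
    and inv: "sweep_inv ts k A X0 Act Fut X F L"
    and tb: "table (nmem s ''nodes'' 0) (out_node s) (nmem s ''nd'') (nmem s ''parent'') (segs s) (slot_pt A X) Act Fut F"
    and fmt: "arcs_format s"
    and u: "nmem s ''u'' 0 = u" "u \<in> Act" and v: "nmem s ''v'' 0 = v" "v \<in> Act" "v \<noteq> u"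
    and Ku: "rmem s ''K'' u = meet A X u v"
    and keys: "\<And>i j. i \<in> Act \<Longrightarrow> j \<in> Act \<Longrightarrow> i \<noteq> j \<Longrightarrow> meet A X u v \<le> meet A X i j"
    and fut: "\<And>i. i \<in> Fut \<Longrightarrow> meet A X u v \<le> X0 i"
    and Q: "\<And>s' t' F' L'. \<lbrakk>t' \<le> t + 18;
      same_but {''e'', ''f'', ''parent'', ''i'', ''nd'', ''nodes'', ''arc'', ''left''}
        {''c'', ''param'', ''X'', ''nodex'', ''nodey''} s s';
      \<And>i. i \<noteq> v \<Longrightarrow> rmem s' ''X'' i = X i;
      sweep_inv ts k A X0 (Act - {u}) Fut (rmem s' ''X'') F' L';
      table (nmem s' ''nodes'' 0) (out_node s') (nmem s' ''nd'') (nmem s' ''parent'') (segs s')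
        (slot_pt A (rmem s' ''X'')) (Act - {u}) Fut F';
      arcs_format s'\<rbrakk> \<Longrightarrow> Q s' t'"
  shows "wp connect_prog Q s t"
proof -
  let ?U = "{''e'', ''f'', ''parent'', ''i'', ''nd'', ''nodes'', ''arc'', ''left''}"
  let ?V = "{''c'', ''param'', ''X'', ''nodex'', ''nodey''}"
  define N where "N = nmem s ''nodes'' 0"
  define \<kappa> where "\<kappa> = meet A X u v"
  define e where "e = nmem s ''nd'' u"
  define f where "f = nmem s ''nd'' v"
  note I = sweep_invD[OF inv]
  have inj: "inj_on (slot_pt A X) Act" using sweep_slot_pt_inj[OF inv] .
  have Suv: "slot_pt A X u \<noteq> slot_pt A X v" using inj u v by (auto simp: inj_on_def)
  have ef: "e \<noteq> f" using tableD(4)[OF tb u(2)] tableD(4)[OF tb v(2)] Suv by (auto simp: e_def f_def)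
  have efN: "e < N" "f < N" using tableD(3)[OF tb] u v by (auto simp: e_def f_def N_def)
  have \<kappa>u: "X u \<le> \<kappa>" using meet_ge[OF I(1), of u v X] I(2) u v by (auto simp: \<kappa>_def)
  define s1 where "s1 = setr ''param'' (2 * e) (\<kappa> - X u) (setr ''c'' 0 \<kappa> (setn ''f'' 0 f (setn ''e'' 0 e s)))"
  have s1v: "nmem s1 ''e'' 0 = e" "nmem s1 ''f'' 0 = f" "nmem s1 ''v'' 0 = v" "rmem s1 ''c'' 0 = \<kappa>"
      "rmem s1 ''X'' = X" "nmem s1 ''nodes'' 0 = N"
    using v by (simp_all add: s1_def N_def X_def)
  have load: "wp connect_prog Q s t = wp connect_tail_prog Q s1 (t + 4)"
  proof -
    have "e + e = 2 * e" by simp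
    then show ?thesis
      unfolding connect_prog_def wp_Seq wp_NSet wp_RSet
      using u v Ku by (simp add: s1_def numeral_eq_Suc X_def flip: e_def f_def \<kappa>_def[unfolded X_def])
  qed
  have pieces: "out_node x = out_node s" if "rmem x ''nodex'' = rmem s ''nodex''" "rmem x ''nodey'' = rmem s ''nodey''" for x
    using that by (auto simp: out_node_def)
  have idx: "2 * a \<noteq> Suc (2 * b)" "Suc (2 * b) \<noteq> 2 * a" for a b :: nat by presburger+
  show ?thesis
  proof (cases "X v < \<kappa>")
    case True
    define p where "p = pt (A v) \<kappa>"
    have y: "\<kappa> = max (X v) (meet A X u v)" using True by (simp add: \<kappa>_def)
    define s2 where "s2 = setn ''i'' 0 v (setn ''parent'' f N (setn ''parent'' e N (setr ''X'' v \<kappa>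
      (setr ''param'' (Suc (2 * f)) (\<kappa> - X v) (setr ''param'' (2 * f) 0 (setr ''param'' (Suc (2 * e)) 0 s1))))))"
    have X2: "rmem s2 ''X'' = X(v := \<kappa>)" by (simp add: s2_def s1_def X_def)
    have same2: "same_but ?U ?V s s2" by (simp add: same_but_def s2_def s1_def)
    have c2: "consts_ok h k A s2" by (rule consts_ok_same[OF c same2]) auto
    have "wp newnode_prog Q s2 (t + 12)"
    proof (rule wp_newnode[OF c2])
      fix s' assume same: "same_but {''nd'', ''nodes'', ''arc'', ''left''} {''nodex'', ''nodey''} s2 s'"
        and N': "nmem s' ''nodes'' 0 = Suc (nmem s2 ''nodes'' 0)"
        and nd': "nmem s' ''nd'' = (nmem s2 ''nd'')(nmem s2 ''i'' 0 := nmem s2 ''nodes'' 0)"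
        and old: "\<And>j. j \<noteq> nmem s2 ''nodes'' 0 \<Longrightarrow> out_node s' j = out_node s2 j"
        and new: "out_node s' (nmem s2 ''nodes'' 0) = slot_pt A (rmem s2 ''X'') (nmem s2 ''i'' 0)"
        and fmt': "arcs_format s2 \<Longrightarrow> arcs_format s'"
      have n2: "nmem s2 ''nodes'' 0 = N" "nmem s2 ''i'' 0 = v" "nmem s2 ''nd'' = nmem s ''nd''"
        by (simp_all add: s2_def s1_def N_def)
      have X': "rmem s' ''X'' = X(v := \<kappa>)" using same X2 by (simp add: same_but_def)
      have par: "rmem s' ''param'' = rmem s2 ''param''" "nmem s' ''parent'' = nmem s2 ''parent''"
        using same by (auto simp: same_but_def)
      have segs': "segs s' e = [(Right_spiral, ereal (\<kappa> - X u)), (Left_spiral, ereal 0)]"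
        "segs s' f = [(Right_spiral, ereal 0), (Left_spiral, ereal (\<kappa> - X v))]"
        "\<And>j. j \<noteq> e \<Longrightarrow> j \<noteq> f \<Longrightarrow> segs s' j = segs s j"
        using ef idx by (auto simp: segs_def par s2_def s1_def)
      define a where "a x = (if x = slot_pt A X u then segs s' e else segs s' f)" for x
      have arcu: "arc_from_to r \<alpha> (a (slot_pt A X u)) (slot_pt A X u) p"
        using arc_two[of "\<kappa> - X u" 0 "slot_pt A X u"] \<kappa>u go_meet[of A X u v 0]
        by (simp add: a_def segs' p_def \<kappa>_def)
      have arcv: "arc_from_to r \<alpha> (a (slot_pt A X v)) (slot_pt A X v) p"
        using arc_two[of 0 "\<kappa> - X v" "slot_pt A X v"] True Suv
        by (simp add: a_def segs' p_def go_pt slot_pt_def)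
      note J = sweep_join[OF inv u(2) v(2) v(3)[symmetric] keys fut y refl refl p_def arcu arcv]
      show "Q s' (t + 12 + 6)"
      proof (rule Q)
        show "same_but ?U ?V s s'" by (rule same_but_chain[OF same2 same]) auto
        show "rmem s' ''X'' i = X i" if "i \<noteq> v" for i using that X' by simp
        show "sweep_inv ts k A X0 (Act - {u}) Fut (rmem s' ''X'')
            (connect {slot_pt A X u, slot_pt A X v} p a F) \<kappa>"
          using J(1) X' by simp
        show "arcs_format s'"
          by (rule fmt') (use fmt in \<open>simp add: arcs_format_def s2_def s1_def\<close>)
        have "table (Suc N) (out_node s') (nmem s' ''nd'') (nmem s' ''parent'') (segs s')
          (slot_pt A (rmem s' ''X'')) (Act - {u}) Fut (connect {slot_pt A X u, slot_pt A X v} p a F)"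
        proof (rule table_join_new[OF tb[folded N_def] u(2) v(2) Suv inj I(4) J(4)])
          show "p \<notin> slot_pt A X ` Act" using J(5) True by (simp add: \<kappa>_def)
          show "p \<noteq> r" by (simp add: p_def)
          show "out_node s' j = out_node s j" if "j < N" for j
          proof -
            have "out_node s2 = out_node s" by (rule pieces) (simp_all add: s2_def s1_def)
            then show ?thesis using old[of j, unfolded n2(1)] that by simp
          qed
          show "out_node s' N = p" using new by (simp add: n2 X2 slot_pt_def p_def)
          show "nmem s' ''parent'' j = (if j = nmem s ''nd'' u \<or> j = nmem s ''nd'' v then N else nmem s ''parent'' j)"
            if "j < N" for j by (simp add: par s2_def s1_def e_def f_def)
          show "segs s' j = segs s j" if "j < N" "j \<noteq> nmem s ''nd'' u" "j \<noteq> nmem s ''nd'' v" for j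
            using segs'(3) that by (simp add: e_def f_def)
          show "a (slot_pt A X u) = segs s' (nmem s ''nd'' u)" "a (slot_pt A X v) = segs s' (nmem s ''nd'' v)"
            using Suv by (simp_all add: a_def e_def f_def)
          show "nmem s' ''nd'' i = (if i = v then N else nmem s ''nd'' i)" for i
            by (simp add: nd' n2)
          show "slot_pt A (rmem s' ''X'') i = slot_pt A X i" if "i \<noteq> v" for i
            using that by (simp add: X' slot_pt_def)
          show "slot_pt A (rmem s' ''X'') v = p" by (simp add: X' slot_pt_def p_def)
        qed
        then show "table (nmem s' ''nodes'' 0) (out_node s') (nmem s' ''nd'') (nmem s' ''parent'') (segs s')
          (slot_pt A (rmem s' ''X'')) (Act - {u}) Fut (connect {slot_pt A X u, slot_pt A X v} p a F)"
          by (simp add: N' n2)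
      qed simp
    qed
    then show ?thesis
      using True unfolding load connect_tail_prog_def Let_def wp_Seq wp_NSet wp_RSet wp_Cond
      by (simp add: s1v s2_def numeral_eq_Suc)
  next
    case False
    define p where "p = pt (A v) (X v)"
    have y: "X v = max (X v) (meet A X u v)" using False by (simp add: \<kappa>_def)
    have pv: "p = slot_pt A X v" by (simp add: p_def slot_pt_def)
    define s2 where "s2 = setn ''parent'' e f (setr ''param'' (Suc (2 * e)) (X v - \<kappa>) s1)"
    have X2: "rmem s2 ''X'' = X" by (simp add: s2_def s1_def X_def)
    have segs': "segs s2 e = [(Right_spiral, ereal (\<kappa> - X u)), (Left_spiral, ereal (X v - \<kappa>))]"
      "\<And>j. j \<noteq> e \<Longrightarrow> segs s2 j = segs s j"
      using idx by (auto simp: segs_def s2_def s1_def)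
    define a where "a x = segs s2 e" for x :: complex
    have arcu: "arc_from_to r \<alpha> (a (slot_pt A X u)) (slot_pt A X u) p"
      using arc_two[of "\<kappa> - X u" "X v - \<kappa>" "slot_pt A X u"] \<kappa>u False go_meet[of A X u v "X v - \<kappa>"]
      by (simp add: a_def segs' p_def \<kappa>_def)
    have arcv: "p \<noteq> slot_pt A X v \<Longrightarrow> arc_from_to r \<alpha> (a (slot_pt A X v)) (slot_pt A X v) p"
      using pv by simp
    note J = sweep_join[OF inv u(2) v(2) v(3)[symmetric] keys fut y refl refl p_def arcu arcv]
    have "Q s2 (t + 7)"
    proof (rule Q)
      show "same_but ?U ?V s s2" by (simp add: same_but_def s2_def s1_def)
      show "rmem s2 ''X'' i = X i" if "i \<noteq> v" for i by (simp add: X2)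
      show "sweep_inv ts k A X0 (Act - {u}) Fut (rmem s2 ''X'') (connect {slot_pt A X u, slot_pt A X v} p a F) (X v)"
        using J(1) by (simp add: X2)
      show "arcs_format s2" using fmt by (simp add: arcs_format_def s2_def s1_def)
      have "table N (out_node s) (nmem s ''nd'') (nmem s2 ''parent'') (segs s2)
          (slot_pt A X) (Act - {u}) Fut (connect {slot_pt A X u, slot_pt A X v} (slot_pt A X v) a F)"
        by (rule table_join_old[OF tb[folded N_def] u(2) v(2) Suv inj])
          (use segs' in \<open>auto simp: s2_def s1_def e_def f_def a_def\<close>)
      moreover have "out_node s2 = out_node s" "nmem s2 ''nodes'' 0 = N" "nmem s2 ''nd'' = nmem s ''nd''"
        using pieces[of s2] by (simp_all add: s2_def s1_def N_def)
      ultimately show "table (nmem s2 ''nodes'' 0) (out_node s2) (nmem s2 ''nd'') (nmem s2 ''parent'') (segs s2)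
          (slot_pt A (rmem s2 ''X'')) (Act - {u}) Fut (connect {slot_pt A X u, slot_pt A X v} p a F)"
        by (simp add: X2 pv)
    qed simp
    then show ?thesis
      using False unfolding load connect_tail_prog_def Let_def wp_Seq wp_NSet wp_RSet wp_Cond
      by (simp add: s1v s2_def numeral_eq_Suc)
  qed
qed

lemma pickE:
  assumes "pick R S v"
  obtains (empty) "v = 0" "S = {}" | (pick) i where "i \<in> S" "v = Suc i" "\<And>t. t \<in> S \<Longrightarrow> R i t"
  using assms unfolding pick_def by blast

definition sweep_state :: "complex list \<Rightarrow> nat \<Rightarrow> nat \<Rightarrow> (nat \<Rightarrow> real) \<Rightarrow> (nat \<Rightarrow> real) \<Rightarrow> nat set \<Rightarrow> nat set \<Rightarrow>
    forest \<Rightarrow> real \<Rightarrow> mem \<Rightarrow> bool" where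
  "sweep_state ts h k A X0 Act Fut F L s \<longleftrightarrow> consts_ok h k A s \<and>
     sweep_inv ts k A X0 Act Fut (rmem s ''X'') F L \<and>
     keys_state h k A X0 Act Fut {} s \<and> links k (nmem s ''nx'') (nmem s ''pv'') Act \<and>
     table (nmem s ''nodes'' 0) (out_node s) (nmem s ''nd'') (nmem s ''parent'') (segs s)
       (slot_pt A (rmem s ''X'')) Act Fut F \<and> arcs_format s"

lemma keys_state_root:
  assumes ks: "keys_state h k A X0 Act Fut {} s" and sub: "Act \<union> Fut \<subseteq> {..<k}"
  shows "nmem s ''w'' 1 = 0 \<and> Fut = {} \<and> (\<forall>i\<in>Act. nmem s ''nx'' i = i) \<or>
    (\<exists>i. nmem s ''w'' 1 = Suc i \<and> i \<in> Fut \<union> {i \<in> Act. nmem s ''nx'' i \<noteq> i} \<and>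
      (\<forall>t\<in>Fut \<union> {t \<in> Act. nmem s ''nx'' t \<noteq> t}.
        rmem s ''K'' i < rmem s ''K'' t \<or> rmem s ''K'' i = rmem s ''K'' t \<and> i \<le> t))"
proof -
  obtain D where tr: "trees h (rmem s ''K'') (rmem s ''L'') (nmem s ''w'') (nmem s ''b'') D Act"
    and D: "\<And>i. i \<in> D \<longleftrightarrow> i \<in> Fut \<or> (i \<in> Act \<and> nmem s ''nx'' i \<noteq> i)"
    and L: "\<And>i. i < k \<Longrightarrow> rmem s ''L'' i = 0"
    using ks unfolding keys_state_def by blast
  have eq: "D = Fut \<union> {t \<in> Act. nmem s ''nx'' t \<noteq> t}" using D by blast
  then have L0: "rmem s ''L'' t = 0" if "t \<in> D" for t using that sub L by blast
  from trees_root(1)[OF tr] show ?thesis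
  proof (cases rule: pickE)
    case empty
    then have "Fut = {}" "\<forall>i\<in>Act. nmem s ''nx'' i = i" unfolding eq by auto
    then show ?thesis using empty(1) by simp
  next
    case (pick i)
    have "rmem s ''K'' i < rmem s ''K'' t \<or> rmem s ''K'' i = rmem s ''K'' t \<and> i \<le> t" if "t \<in> D" for t
      using pick(3)[OF that] L0[OF that] L0[OF pick(1)] by (simp add: lexle_def)
    then show ?thesis using pick(1,2) unfolding eq by (intro disjI2 exI[of _ i]) simp
  qed
qed

lemma keys_state_values:
  assumes "keys_state h k A X0 Act Fut {} s"
  shows "\<And>i. i \<in> Fut \<Longrightarrow> rmem s ''K'' i = X0 i"
    "\<And>i. i \<in> Act \<Longrightarrow> nmem s ''nx'' i \<noteq> i \<Longrightarrow> rmem s ''K'' i = meet A (rmem s ''X'') i (nmem s ''nx'' i)"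
  using assms unfolding keys_state_def by blast+

lemma wp_join:
  assumes st: "sweep_state ts h k A X0 Act Fut F L s" and u: "u \<in> Act"
    and root: "nmem s ''s'' 0 = u" "nmem s ''nx'' u \<noteq> u"
    and min: "\<And>t. t \<in> Fut \<union> {t \<in> Act. nmem s ''nx'' t \<noteq> t} \<Longrightarrow> rmem s ''K'' u \<le> rmem s ''K'' t"
    and Q: "\<And>s' t' F' L'. \<lbrakk>t' \<le> t + 24 * h + 50; sweep_state ts h k A X0 (Act - {u}) Fut F' L' s'\<rbrakk> \<Longrightarrow> Q s' t'"
  shows "wp join_prog Q s t"
proof -
  let ?X = "rmem s ''X''"
  define v where "v = nmem s ''nx'' u"
  note S = st[unfolded sweep_state_def]
  have c: "consts_ok h k A s" and inv: "sweep_inv ts k A X0 Act Fut ?X F L"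
    and ks: "keys_state h k A X0 Act Fut {} s" and ln: "links k (nmem s ''nx'') (nmem s ''pv'') Act"
    and tb: "table (nmem s ''nodes'' 0) (out_node s) (nmem s ''nd'') (nmem s ''parent'') (segs s)
       (slot_pt A ?X) Act Fut F" and fmt: "arcs_format s"
    using S by blast+
  note I = sweep_invD[OF inv]
  have v: "v \<in> Act" "v \<noteq> u" using linksD(2)[OF ln u] root by (auto simp: v_def)
  note Kv = keys_state_values[OF ks]
  have Ku: "rmem s ''K'' u = meet A ?X u v" using Kv(2)[OF u root(2)] by (simp add: v_def)
  \<comment> \<open>The meeting of \<open>i\<close> and \<open>j\<close> is no earlier than that of
    \<open>i\<close> and its successor, whose time is a key in the tournament.\<close>
  have keys: "meet A ?X u v \<le> meet A ?X i j" if "i \<in> Act" "j \<in> Act" "i \<noteq> j" for i j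
  proof -
    note n = meet_next_le(1)[OF I(1) ln that] meet_next_le(2)[OF I(1) ln that, of ?X]
    have "rmem s ''K'' u \<le> rmem s ''K'' i" using min that n(1) by blast
    then show ?thesis using Ku Kv(2)[OF that(1) n(1)] n(2) by simp
  qed
  have fut: "meet A ?X u v \<le> X0 i" if "i \<in> Fut" for i
    using min[of i] that Kv(1)[OF that] Ku by simp
  define s1 where "s1 = setn ''v'' 0 v (setn ''u'' 0 u s)"
  have same1: "same_but {''u'', ''v''} {} s s1" by (simp add: same_but_def s1_def)
  have same: "rmem s1 = rmem s" "out_node s1 = out_node s" "segs s1 = segs s"
    "nmem s1 ''nodes'' = nmem s ''nodes''" "nmem s1 ''nd'' = nmem s ''nd''" "nmem s1 ''parent'' = nmem s ''parent''"
    "nmem s1 ''nx'' = nmem s ''nx''" "nmem s1 ''pv'' = nmem s ''pv''" "nmem s1 ''w'' = nmem s ''w''" "nmem s1 ''b'' = nmem s ''b''"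
    by (auto simp: s1_def out_node_def segs_def fun_eq_iff)
  have "wp connect_prog (wp unlink_prog Q) s1 (t + 2)"
  proof (rule wp_connect)
    show "consts_ok h k A s1" by (rule consts_ok_same[OF c same1]) auto
    show "sweep_inv ts k A X0 Act Fut (rmem s1 ''X'') F L" using inv by (simp add: same)
    show "table (nmem s1 ''nodes'' 0) (out_node s1) (nmem s1 ''nd'') (nmem s1 ''parent'') (segs s1)
       (slot_pt A (rmem s1 ''X'')) Act Fut F" using tb by (simp add: same)
    show "arcs_format s1" using fmt by (simp add: arcs_format_def s1_def)
    show "nmem s1 ''u'' 0 = u" "u \<in> Act" "nmem s1 ''v'' 0 = v" "v \<in> Act" "v \<noteq> u"
      using u v by (simp_all add: s1_def)
    show "rmem s1 ''K'' u = meet A (rmem s1 ''X'') u v" using Ku by (simp add: same)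
    show "meet A (rmem s1 ''X'') u v \<le> meet A (rmem s1 ''X'') i j" if "i \<in> Act" "j \<in> Act" "i \<noteq> j" for i j
      using keys that by (simp add: same)
    show "meet A (rmem s1 ''X'') u v \<le> X0 i" if "i \<in> Fut" for i using fut that by (simp add: same)
    fix s2 t2 F' L'
    assume t2: "t2 \<le> t + 2 + 18"
      and same2: "same_but {''e'', ''f'', ''parent'', ''i'', ''nd'', ''nodes'', ''arc'', ''left''}
        {''c'', ''param'', ''X'', ''nodex'', ''nodey''} s1 s2"
      and X2: "\<And>i. i \<noteq> v \<Longrightarrow> rmem s2 ''X'' i = rmem s1 ''X'' i"
      and inv2: "sweep_inv ts k A X0 (Act - {u}) Fut (rmem s2 ''X'') F' L'"
      and tb2: "table (nmem s2 ''nodes'' 0) (out_node s2) (nmem s2 ''nd'') (nmem s2 ''parent'') (segs s2)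
        (slot_pt A (rmem s2 ''X'')) (Act - {u}) Fut F'" and fmt2: "arcs_format s2"
    have c2: "consts_ok h k A s2"
      by (rule consts_ok_same[OF c same_but_chain[OF same1 same2 order_refl order_refl]]) auto
    have e2: "rmem s2 ''K'' = rmem s ''K''" "rmem s2 ''L'' = rmem s ''L''" "nmem s2 ''w'' = nmem s ''w''"
      "nmem s2 ''b'' = nmem s ''b''" "nmem s2 ''nx'' = nmem s ''nx''" "nmem s2 ''pv'' = nmem s ''pv''"
      "nmem s2 ''u'' 0 = u" "nmem s2 ''v'' 0 = v"
      using same2 by (simp_all add: same_but_def s1_def)
    have "v \<notin> Fut" using v I(4) by auto
    \<comment> \<open>Only the time of \<open>v\<close> has changed, and it enters no key but that
      of \<open>v\<close>; other nodes meet the slot of \<open>v\<close> at the same times as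
      before.\<close>
    have mX: "meet A (rmem s2 ''X'') i j = meet A ?X i j" if "i \<noteq> v" for i j
      using X2[OF that] by (simp add: meet_def same)
    have ks2: "keys_state h k A X0 Act Fut {v} s2"
      using ks unfolding keys_state_def e2 by (auto simp: mX)
    show "wp unlink_prog Q s2 t2"
    proof (rule wp_unlink[OF c2 ks2])
      show "links k (nmem s2 ''nx'') (nmem s2 ''pv'') Act" using ln by (simp add: e2)
      fix s3 t3
      assume t3: "t3 \<le> t2 + 24 * h + 28"
        and same3: "same_but {''p'', ''nx'', ''pv'', ''i'', ''b'', ''w'', ''j'', ''q''} {''d'', ''K''} s2 s3"
        and ks3: "keys_state h k A X0 (Act - {u}) Fut {} s3"
        and ln3: "links k (nmem s3 ''nx'') (nmem s3 ''pv'') (Act - {u})"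
      have e3: "rmem s3 ''X'' = rmem s2 ''X''" "out_node s3 = out_node s2" "segs s3 = segs s2"
        "nmem s3 ''nodes'' = nmem s2 ''nodes''" "nmem s3 ''nd'' = nmem s2 ''nd''" "nmem s3 ''parent'' = nmem s2 ''parent''"
        "arcs_format s3 = arcs_format s2"
        using same3 by (auto simp: same_but_def out_node_def segs_def arcs_format_def fun_eq_iff)
      have c3: "consts_ok h k A s3" by (rule consts_ok_same[OF c2 same3]) auto
      show "Q s3 t3"
        by (rule Q[where F' = F' and L' = L'])
          (use t2 t3 c3 inv2 tb2 fmt2 ks3 ln3 in \<open>simp_all add: sweep_state_def e3\<close>)
    qed (use e2 u v I(4) v_def in auto)
  qed
  then show ?thesis
    unfolding join_prog_def wp_Seq wp_NSet using root by (simp add: s1_def v_def numeral_eq_Suc)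
qed

end

definition event_prog :: prog where
  "event_prog =
    (nset ''s'' (npred (ne ''w'' (NConst 1))) ;;
     Cond (NEq (ne ''b'' (NAdd (nv ''m'') (nv ''s''))) (NConst 0)) insert_prog join_prog)"

definition loop_prog :: prog where
  "loop_prog = While (TNot (NEq (ne ''w'' (NConst 1)) (NConst 0))) event_prog"

context spiral_geometry
begin

lemma sweep_stateD:
  assumes "sweep_state ts h k A X0 Act Fut F L s"
  shows "consts_ok h k A s" "sweep_inv ts k A X0 Act Fut (rmem s ''X'') F L"
    "keys_state h k A X0 Act Fut {} s" "links k (nmem s ''nx'') (nmem s ''pv'') Act"
    "table (nmem s ''nodes'' 0) (out_node s) (nmem s ''nd'') (nmem s ''parent'') (segs s)
       (slot_pt A (rmem s ''X'')) Act Fut F" "arcs_format s"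
  using assms unfolding sweep_state_def by blast+

lemma sweep_state_same:
  assumes st: "sweep_state ts h k A X0 Act Fut F L s" and same: "same_but U {} s s'"
    and U: "U \<inter> {''m'', ''w'', ''b'', ''nx'', ''pv'', ''nodes'', ''nd'', ''parent'', ''arc'', ''left'', ''unbounded''} = {}"
  shows "sweep_state ts h k A X0 Act Fut F L s'"
proof -
  have r: "rmem s' = rmem s" using same by (auto simp: same_but_def)
  have n: "nmem s' x = nmem s x" if "x \<in> {''m'', ''w'', ''b'', ''nx'', ''pv'', ''nodes'', ''nd'', ''parent'', ''arc'', ''left'', ''unbounded''}" for x
    using same U that unfolding same_but_def by blast
  have o: "out_node s' = out_node s" "segs s' = segs s"
    by (auto simp: out_node_def segs_def r fun_eq_iff)
  have "consts_ok h k A s' = consts_ok h k A s" "keys_state h k A X0 Act Fut {} s' = keys_state h k A X0 Act Fut {} s"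
    "arcs_format s' = arcs_format s"
    by (simp_all add: consts_ok_def keys_state_def arcs_format_def r n)
  then show ?thesis using st unfolding sweep_state_def by (simp add: r n o)
qed

lemma insert_facts:
  assumes st: "sweep_state ts h k A X0 Act Fut F L s" and x: "x \<in> Fut"
    and min: "\<And>t. t \<in> Fut \<union> {t \<in> Act. nmem s ''nx'' t \<noteq> t} \<Longrightarrow>
      rmem s ''K'' x < rmem s ''K'' t \<or> rmem s ''K'' x = rmem s ''K'' t \<and> x \<le> t"
  shows "\<And>i. i \<in> Fut \<Longrightarrow> X0 x < X0 i \<or> X0 x = X0 i \<and> x \<le> i"
    "\<And>i j. i \<in> Act \<Longrightarrow> j \<in> Act \<Longrightarrow> i \<noteq> j \<Longrightarrow> X0 x \<le> meet A (rmem s ''X'') i j"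
proof -
  note S = sweep_stateD[OF st]
  note Kv = keys_state_values[OF S(3)]
  show "X0 x < X0 i \<or> X0 x = X0 i \<and> x \<le> i" if "i \<in> Fut" for i
    using min[of i] that Kv(1)[OF x] Kv(1)[OF that] by simp
  fix i j assume ij: "i \<in> Act" "j \<in> Act" "i \<noteq> j"
  note n = meet_next_le(1)[OF sweep_invD(1)[OF S(2)] S(4) ij]
    meet_next_le(2)[OF sweep_invD(1)[OF S(2)] S(4) ij, of "rmem s ''X''"]
  have "i \<in> Fut \<union> {t \<in> Act. nmem s ''nx'' t \<noteq> t}" using ij n(1) by simp
  from min[OF this] have "rmem s ''K'' x \<le> rmem s ''K'' i" by auto
  then show "X0 x \<le> meet A (rmem s ''X'') i j" using Kv(1)[OF x] Kv(2)[OF ij(1) n(1)] n(2) by simp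
qed

lemma table_newnode:
  fixes s s' :: mem
  defines "N \<equiv> nmem s ''nodes'' 0"
  assumes tb: "table N (out_node s) (nmem s ''nd'') (nmem s ''parent'') (segs s) (slot_pt A (rmem s ''X'')) Act Fut F"
    and inv: "sweep_inv ts k A X0 Act Fut (rmem s ''X'') F L" and x: "x \<in> Fut"
    and new: "\<And>j. j \<in> Act \<Longrightarrow> slot_pt A (rmem s ''X'') j \<noteq> slot_pt A (rmem s ''X'') x"
    and same: "same_but {''nd'', ''nodes'', ''arc'', ''left''} {''nodex'', ''nodey''} s s'"
    and s': "nmem s' ''nodes'' 0 = Suc N" "nmem s' ''nd'' = (nmem s ''nd'')(x := N)"
      "\<And>j. j \<noteq> N \<Longrightarrow> out_node s' j = out_node s j" "out_node s' N = slot_pt A (rmem s ''X'') x"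
  shows "table (nmem s' ''nodes'' 0) (out_node s') (nmem s' ''nd'') (nmem s' ''parent'') (segs s')
    (slot_pt A (rmem s' ''X'')) (insert x Act) (Fut - {x}) F"
proof -
  note I = sweep_invD[OF inv]
  have e: "nmem s' ''parent'' = nmem s ''parent''" "segs s' = segs s" "rmem s' ''X'' = rmem s ''X''"
    using same by (auto simp: same_but_def segs_def fun_eq_iff)
  have "slot_pt A (rmem s ''X'') x \<in> active F - {r}" unfolding I(6) using x by blast
  then have none: "up F (slot_pt A (rmem s ''X'') x) = None" "slot_pt A (rmem s ''X'') x \<noteq> r"
    by (auto simp: active_def)
  have "x \<notin> Act" using x I(4) by blast
  moreover have "slot_pt A (rmem s ''X'') x \<notin> slot_pt A (rmem s ''X'') ` Act" using new by force
  ultimately show ?thesis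
    unfolding s'(1) e
    using s' by (intro table_insert[OF tb x _ none]) auto
qed

lemma wp_insert_first:
  assumes st: "sweep_state ts h k A X0 Act Fut F L s" and x: "x \<in> Fut" "nmem s ''s'' 0 = x" and e: "Act = {}"
    and min: "\<And>t. t \<in> Fut \<union> {t \<in> Act. nmem s ''nx'' t \<noteq> t} \<Longrightarrow>
      rmem s ''K'' x < rmem s ''K'' t \<or> rmem s ''K'' x = rmem s ''K'' t \<and> x \<le> t"
    and Q: "\<And>s' t'. \<lbrakk>t' \<le> t + 8 * h + 20; sweep_state ts h k A X0 (insert x Act) (Fut - {x}) F (X0 x) s'\<rbrakk> \<Longrightarrow> Q s' t'"
  shows "wp insert_first_prog Q s t"
proof -
  note S = sweep_stateD[OF st]
  note I = sweep_invD[OF S(2)]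
  note IF = insert_facts[OF st x(1) min]
  obtain D where tr: "trees h (rmem s ''K'') (rmem s ''L'') (nmem s ''w'') (nmem s ''b'') D Act"
    and D: "\<And>i. i \<in> D \<longleftrightarrow> i \<in> Fut \<or> (i \<in> Act \<and> nmem s ''nx'' i \<noteq> i)"
    and K: "\<And>i. i \<in> Fut \<Longrightarrow> rmem s ''K'' i = X0 i" "\<And>i. i < k \<Longrightarrow> rmem s ''L'' i = 0"
    using S(3) unfolding keys_state_def by blast
  have xk: "x < k" using x I(3) by auto
  have xh: "x < 2 ^ h" using xk S(1) by (simp add: consts_ok_def)
  define s1 where "s1 = setn ''i'' 0 x (setn ''pv'' x x (setn ''nx'' x x s))"
  have same1: "same_but {''i'', ''pv'', ''nx''} {} s s1" by (simp add: same_but_def s1_def)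
  have c1: "consts_ok h k A s1" by (rule consts_ok_same[OF S(1) same1]) auto
  have e1: "rmem s1 = rmem s" "out_node s1 = out_node s" "segs s1 = segs s"
    "nmem s1 ''nodes'' = nmem s ''nodes''" "nmem s1 ''nd'' = nmem s ''nd''" "nmem s1 ''parent'' = nmem s ''parent''"
    "nmem s1 ''w'' = nmem s ''w''" "nmem s1 ''b'' = nmem s ''b''" "nmem s1 ''i'' 0 = x" "nmem s1 ''s'' 0 = x"
    "nmem s1 ''m'' 0 = 2 ^ h"
    using x S(1) by (auto simp: s1_def out_node_def segs_def fun_eq_iff consts_ok_def)
  have inv': "sweep_inv ts k A X0 (insert x Act) (Fut - {x}) (rmem s ''X'') F (X0 x)"
    by (rule sweep_insert[OF S(2) x(1) IF]) (auto simp: e)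
  let ?leaf = "NAdd (nv ''m'') (nv ''s'')"
  have "wp newnode_prog (wp (NSet ''b'' ?leaf (nsuc (nv ''s'')) ;; NSet ''w'' ?leaf (NConst 0) ;; fix_prog) Q) s1 (t + 3)"
  proof (rule wp_newnode[OF c1])
    fix s2
    assume same2: "same_but {''nd'', ''nodes'', ''arc'', ''left''} {''nodex'', ''nodey''} s1 s2"
      and n2: "nmem s2 ''nodes'' 0 = Suc (nmem s1 ''nodes'' 0)"
        "nmem s2 ''nd'' = (nmem s1 ''nd'')(nmem s1 ''i'' 0 := nmem s1 ''nodes'' 0)"
        "\<And>j. j \<noteq> nmem s1 ''nodes'' 0 \<Longrightarrow> out_node s2 j = out_node s1 j"
        "out_node s2 (nmem s1 ''nodes'' 0) = slot_pt A (rmem s1 ''X'') (nmem s1 ''i'' 0)"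
      and fmt2: "arcs_format s1 \<Longrightarrow> arcs_format s2"
    have tb2: "table (nmem s2 ''nodes'' 0) (out_node s2) (nmem s2 ''nd'') (nmem s2 ''parent'') (segs s2)
        (slot_pt A (rmem s2 ''X'')) (insert x Act) (Fut - {x}) F"
      by (rule table_newnode[of s1, OF _ _ x(1) _ same2]) (use S(2,5) n2 e in \<open>simp_all add: e1\<close>)
    have e2: "nmem s2 ''s'' 0 = x" "nmem s2 ''m'' 0 = 2 ^ h" "nmem s2 ''w'' = nmem s ''w''" "nmem s2 ''b'' = nmem s ''b''"
      "rmem s2 ''K'' = rmem s ''K''" "rmem s2 ''L'' = rmem s ''L''" "rmem s2 ''X'' = rmem s ''X''"
      using same2 e1 by (auto simp: same_but_def)
    have fmt: "arcs_format s2" by (rule fmt2) (use S(6) in \<open>simp add: arcs_format_def s1_def\<close>)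
    define s3 where "s3 = setn ''w'' (2 ^ h + x) 0 (setn ''b'' (2 ^ h + x) (Suc x) s2)"
    have "wp fix_prog Q s3 (t + 3 + 6 + 2)"
    proof (rule wp_leaf_fix[OF tr, where D' = "D - {x}" and B' = "insert x Act"])
      show "nmem s3 ''m'' 0 = 2 ^ h" by (simp add: s3_def e2)
      show "nmem s3 ''i'' 0 = x" using same2 e1 by (simp add: s3_def same_but_def)
      fix s4 t4
      assume t4: "t4 \<le> t + 3 + 6 + 2 + 8 * h + 2" and same4: "same_but {''j'', ''w'', ''b''} {} s3 s4"
        and tr4: "trees h (rmem s3 ''K'') (rmem s3 ''L'') (nmem s4 ''w'') (nmem s4 ''b'') (D - {x}) (insert x Act)"
      have e4: "rmem s4 = rmem s2" "nmem s4 ''nx'' = (nmem s ''nx'')(x := x)" "nmem s4 ''pv'' = (nmem s ''pv'')(x := x)"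
        using same4 same2 by (auto simp: same_but_def s3_def s1_def)
      have o4: "out_node s4 = out_node s2" "segs s4 = segs s2" "nmem s4 ''nodes'' = nmem s2 ''nodes''"
        "nmem s4 ''nd'' = nmem s2 ''nd''" "nmem s4 ''parent'' = nmem s2 ''parent''" "arcs_format s4 = arcs_format s2"
        using same4 by (auto simp: same_but_def s3_def out_node_def segs_def fun_eq_iff arcs_format_def)
      have c4: "consts_ok h k A s4"
        by (rule consts_ok_same[OF c1, of "{''nd'', ''nodes'', ''arc'', ''left'', ''j'', ''w'', ''b''}" "{''nodex'', ''nodey''}"])
          (use same2 same4 in \<open>auto simp: same_but_def s3_def\<close>)
      have ks4: "keys_state h k A X0 (insert x Act) (Fut - {x}) {} s4"
        unfolding keys_state_def
      proof (intro exI[of _ "D - {x}"] conjI)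
        show "trees h (rmem s4 ''K'') (rmem s4 ''L'') (nmem s4 ''w'') (nmem s4 ''b'') (D - {x}) (insert x Act)"
          using tr4 by (simp add: e4 s3_def)
      qed (use D K e in \<open>auto simp: e4 e2\<close>)
      have ln4: "links k (nmem s4 ''nx'') (nmem s4 ''pv'') (insert x Act)"
        unfolding e using links_single[OF xk] by (simp add: e4)
      show "Q s4 t4"
        by (rule Q) (use t4 c4 ks4 ln4 tb2 inv' fmt in \<open>simp_all add: sweep_state_def e4 e2 o4\<close>)
    qed (use xh e in \<open>auto simp: s3_def e2\<close>)
    then show "wp (NSet ''b'' ?leaf (nsuc (nv ''s'')) ;; NSet ''w'' ?leaf (NConst 0) ;; fix_prog) Q s2 (t + 3 + 6)"
      unfolding wp_Seq wp_NSet by (simp add: e2 s3_def)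
  qed
  then show ?thesis
    unfolding insert_first_prog_def Let_def wp_Seq wp_NSet using x by (simp add: s1_def numeral_eq_Suc)
qed

lemma wp_drop:
  assumes st: "sweep_state ts h k A X0 Act Fut F L s" and x: "x \<in> Fut" "nmem s ''s'' 0 = x"
    and min: "\<And>t. t \<in> Fut \<union> {t \<in> Act. nmem s ''nx'' t \<noteq> t} \<Longrightarrow>
      rmem s ''K'' x < rmem s ''K'' t \<or> rmem s ''K'' x = rmem s ''K'' t \<and> x \<le> t"
    and u: "u \<in> Act" "slot_pt A (rmem s ''X'') u = slot_pt A (rmem s ''X'') x"
    and Q: "\<And>s' t'. \<lbrakk>t' \<le> t + 8 * h + 4; sweep_state ts h k A X0 Act (Fut - {x}) F L s'\<rbrakk> \<Longrightarrow> Q s' t'"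
  shows "wp drop_prog Q s t"
proof -
  note S = sweep_stateD[OF st]
  note I = sweep_invD[OF S(2)]
  note IF = insert_facts[OF st x(1) min]
  obtain D where tr: "trees h (rmem s ''K'') (rmem s ''L'') (nmem s ''w'') (nmem s ''b'') D Act"
    and D: "\<And>i. i \<in> D \<longleftrightarrow> i \<in> Fut \<or> (i \<in> Act \<and> nmem s ''nx'' i \<noteq> i)"
    and K: "\<And>i. i \<in> Fut \<Longrightarrow> rmem s ''K'' i = X0 i" 
      "\<And>i. i \<in> Act \<Longrightarrow> nmem s ''nx'' i \<noteq> i \<Longrightarrow> rmem s ''K'' i = meet A (rmem s ''X'') i (nmem s ''nx'' i)"
      "\<And>i. i < k \<Longrightarrow> rmem s ''L'' i = 0"
    using S(3) unfolding keys_state_def by blast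
  have xk: "x < k" "x \<notin> Act" using x I(3,4) by auto
  have xh: "x < 2 ^ h" and m: "nmem s ''m'' 0 = 2 ^ h" using xk S(1) by (simp_all add: consts_ok_def)
  have bx: "nmem s ''b'' (2 ^ h + x) = 0" using trees_leaf_value(2)[OF tr xh] xk by simp
  define s1 where "s1 = setn ''w'' (2 ^ h + x) 0 (setn ''i'' 0 x s)"
  have inv': "sweep_inv ts k A X0 Act (Fut - {x}) (rmem s ''X'') F L"
    by (rule sweep_drop[OF S(2) x(1) IF(1) u])
  have tb': "table (nmem s ''nodes'' 0) (out_node s) (nmem s ''nd'') (nmem s ''parent'') (segs s)
       (slot_pt A (rmem s ''X'')) Act (Fut - {x}) F"
    by (rule table_drop[OF S(5) u])
  have "wp fix_prog Q s1 (t + 2)"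
  proof (rule wp_leaf_fix[OF tr, where D' = "D - {x}" and B' = Act])
    show "nmem s1 ''b'' = (nmem s ''b'')(2 ^ h + x := (if x \<in> Act then Suc x else 0))"
      using bx xk by (auto simp: s1_def)
    fix s4 t4
    assume t4: "t4 \<le> t + 2 + 8 * h + 2" and same4: "same_but {''j'', ''w'', ''b''} {} s1 s4"
      and tr4: "trees h (rmem s1 ''K'') (rmem s1 ''L'') (nmem s4 ''w'') (nmem s4 ''b'') (D - {x}) Act"
    have e4: "rmem s4 = rmem s" "nmem s4 ''nx'' = nmem s ''nx''" "nmem s4 ''pv'' = nmem s ''pv''"
      "out_node s4 = out_node s" "segs s4 = segs s" "nmem s4 ''nodes'' = nmem s ''nodes''"
      "nmem s4 ''nd'' = nmem s ''nd''" "nmem s4 ''parent'' = nmem s ''parent''" "arcs_format s4 = arcs_format s"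
      using same4 by (auto simp: same_but_def s1_def out_node_def segs_def fun_eq_iff arcs_format_def)
    have c4: "consts_ok h k A s4"
      by (rule consts_ok_same[OF S(1), of "{''i'', ''j'', ''w'', ''b''}" "{}"])
        (use same4 in \<open>auto simp: same_but_def s1_def\<close>)
    have ks4: "keys_state h k A X0 Act (Fut - {x}) {} s4"
      unfolding keys_state_def
    proof (intro exI[of _ "D - {x}"] conjI)
      show "trees h (rmem s4 ''K'') (rmem s4 ''L'') (nmem s4 ''w'') (nmem s4 ''b'') (D - {x}) Act"
        using tr4 by (simp add: e4 s1_def)
    qed (use D K xk in \<open>auto simp: e4\<close>)
    show "Q s4 t4"
      by (rule Q) (use t4 c4 ks4 S(4,6) inv' tb' in \<open>simp_all add: sweep_state_def e4\<close>)
  qed (use xh m in \<open>auto simp: s1_def\<close>)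
  then show ?thesis
    unfolding drop_prog_def wp_Seq wp_NSet using x m by (simp add: s1_def)
qed

lemma wp_insert_after:
  assumes st: "sweep_state ts h k A X0 Act Fut F L s" and x: "x \<in> Fut" "nmem s ''s'' 0 = x"
    and min: "\<And>t. t \<in> Fut \<union> {t \<in> Act. nmem s ''nx'' t \<noteq> t} \<Longrightarrow>
      rmem s ''K'' x < rmem s ''K'' t \<or> rmem s ''K'' x = rmem s ''K'' t \<and> x \<le> t"
    and u: "cyclic_pred Act x u" "nmem s ''u'' 0 = u"
    and new: "\<And>j. j \<in> Act \<Longrightarrow> slot_pt A (rmem s ''X'') j \<noteq> slot_pt A (rmem s ''X'') x"
    and Q: "\<And>s' t'. \<lbrakk>t' \<le> t + 24 * h + 40; sweep_state ts h k A X0 (insert x Act) (Fut - {x}) F (X0 x) s'\<rbrakk> \<Longrightarrow> Q s' t'"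
  shows "wp insert_after_prog Q s t"
proof -
  let ?U = "{''i'', ''pv'', ''nx'', ''v''}"
  let ?W = "{''i'', ''pv'', ''nx'', ''v'', ''nd'', ''nodes'', ''arc'', ''left'', ''j'', ''w'', ''b''}"
  note S = sweep_stateD[OF st]
  note I = sweep_invD[OF S(2)]
  note IF = insert_facts[OF st x(1) min]
  obtain D where tr: "trees h (rmem s ''K'') (rmem s ''L'') (nmem s ''w'') (nmem s ''b'') D Act"
    and D: "\<And>i. i \<in> D \<longleftrightarrow> i \<in> Fut \<or> (i \<in> Act \<and> nmem s ''nx'' i \<noteq> i)"
    and K: "\<And>i. i \<in> Fut \<Longrightarrow> rmem s ''K'' i = X0 i"
      "\<And>i. i \<in> Act \<Longrightarrow> nmem s ''nx'' i \<noteq> i \<Longrightarrow> rmem s ''K'' i = meet A (rmem s ''X'') i (nmem s ''nx'' i)"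
      "\<And>i. i < k \<Longrightarrow> rmem s ''L'' i = 0"
    using S(3) unfolding keys_state_def by blast
  have xk: "x < k" "x \<notin> Act" using x I(3,4) by auto
  have xh: "x < 2 ^ h" using xk S(1) by (simp add: consts_ok_def)
  have ua: "u \<in> Act" "u \<noteq> x" "u \<notin> Fut" using u xk I(4) by (auto simp: cyclic_pred_def)
  define v where "v = nmem s ''nx'' u"
  have va: "v \<noteq> x" using linksD(2)[OF S(4) ua(1)] xk by (auto simp: v_def)
  define s1 where "s1 = setn ''i'' 0 x (setn ''pv'' v x (setn ''nx'' x v (setn ''pv'' x u (setn ''nx'' u x (setn ''v'' 0 v s)))))"
  have same1: "same_but ?U {} s s1" by (simp add: same_but_def s1_def)
  have c1: "consts_ok h k A s1" by (rule consts_ok_same[OF S(1) same1]) auto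
  have e1: "rmem s1 = rmem s" "out_node s1 = out_node s" "segs s1 = segs s"
    "nmem s1 ''nodes'' = nmem s ''nodes''" "nmem s1 ''nd'' = nmem s ''nd''" "nmem s1 ''parent'' = nmem s ''parent''"
    "nmem s1 ''w'' = nmem s ''w''" "nmem s1 ''b'' = nmem s ''b''" "nmem s1 ''i'' 0 = x" "nmem s1 ''s'' 0 = x"
    "nmem s1 ''m'' 0 = 2 ^ h" "nmem s1 ''u'' 0 = u" "nmem s1 ''nx'' = (nmem s ''nx'')(u := x, x := v)"
    using x u S(1) by (auto simp: s1_def out_node_def segs_def fun_eq_iff consts_ok_def)
  have ln1: "links k (nmem s1 ''nx'') (nmem s1 ''pv'') (insert x Act)"
    by (rule links_insert[OF S(4) xk u(1) v_def]) (use va ua in \<open>auto simp: s1_def\<close>)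
  have inv': "sweep_inv ts k A X0 (insert x Act) (Fut - {x}) (rmem s ''X'') F (X0 x)"
    by (rule sweep_insert[OF S(2) x(1) IF new])
  let ?leaf = "NAdd (nv ''m'') (nv ''s'')"
  let ?P4 = "nset ''i'' (nv ''s'') ;; setkey_prog"
  let ?P3 = "nset ''i'' (nv ''u'') ;; setkey_prog ;; ?P4"
  let ?P2 = "NSet ''b'' ?leaf (nsuc (nv ''s'')) ;; fix_prog ;; ?P3"
  have "wp newnode_prog (wp ?P2 Q) s1 (t + 6)"
  proof (rule wp_newnode[OF c1])
    fix s2
    assume same2: "same_but {''nd'', ''nodes'', ''arc'', ''left''} {''nodex'', ''nodey''} s1 s2"
      and n2: "nmem s2 ''nodes'' 0 = Suc (nmem s1 ''nodes'' 0)"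
        "nmem s2 ''nd'' = (nmem s1 ''nd'')(nmem s1 ''i'' 0 := nmem s1 ''nodes'' 0)"
        "\<And>j. j \<noteq> nmem s1 ''nodes'' 0 \<Longrightarrow> out_node s2 j = out_node s1 j"
        "out_node s2 (nmem s1 ''nodes'' 0) = slot_pt A (rmem s1 ''X'') (nmem s1 ''i'' 0)"
      and fmt2: "arcs_format s1 \<Longrightarrow> arcs_format s2"
    have tb2: "table (nmem s2 ''nodes'' 0) (out_node s2) (nmem s2 ''nd'') (nmem s2 ''parent'') (segs s2)
        (slot_pt A (rmem s2 ''X'')) (insert x Act) (Fut - {x}) F"
      by (rule table_newnode[of s1, OF _ _ x(1) _ same2]) (use S(2,5) n2 new in \<open>simp_all add: e1\<close>)
    have e2: "nmem s2 ''s'' 0 = x" "nmem s2 ''m'' 0 = 2 ^ h" "nmem s2 ''w'' = nmem s ''w''" "nmem s2 ''b'' = nmem s ''b''"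
      "rmem s2 ''K'' = rmem s ''K''" "rmem s2 ''L'' = rmem s ''L''" "rmem s2 ''X'' = rmem s ''X''" "nmem s2 ''u'' 0 = u"
      using same2 e1 by (auto simp: same_but_def)
    have fmt: "arcs_format s2" by (rule fmt2) (use S(6) in \<open>simp add: arcs_format_def s1_def\<close>)
    define s3 where "s3 = setn ''b'' (2 ^ h + x) (Suc x) s2"
    have "wp fix_prog (wp ?P3 Q) s3 (t + 6 + 6 + 1)"
    proof (rule wp_leaf_fix[OF tr, where D' = D and B' = "insert x Act"])
      show "nmem s3 ''m'' 0 = 2 ^ h" by (simp add: s3_def e2)
      show "nmem s3 ''i'' 0 = x" using same2 e1 by (simp add: s3_def same_but_def)
      \<comment> \<open>The leaf of \<open>x\<close> in the key tournament is already occupied,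
        since as a future terminal \<open>x\<close> had its arrival time as key.\<close>
      show "nmem s3 ''w'' = (nmem s ''w'')(2 ^ h + x := (if x \<in> D then Suc x else 0))"
        using trees_leaf_value(1)[OF tr xh] by (auto simp: s3_def e2)
      fix s4 t4
      assume t4: "t4 \<le> t + 6 + 6 + 1 + 8 * h + 2" and same4: "same_but {''j'', ''w'', ''b''} {} s3 s4"
        and tr4: "trees h (rmem s3 ''K'') (rmem s3 ''L'') (nmem s4 ''w'') (nmem s4 ''b'') D (insert x Act)"
      have e4: "rmem s4 = rmem s2" "nmem s4 ''nx'' = nmem s1 ''nx''" "nmem s4 ''pv'' = nmem s1 ''pv''"
        "nmem s4 ''s'' 0 = x" "nmem s4 ''u'' 0 = u"
        "out_node s4 = out_node s2" "segs s4 = segs s2" "nmem s4 ''nodes'' = nmem s2 ''nodes''"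
        "nmem s4 ''nd'' = nmem s2 ''nd''" "nmem s4 ''parent'' = nmem s2 ''parent''" "arcs_format s4 = arcs_format s2"
        using same4 same2 e2 by (auto simp: same_but_def s3_def out_node_def segs_def fun_eq_iff arcs_format_def)
      have c4: "consts_ok h k A s4"
        by (rule consts_ok_same[OF c1, of "{''nd'', ''nodes'', ''arc'', ''left'', ''j'', ''w'', ''b''}" "{''nodex'', ''nodey''}"])
          (use same2 same4 in \<open>auto simp: same_but_def s3_def\<close>)
      \<comment> \<open>\<open>u\<close> has a new successor, and the key of \<open>x\<close> is
        still its arrival time.\<close>
      have ks4: "keys_state h k A X0 (insert x Act) (Fut - {x}) {u, x} s4"
        unfolding keys_state_def
      proof (intro exI[of _ D] conjI)
        show "trees h (rmem s4 ''K'') (rmem s4 ''L'') (nmem s4 ''w'') (nmem s4 ''b'') D (insert x Act)"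
          using tr4 by (simp add: e4 s3_def)
      qed (use D K in \<open>auto simp: e4 e2 e1\<close>)
      define s5 where "s5 = setn ''i'' 0 u s4"
      have ks5: "keys_state h k A X0 (insert x Act) (Fut - {x}) {u, x} s5"
        using ks4 by (simp add: keys_state_def s5_def)
      have c5: "consts_ok h k A s5" using c4 by (simp add: consts_ok_def s5_def)
      have "wp setkey_prog (wp ?P4 Q) s5 (Suc t4)"
      proof (rule wp_setkey[OF c5 ks5])
        show "nmem s5 ''i'' 0 = u" by (simp add: s5_def)
        show "u \<in> insert x Act" "u \<notin> Fut - {x}" using ua by auto
        fix s6 t6
        assume t6: "t6 \<le> Suc t4 + 8 * h + 8" and same6: "same_but {''q'', ''j'', ''w'', ''b''} {''d'', ''K''} s5 s6"
          and ks6: "keys_state h k A X0 (insert x Act) (Fut - {x}) ({u, x} - {u}) s6"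
        define s7 where "s7 = setn ''i'' 0 x s6"
        have ks7: "keys_state h k A X0 (insert x Act) (Fut - {x}) ({u, x} - {u}) s7"
          using ks6 by (simp add: keys_state_def s7_def)
        have c7: "consts_ok h k A s7"
          by (rule consts_ok_same[OF c5, of "{''i'', ''q'', ''j'', ''w'', ''b''}" "{''d'', ''K''}"])
            (use same6 in \<open>auto simp: same_but_def s7_def\<close>)
        have x6: "nmem s6 ''s'' 0 = x" using same6 e4 by (simp add: same_but_def s5_def)
        have "wp setkey_prog Q s7 (Suc t6)"
        proof (rule wp_setkey[OF c7 ks7])
          show "nmem s7 ''i'' 0 = x" by (simp add: s7_def)
          show "x \<in> insert x Act" "x \<notin> Fut - {x}" by auto
          fix s8 t8
          assume t8: "t8 \<le> Suc t6 + 8 * h + 8" and same8: "same_but {''q'', ''j'', ''w'', ''b''} {''d'', ''K''} s7 s8"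
            and ks8: "keys_state h k A X0 (insert x Act) (Fut - {x}) ({u, x} - {u} - {x}) s8"
          have "{u, x} - {u} - {x} = {}" by blast
          then have ks8': "keys_state h k A X0 (insert x Act) (Fut - {x}) {} s8" using ks8 by (simp only:)
          have c8: "consts_ok h k A s8" by (rule consts_ok_same[OF c7 same8]) auto
          have e8: "rmem s8 ''X'' = rmem s ''X''" "nmem s8 ''nx'' = nmem s1 ''nx''" "nmem s8 ''pv'' = nmem s1 ''pv''"
            "out_node s8 = out_node s2" "segs s8 = segs s2" "nmem s8 ''nodes'' = nmem s2 ''nodes''"
            "nmem s8 ''nd'' = nmem s2 ''nd''" "nmem s8 ''parent'' = nmem s2 ''parent''" "arcs_format s8 = arcs_format s2"
            using same6 same8 e4 e2
            by (auto simp: same_but_def s5_def s7_def out_node_def segs_def fun_eq_iff arcs_format_def)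
          show "Q s8 t8"
            by (rule Q) (use t4 t6 t8 c8 ks8' ln1 tb2 inv' fmt in \<open>simp_all add: sweep_state_def e8 e2\<close>)
        qed
        then show "wp ?P4 Q s6 t6" unfolding wp_Seq wp_NSet by (simp add: x6 s7_def)
      qed
      then show "wp ?P3 Q s4 t4" unfolding wp_Seq wp_NSet by (simp add: e4 s5_def)
    qed (use xh in \<open>auto simp: s3_def e2\<close>)
    then show "wp ?P2 Q s2 (t + 6 + 6)"
      unfolding wp_Seq wp_NSet by (simp add: e2 s3_def)
  qed
  then show ?thesis
    unfolding insert_after_prog_def Let_def wp_Seq wp_NSet using x u by (simp add: s1_def v_def numeral_eq_Suc)
qed

lemma wp_insert:
  assumes st: "sweep_state ts h k A X0 Act Fut F L s" and x: "x \<in> Fut" "nmem s ''s'' 0 = x"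
    and min: "\<And>t. t \<in> Fut \<union> {t \<in> Act. nmem s ''nx'' t \<noteq> t} \<Longrightarrow>
      rmem s ''K'' x < rmem s ''K'' t \<or> rmem s ''K'' x = rmem s ''K'' t \<and> x \<le> t"
    and Q: "\<And>s' t' B L'. \<lbrakk>t' \<le> t + 28 * h + 60; B = insert x Act \<or> B = Act \<and> Act \<noteq> {};
      sweep_state ts h k A X0 B (Fut - {x}) F L' s'\<rbrakk> \<Longrightarrow> Q s' t'"
  shows "wp insert_prog Q s t"
proof -
  note S = sweep_stateD[OF st]
  note I = sweep_invD[OF S(2)]
  obtain D where tr: "trees h (rmem s ''K'') (rmem s ''L'') (nmem s ''w'') (nmem s ''b'') D Act"
    using S(3) unfolding keys_state_def by blast
  have m: "nmem s ''m'' 0 = 2 ^ h" and xh: "x < 2 ^ h" and xk: "x < k" using x I(3) S(1) by (auto simp: consts_ok_def)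
  show ?thesis
    unfolding insert_prog_def Let_def wp_Seq
  proof (rule wp_pred[OF tr m x(2) xh])
    fix s1 t1
    assume t1: "t1 \<le> t + 4 * h + 8" and same1: "same_but {''j'', ''u''} {} s s1"
      and res: "(Act = {} \<and> nmem s1 ''u'' 0 = 0) \<or> (\<exists>u. nmem s1 ''u'' 0 = Suc u \<and> cyclic_pred Act x u)"
    have st1: "sweep_state ts h k A X0 Act Fut F L s1" by (rule sweep_state_same[OF st same1]) auto
    have e1: "nmem s1 ''s'' 0 = x" "nmem s1 ''nx'' = nmem s ''nx''" "rmem s1 = rmem s"
      using same1 x by (auto simp: same_but_def)
    let ?B = "Cond (TAnd (REq (RGet ''A'' (nv ''u'')) (RGet ''A'' (nv ''s''))) (REq (RGet ''X'' (nv ''u'')) (RGet ''X'' (nv ''s''))))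
          drop_prog insert_after_prog"
    show "wp (Cond (NEq (nv ''u'') (NConst 0)) insert_first_prog (nset ''u'' (npred (nv ''u'')) ;; ?B)) Q s1 t1"
    proof (cases "nmem s1 ''u'' 0 = 0")
      case True
      then have e: "Act = {}" using res by auto
      have "wp insert_first_prog Q s1 (Suc t1)"
      proof (rule wp_insert_first[OF st1 x(1) e1(1) e])
        show "rmem s1 ''K'' x < rmem s1 ''K'' t \<or> rmem s1 ''K'' x = rmem s1 ''K'' t \<and> x \<le> t"
          if "t \<in> Fut \<union> {t \<in> Act. nmem s1 ''nx'' t \<noteq> t}" for t using min that by (simp add: e1)
        show "Q s' t'" if "t' \<le> Suc t1 + 8 * h + 20" "sweep_state ts h k A X0 (insert x Act) (Fut - {x}) F (X0 x) s'" for s' t'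
          using Q[OF _ _ that(2)] that(1) t1 by simp
      qed
      then show ?thesis using True by (simp add: wp_Cond)
    next
      case False
      then obtain u where u: "nmem s1 ''u'' 0 = Suc u" "cyclic_pred Act x u" using res by auto
      have ua: "u \<in> Act" using u by (simp add: cyclic_pred_def)
      define s2 where "s2 = setn ''u'' 0 u s1"
      have st2: "sweep_state ts h k A X0 Act Fut F L s2"
        by (rule sweep_state_same[OF st1, of "{''u''}"]) (auto simp: same_but_def s2_def)
      have e2: "nmem s2 ''s'' 0 = x" "nmem s2 ''nx'' = nmem s ''nx''" "rmem s2 = rmem s" "nmem s2 ''u'' 0 = u"
        by (simp_all add: s2_def e1)
      have min2: "rmem s2 ''K'' x < rmem s2 ''K'' t \<or> rmem s2 ''K'' x = rmem s2 ''K'' t \<and> x \<le> t"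
        if "t \<in> Fut \<union> {t \<in> Act. nmem s2 ''nx'' t \<noteq> t}" for t using min that by (simp add: e2)
      have A: "rmem s ''A'' = A" using S(1) by (simp add: consts_ok_def)
      have "wp ?B Q s2 (Suc (Suc t1))"
      proof (cases "A u = A x \<and> rmem s ''X'' u = rmem s ''X'' x")
        case True
        have "wp drop_prog Q s2 (Suc (Suc (Suc t1)))"
        proof (rule wp_drop[OF st2 x(1) e2(1) min2 ua])
          show "slot_pt A (rmem s2 ''X'') u = slot_pt A (rmem s2 ''X'') x" using True by (simp add: e2 slot_pt_def)
          show "Q s' t'" if "t' \<le> Suc (Suc (Suc t1)) + 8 * h + 4" "sweep_state ts h k A X0 Act (Fut - {x}) F L s'" for s' t'
            by (rule Q[OF _ _ that(2)]) (use that(1) t1 ua in auto)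
        qed
        then show ?thesis using True by (simp add: wp_Cond e2 A)
      next
        case False
        \<comment> \<open>An active node at the place of \<open>x\<close> would be its predecessor
          \<open>u\<close>, and the comparison with \<open>u\<close> has failed.\<close>
        have new: "slot_pt A (rmem s2 ''X'') j \<noteq> slot_pt A (rmem s2 ''X'') x" if j: "j \<in> Act" for j
        proof
          assume eq: "slot_pt A (rmem s2 ''X'') j = slot_pt A (rmem s2 ''X'') x"
          then have eq': "slot_pt A (rmem s ''X'') j = slot_pt A (rmem s ''X'') x" by (simp add: e2)
          have "u = j"
            by (rule sweep_pred_duplicate[OF S(2) x(1) j eq' ua]) (use u(2) in \<open>auto simp: cyclic_pred_def split: if_splits\<close>)
          moreover have "j < k" using j I(2) by auto
          ultimately show False using sweep_slot_pt_eq[OF S(2) _ xk eq'] False by auto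
        qed
        have "wp insert_after_prog Q s2 (Suc (Suc (Suc t1)))"
        proof (rule wp_insert_after[OF st2 x(1) e2(1) min2 u(2) e2(4) new])
          show "Q s' t'" if "t' \<le> Suc (Suc (Suc t1)) + 24 * h + 40"
            "sweep_state ts h k A X0 (insert x Act) (Fut - {x}) F (X0 x) s'" for s' t'
            using Q[OF _ _ that(2)] that(1) t1 by auto
        qed
        then show ?thesis using False by (auto simp: wp_Cond e2 A)
      qed
      then show ?thesis using u(1) by (simp add: wp_Cond wp_Seq wp_NSet s2_def)
    qed
  qed
qed

lemma wp_loop:
  assumes st: "sweep_state ts h k A X0 Act Fut F L s" and ne: "Act \<union> Fut \<noteq> {}"
    and Q: "\<And>s' t' v F' L'. \<lbrakk>t' \<le> t + (2 * card Fut + card Act) * (28 * h + 70) + 1;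
      sweep_state ts h k A X0 {v} {} F' L' s'\<rbrakk> \<Longrightarrow> Q s' t'"
  shows "wp loop_prog Q s t"
proof -
  \<comment> \<open>\<open>C\<close> bounds the cost of one event. At most
    \<open>2 * card Fut + card Act\<close> events are left: an insertion trades a future slot for at
    most one active slot, and a join removes an active slot.\<close>
  define C where "C = 28 * h + 70"
  define T where "T = t + (2 * card Fut + card Act) * C"
  define J where "J n s' t' \<longleftrightarrow> (\<exists>Act Fut F L. sweep_state ts h k A X0 Act Fut F L s' \<and> Act \<union> Fut \<noteq> {} \<and>
      n = 2 * card Fut + card Act \<and> t' + n * C \<le> T)" for n s' t'
  have fin: "finite Act" "finite Fut" if "sweep_state ts h k A X0 Act Fut F L s'" for Act Fut F L s'
    using sweep_invD(2,3)[OF sweep_stateD(2)[OF that]] finite_subset by blast+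
  show ?thesis
    unfolding loop_prog_def
  proof (rule wp_While[where I = J])
    show "J (2 * card Fut + card Act) s t" unfolding J_def T_def using st ne by auto
  next
    fix n s' t' assume "J n s' t'" and test: "tval s' (TNot (NEq (ne ''w'' (NConst 1)) (NConst 0)))"
    then obtain Act Fut F L where st': "sweep_state ts h k A X0 Act Fut F L s'"
      and n: "n = 2 * card Fut + card Act" "t' + n * C \<le> T"
      unfolding J_def by blast
    note S = sweep_stateD[OF st']
    note I = sweep_invD[OF S(2)]
    have sub: "Act \<union> Fut \<subseteq> {..<k}" using I by blast
    obtain x where x: "nmem s' ''w'' 1 = Suc x" "x \<in> Fut \<union> {i \<in> Act. nmem s' ''nx'' i \<noteq> i}"
      and min: "\<And>t. t \<in> Fut \<union> {t \<in> Act. nmem s' ''nx'' t \<noteq> t} \<Longrightarrow>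
        rmem s' ''K'' x < rmem s' ''K'' t \<or> rmem s' ''K'' x = rmem s' ''K'' t \<and> x \<le> t"
      using keys_state_root[OF S(3) sub] test by auto
    define s1 where "s1 = setn ''s'' 0 x s'"
    have st1: "sweep_state ts h k A X0 Act Fut F L s1"
      by (rule sweep_state_same[OF st', of "{''s''}"]) (auto simp: same_but_def s1_def)
    have e1: "nmem s1 ''s'' 0 = x" "nmem s1 ''nx'' = nmem s' ''nx''" "rmem s1 = rmem s'" "nmem s1 ''b'' = nmem s' ''b''"
      "nmem s1 ''m'' 0 = 2 ^ h"
      using S(1) by (simp_all add: s1_def consts_ok_def)
    have min1: "rmem s1 ''K'' x < rmem s1 ''K'' t \<or> rmem s1 ''K'' x = rmem s1 ''K'' t \<and> x \<le> t"
      if "t \<in> Fut \<union> {t \<in> Act. nmem s1 ''nx'' t \<noteq> t}" for t using min that by (simp add: e1)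
    have "x < k" using x(2) sub by auto
    then have xh: "x < 2 ^ h" using S(1) by (simp add: consts_ok_def)
    obtain D where "trees h (rmem s' ''K'') (rmem s' ''L'') (nmem s' ''w'') (nmem s' ''b'') D Act"
      using S(3) unfolding keys_state_def by blast
    from trees_leaf_value(2)[OF this xh] have b: "nmem s' ''b'' (2 ^ h + x) = 0 \<longleftrightarrow> x \<notin> Act" by simp
    define R where "R s' t' \<longleftrightarrow> (\<exists>n'<n. J n' s' t')" for s' t'
    have "wp (Cond (NEq (ne ''b'' (NAdd (nv ''m'') (nv ''s''))) (NConst 0)) insert_prog join_prog) R s1 (Suc (Suc t'))"
    proof (cases "x \<in> Act")
      case False
      then have xF: "x \<in> Fut" using x(2) by blast
      have "wp insert_prog R s1 (Suc (Suc (Suc t')))"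
      proof (rule wp_insert[OF st1 xF e1(1)])
        show "rmem s1 ''K'' x < rmem s1 ''K'' t \<or> rmem s1 ''K'' x = rmem s1 ''K'' t \<and> x \<le> t"
          if "t \<in> Fut \<union> {t \<in> Act. nmem s1 ''nx'' t \<noteq> t}" for t by (rule min1[OF that])
        fix s2 t2 B L'
        assume t2: "t2 \<le> Suc (Suc (Suc t')) + 28 * h + 60" and B: "B = insert x Act \<or> B = Act \<and> Act \<noteq> {}"
          and st2: "sweep_state ts h k A X0 B (Fut - {x}) F L' s2"
        have cF: "card Fut = Suc (card (Fut - {x}))" using card.remove[OF fin(2)[OF st'] xF] by simp
        have cB: "card B \<le> Suc (card Act)" using B fin(1)[OF st'] by (auto simp: card_insert_if)
        define n' where "n' = 2 * card (Fut - {x}) + card B"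
        have n': "Suc n' \<le> n" using n cF cB by (simp add: n'_def)
        then have "Suc n' * C \<le> n * C" by (rule mult_le_mono1)
        then have "t2 + n' * C \<le> T" using t2 n(2) by (simp add: C_def)
        then have "J n' s2 t2" unfolding J_def n'_def using st2 B by blast
        then show "R s2 t2" using n' unfolding R_def by (intro exI[of _ n']) simp
      qed
      then show ?thesis using False b by (simp add: wp_Cond e1)
    next
      case True
      then have "x \<notin> Fut" using I(4) by blast
      then have nx: "nmem s1 ''nx'' x \<noteq> x" using x(2) by (simp add: e1)
      have "wp join_prog R s1 (Suc (Suc (Suc t')))"
      proof (rule wp_join[OF st1 True e1(1) nx])
        show "rmem s1 ''K'' x \<le> rmem s1 ''K'' t" if "t \<in> Fut \<union> {t \<in> Act. nmem s1 ''nx'' t \<noteq> t}" for t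
          using min1[OF that] by auto
        fix s2 t2 F' L'
        assume t2: "t2 \<le> Suc (Suc (Suc t')) + 24 * h + 50"
          and st2: "sweep_state ts h k A X0 (Act - {x}) Fut F' L' s2"
        have cA: "card Act = Suc (card (Act - {x}))" using card.remove[OF fin(1)[OF st'] True] by simp
        have "nmem s' ''nx'' x \<in> Act - {x}" using linksD(2)[OF S(4) True] nx by (simp add: e1)
        then have ne2: "(Act - {x}) \<union> Fut \<noteq> {}" by blast
        define n' where "n' = 2 * card Fut + card (Act - {x})"
        have n': "Suc n' = n" using n cA by (simp add: n'_def)
        then have "t2 + n' * C \<le> T" using t2 n(2) by (auto simp: C_def simp flip: n')
        then have "J n' s2 t2" unfolding J_def n'_def using st2 ne2 by blast
        then show "R s2 t2" using n' unfolding R_def by (intro exI[of _ n']) simp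
      qed
      then show ?thesis using True b by (simp add: wp_Cond e1)
    qed
    then show "wp event_prog (\<lambda>s' t'. \<exists>n'<n. J n' s' t') s' (Suc t')"
      unfolding R_def[abs_def, symmetric] event_prog_def wp_Seq wp_NSet using x by (simp add: s1_def)
  next
    fix n s' t' assume "J n s' t'" and test: "\<not> tval s' (TNot (NEq (ne ''w'' (NConst 1)) (NConst 0)))"
    then obtain Act Fut F L where st': "sweep_state ts h k A X0 Act Fut F L s'" "Act \<union> Fut \<noteq> {}"
      and n: "t' + n * C \<le> T"
      unfolding J_def by blast
    note S = sweep_stateD[OF st'(1)]
    note I = sweep_invD[OF S(2)]
    have sub: "Act \<union> Fut \<subseteq> {..<k}" using I by blast
    \<comment> \<open>An empty tournament means that no terminal is left and every active node is
      its own successor, which leaves a single active node.\<close>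
    have F: "Fut = {}" "\<And>i. i \<in> Act \<Longrightarrow> nmem s' ''nx'' i = i"
      using keys_state_root[OF S(3) sub] test by auto
    then obtain v where "v \<in> Act" using st'(2) by auto
    then have "Act = {v}" using links_self_iff[OF S(4)] F by blast
    then have "sweep_state ts h k A X0 {v} {} F L s'" using st'(1) F by simp
    then show "Q s' (Suc t')" by (rule Q[rotated]) (use n in \<open>simp add: T_def C_def\<close>)
  qed
qed

end

section \<open>Setup, output and running time\<close>

definition for_prog :: "string \<Rightarrow> prog \<Rightarrow> prog" where
  "for_prog B P = (nset ''l'' (NConst 0) ;; While (NLess (nv ''l'') (nv B)) (P ;; nset ''l'' (nsuc (nv ''l''))))"

lemma wp_for:
  assumes init: "I 0 (setn ''l'' 0 0 s) (Suc t)"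
    and var: "\<And>l s t. I l s t \<Longrightarrow> nmem s ''l'' 0 = l \<and> nmem s B 0 = n \<and> l \<le> n"
    and step: "\<And>l s t. l < n \<Longrightarrow> I l s t \<Longrightarrow>
      wp P (\<lambda>s' t'. nmem s' ''l'' 0 = l \<and> I (Suc l) (setn ''l'' 0 (Suc l) s') (Suc t')) s (Suc t)"
    and Q: "\<And>s' t'. I n s' t' \<Longrightarrow> Q s' (Suc t')"
  shows "wp (for_prog B P) Q s t"
proof -
  define J where "J d s' t' \<longleftrightarrow> (\<exists>l. d = n - l \<and> I l s' t')" for d s' t'
  have "wp (While (NLess (nv ''l'') (nv B)) (P ;; nset ''l'' (nsuc (nv ''l'')))) Q (setn ''l'' 0 0 s) (Suc t)"
  proof (rule wp_While[where I = J])
    show "J n (setn ''l'' 0 0 s) (Suc t)" unfolding J_def using init by (intro exI[of _ 0]) simp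
  next
    fix d s' t' assume "J d s' t'" and test: "tval s' (NLess (nv ''l'') (nv B))"
    then obtain l where l: "d = n - l" "I l s' t'" unfolding J_def by blast
    then have ln: "l < n" using var[OF l(2)] test by simp
    have "wp P (\<lambda>s' t'. nmem s' ''l'' 0 = l \<and> I (Suc l) (setn ''l'' 0 (Suc l) s') (Suc t')) s' (Suc t')"
      using step[OF ln l(2)] .
    then show "wp (P ;; nset ''l'' (nsuc (nv ''l''))) (\<lambda>s' t'. \<exists>d'<d. J d' s' t') s' (Suc t')"
      unfolding wp_Seq
    proof (rule wp_mono)
      fix s'' t'' assume *: "nmem s'' ''l'' 0 = l \<and> I (Suc l) (setn ''l'' 0 (Suc l) s'') (Suc t'')"
      then have "J (n - Suc l) (setn ''l'' 0 (Suc l) s'') (Suc t'')" unfolding J_def by blast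
      then have "\<exists>d'<d. J d' (setn ''l'' 0 (Suc l) s'') (Suc t'')"
        using l(1) ln by (intro exI[of _ "n - Suc l"]) auto
      then show "wp (nset ''l'' (nsuc (nv ''l''))) (\<lambda>s' t'. \<exists>d'<d. J d' s' t') s'' t''"
        unfolding wp_NSet using * by simp
    qed
  next
    fix d s' t' assume "J d s' t'" and test: "\<not> tval s' (NLess (nv ''l'') (nv B))"
    then obtain l where l: "d = n - l" "I l s' t'" unfolding J_def by blast
    then have "l = n" using var[OF l(2)] test by simp
    then show "Q s' (Suc t')" using Q l by blast
  qed
  then show ?thesis unfolding for_prog_def wp_Seq wp_NSet by simp
qed

definition size_prog :: prog where
  "size_prog = (nset ''m'' (NConst 1) ;; While (NLess (nv ''m'') (nv ''n'')) (nset ''m'' (ndbl (nv ''m''))))"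

lemma wp_size:
  assumes n: "nmem s ''n'' 0 = n" "0 < n"
    and Q: "\<And>s' t' h. \<lbrakk>t' \<le> t + 2 * h + 2; same_but {''m''} {} s s'; nmem s' ''m'' 0 = 2 ^ h; n \<le> 2 ^ h; 2 ^ h < 2 * n\<rbrakk>
      \<Longrightarrow> Q s' t'"
  shows "wp size_prog Q s t"
proof -
  define J where "J d s' t' \<longleftrightarrow> (\<exists>h. d = n - 2 ^ h \<and> t' \<le> t + 1 + 2 * h \<and> same_but {''m''} {} s s' \<and>
      nmem s' ''m'' 0 = 2 ^ h \<and> 2 ^ h < 2 * n)" for d s' t'
  have "wp (While (NLess (nv ''m'') (nv ''n'')) (nset ''m'' (ndbl (nv ''m'')))) Q (setn ''m'' 0 1 s) (Suc t)"
  proof (rule wp_While[where I = J])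
    show "J (n - 1) (setn ''m'' 0 1 s) (Suc t)"
      unfolding J_def using n by (intro exI[of _ 0]) (auto simp: same_but_def)
  next
    fix d s' t' assume "J d s' t'" and test: "tval s' (NLess (nv ''m'') (nv ''n''))"
    then obtain h where h: "d = n - 2 ^ h" "t' \<le> t + 1 + 2 * h" "same_but {''m''} {} s s'"
      "nmem s' ''m'' 0 = 2 ^ h" unfolding J_def by blast
    have lt: "2 ^ h < n" using test h n by (simp add: same_but_def)
    have "J (n - 2 ^ Suc h) (setn ''m'' 0 (2 ^ h + 2 ^ h) s') (Suc (Suc t'))"
      unfolding J_def using h lt by (intro exI[of _ "Suc h"]) (auto simp: same_but_def)
    moreover have "n - 2 ^ Suc h < d"
    proof -
      have "(2::nat) ^ h < 2 ^ Suc h" by simp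
      then show ?thesis using h(1) lt by linarith
    qed
    ultimately show "wp (nset ''m'' (ndbl (nv ''m''))) (\<lambda>s' t'. \<exists>d'<d. J d' s' t') s' (Suc t')"
      unfolding wp_NSet by (intro exI[of _ "n - 2 ^ Suc h"]) (simp add: h)
  next
    fix d s' t' assume "J d s' t'" and test: "\<not> tval s' (NLess (nv ''m'') (nv ''n''))"
    then obtain h where h: "t' \<le> t + 1 + 2 * h" "same_but {''m''} {} s s'"
      "nmem s' ''m'' 0 = 2 ^ h" "2 ^ h < 2 * n" unfolding J_def by blast
    show "Q s' (Suc t')" by (rule Q[of _ h]) (use h test n in \<open>auto simp: same_but_def\<close>)
  qed
  then show ?thesis unfolding size_prog_def wp_Seq wp_NSet by simp
qed

section \<open>Slots from Cartesian coordinates, and the phases of the program\<close>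

text \<open>The half-angle formula \<open>cot (\<theta> / 2) = s / (1 - c)\<close> yields the angle
  in \<open>[0, 2 * pi)\<close> from one arctangent without distinguishing quadrants; its only
  singular direction, \<open>c = 1\<close>, is the angle 0.\<close>

lemma angle_of_unit:
  fixes c s :: real
  assumes unit: "c\<^sup>2 + s\<^sup>2 = 1"
  defines "\<theta> \<equiv> (if c = 1 then 0 else pi + 2 * arctan ((0 - s) / (1 - c)))"
  shows "0 \<le> \<theta>" "\<theta> < 2 * pi" "cis \<theta> = Complex c s"
proof -
  have "0 \<le> \<theta> \<and> \<theta> < 2 * pi \<and> cos \<theta> = c \<and> sin \<theta> = s"
  proof (cases "c = 1")
    case True
    then show ?thesis using unit by (simp add: \<theta>_def)
  next
    case False
    define t where "t = (0 - s) / (1 - c)"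
    define \<phi> where "\<phi> = arctan t"
    have \<theta>: "\<theta> = pi + 2 * \<phi>" using False by (simp add: \<theta>_def \<phi>_def t_def)
    have range: "- (pi / 2) < \<phi>" "\<phi> < pi / 2" unfolding \<phi>_def by (rule arctan_lbound arctan_ubound)+
    have c1: "1 - c \<noteq> 0" using False by simp
    have s2: "s\<^sup>2 = (1 - c) * (1 + c)" using unit by (simp add: algebra_simps power2_eq_square)
    have t2: "t\<^sup>2 * (1 - c) = 1 + c"
      using c1 s2 by (simp add: t_def power_divide) (simp add: power2_eq_square)
    have t2': "(1 + t\<^sup>2) * (1 - c) = 2" using t2 by (simp add: algebra_simps)
    have pos: "1 + t\<^sup>2 \<noteq> 0" by (smt (verit) zero_le_power2)
    have cos2: "(cos \<phi>)\<^sup>2 = 1 / (1 + t\<^sup>2)"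
      by (simp add: \<phi>_def cos_arctan power_divide)
    have cosnz: "cos \<phi> \<noteq> 0" unfolding \<phi>_def by (rule cos_arctan_not_zero)
    have sin: "sin \<phi> = t * cos \<phi>" using cosnz tan_arctan[of t] by (simp add: tan_def \<phi>_def field_simps)
    have half: "2 * (cos \<phi>)\<^sup>2 = 1 - c"
    proof -
      have "1 - c = 2 / (1 + t\<^sup>2)" using t2' pos by (simp add: eq_divide_eq mult.commute)
      then show ?thesis by (simp add: cos2)
    qed
    have "cos \<theta> = 1 - 2 * (cos \<phi>)\<^sup>2" unfolding \<theta> by (simp add: cos_add cos_double_cos)
    then have "cos \<theta> = c" using half by simp
    moreover have "sin \<theta> = - (t * (2 * (cos \<phi>)\<^sup>2))"
      unfolding \<theta> by (simp add: sin_add sin_double sin power2_eq_square)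
    then have "sin \<theta> = s" using half c1 by (simp add: t_def)
    ultimately show ?thesis using range \<theta> by auto
  qed
  then show "0 \<le> \<theta>" "\<theta> < 2 * pi" "cis \<theta> = Complex c s" by (auto simp: complex_eq_iff)
qed

lemma trees_empty: "(\<And>j. w j = 0) \<Longrightarrow> (\<And>j. b j = 0) \<Longrightarrow> trees h K L w b {} {}"
  by (simp add: trees_def node_ok_def leaves_def pick_def)

definition polar_store_prog :: prog where
  "polar_store_prog =
    (let i = nv ''i'' in
     Cond (REq (rv ''c'') (RConst 1)) (RSet ''K'' i (RConst 0))
      (RSet ''K'' i (RAdd (rv ''pi'')
        (RMul (RConst 2) (RFun Arctan (RDiv (rneg (rv ''d'')) (RSub (RConst 1) (rv ''c''))))))) ;;
     NSet ''w'' (NAdd (nv ''m'') i) (nsuc i) ;; fix_prog ;;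
     nset ''k'' (nsuc (nv ''k'')))"

text \<open>\<open>c\<close> and \<open>d\<close> are the cosine and sine of the direction of the
  terminal turned by \<open>\<tau> * X\<close>. This undoes the winding of the left spiral, so the
  stored angle is constant along it. Terminals at \<open>r\<close> have no logarithm and receive no
  slot, so \<open>k\<close> may be smaller than \<open>n\<close>.\<close>

definition polar_prog :: prog where
  "polar_prog =
    (let l = nv ''l''; i = nv ''i''; sq = \<lambda>a. RMul a a; \<psi> = RMul (rv ''tau'') (RGet ''L'' i) in
     rset ''dx'' (RSub (RGet ''x'' l) (rv ''rootx'')) ;;
     rset ''dy'' (RSub (RGet ''y'' l) (rv ''rooty'')) ;;
     Cond (TAnd (REq (rv ''dx'') (RConst 0)) (REq (rv ''dy'') (RConst 0))) Skip
      (rset ''R'' (RFun Sqrt (RAdd (sq (rv ''dx'')) (sq (rv ''dy'')))) ;;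
       nset ''i'' (nv ''k'') ;;
       RSet ''L'' i (rneg (RFun Ln (rv ''R''))) ;;
       rset ''c'' (RDiv (RSub (RMul (rv ''dx'') (RFun Cos \<psi>)) (RMul (rv ''dy'') (RFun Sin \<psi>))) (rv ''R'')) ;;
       rset ''d'' (RDiv (RAdd (RMul (rv ''dx'') (RFun Sin \<psi>)) (RMul (rv ''dy'') (RFun Cos \<psi>))) (rv ''R'')) ;;
       polar_store_prog))"

text \<open>The tournament tree serves as a heap: each round extracts the least pair of angle and
  time.\<close>

definition sort_prog :: prog where
  "sort_prog =
    (let l = nv ''l''; i = nv ''i'' in
     nset ''i'' (npred (ne ''w'' (NConst 1))) ;;
     RSet ''A'' l (RGet ''K'' i) ;; RSet ''X'' l (RGet ''L'' i) ;;
     NSet ''w'' (NAdd (nv ''m'') i) (NConst 0) ;; fix_prog)"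

text \<open>The same tree is refilled for the sweep, now keyed by arrival times; resetting
  \<open>L\<close> makes ties go to the smaller slot.\<close>

definition load_prog :: prog where
  "load_prog =
    (let i = nv ''i'' in
     nset ''i'' (nv ''l'') ;;
     RSet ''K'' i (RGet ''X'' i) ;; RSet ''L'' i (RConst 0) ;;
     NSet ''w'' (NAdd (nv ''m'') i) (nsuc i) ;; fix_prog)"

text \<open>The last arc is a right spiral run to its limit \<open>r\<close>, followed by a left
  segment with parameter 0, which stays at \<open>r\<close>. The root gets a parent number out of
  range, which the output format reads as none. If all terminals are at \<open>r\<close>, only the
  root is added.\<close>

definition finish_prog :: prog where
  "finish_prog =
    (let i = nv ''i''; N = nv ''nodes'' in
     Cond (NEq (ne ''b'' (NConst 1)) (NConst 0)) Skip
      (nset ''i'' (ne ''nd'' (npred (ne ''b'' (NConst 1)))) ;;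
       NSet ''parent'' i N ;; NSet ''unbounded'' (ndbl i) (NConst 1) ;;
       RSet ''param'' (nsuc (ndbl i)) (RConst 0)) ;;
     RSet ''nodex'' N (rv ''rootx'') ;; RSet ''nodey'' N (rv ''rooty'') ;;
     NSet ''parent'' N (nsuc N) ;; nset ''nodes'' (nsuc N))"

definition greedy_prog :: prog where
  "greedy_prog =
    (rset ''tau'' (RFun Tan (rv ''alpha'')) ;;
     rset ''pi'' (RMul (RConst 4) (RFun Arctan (RConst 1))) ;;
     size_prog ;; for_prog ''n'' polar_prog ;; for_prog ''k'' sort_prog ;; for_prog ''k'' load_prog ;;
     loop_prog ;; finish_prog)"

abbreviation setup_nvars :: "string set" where
  "setup_nvars \<equiv> {''m'', ''l'', ''k'', ''i'', ''w'', ''b'', ''j''}"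
abbreviation setup_rvars :: "string set" where
  "setup_rvars \<equiv> {''tau'', ''pi'', ''dx'', ''dy'', ''R'', ''c'', ''d'', ''K'', ''L'', ''A'', ''X''}"

context spiral_geometry
begin

definition setup_ok :: "complex list \<Rightarrow> nat \<Rightarrow> mem \<Rightarrow> bool" where
  "setup_ok ts h s \<longleftrightarrow> same_but setup_nvars setup_rvars (input_mem r \<alpha> ts) s \<and> nmem s ''m'' 0 = 2 ^ h \<and>
     rmem s ''tau'' 0 = \<tau> \<and> rmem s ''pi'' 0 = pi \<and> length ts \<le> 2 ^ h"

lemma setup_ok_same:
  assumes "setup_ok ts h s" "same_but U V s s'" "U \<subseteq> setup_nvars - {''m''}" "V \<subseteq> setup_rvars - {''tau'', ''pi''}"
  shows "setup_ok ts h s'"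
proof -
  have "same_but setup_nvars setup_rvars (input_mem r \<alpha> ts) s'"
  proof (rule same_but_chain)
    show "same_but setup_nvars setup_rvars (input_mem r \<alpha> ts) s" using assms(1) by (simp only: setup_ok_def)
    show "same_but U V s s'" by (rule assms(2))
    show "setup_nvars \<union> U \<subseteq> setup_nvars" by (rule Un_least[OF order_refl order_trans[OF assms(3) Diff_subset]])
    show "setup_rvars \<union> V \<subseteq> setup_rvars" by (rule Un_least[OF order_refl order_trans[OF assms(4) Diff_subset]])
  qed
  moreover have "''m'' \<notin> U" "''tau'' \<notin> V" "''pi'' \<notin> V"
    using subsetD[OF assms(3), of "''m''"] subsetD[OF assms(4), of "''tau''"] subsetD[OF assms(4), of "''pi''"]
    by (simp, blast)+
  ultimately show ?thesis using assms(1,2) by (simp add: setup_ok_def same_but_def)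
qed

lemma polar_coordinates:
  fixes p :: complex
  assumes p: "p \<noteq> r"
  defines "R \<equiv> sqrt ((Re p - Re r) * (Re p - Re r) + (Im p - Im r) * (Im p - Im r))"
  defines "X \<equiv> 0 - ln R"
  defines "c \<equiv> ((Re p - Re r) * cos (\<tau> * X) - (Im p - Im r) * sin (\<tau> * X)) / R"
    and "d \<equiv> ((Re p - Re r) * sin (\<tau> * X) + (Im p - Im r) * cos (\<tau> * X)) / R"
  defines "A \<equiv> (if c = 1 then 0 else pi + 2 * arctan ((0 - d) / (1 - c)))"
  shows "0 \<le> A" "A < 2 * pi" "pt A X = p"
proof -
  have R: "R = cmod (p - r)" by (simp add: R_def cmod_def power2_eq_square)
  have R0: "0 < R" using p R by simp
  have eX: "exp (- X) = R" using R0 by (simp add: X_def)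
  have cd: "Complex c d = (p - r) / of_real R * cis (\<tau> * X)"
    using R0 by (simp add: complex_eq_iff c_def d_def Re_divide_of_real Im_divide_of_real field_simps)
  have "cmod (Complex c d) = 1" unfolding cd using R R0 by (simp add: norm_mult norm_divide)
  then have "c\<^sup>2 + d\<^sup>2 = 1" by (simp add: complex_norm)
  note a = angle_of_unit[OF this, folded A_def]
  show "0 \<le> A" "A < 2 * pi" by (rule a(1,2))+
  have "cis (A - \<tau> * X) = cis A * cis (- (\<tau> * X))" by (simp add: cis_mult)
  also have "\<dots> = (p - r) / of_real R * (cis (\<tau> * X) * cis (- (\<tau> * X)))" by (simp add: a(3) cd)
  also have "\<dots> = (p - r) / of_real R" by (simp add: cis_mult)
  finally show "pt A X = p" using R0 by (simp add: pt_def eX)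
qed

lemma wp_polar_loop:
  assumes s: "setup_ok ts h s" "nmem s ''k'' 0 = 0" "\<And>j. nmem s ''w'' j = 0" "\<And>j. nmem s ''b'' j = 0"
    and Q: "\<And>s' t' k. \<lbrakk>t' \<le> t + length ts * (8 * h + 20) + 2; setup_ok ts h s'; nmem s' ''k'' 0 = k; k \<le> length ts;
      trees h (rmem s' ''K'') (rmem s' ''L'') (nmem s' ''w'') (nmem s' ''b'') {..<k} {};
      \<And>i. i < k \<Longrightarrow> 0 \<le> rmem s' ''K'' i \<and> rmem s' ''K'' i < 2 * pi;
      (\<lambda>i. pt (rmem s' ''K'' i) (rmem s' ''L'' i)) ` {..<k} = set ts - {r}\<rbrakk> \<Longrightarrow> Q s' t'"
  shows "wp (for_prog ''n'' polar_prog) Q s t"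
proof -
  define P where "P k l s' t' \<longleftrightarrow> t' \<le> t + 1 + l * (8 * h + 20) \<and> setup_ok ts h s' \<and> nmem s' ''l'' 0 = l \<and>
      nmem s' ''k'' 0 = k \<and> k \<le> l \<and> l \<le> length ts \<and>
      trees h (rmem s' ''K'') (rmem s' ''L'') (nmem s' ''w'') (nmem s' ''b'') {..<k} {} \<and>
      (\<forall>i<k. 0 \<le> rmem s' ''K'' i \<and> rmem s' ''K'' i < 2 * pi) \<and>
      (\<lambda>i. pt (rmem s' ''K'' i) (rmem s' ''L'' i)) ` {..<k} = set (take l ts) - {r}" for k l s' t'
  define I where "I l s' t' \<longleftrightarrow> (\<exists>k. P k l s' t')" for l s' t'
  have inp: "nmem s' ''n'' 0 = length ts" "rmem s' ''rootx'' 0 = Re r" "rmem s' ''rooty'' 0 = Im r"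
    "\<And>i. i < length ts \<Longrightarrow> rmem s' ''x'' i = Re (ts ! i)" "\<And>i. i < length ts \<Longrightarrow> rmem s' ''y'' i = Im (ts ! i)"
    if "setup_ok ts h s'" for s'
    using that by (simp_all add: setup_ok_def same_but_def input_mem_def)
  show ?thesis
  proof (rule wp_for[where I = I and n = "length ts"])
    have "setup_ok ts h (setn ''l'' 0 0 s)"
      by (rule setup_ok_same[OF s(1), of "{''l''}" "{}"]) (auto simp: same_but_def)
    then show "I 0 (setn ''l'' 0 0 s) (Suc t)"
      unfolding I_def P_def using s(2-4) trees_empty[of "nmem s ''w''" "nmem s ''b''"]
      by (intro exI[of _ 0]) simp
    show "nmem s' ''l'' 0 = l \<and> nmem s' ''n'' 0 = length ts \<and> l \<le> length ts" if I: "I l s' t'" for l s' t'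
    proof -
      obtain k where "P k l s' t'" using I unfolding I_def by blast
      then show ?thesis using inp(1)[of s'] by (simp add: P_def)
    qed
    show "Q s' (Suc t')" if I: "I (length ts) s' t'" for s' t'
    proof -
      obtain k where "P k (length ts) s' t'" using I unfolding I_def by blast
      then show ?thesis by (intro Q[of _ _ k]) (simp_all add: P_def)
    qed
    fix l s' t' assume l: "l < length ts" and "I l s' t'"
    then obtain k where kP: "P k l s' t'" unfolding I_def by blast
    have t': "t' \<le> t + 1 + l * (8 * h + 20)" and so: "setup_ok ts h s'" and ll: "nmem s' ''l'' 0 = l"
      and k: "nmem s' ''k'' 0 = k" "k \<le> l"
      and tr: "trees h (rmem s' ''K'') (rmem s' ''L'') (nmem s' ''w'') (nmem s' ''b'') {..<k} {}"
      and K: "\<And>i. i < k \<Longrightarrow> 0 \<le> rmem s' ''K'' i \<and> rmem s' ''K'' i < 2 * pi"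
      and im: "(\<lambda>i. pt (rmem s' ''K'' i) (rmem s' ''L'' i)) ` {..<k} = set (take l ts) - {r}"
      using kP by (simp_all add: P_def)
    define p where "p = ts ! l"
    note in' = inp[OF so]
    have x: "rmem s' ''x'' l = Re p" "rmem s' ''y'' l = Im p" using in'(4,5) l by (simp_all add: p_def)
    have m: "nmem s' ''m'' 0 = 2 ^ h" and kh: "k < 2 ^ h" and tau: "rmem s' ''tau'' 0 = \<tau>" "rmem s' ''pi'' 0 = pi"
      using so k l by (simp_all add: setup_ok_def)
    have tk: "set (take (Suc l) ts) = insert p (set (take l ts))"
      using l by (simp add: take_Suc_conv_app_nth p_def)
    define s1 where "s1 = setr ''dy'' 0 (Im p - Im r) (setr ''dx'' 0 (Re p - Re r) s')"
    have so1: "setup_ok ts h s1"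
      by (rule setup_ok_same[OF so, of "{}" "{''dx'', ''dy''}"]) (auto simp: same_but_def s1_def)
    let ?Q = "\<lambda>s' t'. nmem s' ''l'' 0 = l \<and> I (Suc l) (setn ''l'' 0 (Suc l) s') (Suc t')"
    show "wp polar_prog ?Q s' (Suc t')"
    proof (cases "p = r")
      case True
      have "?Q s1 (Suc (Suc (Suc (Suc (Suc t')))))"
      proof
        show "nmem s1 ''l'' 0 = l" by (simp add: s1_def ll)
        have "setup_ok ts h (setn ''l'' 0 (Suc l) s1)"
          by (rule setup_ok_same[OF so1, of "{''l''}" "{}"]) (auto simp: same_but_def)
        then show "I (Suc l) (setn ''l'' 0 (Suc l) s1) (Suc (Suc (Suc (Suc (Suc (Suc t'))))))"
          unfolding I_def P_def using t' k tr K im l True tk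
          by (intro exI[of _ k]) (simp add: s1_def)
      qed
      then show ?thesis
        using True unfolding polar_prog_def Let_def wp_Seq wp_NSet wp_RSet wp_Cond wp_Skip
        by (simp add: ll x in' s1_def)
    next
      case False
      have ne: "\<not> (Re p - Re r = 0 \<and> Im p - Im r = 0)" using False by (auto simp: complex_eq_iff)
      define R where "R = sqrt ((Re p - Re r) * (Re p - Re r) + (Im p - Im r) * (Im p - Im r))"
      define X where "X = 0 - ln R"
      define c where "c = ((Re p - Re r) * cos (\<tau> * X) - (Im p - Im r) * sin (\<tau> * X)) / R"
      define d where "d = ((Re p - Re r) * sin (\<tau> * X) + (Im p - Im r) * cos (\<tau> * X)) / R"
      define A where "A = (if c = 1 then 0 else pi + 2 * arctan ((0 - d) / (1 - c)))"
      note pc = polar_coordinates[OF False, folded R_def, folded X_def, folded c_def d_def, folded A_def]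
      define s2 where "s2 = setr ''d'' 0 d (setr ''c'' 0 c (setr ''L'' k X (setn ''i'' 0 k (setr ''R'' 0 R s1))))"
      define s3 where "s3 = setn ''w'' (2 ^ h + k) (Suc k) (setr ''K'' k A s2)"
      have same3: "same_but {''i'', ''w''} {''R'', ''L'', ''c'', ''d'', ''K''} s1 s3"
        by (simp add: same_but_def s3_def s2_def)
      have s2v: "rmem s2 ''c'' 0 = c" "rmem s2 ''d'' 0 = d" "nmem s2 ''i'' 0 = k" "rmem s2 ''pi'' 0 = pi"
        "nmem s2 ''m'' 0 = 2 ^ h" "nmem s2 ''k'' 0 = k" "nmem s2 ''l'' 0 = l"
        using tau m k ll by (simp_all add: s2_def s1_def)
      let ?P = "nset ''k'' (nsuc (nv ''k''))"
      have "wp fix_prog (wp ?P ?Q) s3 (t' + 12)"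
      proof (rule wp_leaf_fix[OF tr, where D' = "{..<Suc k}" and B' = "{}"])
        show "nmem s3 ''b'' = (nmem s' ''b'')(2 ^ h + k := (if k \<in> {} then Suc k else 0))"
          using trees_leaf_value(2)[OF tr kh] by (auto simp: s3_def s2_def s1_def)
        fix s4 t4
        assume t4: "t4 \<le> t' + 12 + 8 * h + 2" and same4: "same_but {''j'', ''w'', ''b''} {} s3 s4"
          and tr4: "trees h (rmem s3 ''K'') (rmem s3 ''L'') (nmem s4 ''w'') (nmem s4 ''b'') {..<Suc k} {}"
        define s5 where "s5 = setn ''l'' 0 (Suc l) (setn ''k'' 0 (Suc k) s4)"
        have so5: "setup_ok ts h s5"
          by (rule setup_ok_same[OF so1, of "{''i'', ''w'', ''j'', ''b'', ''l'', ''k''}" "{''R'', ''L'', ''c'', ''d'', ''K''}"])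
            (use same3 same4 in \<open>auto simp: same_but_def s5_def\<close>)
        have r5: "rmem s5 ''K'' = (rmem s' ''K'')(k := A)" "rmem s5 ''L'' = (rmem s' ''L'')(k := X)"
          "rmem s3 ''K'' = (rmem s' ''K'')(k := A)" "rmem s3 ''L'' = (rmem s' ''L'')(k := X)"
          using same4 by (auto simp: s5_def same_but_def s3_def s2_def s1_def)
        have k4: "nmem s4 ''k'' 0 = k" "nmem s4 ''l'' 0 = l"
          using same4 s2v by (auto simp: same_but_def s3_def)
        have "I (Suc l) s5 (Suc (Suc t4))"
          unfolding I_def P_def
        proof (intro exI conjI)
          show "Suc (Suc t4) \<le> t + 1 + Suc l * (8 * h + 20)" using t' t4 by simp
          show "setup_ok ts h s5" by (rule so5)
          show "nmem s5 ''l'' 0 = Suc l" "nmem s5 ''k'' 0 = Suc k" by (simp_all add: s5_def)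
          show "Suc k \<le> Suc l" "Suc l \<le> length ts" using k l by simp_all
          show "trees h (rmem s5 ''K'') (rmem s5 ''L'') (nmem s5 ''w'') (nmem s5 ''b'') {..<Suc k} {}"
            using tr4 by (simp add: r5) (simp add: s5_def)
          show "\<forall>i<Suc k. 0 \<le> rmem s5 ''K'' i \<and> rmem s5 ''K'' i < 2 * pi"
            using K pc by (simp add: r5 less_Suc_eq)
          have "(\<lambda>i. pt (rmem s5 ''K'' i) (rmem s5 ''L'' i)) ` {..<k} = set (take l ts) - {r}"
            unfolding im[symmetric] by (intro image_cong) (auto simp: r5)
          then show "(\<lambda>i. pt (rmem s5 ''K'' i) (rmem s5 ''L'' i)) ` {..<Suc k} = set (take (Suc l) ts) - {r}"
            unfolding tk lessThan_Suc using False pc(3) by (auto simp: r5)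
        qed
        then show "wp ?P ?Q s4 t4" unfolding wp_NSet by (simp add: k4 s5_def)
      qed (use m kh in \<open>auto simp: s3_def s2_def s1_def less_Suc_eq\<close>)
      moreover have "wp polar_store_prog ?Q s2 (t' + 9) \<longleftrightarrow> wp fix_prog (wp ?P ?Q) s3 (t' + 12)"
        unfolding polar_store_prog_def Let_def wp_Seq wp_NSet wp_RSet wp_Cond
        by (simp add: s2v s3_def A_def numeral_eq_Suc)
      moreover have "wp polar_prog ?Q s' (Suc t') \<longleftrightarrow> wp polar_store_prog ?Q s2 (t' + 9)"
        using ne unfolding polar_prog_def Let_def wp_Seq wp_NSet wp_RSet wp_Cond
        by (simp add: ll x in' k tau s2_def s1_def c_def d_def X_def R_def numeral_eq_Suc) (use ne in auto)
      ultimately show ?thesis by simp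
    qed
  qed
qed

lemma wp_sort_loop:
  assumes s: "setup_ok ts h s" "nmem s ''k'' 0 = k" "k \<le> length ts"
    and tr0: "trees h (rmem s ''K'') (rmem s ''L'') (nmem s ''w'') (nmem s ''b'') {..<k} {}"
    and K0: "\<And>i. i < k \<Longrightarrow> 0 \<le> rmem s ''K'' i \<and> rmem s ''K'' i < 2 * pi"
    and im0: "(\<lambda>i. pt (rmem s ''K'' i) (rmem s ''L'' i)) ` {..<k} = S"
    and Q: "\<And>s' t'. \<lbrakk>t' \<le> t + k * (8 * h + 20) + 2; setup_ok ts h s'; nmem s' ''k'' 0 = k;
      trees h (rmem s' ''K'') (rmem s' ''L'') (nmem s' ''w'') (nmem s' ''b'') {} {};
      slots k (rmem s' ''A'') (rmem s' ''X'');
      slot_pt (rmem s' ''A'') (rmem s' ''X'') ` {..<k} = S\<rbrakk> \<Longrightarrow> Q s' t'"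
  shows "wp (for_prog ''k'' sort_prog) Q s t"
proof -
  \<comment> \<open>\<open>D\<close> is what remains in the heap; every pair already written is
    lexicographically at most every pair in \<open>D\<close>.\<close>
  define P where "P D l s' t' \<longleftrightarrow> t' \<le> t + 1 + l * (8 * h + 20) \<and> setup_ok ts h s' \<and> nmem s' ''l'' 0 = l \<and>
      nmem s' ''k'' 0 = k \<and> l \<le> k \<and> D \<subseteq> {..<k} \<and> card D = k - l \<and>
      rmem s' ''K'' = rmem s ''K'' \<and> rmem s' ''L'' = rmem s ''L'' \<and>
      trees h (rmem s ''K'') (rmem s ''L'') (nmem s' ''w'') (nmem s' ''b'') D {} \<and>
      slots l (rmem s' ''A'') (rmem s' ''X'') \<and>
      (\<forall>j<l. \<forall>d\<in>D. rmem s' ''A'' j < rmem s ''K'' d \<or>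
        rmem s' ''A'' j = rmem s ''K'' d \<and> rmem s' ''X'' j \<le> rmem s ''L'' d) \<and>
      slot_pt (rmem s' ''A'') (rmem s' ''X'') ` {..<l} \<union> (\<lambda>i. pt (rmem s ''K'' i) (rmem s ''L'' i)) ` D = S" for D l s' t'
  define I where "I l s' t' \<longleftrightarrow> (\<exists>D. P D l s' t')" for l s' t'
  have kh: "k \<le> 2 ^ h" using s by (simp add: setup_ok_def)
  show ?thesis
  proof (rule wp_for[where I = I and n = k])
    have "setup_ok ts h (setn ''l'' 0 0 s)"
      by (rule setup_ok_same[OF s(1), of "{''l''}" "{}"]) (auto simp: same_but_def)
    then show "I 0 (setn ''l'' 0 0 s) (Suc t)"
      unfolding I_def P_def using s(2) tr0 im0
      by (intro exI[of _ "{..<k}"]) (simp add: slots_def)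
    show "nmem s' ''l'' 0 = l \<and> nmem s' ''k'' 0 = k \<and> l \<le> k" if I: "I l s' t'" for l s' t'
    proof -
      obtain D where "P D l s' t'" using I unfolding I_def by blast
      then show ?thesis by (simp add: P_def)
    qed
    show "Q s' (Suc t')" if I: "I k s' t'" for s' t'
    proof -
      obtain D where D: "P D k s' t'" using I unfolding I_def by blast
      then have "finite D" "card D = 0" using finite_subset[of D "{..<k}"] by (auto simp: P_def)
      then have "D = {}" by simp
      then show ?thesis using D by (intro Q) (simp_all add: P_def)
    qed
    fix l s' t' assume l: "l < k" and "I l s' t'"
    then obtain D where DP: "P D l s' t'" unfolding I_def by blast
    have t': "t' \<le> t + 1 + l * (8 * h + 20)" and so: "setup_ok ts h s'" and ll: "nmem s' ''l'' 0 = l"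
      and k: "nmem s' ''k'' 0 = k" and D: "D \<subseteq> {..<k}" "card D = k - l"
      and KL: "rmem s' ''K'' = rmem s ''K''" "rmem s' ''L'' = rmem s ''L''"
      and tr: "trees h (rmem s ''K'') (rmem s ''L'') (nmem s' ''w'') (nmem s' ''b'') D {}"
      and sl: "slots l (rmem s' ''A'') (rmem s' ''X'')"
      and low: "\<And>j d. j < l \<Longrightarrow> d \<in> D \<Longrightarrow> rmem s' ''A'' j < rmem s ''K'' d \<or>
        rmem s' ''A'' j = rmem s ''K'' d \<and> rmem s' ''X'' j \<le> rmem s ''L'' d"
      and im: "slot_pt (rmem s' ''A'') (rmem s' ''X'') ` {..<l} \<union> (\<lambda>i. pt (rmem s ''K'' i) (rmem s ''L'' i)) ` D = S"
      using DP by (simp_all add: P_def)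
    have m: "nmem s' ''m'' 0 = 2 ^ h" using so by (simp add: setup_ok_def)
    have fin: "finite D" using D(1) finite_subset by blast
    have "D \<noteq> {}" using D(2) l by auto
    then obtain x where w: "nmem s' ''w'' 1 = Suc x" and x: "x \<in> D"
      and min: "\<And>d. d \<in> D \<Longrightarrow> lexle (rmem s ''K'') (rmem s ''L'') x d"
      using trees_root(1)[OF tr] by (auto elim: pickE)
    have xk: "x < k" using x D by auto
    have xh: "x < 2 ^ h" using xk kh by simp
    define s1 where "s1 = setn ''w'' (2 ^ h + x) 0 (setr ''X'' l (rmem s ''L'' x) (setr ''A'' l (rmem s ''K'' x) (setn ''i'' 0 x s')))"
    let ?Q = "\<lambda>s' t'. nmem s' ''l'' 0 = l \<and> I (Suc l) (setn ''l'' 0 (Suc l) s') (Suc t')"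
    have "wp fix_prog ?Q s1 (t' + 5)"
    proof (rule wp_leaf_fix[OF tr, where D' = "D - {x}" and B' = "{}"])
      show "nmem s1 ''b'' = (nmem s' ''b'')(2 ^ h + x := (if x \<in> {} then Suc x else 0))"
        using trees_leaf_value(2)[OF tr xh] by (auto simp: s1_def)
      fix s4 t4
      assume t4: "t4 \<le> t' + 5 + 8 * h + 2" and same4: "same_but {''j'', ''w'', ''b''} {} s1 s4"
        and tr4: "trees h (rmem s1 ''K'') (rmem s1 ''L'') (nmem s4 ''w'') (nmem s4 ''b'') (D - {x}) {}"
      define s5 where "s5 = setn ''l'' 0 (Suc l) s4"
      have so5: "setup_ok ts h s5"
        by (rule setup_ok_same[OF so, of "{''i'', ''w'', ''j'', ''b'', ''l''}" "{''A'', ''X''}"])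
          (use same4 in \<open>auto simp: same_but_def s5_def s1_def\<close>)
      have r5: "rmem s5 ''K'' = rmem s ''K''" "rmem s5 ''L'' = rmem s ''L''"
        "rmem s5 ''A'' = (rmem s' ''A'')(l := rmem s ''K'' x)" "rmem s5 ''X'' = (rmem s' ''X'')(l := rmem s ''L'' x)"
        "rmem s1 ''K'' = rmem s ''K''" "rmem s1 ''L'' = rmem s ''L''"
        "nmem s5 ''w'' = nmem s4 ''w''" "nmem s5 ''b'' = nmem s4 ''b''" "nmem s5 ''k'' 0 = k" "nmem s4 ''l'' 0 = l"
        using same4 KL k ll by (auto simp: s5_def same_but_def s1_def)
      have "P (D - {x}) (Suc l) s5 (Suc t4)"
        unfolding P_def
      proof (intro conjI)
        show "Suc t4 \<le> t + 1 + Suc l * (8 * h + 20)" using t' t4 by simp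
        show "setup_ok ts h s5" by (rule so5)
        show "nmem s5 ''l'' 0 = Suc l" by (simp add: s5_def)
        show "nmem s5 ''k'' 0 = k" "rmem s5 ''K'' = rmem s ''K''" "rmem s5 ''L'' = rmem s ''L''" by (rule r5)+
        show "Suc l \<le> k" using l by simp
        show "D - {x} \<subseteq> {..<k}" using D by auto
        show "card (D - {x}) = k - Suc l" using D x fin by simp
        show "trees h (rmem s ''K'') (rmem s ''L'') (nmem s5 ''w'') (nmem s5 ''b'') (D - {x}) {}"
          using tr4 by (simp add: r5)
        show "slots (Suc l) (rmem s5 ''A'') (rmem s5 ''X'')"
          using sl low[OF _ x] K0[OF xk] unfolding slots_def r5 by (auto simp: less_Suc_eq)
        show "\<forall>j<Suc l. \<forall>d\<in>D - {x}. rmem s5 ''A'' j < rmem s ''K'' d \<or>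
            rmem s5 ''A'' j = rmem s ''K'' d \<and> rmem s5 ''X'' j \<le> rmem s ''L'' d"
          using low min unfolding r5 by (auto simp: less_Suc_eq lexle_def) force+
        have "slot_pt (rmem s5 ''A'') (rmem s5 ''X'') ` {..<l} = slot_pt (rmem s' ''A'') (rmem s' ''X'') ` {..<l}"
          by (intro image_cong) (auto simp: r5 slot_pt_def)
        moreover have Dx: "D = insert x (D - {x})" using x by blast
        have "(\<lambda>i. pt (rmem s ''K'' i) (rmem s ''L'' i)) ` D =
          insert (pt (rmem s ''K'' x) (rmem s ''L'' x)) ((\<lambda>i. pt (rmem s ''K'' i) (rmem s ''L'' i)) ` (D - {x}))"
          by (rule trans[OF arg_cong[OF Dx, of "image (\<lambda>i. pt (rmem s ''K'' i) (rmem s ''L'' i))"] image_insert])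
        ultimately show "slot_pt (rmem s5 ''A'') (rmem s5 ''X'') ` {..<Suc l} \<union>
            (\<lambda>i. pt (rmem s ''K'' i) (rmem s ''L'' i)) ` (D - {x}) = S"
          using im by (simp add: lessThan_Suc slot_pt_def r5)
      qed
      then have "I (Suc l) s5 (Suc t4)" unfolding I_def by blast
      then show "?Q s4 t4" using r5 by (simp add: s5_def)
    qed (use m xh in \<open>auto simp: s1_def KL\<close>)
    then show "wp sort_prog ?Q s' (Suc t')"
      unfolding sort_prog_def Let_def wp_Seq wp_NSet wp_RSet
      by (simp add: w[unfolded One_nat_def] ll m KL s1_def numeral_eq_Suc)
  qed
qed

lemma wp_load_loop:
  assumes s: "setup_ok ts h s" "nmem s ''k'' 0 = k" "k \<le> length ts"
    and tr0: "trees h (rmem s ''K'') (rmem s ''L'') (nmem s ''w'') (nmem s ''b'') {} {}"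
    and Q: "\<And>s' t'. \<lbrakk>t' \<le> t + k * (8 * h + 20) + 2; setup_ok ts h s'; nmem s' ''k'' 0 = k;
      trees h (rmem s' ''K'') (rmem s' ''L'') (nmem s' ''w'') (nmem s' ''b'') {..<k} {};
      rmem s' ''A'' = rmem s ''A''; rmem s' ''X'' = rmem s ''X'';
      \<And>i. i < k \<Longrightarrow> rmem s' ''K'' i = rmem s ''X'' i; \<And>i. i < k \<Longrightarrow> rmem s' ''L'' i = 0\<rbrakk> \<Longrightarrow> Q s' t'"
  shows "wp (for_prog ''k'' load_prog) Q s t"
proof -
  define I where "I l s' t' \<longleftrightarrow> t' \<le> t + 1 + l * (8 * h + 20) \<and> setup_ok ts h s' \<and> nmem s' ''l'' 0 = l \<and>
      nmem s' ''k'' 0 = k \<and> l \<le> k \<and> rmem s' ''A'' = rmem s ''A'' \<and> rmem s' ''X'' = rmem s ''X'' \<and>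
      trees h (rmem s' ''K'') (rmem s' ''L'') (nmem s' ''w'') (nmem s' ''b'') {..<l} {} \<and>
      (\<forall>i<l. rmem s' ''K'' i = rmem s ''X'' i \<and> rmem s' ''L'' i = 0)" for l s' t'
  have kh: "k \<le> 2 ^ h" using s by (simp add: setup_ok_def)
  show ?thesis
  proof (rule wp_for[where I = I and n = k])
    have "setup_ok ts h (setn ''l'' 0 0 s)"
      by (rule setup_ok_same[OF s(1), of "{''l''}" "{}"]) (auto simp: same_but_def)
    then show "I 0 (setn ''l'' 0 0 s) (Suc t)"
      unfolding I_def using s(2) tr0 by simp
    show "nmem s' ''l'' 0 = l \<and> nmem s' ''k'' 0 = k \<and> l \<le> k" if "I l s' t'" for l s' t'
      using that by (simp add: I_def)
    show "Q s' (Suc t')" if "I k s' t'" for s' t'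
      using that by (intro Q) (simp_all add: I_def)
    fix l s' t' assume l: "l < k" and I: "I l s' t'"
    have t': "t' \<le> t + 1 + l * (8 * h + 20)" and so: "setup_ok ts h s'" and ll: "nmem s' ''l'' 0 = l"
      and k: "nmem s' ''k'' 0 = k" and AX: "rmem s' ''A'' = rmem s ''A''" "rmem s' ''X'' = rmem s ''X''"
      and tr: "trees h (rmem s' ''K'') (rmem s' ''L'') (nmem s' ''w'') (nmem s' ''b'') {..<l} {}"
      and KL: "\<And>i. i < l \<Longrightarrow> rmem s' ''K'' i = rmem s ''X'' i \<and> rmem s' ''L'' i = 0"
      using I by (simp_all add: I_def)
    have m: "nmem s' ''m'' 0 = 2 ^ h" using so by (simp add: setup_ok_def)
    have lh: "l < 2 ^ h" using l kh by simp
    define s1 where "s1 = setn ''w'' (2 ^ h + l) (Suc l) (setr ''L'' l 0 (setr ''K'' l (rmem s ''X'' l) (setn ''i'' 0 l s')))"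
    let ?Q = "\<lambda>s' t'. nmem s' ''l'' 0 = l \<and> I (Suc l) (setn ''l'' 0 (Suc l) s') (Suc t')"
    have "wp fix_prog ?Q s1 (t' + 5)"
    proof (rule wp_leaf_fix[OF tr, where D' = "{..<Suc l}" and B' = "{}"])
      show "nmem s1 ''b'' = (nmem s' ''b'')(2 ^ h + l := (if l \<in> {} then Suc l else 0))"
        using trees_leaf_value(2)[OF tr lh] by (auto simp: s1_def)
      fix s4 t4
      assume t4: "t4 \<le> t' + 5 + 8 * h + 2" and same4: "same_but {''j'', ''w'', ''b''} {} s1 s4"
        and tr4: "trees h (rmem s1 ''K'') (rmem s1 ''L'') (nmem s4 ''w'') (nmem s4 ''b'') {..<Suc l} {}"
      define s5 where "s5 = setn ''l'' 0 (Suc l) s4"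
      have so5: "setup_ok ts h s5"
        by (rule setup_ok_same[OF so, of "{''i'', ''w'', ''j'', ''b'', ''l''}" "{''K'', ''L''}"])
          (use same4 in \<open>auto simp: same_but_def s5_def s1_def\<close>)
      have r5: "rmem s5 ''K'' = rmem s1 ''K''" "rmem s5 ''L'' = rmem s1 ''L''"
        "rmem s1 ''K'' = (rmem s' ''K'')(l := rmem s ''X'' l)" "rmem s1 ''L'' = (rmem s' ''L'')(l := 0)"
        "rmem s5 ''A'' = rmem s ''A''" "rmem s5 ''X'' = rmem s ''X''"
        "nmem s5 ''w'' = nmem s4 ''w''" "nmem s5 ''b'' = nmem s4 ''b''" "nmem s5 ''k'' 0 = k" "nmem s4 ''l'' 0 = l"
        using same4 AX k ll by (auto simp: s5_def same_but_def s1_def)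
      have "I (Suc l) s5 (Suc t4)"
        unfolding I_def using t' t4 so5 l r5(5,6,9) tr4 KL
        by (simp add: r5(1,2,7,8)) (simp add: r5(3,4) s5_def less_Suc_eq)
      then show "?Q s4 t4" using r5 by (simp add: s5_def)
    qed (use m lh in \<open>auto simp: s1_def less_Suc_eq\<close>)
    then show "wp load_prog ?Q s' (Suc t')"
      unfolding load_prog_def Let_def wp_Seq wp_NSet wp_RSet
      by (simp add: ll m AX s1_def numeral_eq_Suc)
  qed
qed

section \<open>Completion of the tree and its output\<close>

text \<open>If \<open>r\<close> is a terminal it stays active, and the last other node
  \<open>w\<close> has to be joined with it by an ordinary step whose join point is
  \<open>r\<close>. The final connection of \<open>r\<close> to itself is then void, so both cases
  give the same forest.\<close>

lemma greedy_tree_finish: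
  assumes steps: "(greedy_step r \<alpha>)\<^sup>*\<^sup>* (initial_forest ts) F" and act: "active F - {r} = {w}"
    and arc: "arc_from_to r \<alpha> (a w) w r"
  shows "greedy_spiral_tree r \<alpha> ts (connect {w} r a F)"
proof (cases "r \<in> active F")
  case False
  then have "active F = {w}" using act by auto
  then show ?thesis using greedy_spiral_tree.intros[OF steps, of w a] arc by blast
next
  case True
  then have aF: "active F = {w, r}" and wr: "w \<noteq> r" using act by auto
  have join: "join_point r \<alpha> w r r"
    using root_in_region[of w] by (auto simp: join_point_def)
  have "greedy_step r \<alpha> F (connect {w, r} r a F)"
  proof (rule greedy_step.intros[OF _ _ wr join])
    show "w \<in> active F" "r \<in> active F" using aF by auto
    fix u' v' p' assume "u' \<in> active F" "v' \<in> active F" "u' \<noteq> v'" "join_point r \<alpha> u' v' p'"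
    then have "p' = r" using aF by (auto simp: join_point_def)
    then show "dist r p' \<le> dist r r" by simp
  qed (use arc in auto)
  then have steps': "(greedy_step r \<alpha>)\<^sup>*\<^sup>* (initial_forest ts) (connect {w, r} r a F)"
    using steps by simp
  have "active (connect {w, r} r a F) = {r}"
  proof -
    have "up F r = None" using True by (simp add: active_def)
    moreover have "x \<in> {w, r}" if "x \<in> nodes F" "up F x = None" for x
      using that aF by (auto simp: active_def)
    ultimately show ?thesis by (auto simp: active_def split: if_splits)
  qed
  from greedy_spiral_tree.intros[OF steps' this, of a]
  have "greedy_spiral_tree r \<alpha> ts (connect {r} r a (connect {w, r} r a F))" by simp
  moreover have "connect {r} r a (connect {w, r} r a F) = connect {w} r a F"
    using wr by (auto simp: connect_def fun_eq_iff)
  ultimately show ?thesis by simp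
qed

lemma greedy_tree_trivial:
  assumes steps: "(greedy_step r \<alpha>)\<^sup>*\<^sup>* (initial_forest ts) F" and act: "active F - {r} = {}" and ts: "ts \<noteq> []"
  shows "greedy_spiral_tree r \<alpha> ts (connect {r} r a F)"
proof -
  note inv = greedy_steps_inv[OF steps]
  have "nodes F \<noteq> {}" using inv ts unfolding greedy_inv_def arc_forest_def by (cases ts) auto
  then have "active F \<noteq> {}" using inv unfolding greedy_inv_def by blast
  then have "active F = {r}" using act by auto
  then show ?thesis using greedy_spiral_tree.intros[OF steps, of r a] by simp
qed

lemma outputs_finish:
  assumes tb: "table N (out_node s) nd (nmem s ''parent'') (segs s) S B {} F" and fmt: "arcs_format s"
    and N: "nmem s ''nodes'' 0 = N" and B: "B = {} \<and> x = r \<or> (\<exists>v. B = {v} \<and> x = S v \<and> e = nd v)"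
    and domF: "dom (up F) \<subseteq> nodes F" "up F r = None"
    and s': "nmem s' ''nodes'' 0 = Suc N" "\<And>j. j < N \<Longrightarrow> out_node s' j = out_node s j" "out_node s' N = r"
      "\<And>j. j < N \<Longrightarrow> nmem s' ''parent'' j = (if B \<noteq> {} \<and> j = e then N else nmem s ''parent'' j)"
      "nmem s' ''parent'' N = Suc N" "nmem s' ''arc'' = nmem s ''arc''" "nmem s' ''left'' = nmem s ''left''"
      "\<And>j. B = {} \<or> j \<noteq> 2 * e \<Longrightarrow> nmem s' ''unbounded'' j = 0"
      "\<And>j. B = {} \<or> j \<noteq> Suc (2 * e) \<Longrightarrow> rmem s' ''param'' j = rmem s ''param'' j"
    and a: "a x = out_arc s' e"
  shows "outputs s' (connect {x} r a F)"
proof -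
  note T = tableD[OF tb]
  let ?G = "connect {x} r a F"
  have im: "out_node s' ` {..<N} = out_node s ` {..<N}" using s'(2) by (auto intro!: image_cong)
  have notr: "r \<notin> out_node s' ` {..<N}" unfolding im using T(2) by auto
  have "inj_on (out_node s') {..<N}" using T(1) s'(2) by (simp add: inj_on_def)
  moreover have "out_node s' N \<notin> out_node s' ` ({..<N} - {N})" using notr s'(3) by auto
  ultimately have inj: "inj_on (out_node s') {..<Suc N}" by (simp only: lessThan_Suc inj_on_insert simp_thms)
  have "nodes ?G = insert r (nodes F - {r})" by auto
  then have nodes: "nodes ?G = out_node s' ` {..<Suc N}" using T(5) im s'(3) by (simp add: lessThan_Suc)
  have xF: "x \<noteq> r \<Longrightarrow> x \<in> nodes F"
  proof -
    assume "x \<noteq> r"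
    then obtain v where "B = {v}" "x = S v" using B by auto
    then have "x \<in> out_node s ` {..<N}" using T(3,4)[of v] by force
    then show ?thesis using T(5) by auto
  qed
  have dom: "dom (up ?G) \<subseteq> nodes ?G"
  proof
    fix y assume "y \<in> dom (up ?G)"
    then have "y = x \<and> x \<noteq> r \<or> y \<in> dom (up F)" by (auto split: if_splits)
    then show "y \<in> nodes ?G" using xF domF(1) by auto
  qed
  have arcs: "out_arc s' j = segs s j" if j: "j < N" "B = {} \<or> j \<noteq> e" for j
  proof -
    have f: "nmem s ''arc'' j = 2 * j" "nmem s ''arc'' (Suc j) = 2 * Suc j" "nmem s ''left'' (2 * j) = 0"
      "nmem s ''left'' (Suc (2 * j)) = 1"
      using fmt j N by (simp_all add: arcs_format_def)
    \<comment> \<open>Only the even segment number of \<open>e\<close> becomes unbounded and only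
      its odd one gets a new parameter, so by parity the segments of other nodes are
      untouched.\<close>
    have i: "2 * j \<noteq> Suc (2 * e)" "Suc (2 * j) \<noteq> 2 * e" by presburger+
    have "[2 * j..<2 * Suc j] = [2 * j, Suc (2 * j)]" by (simp add: upt_rec)
    then show ?thesis
      using f i j s'(8)[of "2 * j"] s'(8)[of "Suc (2 * j)"] s'(9)[of "2 * j"] s'(9)[of "Suc (2 * j)"]
      by (auto simp: out_arc_def out_segment_def segs_def s'(6,7))
  qed
  have up: "up ?G (out_node s' i) = (let j = nmem s' ''parent'' i in
      if j < Suc N then Some (out_node s' j, out_arc s' i) else None)" if i: "i < Suc N" for i
  proof (cases "i = N")
    case True
    then show ?thesis using s' domF by simp
  next
    case False
    then have iN: "i < N" using i by simp
    have ir: "out_node s i \<noteq> r" using T(2)[OF iN] .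
    show ?thesis
    proof (cases "B \<noteq> {} \<and> i = e")
      case True
      then obtain v where v: "B = {v}" "x = S v" "e = nd v" using B by auto
      then have "out_node s i = x" using T(4)[of v] True by simp
      then show ?thesis using True iN ir s' a by simp
    next
      case False
      have neq: "out_node s i \<noteq> x"
      proof
        assume eq: "out_node s i = x"
        then obtain v where v: "B = {v}" "x = S v" "e = nd v" using B ir by auto
        then have "out_node s i = out_node s e" "e < N" using T(3,4)[of v] eq by simp_all
        then have "i = e" using T(1) iN by (auto simp: inj_on_def)
        then show False using False v by simp
      qed
      have nB: "i \<notin> nd ` B" using False B by auto
      have "out_arc s' i = segs s i" using arcs[OF iN] False by blast
      then show ?thesis
        using T(7,8)[OF iN nB] neq s'(2)[OF iN] s'(4)[OF iN] False s'(2)[OF T(7)[OF iN nB]]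
        by (auto simp: Let_def)
    qed
  qed
  show ?thesis
    unfolding outputs_def s'(1) Let_def
    using inj nodes dom up by (auto simp: Let_def)
qed

lemma wp_finish:
  assumes st: "sweep_state ts h k A X0 B {} F L s" and B: "B = {} \<or> (\<exists>v. B = {v})" and ts: "ts \<noteq> []"
    and Q: "\<And>s' t' G. \<lbrakk>t' \<le> t + 9; greedy_spiral_tree r \<alpha> ts G; outputs s' G\<rbrakk> \<Longrightarrow> Q s' t'"
  shows "wp finish_prog Q s t"
proof -
  note S = sweep_stateD[OF st]
  note I = sweep_invD[OF S(2)]
  let ?S = "slot_pt A (rmem s ''X'')"
  define N where "N = nmem s ''nodes'' 0"
  have af: "arc_forest ts F" using greedy_steps_inv[OF I(5)] by (simp add: greedy_inv_def)
  have domF: "dom (up F) \<subseteq> nodes F" "up F r = None"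
    using af root_has_no_parent[OF af] by (auto simp: arc_forest_def)
  obtain D where tr: "trees h (rmem s ''K'') (rmem s ''L'') (nmem s ''w'') (nmem s ''b'') D B"
    using S(3) unfolding keys_state_def by blast
  note root = trees_root(2)[OF tr]
  have c: "rmem s ''rootx'' 0 = Re r" "rmem s ''rooty'' 0 = Im r" using S(1) by (simp_all add: consts_ok_def)
  have unb: "nmem s ''unbounded'' j = 0" for j using S(6) by (simp add: arcs_format_def)
  note tb = S(5)[folded N_def]
  from B show ?thesis
  proof
    assume e: "B = {}"
    then have b1: "nmem s ''b'' 1 = 0" using root by (simp add: pick_def)
    define s' where "s' = setn ''nodes'' 0 (Suc N) (setn ''parent'' N (Suc N) (setr ''nodey'' N (Im r) (setr ''nodex'' N (Re r) s)))"
    define a where "a = (\<lambda>y::complex. out_arc s' 0)"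
    have "outputs s' (connect {r} r a F)"
      by (rule outputs_finish[OF tb S(6) N_def[symmetric] _ domF, where e = 0])
         (use e unb in \<open>auto simp: s'_def out_node_def complex_eq_iff a_def\<close>)
    moreover have "greedy_spiral_tree r \<alpha> ts (connect {r} r a F)"
      by (rule greedy_tree_trivial[OF I(5) _ ts]) (use I(6) e in simp)
    ultimately have "Q s' (t + 6)" by (intro Q) simp_all
    then show ?thesis
      unfolding finish_prog_def Let_def wp_Seq wp_NSet wp_RSet wp_Cond wp_Skip
      by (simp add: b1[unfolded One_nat_def] c s'_def N_def numeral_eq_Suc)
  next
    assume "\<exists>v. B = {v}"
    then obtain v where v: "B = {v}" by blast
    then have b1: "nmem s ''b'' 1 = Suc v" using root by (auto simp: pick_def)
    define e where "e = nmem s ''nd'' v"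
    have eN: "e < N" using tableD(3)[OF tb] v by (simp add: e_def)
    define s1 where "s1 = setr ''param'' (Suc (2 * e)) 0 (setn ''unbounded'' (2 * e) 1 (setn ''parent'' e N (setn ''i'' 0 e s)))"
    define s' where "s' = setn ''nodes'' 0 (Suc N) (setn ''parent'' N (Suc N) (setr ''nodey'' N (Im r) (setr ''nodex'' N (Re r) s1)))"
    define a where "a = (\<lambda>y::complex. out_arc s' e)"
    have fmt: "nmem s ''arc'' e = 2 * e" "nmem s ''arc'' (Suc e) = 2 * Suc e" "nmem s ''left'' (2 * e) = 0"
      "nmem s ''left'' (Suc (2 * e)) = 1"
      using S(6) eN unfolding arcs_format_def N_def by (simp_all add: Suc_leI)
    have "[2 * e..<2 * Suc e] = [2 * e, Suc (2 * e)]" by (simp add: upt_rec)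
    moreover have "2 * e \<noteq> Suc (2 * e)" by simp
    ultimately have oa: "out_arc s' e = [(Right_spiral, \<infinity>), (Left_spiral, ereal 0)]"
      using fmt unb by (simp add: out_arc_def out_segment_def s'_def s1_def)
    have arc: "arc_from_to r \<alpha> (a (?S v)) (?S v) r"
      unfolding a_def oa arc_from_to_def using spiral_left[of r 0] by simp
    have "outputs s' (connect {?S v} r a F)"
    proof (rule outputs_finish[OF tb S(6) N_def[symmetric] _ domF, where e = e])
      show "B = {} \<and> ?S v = r \<or> (\<exists>v'. B = {v'} \<and> ?S v = ?S v' \<and> e = nmem s ''nd'' v')" using v e_def by blast
    qed (use v unb eN in \<open>auto simp: s'_def s1_def out_node_def complex_eq_iff a_def\<close>)
    moreover have "greedy_spiral_tree r \<alpha> ts (connect {?S v} r a F)"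
      by (rule greedy_tree_finish[where a = a, OF I(5) _ arc]) (use I(6) v in simp)
    ultimately have "Q s' (t + 9)" by (intro Q) simp_all
    moreover have "rmem s1 ''rootx'' 0 = Re r" "rmem s1 ''rooty'' 0 = Im r" "nmem s1 ''nodes'' 0 = N"
      using c by (simp_all add: s1_def N_def)
    moreover have "e + e = 2 * e" by simp
    ultimately show ?thesis
      unfolding finish_prog_def Let_def wp_Seq wp_NSet wp_RSet wp_Cond wp_Skip
      by (simp add: b1[unfolded One_nat_def] c s'_def s1_def N_def e_def numeral_eq_Suc)
  qed
qed

lemma sweep_state_initial:
  assumes so: "setup_ok ts h s" and k: "k \<le> length ts"
    and tr: "trees h (rmem s ''K'') (rmem s ''L'') (nmem s ''w'') (nmem s ''b'') {..<k} {}"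
    and sl: "slots k (rmem s ''A'') (rmem s ''X'')"
    and im: "slot_pt (rmem s ''A'') (rmem s ''X'') ` {..<k} = set ts - {r}"
    and KL: "\<And>i. i < k \<Longrightarrow> rmem s ''K'' i = rmem s ''X'' i" "\<And>i. i < k \<Longrightarrow> rmem s ''L'' i = 0"
  shows "\<exists>L. sweep_state ts h k (rmem s ''A'') (rmem s ''X'') {} {..<k} (initial_forest ts) L s"
proof -
  let ?X = "rmem s ''X''"
  have "finite (?X ` {..<k})" by simp
  \<comment> \<open>Any lower bound of the arrival times serves: the sweep starts with no terminal
    outside the circle.\<close>
  then obtain L where L: "\<And>i. i < k \<Longrightarrow> L \<le> ?X i"
    using finite_has_minimal2 by (metis (no_types, lifting) Min_le image_eqI lessThan_iff)
  have inp: "nmem s ''nodes'' 0 = 0" "nmem s ''arc'' j = 0" "nmem s ''left'' j = 0" "nmem s ''unbounded'' j = 0"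
    "rmem s ''rootx'' 0 = Re r" "rmem s ''rooty'' 0 = Im r" for j
    using so by (simp_all add: setup_ok_def same_but_def input_mem_def)
  have act: "active (initial_forest ts) = set ts" "nodes (initial_forest ts) = set ts"
    by (auto simp: active_def initial_forest_def)
  have "sweep_inv ts k (rmem s ''A'') ?X {} {..<k} ?X (initial_forest ts) L"
    by (rule sweep_invI) (use sl im L act in auto)
  moreover have "consts_ok h k (rmem s ''A'') s"
    using so k by (simp add: setup_ok_def consts_ok_def inp)
  moreover have "keys_state h k (rmem s ''A'') ?X {} {..<k} {} s"
    unfolding keys_state_def using tr KL by (intro exI[of _ "{..<k}"]) simp
  moreover have "table (nmem s ''nodes'' 0) (out_node s) (nmem s ''nd'') (nmem s ''parent'') (segs s)
      (slot_pt (rmem s ''A'') ?X) {} {..<k} (initial_forest ts)"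
    by (simp add: table_def inp act im)
  moreover have "arcs_format s" by (simp add: arcs_format_def inp)
  ultimately show ?thesis unfolding sweep_state_def by (auto simp: links_def)
qed

lemma greedy_prog_correct:
  assumes ts: "ts \<noteq> []"
  shows "\<exists>k s G h. exec greedy_prog (input_mem r \<alpha> ts) k s \<and> k \<le> length ts * (80 * h + 200) + 2 * h + 40 \<and>
    2 ^ h < 2 * length ts \<and> outputs s G \<and> greedy_spiral_tree r \<alpha> ts G"
proof -
  let ?n = "length ts"
  define R where "R s t \<longleftrightarrow> (\<exists>G h. t \<le> ?n * (80 * h + 200) + 2 * h + 40 \<and> 2 ^ h < 2 * ?n \<and> outputs s G \<and>
    greedy_spiral_tree r \<alpha> ts G)" for s t
  define s0 where "s0 = setr ''pi'' 0 pi (setr ''tau'' 0 \<tau> (input_mem r \<alpha> ts))"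
  let ?rest = "for_prog ''n'' polar_prog ;; for_prog ''k'' sort_prog ;; for_prog ''k'' load_prog ;; loop_prog ;; finish_prog"
  have "wp size_prog (wp ?rest R) s0 2"
  proof (rule wp_size)
    show "nmem s0 ''n'' 0 = ?n" "0 < ?n" using ts by (simp_all add: s0_def input_mem_def)
    fix s1 t1 h
    assume t1: "t1 \<le> 2 + 2 * h + 2" and same1: "same_but {''m''} {} s0 s1" and m1: "nmem s1 ''m'' 0 = 2 ^ h"
      and h: "?n \<le> 2 ^ h" "2 ^ h < 2 * ?n"
    have so1: "setup_ok ts h s1"
      using same1 m1 h by (simp add: setup_ok_def same_but_def s0_def)
    have z1: "nmem s1 ''k'' 0 = 0" "nmem s1 ''w'' j = 0" "nmem s1 ''b'' j = 0" for j
      using same1 by (simp_all add: same_but_def s0_def input_mem_def)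
    show "wp ?rest R s1 t1"
      unfolding wp_Seq
    proof (rule wp_polar_loop[OF so1 z1])
      fix s2 t2 k
      assume t2: "t2 \<le> t1 + ?n * (8 * h + 20) + 2" and so2: "setup_ok ts h s2" and k2: "nmem s2 ''k'' 0 = k" "k \<le> ?n"
        and tr2: "trees h (rmem s2 ''K'') (rmem s2 ''L'') (nmem s2 ''w'') (nmem s2 ''b'') {..<k} {}"
        and K2: "\<And>i. i < k \<Longrightarrow> 0 \<le> rmem s2 ''K'' i \<and> rmem s2 ''K'' i < 2 * pi"
        and im2: "(\<lambda>i. pt (rmem s2 ''K'' i) (rmem s2 ''L'' i)) ` {..<k} = set ts - {r}"
      show "wp (for_prog ''k'' sort_prog) (wp (for_prog ''k'' load_prog) (wp loop_prog (wp finish_prog R))) s2 t2"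
      proof (rule wp_sort_loop[OF so2 k2 tr2 K2 im2])
        fix s3 t3
        assume t3: "t3 \<le> t2 + k * (8 * h + 20) + 2" and so3: "setup_ok ts h s3" and k3: "nmem s3 ''k'' 0 = k"
          and tr3: "trees h (rmem s3 ''K'') (rmem s3 ''L'') (nmem s3 ''w'') (nmem s3 ''b'') {} {}"
          and sl3: "slots k (rmem s3 ''A'') (rmem s3 ''X'')"
          and im3: "slot_pt (rmem s3 ''A'') (rmem s3 ''X'') ` {..<k} = set ts - {r}"
        show "wp (for_prog ''k'' load_prog) (wp loop_prog (wp finish_prog R)) s3 t3"
        proof (rule wp_load_loop[OF so3 k3 k2(2) tr3])
          fix s4 t4
          assume t4: "t4 \<le> t3 + k * (8 * h + 20) + 2" and so4: "setup_ok ts h s4"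
            and tr4: "trees h (rmem s4 ''K'') (rmem s4 ''L'') (nmem s4 ''w'') (nmem s4 ''b'') {..<k} {}"
            and AX: "rmem s4 ''A'' = rmem s3 ''A''" "rmem s4 ''X'' = rmem s3 ''X''"
            and KL: "\<And>i. i < k \<Longrightarrow> rmem s4 ''K'' i = rmem s3 ''X'' i" "\<And>i. i < k \<Longrightarrow> rmem s4 ''L'' i = 0"
          obtain L where st: "sweep_state ts h k (rmem s4 ''A'') (rmem s4 ''X'') {} {..<k} (initial_forest ts) L s4"
            using sweep_state_initial[OF so4 k2(2) tr4] sl3 im3 KL unfolding AX by blast
          have "3 * (k * (8 * h + 20)) \<le> 3 * (?n * (8 * h + 20))" using k2(2) by (intro mult_le_mono) simp_all
          then have t4': "t4 \<le> 2 * h + 10 + 3 * (?n * (8 * h + 20))"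
            using t1 t2 t3 t4 mult_le_mono1[OF k2(2), of "8 * h + 20"] by linarith
          have fin: "R s' t'" if "t' \<le> t4 + 2 * ?n * (28 * h + 70) + 1 + 9" "greedy_spiral_tree r \<alpha> ts G" "outputs s' G"
            for s' t' G
            unfolding R_def
          proof (intro exI conjI)
            \<comment> \<open>Three setup loops of at most \<open>8 * h + 20\<close> steps per
              terminal and two events per terminal of at most \<open>28 * h + 70\<close> steps:
              \<open>80 = 3 * 8 + 2 * 28\<close> and \<open>200 = 3 * 20 + 2 * 70\<close>.\<close>
            show "t' \<le> ?n * (80 * h + 200) + 2 * h + 40" using that(1) t4' by (simp add: algebra_simps)
          qed (use h that in auto)
          show "wp loop_prog (wp finish_prog R) s4 t4"
          proof (cases "k = 0")
            \<comment> \<open>All terminals are at \<open>r\<close>. This is separate because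
              \<open>wp_loop\<close> ends with exactly one active node outside
              \<open>r\<close>.\<close>
            case True
            then have st': "sweep_state ts h k (rmem s4 ''A'') (rmem s4 ''X'') {} {} (initial_forest ts) L s4"
              using st by simp
            have "nmem s4 ''w'' 1 = 0"
              using trees_root(1)[OF tr4] True by (simp add: pick_def)
            then have "wp finish_prog R s4 (Suc t4) \<Longrightarrow> wp loop_prog (wp finish_prog R) s4 t4"
              unfolding loop_prog_def by (intro wp_While[where I = "\<lambda>n s t. s = s4 \<and> t = t4" and n = 0]) auto
            moreover have "wp finish_prog R s4 (Suc t4)"
              by (rule wp_finish[OF st' _ ts]) (use fin in auto)
            ultimately show ?thesis by simp
          next
            case False
            then have ne: "{} \<union> {..<k} \<noteq> {}" by auto
            show ?thesis
            proof (rule wp_loop[OF st ne])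
              fix s5 t5 v F' L'
              assume t5: "t5 \<le> t4 + (2 * card {..<k} + card {}) * (28 * h + 70) + 1"
                and st5: "sweep_state ts h k (rmem s4 ''A'') (rmem s4 ''X'') {v} {} F' L' s5"
              have "2 * k * (28 * h + 70) \<le> 2 * ?n * (28 * h + 70)" using k2(2) by (intro mult_le_mono) simp_all
              moreover have "t5 \<le> t4 + 2 * k * (28 * h + 70) + 1" using t5 by simp
              ultimately have t5': "t5 \<le> t4 + 2 * ?n * (28 * h + 70) + 1" by linarith
              show "wp finish_prog R s5 t5"
                by (rule wp_finish[OF st5 _ ts]) (use fin t5' in auto)
            qed
          qed
        qed
      qed
    qed
  qed
  then have "wp greedy_prog R (input_mem r \<alpha> ts) 0"
    unfolding greedy_prog_def wp_Seq wp_RSet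
    by (simp add: s0_def input_mem_def arctan_one numeral_eq_Suc)
  then show ?thesis unfolding wp_def R_def by auto
qed

end

theorem theorem5:
  shows "(\<forall>r \<alpha> ts G. 0 < \<alpha> \<and> \<alpha> < pi / 2 \<and> ts \<noteq> [] \<and> greedy_spiral_tree r \<alpha> ts G \<longrightarrow>
            approximation 2 r \<alpha> ts G) \<and>
         (\<exists>(P :: prog) (f :: nat \<Rightarrow> real). f \<in> O(\<lambda>n. real n * ln (real n)) \<and>
            (\<forall>r \<alpha> ts. 0 < \<alpha> \<and> \<alpha> < pi / 2 \<and> ts \<noteq> [] \<longrightarrow>
               (\<exists>k s G. exec P (input_mem r \<alpha> ts) k s \<and> real k \<le> f (length ts) \<and>
                  outputs s G \<and> greedy_spiral_tree r \<alpha> ts G)))"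
proof (intro conjI)
  show "\<forall>r \<alpha> ts G. 0 < \<alpha> \<and> \<alpha> < pi / 2 \<and> ts \<noteq> [] \<and> greedy_spiral_tree r \<alpha> ts G \<longrightarrow>
            approximation 2 r \<alpha> ts G"
    using spiral_geometry.greedy_approximation by (auto simp: spiral_geometry_def)
  \<comment> \<open>From \<open>2 ^ h < 2 * n\<close> follows \<open>h \<le> 1 + log 2 n\<close>. At
    \<open>n = 1\<close> the comparison function vanishes, but the asymptotic relation concerns
    large \<open>n\<close>.\<close>
  define f :: "nat \<Rightarrow> real" where
    "f n = real n * (80 * (1 + log 2 (real n)) + 200) + 2 * (1 + log 2 (real n)) + 40" for n
  have "f \<in> O(\<lambda>n. real n * ln (real n))" unfolding f_def[abs_def] log_def by real_asymp
  moreover have "\<exists>k s G. exec greedy_prog (input_mem r \<alpha> ts) k s \<and> real k \<le> f (length ts) \<and>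
      outputs s G \<and> greedy_spiral_tree r \<alpha> ts G" if \<alpha>: "0 < \<alpha>" "\<alpha> < pi / 2" and ts: "ts \<noteq> []" for r \<alpha> ts
  proof -
    interpret spiral_geometry r \<alpha> by unfold_locales (use \<alpha> in auto)
    let ?n = "length ts"
    obtain k s G h where e: "exec greedy_prog (input_mem r \<alpha> ts) k s" "outputs s G" "greedy_spiral_tree r \<alpha> ts G"
      and k: "k \<le> ?n * (80 * h + 200) + 2 * h + 40" and h: "2 ^ h < 2 * ?n"
      using greedy_prog_correct[OF ts] by blast
    have n: "0 < real ?n" using ts by simp
    have "real (2 ^ h) \<le> 2 * real ?n" using h by (metis less_imp_le of_nat_le_iff of_nat_mult of_nat_numeral)
    then have "log 2 (2 ^ h) \<le> log 2 (2 * real ?n)" using n by (subst log_le_cancel_iff) auto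
    then have hl: "real h \<le> 1 + log 2 (real ?n)" using n by (simp add: log_mult log_pow_cancel)
    have "real k \<le> real (?n * (80 * h + 200) + 2 * h + 40)" using k by (simp only: of_nat_le_iff)
    also have "\<dots> = real ?n * (80 * real h + 200) + 2 * real h + 40" by simp
    also have "\<dots> \<le> f ?n"
      unfolding f_def using hl by (intro add_mono mult_left_mono) auto
    finally show ?thesis using e by blast
  qed
  ultimately show "\<exists>(P :: prog) (f :: nat \<Rightarrow> real). f \<in> O(\<lambda>n. real n * ln (real n)) \<and>
            (\<forall>r \<alpha> ts. 0 < \<alpha> \<and> \<alpha> < pi / 2 \<and> ts \<noteq> [] \<longrightarrow>
               (\<exists>k s G. exec P (input_mem r \<alpha> ts) k s \<and> real k \<le> f (length ts) \<and>
                  outputs s G \<and> greedy_spiral_tree r \<alpha> ts G))"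
    by (intro exI[of _ greedy_prog] exI[of _ f]) blast
qed

end
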